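(* Let $\epsilon \geq 1$ be an integer with $\epsilon \neq 3$, and let $H(\epsilon) = \lfloor (7 + \sqrt{24\epsilon + 1})/2 \rfloor$. Let $G$ be a graph embedded on a surface of Euler genus $\epsilon$ with a distinguished face $F$, and let $V(F)$ be the set of vertices of $G$ lying on $F$. Let $L$ assign to each vertex $v$ of $G$ a list $L(v)$ of colors with $|L(v)| = H(\epsilon)-2$ for every $v \in V(F)$ and $|L(v)| = H(\epsilon)$ for every $v \in V(G)\setminus V(F)$. Then $G$ is $L$-list-colorable unless $G$ contains a complete graph $K_{H(\epsilon)-1}$ all of whose vertices lie on $F$.
   Context: Graphs are finite and simple. A surface is a compact connected 2-manifold without boundary; its Euler genus is $2-\chi$, where $\chi$ is its Euler characteristic (the surface may be orientable or nonorientable). A face of an embedding is a connected component of the complement of the embedded graph in the surface; a vertex lies on a face if it is on the boundary of that face. Given a list $L(v)$ of colors for each vertex $v$ of $G$, the graph is $L$-list-colorable if a color from $L(v)$ can be selected for each $v$ so that adjacent vertices receive different colors. $K_m$ is the complete graph on $m$ vertices. "Unless" means: if $G$ contains no such complete graph, then $G$ is $L$-list-colorable. *)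

theory Defs
  imports "HOL-Analysis.Analysis" "HOL-Homology.Homology" "Graph_Theory.Graph_Theory"
begin

text \<open>Surfaces. A space is an abstract topology, so that every topological space is covered and
  the singular homology groups are available.\<close>

definition manifold :: "nat \<Rightarrow> 'a topology \<Rightarrow> bool" where
  "manifold n X \<longleftrightarrow> Hausdorff_space X \<and> second_countable X \<and>
     (\<forall>x \<in> topspace X. \<exists>U. openin X U \<and> x \<in> U \<and>
        subtopology X U homeomorphic_space Euclidean_space n)"

text \<open>\<^const>\<open>connected_space\<close> holds of the empty space, which is therefore excluded.\<close>

definition surface :: "'a topology \<Rightarrow> bool" where
  "surface X \<longleftrightarrow> manifold 2 X \<and> compact_space X \<and> connected_space X \<and> topspace X \<noteq> {}"

text \<open>The homology groups are abelian groups in multiplicative notation, so \<open>b [^] k\<close> below is the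
  multiple \<open>k b\<close> and \<open>finprod\<close> the sum.\<close>

definition int_independent :: "('a, 'b) monoid_scheme \<Rightarrow> 'a set \<Rightarrow> bool" where
  "int_independent A B \<longleftrightarrow> finite B \<and> B \<subseteq> carrier A \<and>
     (\<forall>k :: 'a \<Rightarrow> int. finprod A (\<lambda>b. b [^]\<^bsub>A\<^esub> k b) B = \<one>\<^bsub>A\<^esub> \<longrightarrow> (\<forall>b \<in> B. k b = 0))"

text \<open>Only meaningful for groups of finite rank, since \<open>Sup\<close> of an unbounded set of naturals is
  unspecified.\<close>

definition group_rank :: "('a, 'b) monoid_scheme \<Rightarrow> nat" where
  "group_rank A = Sup {card B | B. int_independent A B}"

definition betti_number :: "nat \<Rightarrow> 'a topology \<Rightarrow> nat" where
  "betti_number p X = group_rank (homology_group (int p) X)"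

text \<open>Only meaningful for spaces whose Betti numbers are finite and almost all zero; compact
  surfaces are such spaces.\<close>

definition euler_characteristic :: "'a topology \<Rightarrow> int" where
  "euler_characteristic X = (\<Sum>p | betti_number p X \<noteq> 0. (- 1) ^ p * int (betti_number p X))"

definition euler_genus :: "'a topology \<Rightarrow> int" where
  "euler_genus X = 2 - euler_characteristic X"

text \<open>Embedded graphs. A finite simple graph is a \<^locale>\<open>pair_graph\<close>, which represents the edge
  between \<open>u\<close> and \<open>v\<close> by the two arcs \<open>(u, v)\<close> and \<open>(v, u)\<close>; these are drawn as one curve traversed
  in opposite directions. The faces of an embedding need not be discs.\<close>

definition embedding ::
  "'s topology \<Rightarrow> 'v pair_pre_digraph \<Rightarrow> ('v \<Rightarrow> 's) \<Rightarrow> ('v \<times> 'v \<Rightarrow> real \<Rightarrow> 's) \<Rightarrow> bool" where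
  "embedding X G pos crv \<longleftrightarrow>
     pos ` pverts G \<subseteq> topspace X \<and> inj_on pos (pverts G) \<and>
     (\<forall>(u, v) \<in> parcs G.
        pathin X (crv (u, v)) \<and> inj_on (crv (u, v)) {0..1} \<and>
        crv (u, v) 0 = pos u \<and> crv (u, v) 1 = pos v \<and>
        (\<forall>t \<in> {0..1}. crv (v, u) t = crv (u, v) (1 - t)) \<and>
        crv (u, v) ` {0<..<1} \<inter> pos ` pverts G = {}) \<and>
     (\<forall>(u, v) \<in> parcs G. \<forall>(x, y) \<in> parcs G. {u, v} \<noteq> {x, y} \<longrightarrow>
        crv (u, v) ` {0<..<1} \<inter> crv (x, y) ` {0<..<1} = {})"

definition drawing :: "'v pair_pre_digraph \<Rightarrow> ('v \<Rightarrow> 's) \<Rightarrow> ('v \<times> 'v \<Rightarrow> real \<Rightarrow> 's) \<Rightarrow> 's set" where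
  "drawing G pos crv = pos ` pverts G \<union> (\<Union>a \<in> parcs G. crv a ` {0..1})"

definition faces ::
  "'s topology \<Rightarrow> 'v pair_pre_digraph \<Rightarrow> ('v \<Rightarrow> 's) \<Rightarrow> ('v \<times> 'v \<Rightarrow> real \<Rightarrow> 's) \<Rightarrow> 's set set" where
  "faces X G pos crv =
     connected_components_of (subtopology X (topspace X - drawing G pos crv))"

definition face_verts ::
  "'s topology \<Rightarrow> 'v pair_pre_digraph \<Rightarrow> ('v \<Rightarrow> 's) \<Rightarrow> 's set \<Rightarrow> 'v set" where
  "face_verts X G pos F = {v \<in> pverts G. pos v \<in> X frontier_of F}"

definition list_colorable :: "'v pair_pre_digraph \<Rightarrow> ('v \<Rightarrow> 'c set) \<Rightarrow> bool" where
  "list_colorable G L \<longleftrightarrow>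
     (\<exists>c. (\<forall>v \<in> pverts G. c v \<in> L v) \<and> (\<forall>(u, v) \<in> parcs G. c u \<noteq> c v))"

definition heawood :: "int \<Rightarrow> nat" where
  "heawood \<epsilon> = nat \<lfloor>(7 + sqrt (24 * real_of_int \<epsilon> + 1)) / 2\<rfloor>"

end

theory Submission imports Defs begin

text \<open>
  The proof counts edges of a minimal counterexample and then colours it.

  Take an induced subgraph on a vertex set \<open>S\<close> that cannot be coloured although all its proper
  subgraphs can. Each vertex of \<open>S\<close> has at least as many neighbours in \<open>S\<close> as colours, so with \<open>n\<close>
  vertices, \<open>f\<close> of them on the face, and the Heawood number \<open>H\<close> there are at least \<open>H n / 2 - f\<close> edges. On the
  other hand Euler's inequality bounds the number of edges: every face has at least three edge sides, and the
  distinguished face has at least as many as it has vertices, which for Euler genus \<open>\<epsilon>\<close> leaves at most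
  \<open>3 n - 3 + 3 \<epsilon> - max 3 f\<close> edges (\<open>face_count\<close>). The loss of two colours at a vertex of the face
  is balanced exactly by the term \<open>f\<close>. The two bounds leave \<open>(H - 6) n \<le> 6 \<epsilon> - 6\<close>, and with the
  quadratic inequalities that define \<open>H\<close> this means that \<open>n\<close> is \<open>H - 1\<close>, \<open>H\<close> or
  \<open>H + 1\<close>, except that nothing is said when \<open>\<epsilon> = 1\<close>, and that \<open>n = 12\<close> is possible when
  \<open>\<epsilon> = 9\<close> (\<open>critical_count.impossible\<close>).

  If \<open>n = H - 1\<close>, the graph is a complete graph on the face, which is excluded. In the other
  cases the graph is complete up to a few missing edges, and the count of edges, or for \<open>n = H\<close> the absence of the
  excluded complete graph, provides disjoint pairs of nonadjacent vertices. If the two lists of a pair share a colour, it serves for both vertices;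
  if no pair shares a colour, the lists are so large that Hall's theorem gives all vertices different colours
  (\<open>antimatching_colorable\<close>). Only for \<open>n = 12\<close> with vertices both on the face and off it, the argument is
  the one for equal lists below.

  If \<open>\<epsilon> = 1\<close>, all inequalities are equalities: every vertex has as many colours as neighbours, and
  all faces but the distinguished one are triangles. In this situation neighbours have equal lists unless one
  of them is a cut vertex (\<open>noncut_lists_equal\<close>). A vertex off the face is no cut vertex, because the triangles
  around it link its neighbours (\<open>tight_link_connected\<close>), and a cut vertex on the face cannot occur because
  its list is not larger than the others (\<open>critical_no_cutvertex\<close>). So all lists are equal, and Brooks' theorem leaves only the complete
  graph on five vertices (\<open>brooks\<close>).

  The topology consists of Euler's inequality and of the local structure of faces, and the curves are
  arbitrary arcs, not assumed tame. Both come from singular homology. The groups \<open>H_q(X, X - K)\<close> for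
  compact \<open>K\<close> are assembled from those of convex sets in charts: degree two is detected at points and higher degrees
  vanish (\<open>detects_compact\<close>). Removing a point or an open arc changes the ranks of \<open>H_1(X, X - D)\<close> and
  \<open>H_2(X, X - D)\<close> by a single unit (\<open>excess_insert_point\<close>, \<open>excess_Un_short_arc\<close>), and the exact sequence
  of the pair turns these ranks into the number of faces (\<open>comps_card_ge\<close>). The same computation shows that
  at most two faces lie along an edge; that an arc has only one side at its end point is Janiszewski's
  theorem.
\<close>

section \<open>Rank of abelian groups\<close>

text \<open>A homogeneous system with fewer equations than unknowns has a nonzero integral solution: Gaussian
  elimination that cross-multiplies instead of dividing.\<close>

lemma int_kernel_nontrivial:
  fixes a :: "'i \<Rightarrow> 'j \<Rightarrow> int"
  assumes "finite I" "finite J" "card I < card J"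
  shows "\<exists>x. (\<exists>j\<in>J. x j \<noteq> 0) \<and> (\<forall>i\<in>I. (\<Sum>j\<in>J. a i j * x j) = 0)"
  using assms
proof (induction I arbitrary: J a rule: finite_induct)
  case empty
  then obtain j where "j \<in> J" by fastforce
  then show ?case by (intro exI[of _ "\<lambda>_. 1"]) auto
next
  case (insert i0 I)
  show ?case
  proof (cases "\<forall>j\<in>J. a i0 j = 0")
    case True
    obtain x where "\<exists>j\<in>J. x j \<noteq> 0" "\<forall>i\<in>I. (\<Sum>j\<in>J. a i j * x j) = 0"
      using insert.IH[of J a] insert.prems insert.hyps by (auto simp: card_insert_if)
    then show ?thesis using True by (intro exI[of _ x]) auto
  next
    case False
    then obtain j0 where j0: "j0 \<in> J" "a i0 j0 \<noteq> 0" by auto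
    define J' where "J' = J - {j0}"
    have J: "J = insert j0 J'" "j0 \<notin> J'" "finite J'" using j0 insert.prems by (auto simp: J'_def)
    define b where "b i j = a i0 j0 * a i j - a i j0 * a i0 j" for i j
    have "card I < card J'"
      using insert.prems insert.hyps J by (auto simp: card_insert_if)
    then obtain x where x: "\<exists>j\<in>J'. x j \<noteq> 0" "\<forall>i\<in>I. (\<Sum>j\<in>J'. b i j * x j) = 0"
      using insert.IH[of J' b] J by auto
    define y where "y j = (if j = j0 then - (\<Sum>j\<in>J'. a i0 j * x j) else a i0 j0 * x j)" for j
    have sum_eq: "(\<Sum>j\<in>J. a i j * y j) =
        (\<Sum>j\<in>J'. a i0 j0 * a i j * x j) - (\<Sum>j\<in>J'. a i j0 * a i0 j * x j)" for i
    proof -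
      have "(\<Sum>j\<in>J'. a i j * y j) = (\<Sum>j\<in>J'. a i0 j0 * a i j * x j)"
        using J by (intro sum.cong) (auto simp: y_def)
      moreover have "a i j0 * y j0 = - (\<Sum>j\<in>J'. a i j0 * a i0 j * x j)"
        by (simp add: y_def sum_distrib_left mult.assoc)
      ultimately show ?thesis using J by simp
    qed
    have "(\<Sum>j\<in>J. a i j * y j) = 0" if "i \<in> insert i0 I" for i
    proof (cases "i = i0")
      case True
      show ?thesis unfolding sum_eq True by (simp add: mult.commute mult.left_commute)
    next
      case False
      then have "(\<Sum>j\<in>J'. b i j * x j) = 0" using x that by auto
      moreover have "(\<Sum>j\<in>J'. b i j * x j) =
         (\<Sum>j\<in>J'. a i0 j0 * a i j * x j) - (\<Sum>j\<in>J'. a i j0 * a i0 j * x j)"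
        by (simp add: b_def left_diff_distrib sum_subtractf)
      ultimately show ?thesis unfolding sum_eq by simp
    qed
    moreover have "\<exists>j\<in>J. y j \<noteq> 0"
      using x J j0 by (auto simp: y_def)
    ultimately show ?thesis by blast
  qed
qed

context comm_group
begin

lemma finprod_pow_add:
  assumes "g \<in> J \<rightarrow> carrier G"
  shows "finprod G (\<lambda>j. g j [^] (k j + l j :: int)) J =
    finprod G (\<lambda>j. g j [^] k j) J \<otimes> finprod G (\<lambda>j. g j [^] l j) J"
proof -
  have "finprod G (\<lambda>j. g j [^] (k j + l j)) J = finprod G (\<lambda>j. g j [^] k j \<otimes> g j [^] l j) J"
    using assms by (intro finprod_cong') (auto simp: int_pow_mult Pi_iff)
  also have "\<dots> = finprod G (\<lambda>j. g j [^] k j) J \<otimes> finprod G (\<lambda>j. g j [^] l j) J"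
    using assms by (intro finprod_multf) auto
  finally show ?thesis .
qed

lemma finprod_pow_scale:
  assumes "finite J" "g \<in> J \<rightarrow> carrier G"
  shows "finprod G (\<lambda>j. g j [^] (k j * n :: int)) J = finprod G (\<lambda>j. g j [^] k j) J [^] n"
  using assms
proof (induction J rule: finite_induct)
  case (insert x J)
  have "g x [^] (k x * n) = (g x [^] k x) [^] n" using insert by (simp add: int_pow_pow)
  moreover have "(g x [^] k x \<otimes> finprod G (\<lambda>j. g j [^] k j) J) [^] n
     = (g x [^] k x) [^] n \<otimes> finprod G (\<lambda>j. g j [^] k j) J [^] n"
    using insert by (intro int_pow_mult_distrib m_comm) (auto simp: Pi_iff)
  ultimately show ?case using insert by (simp add: Pi_iff)
qed simp

lemma finprod_pow_zero:
  assumes "g \<in> J \<rightarrow> carrier G" "\<And>j. j \<in> J \<Longrightarrow> k j = (0::int)"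
  shows "finprod G (\<lambda>j. g j [^] k j) J = \<one>"
  using assms by (intro finprod_one_eqI) auto

lemma finprod_pow_pow:
  fixes m x :: "'j \<Rightarrow> int"
  assumes "finite J" "finite I" "g \<in> I \<rightarrow> carrier G" "b \<in> J \<rightarrow> carrier G"
    and "\<And>j. j \<in> J \<Longrightarrow> b j [^] m j = finprod G (\<lambda>i. g i [^] a i j) I"
  shows "finprod G (\<lambda>j. b j [^] (m j * x j)) J = finprod G (\<lambda>i. g i [^] (\<Sum>j\<in>J. a i j * x j)) I"
  using assms
proof (induction J rule: finite_induct)
  case empty
  then show ?case by (simp add: finprod_one_eqI)
next
  case (insert y J)
  have "b y \<in> carrier G" using insert by auto
  then have "b y [^] (m y * x y) = (b y [^] m y) [^] x y"
    by (rule int_pow_pow[symmetric])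
  also have "b y [^] m y = finprod G (\<lambda>i. g i [^] a i y) I" using insert by blast
  also have "finprod G (\<lambda>i. g i [^] a i y) I [^] x y = finprod G (\<lambda>i. g i [^] (a i y * x y)) I"
    using insert by (simp add: finprod_pow_scale)
  finally have "b y [^] (m y * x y) = \<dots>" .
  moreover have "finprod G (\<lambda>j. b j [^] (m j * x j)) J = finprod G (\<lambda>i. g i [^] (\<Sum>j\<in>J. a i j * x j)) I"
    using insert by auto
  ultimately show ?case
    using insert by (simp add: finprod_pow_add Pi_iff)
qed

lemma int_independentD:
  assumes "int_independent G B" "finprod G (\<lambda>b. b [^] k b) B = \<one>" "b \<in> B"
  shows "k b = (0::int)"
  using assms by (auto simp: int_independent_def)

text \<open>Many elements whose multiples lie in the span of few cannot be independent: a system of linear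
  equations over the integers with more unknowns than equations has a nontrivial solution.\<close>

lemma int_independent_card_le:
  assumes B: "int_independent G B" and I: "finite I" "g \<in> I \<rightarrow> carrier G"
    and span: "\<And>b. b \<in> B \<Longrightarrow> \<exists>n a. n \<noteq> (0::int) \<and> b [^] n = finprod G (\<lambda>i. g i [^] (a i :: int)) I"
  shows "card B \<le> card I"
proof (rule ccontr)
  assume "\<not> card B \<le> card I"
  obtain n a where na: "\<And>b. b \<in> B \<Longrightarrow> n b \<noteq> (0::int) \<and> b [^] n b = finprod G (\<lambda>i. g i [^] (a b i :: int)) I"
    using span by metis
  have fin: "finite B" "B \<subseteq> carrier G" using B by (auto simp: int_independent_def)
  then obtain x where x: "\<exists>j\<in>B. x j \<noteq> 0" "\<forall>i\<in>I. (\<Sum>j\<in>B. a j i * x j) = 0"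
    using int_kernel_nontrivial[of I B "\<lambda>i j. a j i"] I \<open>\<not> _\<close> by auto
  have "finprod G (\<lambda>j. j [^] (n j * x j)) B = finprod G (\<lambda>i. g i [^] (\<Sum>j\<in>B. a j i * x j)) I"
    using fin I na by (intro finprod_pow_pow) auto
  also have "\<dots> = \<one>" using x I by (intro finprod_pow_zero) auto
  finally have "n j * x j = 0" if "j \<in> B" for j
    using int_independentD[OF B, of "\<lambda>j. n j * x j"] that by blast
  then show False using x na by (metis mult_eq_0_iff)
qed

lemma left_inverse_unique:
  assumes "x \<otimes> y = \<one>" "z \<otimes> y = \<one>" "x \<in> carrier G" "z \<in> carrier G" "y \<in> carrier G"
  shows "x = z"
  using assms by (metis inv_equality)

text \<open>A relation that involves \<open>b\<close> exists because \<open>C\<close> cannot be enlarged by \<open>b\<close>; solving it for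
  \<open>b\<close> is possible up to the coefficient of \<open>b\<close>, which is therefore allowed to be any nonzero \<open>n\<close>.\<close>

lemma int_independent_maximal_span:
  assumes C: "int_independent G C" and b: "b \<in> carrier G"
    and max: "b \<in> C \<or> \<not> int_independent G (insert b C)"
  shows "\<exists>n a. n \<noteq> (0::int) \<and> b [^] n = finprod G (\<lambda>i. i [^] (a i :: int)) C"
proof (cases "b \<in> C")
  case True
  have fin: "finite C" "C \<subseteq> carrier G" using C by (auto simp: int_independent_def)
  have "finprod G (\<lambda>i. i [^] (if i = b then 1 else 0 :: int)) C = finprod G (\<lambda>i. if i = b then i else \<one>) C"
    using fin by (intro finprod_cong') auto
  also have "\<dots> = b" using fin True by (subst finprod_singleton_swap) auto
  finally show ?thesis using b by (intro exI[of _ 1] exI[of _ "\<lambda>i. if i = b then 1 else 0"]) auto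
next
  case False
  have fin: "finite C" "C \<subseteq> carrier G" using C by (auto simp: int_independent_def)
  obtain k where k: "finprod G (\<lambda>c. c [^] (k c::int)) (insert b C) = \<one>" "\<exists>c\<in>insert b C. k c \<noteq> 0"
    using max False fin b by (auto simp: int_independent_def)
  have eq: "b [^] k b \<otimes> finprod G (\<lambda>c. c [^] k c) C = \<one>"
    using k(1) fin b False by (subst (asm) finprod_insert) auto
  have "k b \<noteq> 0"
  proof
    assume "k b = 0"
    then have "finprod G (\<lambda>c. c [^] k c) C = \<one>" using eq fin by (auto simp: subset_iff)
    then have "\<forall>c\<in>C. k c = 0" using int_independentD[OF C] by blast
    then show False using k(2) \<open>k b = 0\<close> by auto
  qed
  have "finprod G (\<lambda>c. c [^] (- k c)) C \<otimes> finprod G (\<lambda>c. c [^] k c) C = finprod G (\<lambda>c. c [^] (- k c + k c)) C"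
    using fin by (intro finprod_pow_add[symmetric]) auto
  also have "\<dots> = \<one>" using fin by (intro finprod_pow_zero) auto
  finally have "finprod G (\<lambda>c. c [^] (- k c)) C \<otimes> finprod G (\<lambda>c. c [^] k c) C = \<one>" .
  note inv = this
  have "finprod G (\<lambda>c. c [^] (- k c)) C \<in> carrier G" "finprod G (\<lambda>c. c [^] k c) C \<in> carrier G"
    using fin by - (rule finprod_closed, blast intro: int_pow_closed)+
  then have "b [^] k b = finprod G (\<lambda>c. c [^] (- k c)) C"
    by (rule left_inverse_unique[OF eq inv int_pow_closed[OF b]])
  then show ?thesis using \<open>k b \<noteq> 0\<close>
    by (intro exI[of _ "k b"] exI[of _ "\<lambda>c. - k c"]) simp
qed

lemma one_notin_int_independent:
  assumes "int_independent G B"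
  shows "\<one> \<notin> B"
proof
  assume 1: "\<one> \<in> B"
  have "finprod G (\<lambda>b. b [^] (if b = \<one> then 1 else 0 :: int)) B = \<one>"
    using assms by (intro finprod_one_eqI) (auto simp: int_independent_def)
  from int_independentD[OF assms this 1] show False by simp
qed

end

text \<open>Rank of a subgroup \<open>S\<close> of \<open>A\<close>, allowed to be infinite so that it is additive along
  exact sequences without finiteness hypotheses. Taking the subgroup as a set, rather than as a group of its own,
  keeps images and kernels of homomorphisms in the ambient group.\<close>

definition erank :: "('a, 'b) monoid_scheme \<Rightarrow> 'a set \<Rightarrow> enat" where
  "erank A S = (SUP B \<in> {B. int_independent A B \<and> B \<subseteq> S}. enat (card B))"

lemma erank_ge: "int_independent A B \<Longrightarrow> B \<subseteq> S \<Longrightarrow> enat (card B) \<le> erank A S"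
  unfolding erank_def by (intro SUP_upper) auto

lemma erank_le: "(\<And>B. int_independent A B \<Longrightarrow> B \<subseteq> S \<Longrightarrow> enat (card B) \<le> n) \<Longrightarrow> erank A S \<le> n"
  unfolding erank_def by (intro SUP_least) auto

lemma erank_mono: "S \<subseteq> T \<Longrightarrow> erank A S \<le> erank A T"
  by (intro erank_le erank_ge) auto

lemma int_independent_empty [simp]: "int_independent A {}"
  by (simp add: int_independent_def)

lemma erank_attained:
  assumes "erank A S = enat n"
  obtains B where "int_independent A B" "B \<subseteq> S" "card B = n"
proof -
  let ?X = "(\<lambda>B. enat (card B)) ` {B. int_independent A B \<and> B \<subseteq> S}"
  have ne: "?X \<noteq> {}" by (auto intro!: exI[of _ "{}"])
  have "Sup ?X = enat n" using assms by (simp add: erank_def)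
  then have "finite ?X" using ne by (auto simp: Sup_enat_def split: if_splits)
  then have "Sup ?X \<in> ?X"
    using Max_in[of ?X] ne unfolding Sup_enat_def by presburger
  then have "enat n \<in> ?X" using \<open>Sup ?X = enat n\<close> by simp
  then show ?thesis using that by auto
qed

lemma erank_one:
  assumes "comm_group A"
  shows "erank A {\<one>\<^bsub>A\<^esub>} = 0"
proof -
  interpret A: comm_group A by fact
  have "erank A {\<one>\<^bsub>A\<^esub>} \<le> 0"
    using A.one_notin_int_independent by (intro erank_le) (auto simp: subset_singleton_iff zero_enat_def)
  then show ?thesis by simp
qed

lemma group_rank_eq_erank:
  assumes "erank A (carrier A) = enat n"
  shows "group_rank A = n"
proof -
  obtain B where B: "int_independent A B" "card B = n" using erank_attained[OF assms] by metis
  have "Sup {card B |B. int_independent A B} = n"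
  proof (rule cSup_eq_maximum)
    fix m assume "m \<in> {card B |B. int_independent A B}"
    then obtain C where "int_independent A C" "m = card C" by auto
    then show "m \<le> n" using erank_ge[of A C "carrier A"] assms by (auto simp: int_independent_def)
  qed (use B in auto)
  then show ?thesis by (simp add: group_rank_def)
qed

lemma hom_finprod_pow:
  assumes "comm_group A" "comm_group B" "h \<in> hom A B" "g \<in> J \<rightarrow> carrier A"
  shows "h (finprod A (\<lambda>j. g j [^]\<^bsub>A\<^esub> (k j :: int)) J) = finprod B (\<lambda>j. h (g j) [^]\<^bsub>B\<^esub> k j) J"
proof -
  interpret A: comm_group A by fact
  interpret B: comm_group B by fact
  interpret H: group_hom A B h by unfold_locales fact
  show ?thesis
  proof (cases "finite J")
    case True
    then show ?thesis using assms(4)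
    proof (induction J rule: finite_induct)
      case (insert x J)
      then show ?case by (simp add: Pi_iff H.hom_int_pow)
    qed simp
  qed simp
qed

text \<open>Rank is additive: a maximal independent set of the kernel together with lifts of a maximal
  independent set of the image is independent, and spans up to multiples.\<close>

theorem erank_hom:
  assumes A: "comm_group A" and B: "comm_group B" and h: "h \<in> hom A B" and S: "subgroup S A"
  shows "erank A S = erank A (S \<inter> kernel A B h) + erank B (h ` S)"
proof -
  interpret A: comm_group A by fact
  interpret B: comm_group B by fact
  interpret H: group_hom A B h by unfold_locales fact
  have SA: "S \<subseteq> carrier A" using S subgroup.subset by blast
  let ?K = "S \<inter> kernel A B h"
  have lift: "\<exists>C. inj_on h C \<and> h ` C = D \<and> C \<subseteq> S \<and> finite C \<and> card C = card D \<and> (\<forall>k. finprod B (\<lambda>b. b [^]\<^bsub>B\<^esub> k b) D = finprod B (\<lambda>c. h c [^]\<^bsub>B\<^esub> (k (h c)::int)) C)"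
    if D: "int_independent B D" "D \<subseteq> h ` S" for D
  proof -
    define s where "s = inv_into S h"
    have s: "s d \<in> S" "h (s d) = d" if "d \<in> D" for d
      using that D(2) by (auto simp: s_def inv_into_into f_inv_into_f subset_iff)
    have inj: "inj_on h (s ` D)" using s by (auto simp: inj_on_def)
    have hD: "h ` (s ` D) = D" using s by (auto simp: image_iff)
    have finD: "finite D" "D \<subseteq> carrier B" using D by (auto simp: int_independent_def)
    have "card (s ` D) = card D" using card_image[OF inj] hD by simp
    moreover have "finprod B (\<lambda>b. b [^]\<^bsub>B\<^esub> k b) D = finprod B (\<lambda>c. h c [^]\<^bsub>B\<^esub> (k (h c)::int)) (s ` D)" for k
      using B.finprod_reindex[of "\<lambda>b. b [^]\<^bsub>B\<^esub> k b" h "s ` D"] inj hD finD by (auto simp: Pi_iff)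
    ultimately show ?thesis using inj hD finD s by (intro exI[of _ "s ` D"]) auto
  qed
  have indep_of: "int_independent A (B1 \<union> C)" "B1 \<inter> C = {}"
    if B1: "int_independent A B1" "B1 \<subseteq> ?K" and D: "int_independent B D"
      and C: "inj_on h C" "h ` C = D" "C \<subseteq> S" "finite C"
        "\<And>k. finprod B (\<lambda>b. b [^]\<^bsub>B\<^esub> k b) D = finprod B (\<lambda>c. h c [^]\<^bsub>B\<^esub> (k (h c)::int)) C"
    for B1 C D
  proof -
    show disj: "B1 \<inter> C = {}"
      using B.one_notin_int_independent[OF D] B1(2) C(2) by (force simp: kernel_def)
    have fin: "finite B1" "B1 \<subseteq> carrier A" using B1 by (auto simp: int_independent_def)
    have finD: "finite D" "D \<subseteq> carrier B" using D by (auto simp: int_independent_def)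
    have CA: "C \<subseteq> carrier A" using C SA by auto
    have "k b = 0" if k: "finprod A (\<lambda>b. b [^]\<^bsub>A\<^esub> k b) (B1 \<union> C) = \<one>\<^bsub>A\<^esub>" and b: "b \<in> B1 \<union> C" for k :: "_ \<Rightarrow> int" and b
    proof -
      have split: "finprod A (\<lambda>b. b [^]\<^bsub>A\<^esub> k b) B1 \<otimes>\<^bsub>A\<^esub> finprod A (\<lambda>b. b [^]\<^bsub>A\<^esub> k b) C = \<one>\<^bsub>A\<^esub>"
        using k A.finprod_Un_disjoint[of B1 C "\<lambda>b. b [^]\<^bsub>A\<^esub> k b"] fin C(4) disj CA by (auto simp: Pi_iff subset_iff)
      have c1: "finprod A (\<lambda>b. b [^]\<^bsub>A\<^esub> k b) B1 \<in> carrier A" "finprod A (\<lambda>b. b [^]\<^bsub>A\<^esub> k b) C \<in> carrier A"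
        using fin CA by (auto intro!: A.finprod_closed)
      have "h (finprod A (\<lambda>b. b [^]\<^bsub>A\<^esub> k b) B1) = finprod B (\<lambda>b. h b [^]\<^bsub>B\<^esub> k b) B1"
        using fin by (intro hom_finprod_pow A B h) auto
      also have "\<dots> = \<one>\<^bsub>B\<^esub>" using B1(2) by (intro B.finprod_one_eqI) (auto simp: kernel_def)
      finally have "h (finprod A (\<lambda>b. b [^]\<^bsub>A\<^esub> k b) C) = \<one>\<^bsub>B\<^esub>"
        using arg_cong[OF split, of h] c1 by simp
      moreover have "h (finprod A (\<lambda>b. b [^]\<^bsub>A\<^esub> k b) C) = finprod B (\<lambda>b. h b [^]\<^bsub>B\<^esub> k b) C"
        using CA by (intro hom_finprod_pow A B h) auto
      moreover have "finprod B (\<lambda>b. h b [^]\<^bsub>B\<^esub> k b) C = finprod B (\<lambda>b. b [^]\<^bsub>B\<^esub> (k (inv_into C h b))) D"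
        unfolding C(5) using C(1) CA by (intro B.finprod_cong') auto
      ultimately have "finprod B (\<lambda>b. b [^]\<^bsub>B\<^esub> (k (inv_into C h b))) D = \<one>\<^bsub>B\<^esub>" by simp
      then have "\<forall>d\<in>D. k (inv_into C h d) = 0" using B.int_independentD[OF D, of "\<lambda>b. k (inv_into C h b)"] by simp
      then have kC: "\<forall>c\<in>C. k c = 0" using C by auto
      then have "finprod A (\<lambda>b. b [^]\<^bsub>A\<^esub> k b) C = \<one>\<^bsub>A\<^esub>" using CA by (intro A.finprod_pow_zero) auto
      then have "finprod A (\<lambda>b. b [^]\<^bsub>A\<^esub> k b) B1 = \<one>\<^bsub>A\<^esub>" using split c1 by simp
      then show ?thesis using A.int_independentD[OF B1(1)] b kC by auto
    qed
    then show "int_independent A (B1 \<union> C)"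
      using fin CA C(4) by (auto simp: int_independent_def)
  qed
  have ge_im: "erank B (h ` S) \<le> erank A S"
  proof (rule erank_le)
    fix D assume D: "int_independent B D" "D \<subseteq> h ` S"
    from lift[OF this] obtain C where C: "inj_on h C" "h ` C = D" "C \<subseteq> S" "finite C" "card C = card D"
        "\<And>k. finprod B (\<lambda>b. b [^]\<^bsub>B\<^esub> k b) D = finprod B (\<lambda>c. h c [^]\<^bsub>B\<^esub> (k (h c)::int)) C"
      by metis
    have "int_independent A ({} \<union> C)" by (rule indep_of[OF _ _ D(1) C(1-4,6)]) auto
    then show "enat (card D) \<le> erank A S" using C erank_ge[of A C S] by auto
  qed
  have ge_ker: "erank A ?K \<le> erank A S" by (intro erank_mono) auto
  show ?thesis
  proof (cases "erank A ?K = \<infinity> \<or> erank B (h ` S) = \<infinity>")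
    case True
    then show ?thesis using ge_im ge_ker by auto
  next
    case False
    then obtain m n where m: "erank A ?K = enat m" and n: "erank B (h ` S) = enat n" by auto
    obtain B1 where B1: "int_independent A B1" "B1 \<subseteq> ?K" "card B1 = m" using erank_attained[OF m] .
    obtain D where D: "int_independent B D" "D \<subseteq> h ` S" "card D = n" using erank_attained[OF n] .
    from lift[OF D(1,2)] obtain C where C: "inj_on h C" "h ` C = D" "C \<subseteq> S" "finite C" "card C = card D"
        "\<And>k. finprod B (\<lambda>b. b [^]\<^bsub>B\<^esub> k b) D = finprod B (\<lambda>c. h c [^]\<^bsub>B\<^esub> (k (h c)::int)) C"
      by metis
    note ind = indep_of[OF B1(1,2) D(1) C(1-4,6)]
    have fin: "finite B1" "B1 \<subseteq> carrier A" using B1 by (auto simp: int_independent_def)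
    have CA: "C \<subseteq> carrier A" using C SA by auto
    have card: "card (B1 \<union> C) = m + n"
      using fin C ind B1 D by (simp add: card_Un_disjoint)
    have "enat (m + n) \<le> erank A S"
      using erank_ge[OF ind(1), of S] B1 C card by auto
    moreover have "erank A S \<le> enat (m + n)"
    proof (rule erank_le)
      fix E assume E: "int_independent A E" "E \<subseteq> S"
      have "card E \<le> card (B1 \<union> C)"
      proof (rule A.int_independent_card_le[OF E(1), of _ "\<lambda>x. x"])
        show "finite (B1 \<union> C)" "(\<lambda>x. x) \<in> B1 \<union> C \<rightarrow> carrier A" using fin C CA by auto
        fix e assume e: "e \<in> E"
        then have eS: "e \<in> S" "e \<in> carrier A" using E SA by auto
        have nD: "\<not> int_independent B (insert (h e) D)" if "h e \<notin> D"
        proof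
          assume "int_independent B (insert (h e) D)"
          then have "enat (card (insert (h e) D)) \<le> erank B (h ` S)" using D eS by (intro erank_ge) auto
          then show False using that D n by (auto simp: int_independent_def)
        qed
        have "h e \<in> D \<or> \<not> int_independent B (insert (h e) D)" using nD by blast
        from B.int_independent_maximal_span[OF D(1) H.hom_closed[OF eS(2)] this]
        obtain p a where p: "p \<noteq> (0::int)" "h e [^]\<^bsub>B\<^esub> p = finprod B (\<lambda>i. i [^]\<^bsub>B\<^esub> (a i::int)) D"
          by (elim exE conjE)
        define x where "x = finprod A (\<lambda>c. c [^]\<^bsub>A\<^esub> a (h c)) C"
        have xS: "x \<in> S"
        proof -
          have "finprod A (\<lambda>c. c [^]\<^bsub>A\<^esub> a (h c)) C' \<in> S" if "C' \<subseteq> C" for C'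
          proof -
            have "finite C'" using that C(4) finite_subset by auto
            then show ?thesis using that
            proof (induction C' rule: finite_induct)
              case empty then show ?case using S subgroup.one_closed by auto
            next
              case (insert c C')
              have "c [^]\<^bsub>A\<^esub> a (h c) \<in> S"
                using S insert C(3) A.subgroup_int_pow_closed by auto
              then show ?case using insert S CA by (auto simp: Pi_iff subset_iff subgroup.m_closed)
            qed
          qed
          then show ?thesis by (simp add: x_def)
        qed
        have "h x = finprod B (\<lambda>c. h c [^]\<^bsub>B\<^esub> a (h c)) C"
          unfolding x_def using CA by (intro hom_finprod_pow A B h) auto
        then have hx: "h x = h e [^]\<^bsub>B\<^esub> p" using p C(6) by simp
        define y where "y = e [^]\<^bsub>A\<^esub> p \<otimes>\<^bsub>A\<^esub> inv\<^bsub>A\<^esub> x"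
        have yS: "y \<in> S" unfolding y_def
          using S eS xS A.subgroup_int_pow_closed by (intro subgroup.m_closed subgroup.m_inv_closed) auto
        have xA: "x \<in> carrier A" "y \<in> carrier A" using xS yS SA by auto
        have "h y = \<one>\<^bsub>B\<^esub>" unfolding y_def using hx eS xA by (simp add: H.hom_int_pow)
        then have yK: "y \<in> ?K" using yS xA by (auto simp: kernel_def)
        have nB: "\<not> int_independent A (insert y B1)" if "y \<notin> B1"
        proof
          assume "int_independent A (insert y B1)"
          then have "enat (card (insert y B1)) \<le> erank A ?K" using B1 yK by (intro erank_ge) auto
          then show False using that B1 m fin by auto
        qed
        have "y \<in> B1 \<or> \<not> int_independent A (insert y B1)" using nB by blast
        from A.int_independent_maximal_span[OF B1(1) xA(2) this]
        obtain q b where q: "q \<noteq> (0::int)" "y [^]\<^bsub>A\<^esub> q = finprod A (\<lambda>i. i [^]\<^bsub>A\<^esub> (b i::int)) B1"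
          by (elim exE conjE)
        have eq: "e [^]\<^bsub>A\<^esub> p = y \<otimes>\<^bsub>A\<^esub> x" using eS xA by (simp add: y_def A.m_assoc)
        have "e [^]\<^bsub>A\<^esub> (p * q) = (y \<otimes>\<^bsub>A\<^esub> x) [^]\<^bsub>A\<^esub> q" using eS eq by (simp flip: A.int_pow_pow)
        also have "\<dots> = y [^]\<^bsub>A\<^esub> q \<otimes>\<^bsub>A\<^esub> x [^]\<^bsub>A\<^esub> q"
          using xA by (intro A.int_pow_mult_distrib A.m_comm)
        also have "x [^]\<^bsub>A\<^esub> q = finprod A (\<lambda>c. c [^]\<^bsub>A\<^esub> (a (h c) * q)) C"
          unfolding x_def using CA C by (intro A.finprod_pow_scale[symmetric]) auto
        also have "y [^]\<^bsub>A\<^esub> q = finprod A (\<lambda>i. i [^]\<^bsub>A\<^esub> (b i)) B1" by (fact q)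
        also have "finprod A (\<lambda>i. i [^]\<^bsub>A\<^esub> (b i)) B1 =
            finprod A (\<lambda>i. i [^]\<^bsub>A\<^esub> (if i \<in> B1 then b i else a (h i) * q)) B1"
          using fin by (intro A.finprod_cong') auto
        also have "finprod A (\<lambda>c. c [^]\<^bsub>A\<^esub> (a (h c) * q)) C =
            finprod A (\<lambda>i. i [^]\<^bsub>A\<^esub> (if i \<in> B1 then b i else a (h i) * q)) C"
          using ind CA by (intro A.finprod_cong') auto
        also have "finprod A (\<lambda>i. i [^]\<^bsub>A\<^esub> (if i \<in> B1 then b i else a (h i) * q)) B1 \<otimes>\<^bsub>A\<^esub>
            finprod A (\<lambda>i. i [^]\<^bsub>A\<^esub> (if i \<in> B1 then b i else a (h i) * q)) C =
            finprod A (\<lambda>i. i [^]\<^bsub>A\<^esub> (if i \<in> B1 then b i else a (h i) * q)) (B1 \<union> C)"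
          using fin C(4) CA ind by (intro A.finprod_Un_disjoint[symmetric]) auto
        finally show "\<exists>n a. n \<noteq> (0::int) \<and> e [^]\<^bsub>A\<^esub> n = finprod A (\<lambda>i. i [^]\<^bsub>A\<^esub> (a i :: int)) (B1 \<union> C)"
          using p(1) q(1) by (intro exI[of _ "p * q"]) auto
      qed
      then show "enat (card E) \<le> enat (m + n)" using card by simp
    qed
    ultimately show ?thesis using m n by auto
  qed
qed

lemma erank_carrier_hom:
  assumes "comm_group A" "comm_group B" "h \<in> hom A B"
  shows "erank A (carrier A) = erank A (kernel A B h) + erank B (h ` carrier A)"
proof -
  interpret A: comm_group A by fact
  have "carrier A \<inter> kernel A B h = kernel A B h" by (auto simp: kernel_def)
  then show ?thesis
    using erank_hom[OF assms] A.subgroup_self by metis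
qed

lemma erank_image_inj:
  assumes "comm_group A" "comm_group B" "h \<in> hom A B" "subgroup S A"
    and "\<And>x. x \<in> S \<Longrightarrow> h x = \<one>\<^bsub>B\<^esub> \<Longrightarrow> x = \<one>\<^bsub>A\<^esub>"
  shows "erank B (h ` S) = erank A S"
proof -
  interpret A: comm_group A by fact
  interpret B: comm_group B by fact
  interpret H: group_hom A B h by unfold_locales fact
  have "S \<inter> kernel A B h = {\<one>\<^bsub>A\<^esub>}"
  proof
    show "S \<inter> kernel A B h \<subseteq> {\<one>\<^bsub>A\<^esub>}"
    proof
      fix x assume "x \<in> S \<inter> kernel A B h"
      then have "x \<in> S" "h x = \<one>\<^bsub>B\<^esub>" by (simp_all add: kernel_def)
      then have "x = \<one>\<^bsub>A\<^esub>" by (rule assms(5))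
      then show "x \<in> {\<one>\<^bsub>A\<^esub>}" by simp
    qed
    show "{\<one>\<^bsub>A\<^esub>} \<subseteq> S \<inter> kernel A B h"
      using subgroup.one_closed[OF assms(4)] by (simp add: kernel_def)
  qed
  then show ?thesis using erank_hom[OF assms(1-4)] erank_one[OF assms(1)] by simp
qed

lemma erank_iso:
  assumes "comm_group A" "comm_group B" "A \<cong> B"
  shows "erank A (carrier A) = erank B (carrier B)"
proof -
  interpret A: comm_group A by fact
  interpret B: comm_group B by fact
  obtain h where h: "h \<in> iso A B" using assms(3) by (auto simp: is_iso_def)
  then have hom: "h \<in> hom A B" and inj: "inj_on h (carrier A)" and im: "h ` carrier A = carrier B"
    by (auto simp: iso_def bij_betw_def)
  interpret H: group_hom A B h by unfold_locales fact
  have "erank B (h ` carrier A) = erank A (carrier A)"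
    by (rule erank_image_inj[OF assms(1,2) hom A.subgroup_self])
      (metis H.hom_one A.one_closed inj inj_onD)
  then show ?thesis using im by simp
qed

lemma erank_trivial_group:
  assumes "comm_group A" "trivial_group A"
  shows "erank A (carrier A) = 0"
  using assms erank_one by (auto simp: trivial_group_def)

lemma finprod_free_Abelian_group:
  assumes "finite J" "\<And>j. j \<in> J \<Longrightarrow> Poly_Mapping.keys (g j) \<subseteq> S"
  shows "finprod (free_Abelian_group S) (\<lambda>j. g j [^]\<^bsub>free_Abelian_group S\<^esub> (k j::int)) J = (\<Sum>j\<in>J. frag_cmul (k j) (g j))"
proof -
  interpret comm_group "free_Abelian_group S" by (rule abelian_free_Abelian_group)
  have c: "Poly_Mapping.keys (frag_cmul (k j) (g j)) \<subseteq> S" if "j \<in> J" for j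
    using assms(2)[OF that] keys_cmul[of "k j" "g j"] by blast
  show ?thesis using assms c
  proof (induction J rule: finite_induct)
    case (insert x J)
    have "(\<lambda>j. g j [^]\<^bsub>free_Abelian_group S\<^esub> (k j::int)) \<in> J \<rightarrow> carrier (free_Abelian_group S)"
      using insert by (auto intro!: int_pow_closed)
    moreover have "g x [^]\<^bsub>free_Abelian_group S\<^esub> (k x::int) \<in> carrier (free_Abelian_group S)"
      using insert by (intro int_pow_closed) auto
    ultimately show ?case using insert by (simp del: carrier_free_Abelian_group_iff)
  qed simp
qed

lemma erank_free_Abelian_group_le:
  assumes "finite S"
  shows "erank (free_Abelian_group S) (carrier (free_Abelian_group S)) \<le> enat (card S)"
proof (rule erank_le)
  interpret comm_group "free_Abelian_group S" by (rule abelian_free_Abelian_group)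
  fix B assume B: "int_independent (free_Abelian_group S) B"
  have "card B \<le> card S"
  proof (rule int_independent_card_le[OF B assms, of frag_of])
    show "frag_of \<in> S \<rightarrow> carrier (free_Abelian_group S)" by auto
    fix b assume b: "b \<in> B"
    then have "b \<in> carrier (free_Abelian_group S)" using B unfolding int_independent_def by blast
    then have kb: "Poly_Mapping.keys b \<subseteq> S" by simp
    have "b = (\<Sum>j\<in>S. frag_cmul (Poly_Mapping.lookup b j) (frag_of j))"
    proof (rule poly_mapping_eqI)
      fix i
      have "Poly_Mapping.lookup (\<Sum>j\<in>S. frag_cmul (Poly_Mapping.lookup b j) (frag_of j)) i
         = (\<Sum>j\<in>S. Poly_Mapping.lookup b j * (if j = i then 1 else 0))"
        by (auto simp: lookup_sum intro!: sum.cong)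
      also have "\<dots> = (\<Sum>j\<in>S. if j = i then Poly_Mapping.lookup b j else 0)"
        by (intro sum.cong) auto
      also have "\<dots> = Poly_Mapping.lookup b i"
        using assms kb by (auto simp: sum.delta in_keys_iff)
      finally show "Poly_Mapping.lookup b i = Poly_Mapping.lookup (\<Sum>j\<in>S. frag_cmul (Poly_Mapping.lookup b j) (frag_of j)) i"
        by simp
    qed
    also have "\<dots> = finprod (free_Abelian_group S) (\<lambda>j. frag_of j [^]\<^bsub>free_Abelian_group S\<^esub> Poly_Mapping.lookup b j) S"
      using assms by (subst finprod_free_Abelian_group) auto
    finally have "b [^]\<^bsub>free_Abelian_group S\<^esub> (1::int) = finprod (free_Abelian_group S) (\<lambda>j. frag_of j [^]\<^bsub>free_Abelian_group S\<^esub> Poly_Mapping.lookup b j) S"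
      using kb by simp
    then show "\<exists>n a. n \<noteq> (0::int) \<and> b [^]\<^bsub>free_Abelian_group S\<^esub> n =
        finprod (free_Abelian_group S) (\<lambda>i. frag_of i [^]\<^bsub>free_Abelian_group S\<^esub> (a i :: int)) S"
      by (intro exI[of _ 1] exI[of _ "Poly_Mapping.lookup b"] conjI) simp_all
  qed
  then show "enat (card B) \<le> enat (card S)" by simp
qed

lemma erank_free_Abelian_group_ge:
  assumes "finite T" "T \<subseteq> S"
  shows "enat (card T) \<le> erank (free_Abelian_group S) (carrier (free_Abelian_group S))"
proof -
  have inj: "inj_on frag_of T" by (auto simp: inj_on_def) (metis keys_frag_of singleton_inject)
  have "int_independent (free_Abelian_group S) (frag_of ` T)"
    unfolding int_independent_def
  proof (intro conjI allI impI ballI)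
    fix k :: "('a \<Rightarrow>\<^sub>0 int) \<Rightarrow> int" and b
    assume eq: "finprod (free_Abelian_group S) (\<lambda>b. b [^]\<^bsub>free_Abelian_group S\<^esub> k b) (frag_of ` T) = \<one>\<^bsub>free_Abelian_group S\<^esub>"
      and b: "b \<in> frag_of ` T"
    then obtain t where t: "t \<in> T" "b = frag_of t" by auto
    have "(\<Sum>j\<in>frag_of ` T. frag_cmul (k j) j) = 0"
      using eq assms by (subst (asm) finprod_free_Abelian_group) auto
    then have "(\<Sum>j\<in>T. frag_cmul (k (frag_of j)) (frag_of j)) = 0"
      using inj by (simp add: sum.reindex)
    then have "0 = Poly_Mapping.lookup (\<Sum>j\<in>T. frag_cmul (k (frag_of j)) (frag_of j)) t" by simp
    also have "\<dots> = (\<Sum>j\<in>T. k (frag_of j) * (if j = t then 1 else 0))"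
      by (auto simp: lookup_sum intro!: sum.cong)
    also have "\<dots> = (\<Sum>j\<in>T. if j = t then k (frag_of j) else 0)" by (intro sum.cong) auto
    also have "\<dots> = k b" using assms t by (simp add: sum.delta)
    finally show "k b = 0" by simp
  qed (use assms in auto)
  moreover have "frag_of ` T \<subseteq> carrier (free_Abelian_group S)" using assms by auto
  ultimately have "enat (card (frag_of ` T)) \<le> erank (free_Abelian_group S) (carrier (free_Abelian_group S))"
    by (rule erank_ge)
  then show ?thesis using inj by (simp add: card_image)
qed

lemma erank_free_Abelian_group:
  assumes "finite S"
  shows "erank (free_Abelian_group S) (carrier (free_Abelian_group S)) = enat (card S)"
  using erank_free_Abelian_group_le[OF assms] erank_free_Abelian_group_ge[OF assms, of S] by auto

lemma erank_integer_group: "erank integer_group (carrier integer_group) = 1"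
proof -
  have "erank integer_group (carrier integer_group) = erank (free_Abelian_group {()}) (carrier (free_Abelian_group {()}))"
    by (intro erank_iso isomorphic_group_integer_free_Abelian_group_singleton abelian_free_Abelian_group abelian_integer_group)
  then show ?thesis by (simp add: erank_free_Abelian_group one_enat_def)
qed

text \<open>The form in which the long exact sequences of homology are used: the kernel in \<open>erank_hom\<close> is
  the image of the preceding map.\<close>

lemma erank_exact:
  assumes "exact_seq ([C, B, A], [g, f])" "comm_group B" "comm_group C"
  shows "erank B (carrier B) = erank B (f ` carrier A) + erank C (g ` carrier B)"
proof -
  have "g \<in> hom B C" "kernel B C g = f ` carrier A"
    using assms(1) by (auto simp: group_hom_def group_hom_axioms_def)
  then show ?thesis using erank_carrier_hom[OF assms(2,3)] by metis
qed

lemma erank_image_le: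
  assumes "comm_group A" "comm_group B" "h \<in> hom A B" "subgroup S A"
  shows "erank B (h ` S) \<le> erank A S"
  using erank_hom[OF assms] by simp

text \<open>Additivity for \<open>j\<close> on \<open>S\<close>, transported along \<open>i\<close>: the image of \<open>S\<close> under \<open>i\<close> is
  controlled by the part of \<open>S\<close> that \<open>j\<close> kills, up to the rank of what \<open>j\<close> sees.\<close>

lemma erank_image_two_homs:
  assumes "comm_group A" "comm_group B" "comm_group C" "i \<in> hom A B" "j \<in> hom A C" "subgroup S A"
  shows "erank B (i ` S) \<le> erank B (i ` (S \<inter> kernel A C j)) + erank C (j ` S)"
proof -
  interpret A: comm_group A by fact
  interpret B: comm_group B by fact
  interpret C: comm_group C by fact
  interpret I: group_hom A B i by unfold_locales fact
  interpret J: group_hom A C j by unfold_locales fact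
  let ?P = "B \<times>\<times> C"
  let ?p = "\<lambda>x. (i x, j x)"
  have P: "comm_group ?P"
    using DirProd_group[OF A.is_group B.is_group] DirProd_group[OF B.is_group C.is_group]
    by (intro group.group_comm_groupI) (auto intro: B.m_comm C.m_comm simp: DirProd_group[OF B.is_group C.is_group])
  interpret P: comm_group ?P by (fact P)
  have p: "?p \<in> hom A ?P" by (auto simp: hom_def)
  interpret p: group_hom A ?P ?p by unfold_locales (fact p)
  have T: "subgroup (?p ` S) ?P" using assms(6) by (rule p.subgroup_img_is_subgroup)
  have SA: "S \<subseteq> carrier A" using assms(6) subgroup.subset by blast
  have fst: "fst \<in> hom ?P B" and snd: "snd \<in> hom ?P C" by (auto simp: hom_def)
  have "erank B (i ` S) = erank B (fst ` ?p ` S)" by (simp add: image_image)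
  also have "\<dots> \<le> erank ?P (?p ` S)" by (rule erank_image_le[OF P assms(2) fst T])
  also have "\<dots> = erank ?P (?p ` S \<inter> kernel ?P C snd) + erank C (snd ` ?p ` S)"
    by (rule erank_hom[OF P assms(3) snd T])
  also have "snd ` ?p ` S = j ` S" by (simp add: image_image)
  also have "erank ?P (?p ` S \<inter> kernel ?P C snd) = erank B (i ` (S \<inter> kernel A C j))"
  proof -
    have "erank B (fst ` (?p ` S \<inter> kernel ?P C snd)) = erank ?P (?p ` S \<inter> kernel ?P C snd)"
    proof (rule erank_image_inj[OF P assms(2) fst])
      show "subgroup (?p ` S \<inter> kernel ?P C snd) ?P"
        using P assms(3) snd T
        by (intro P.subgroups_Inter_pair group_hom.subgroup_kernel) (auto simp: group_hom_def group_hom_axioms_def)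
    qed (auto simp: kernel_def)
    moreover have "fst ` (?p ` S \<inter> kernel ?P C snd) = i ` (S \<inter> kernel A C j)"
      using SA by (force simp: kernel_def)
    ultimately show ?thesis by simp
  qed
  finally show ?thesis .
qed

section \<open>Relative homology\<close>

lemma trivial_groupI:
  assumes "group G" "\<And>x. x \<in> carrier G \<Longrightarrow> x = \<one>\<^bsub>G\<^esub>"
  shows "trivial_group G"
proof -
  have "carrier G \<subseteq> {\<one>\<^bsub>G\<^esub>}" using assms(2) by blast
  then show ?thesis using group.trivial_group_alt[OF assms(1)] by blast
qed

lemma hom_induced_one:
  "hom_induced q X S Y T f \<one>\<^bsub>relative_homology_group q X S\<^esub> = \<one>\<^bsub>relative_homology_group q Y T\<^esub>"
  by (intro hom_one[OF hom_induced_hom]) simp_all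

text \<open>All maps between relative groups below are induced by inclusions, so they compose whenever
  they are composable. The following forms cover the combinations of subspaces and pairs that occur; they
  are stated on elements because most arguments are diagram chases.\<close>

lemma hom_induced_incl_incl:
  assumes "topspace X \<inter> A \<subseteq> B" "S \<subseteq> T" "T \<subseteq> U" "B \<subseteq> C"
  shows "hom_induced q (subtopology X B) T (subtopology X C) U id (hom_induced q (subtopology X A) S (subtopology X B) T id z)
    = hom_induced q (subtopology X A) S (subtopology X C) U id z"
proof -
  have *: "continuous_map (subtopology X A) (subtopology X B) id" if "topspace X \<inter> A \<subseteq> B" for A B
    using that by (auto simp: continuous_map_in_subtopology continuous_map_from_subtopology)
  have "hom_induced q (subtopology X B) T (subtopology X C) U id (hom_induced q (subtopology X A) S (subtopology X B) T id z)
      = hom_induced q (subtopology X A) S (subtopology X C) U (id \<circ> id) z"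
    using assms by (intro hom_induced_compose' *) auto
  then show ?thesis by simp
qed

lemma hom_induced_incl_abs:
  assumes "S \<subseteq> T" "T \<subseteq> U"
  shows "hom_induced q (subtopology X B) T X U id (hom_induced q (subtopology X B) S (subtopology X B) T id z)
    = hom_induced q (subtopology X B) S X U id z"
    and "hom_induced q X T X U id (hom_induced q (subtopology X B) S X T id z)
    = hom_induced q (subtopology X B) S X U id z"
    and "hom_induced q X T X U id (hom_induced q X S X T id y)
    = hom_induced q X S X U id y"
proof -
  have *: "continuous_map (subtopology X B) X id" by (simp add: continuous_map_from_subtopology)
  show "hom_induced q (subtopology X B) T X U id (hom_induced q (subtopology X B) S (subtopology X B) T id z)
    = hom_induced q (subtopology X B) S X U id z"
    using assms by (subst hom_induced_compose'[OF _ _ *]) auto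
  show "hom_induced q X T X U id (hom_induced q (subtopology X B) S X T id z)
    = hom_induced q (subtopology X B) S X U id z"
    using assms by (subst hom_induced_compose'[OF *]) auto
  show "hom_induced q X T X U id (hom_induced q X S X T id y) = hom_induced q X S X U id y"
    using assms by (subst hom_induced_compose') auto
qed

lemma hom_induced_incl_sub:
  assumes "topspace X \<inter> A \<subseteq> B" "S \<subseteq> T" "T \<subseteq> U"
  shows "hom_induced q (subtopology X B) T X U id (hom_induced q (subtopology X A) S (subtopology X B) T id z)
    = hom_induced q (subtopology X A) S X U id z"
proof -
  have "continuous_map (subtopology X A) (subtopology X B) id"
    using assms by (auto simp: continuous_map_in_subtopology continuous_map_from_subtopology)
  moreover have "continuous_map (subtopology X B) X id" by (simp add: continuous_map_from_subtopology)
  ultimately have "hom_induced q (subtopology X B) T X U id (hom_induced q (subtopology X A) S (subtopology X B) T id z)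
      = hom_induced q (subtopology X A) S X U (id \<circ> id) z"
    using assms by (intro hom_induced_compose') auto
  then show ?thesis by simp
qed

lemma excision_open:
  assumes "A \<subseteq> topspace X" "openin (subtopology X A) U" "closedin (subtopology X A) C" "C \<subseteq> U"
  shows "hom_induced q (subtopology X U) (U - C) (subtopology X A) (A - C) id \<in>
    iso (relative_homology_group q (subtopology X U) (U - C)) (relative_homology_group q (subtopology X A) (A - C))"
proof -
  let ?Y = "subtopology X A"
  have UA: "U \<subseteq> A" using openin_subset[OF assms(2)] by auto
  have top: "topspace ?Y = A" using assms(1) by auto
  have "hom_induced q (subtopology ?Y (A - (A - U))) ((A - C) - (A - U)) (subtopology ?Y A) (A - C) id
    \<in> iso (relative_homology_group q (subtopology ?Y (A - (A - U))) ((A - C) - (A - U)))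
          (relative_homology_group q (subtopology ?Y A) (A - C))"
  proof (rule homology_excision_axiom)
    have "closedin ?Y (A - U)" using assms(2) top closedin_def openin_closedin_eq by (metis)
    moreover have "openin ?Y (A - C)" using assms(3) top closedin_def by metis
    ultimately show "?Y closure_of (A - U) \<subseteq> ?Y interior_of (A - C)"
      using assms(4) UA by (auto simp: closure_of_closedin interior_of_openin)
  qed auto
  moreover have "A - (A - U) = U" "(A - C) - (A - U) = U - C" using UA by auto
  moreover have "subtopology ?Y U = subtopology X U" using UA by (simp add: subtopology_subtopology inf.absorb2)
  moreover have "subtopology ?Y A = ?Y" by (simp add: subtopology_subtopology)
  ultimately show ?thesis by simp
qed

text \<open>Excision of \<open>A - B\<close> complement-wise: what is cut out of \<open>A \<union> B\<close> is the part of \<open>B\<close> off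
  \<open>A\<close>.\<close>

lemma excision_Un:
  assumes "openin X A" "openin X B"
  shows "hom_induced q (subtopology X A) (A \<inter> B) (subtopology X (A \<union> B)) B id \<in>
    iso (relative_homology_group q (subtopology X A) (A \<inter> B)) (relative_homology_group q (subtopology X (A \<union> B)) B)"
proof -
  have sub: "A \<subseteq> topspace X" "B \<subseteq> topspace X" using assms openin_subset by blast+
  have "hom_induced q (subtopology X A) (A - (A - B)) (subtopology X (A \<union> B)) ((A \<union> B) - (A - B)) id \<in>
    iso (relative_homology_group q (subtopology X A) (A - (A - B))) (relative_homology_group q (subtopology X (A \<union> B)) ((A \<union> B) - (A - B)))"
  proof (rule excision_open)
    show "openin (subtopology X (A \<union> B)) A" using assms by (simp add: openin_open_subtopology openin_Un)
    have "A - B = (topspace X - B) \<inter> (A \<union> B)" using sub by auto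
    moreover have "closedin X (topspace X - B)" using assms(2) by blast
    ultimately show "closedin (subtopology X (A \<union> B)) (A - B)"
      unfolding closedin_subtopology by blast
  qed (use sub in auto)
  moreover have "A - (A - B) = A \<inter> B" "(A \<union> B) - (A - B) = B" by auto
  ultimately show ?thesis by simp
qed

text \<open>The exact sequence of the triple \<open>T \<subseteq> S \<subseteq> X\<close>, split into the statements about single elements
  that diagram chases need.\<close>

lemma triple_kernel_lift:
  assumes "T \<subseteq> S" "z \<in> carrier (relative_homology_group q X T)"
    "hom_induced q X T X S id z = \<one>\<^bsub>relative_homology_group q X S\<^esub>"
  obtains w where "w \<in> carrier (relative_homology_group q (subtopology X S) T)"
    "hom_induced q (subtopology X S) T X T id w = z"
proof -
  have "z \<in> kernel (relative_homology_group q X T) (relative_homology_group q X S) (hom_induced q X T X S id)"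
    using assms by (auto simp: kernel_def)
  then show ?thesis using homology_exactness_triple_3[OF assms(1), of q X] that by (auto simp: image_iff)
qed

lemma triple_inj:
  assumes "T \<subseteq> S" "trivial_group (relative_homology_group q (subtopology X S) T)"
    "z \<in> carrier (relative_homology_group q X T)"
    "hom_induced q X T X S id z = \<one>\<^bsub>relative_homology_group q X S\<^esub>"
  shows "z = \<one>\<^bsub>relative_homology_group q X T\<^esub>"
proof -
  obtain w where "w \<in> carrier (relative_homology_group q (subtopology X S) T)"
    "hom_induced q (subtopology X S) T X T id w = z"
    using triple_kernel_lift[OF assms(1,3,4)] .
  then show ?thesis using assms(2) hom_induced_one by (metis trivial_group_def singletonD)
qed

lemma triple_inj2:
  assumes "T \<subseteq> S" "trivial_group (relative_homology_group (q + 1) X S)"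
    "w \<in> carrier (relative_homology_group q (subtopology X S) T)"
    "hom_induced q (subtopology X S) T X T id w = \<one>\<^bsub>relative_homology_group q X T\<^esub>"
  shows "w = \<one>\<^bsub>relative_homology_group q (subtopology X S) T\<^esub>"
proof -
  have *: "exact_seq ([relative_homology_group q X T, relative_homology_group q (subtopology X S) T, relative_homology_group (q+1) X S],
    [hom_induced q (subtopology X S) T X T id, hom_relboundary (q+1) X S T])"
    using homology_exactness_triple_2[OF assms(1), of "q+1" X] by simp
  have "w \<in> kernel (relative_homology_group q (subtopology X S) T) (relative_homology_group q X T) (hom_induced q (subtopology X S) T X T id)"
    using assms by (auto simp: kernel_def)
  then have "w \<in> hom_relboundary (q+1) X S T ` carrier (relative_homology_group (q+1) X S)" using * by auto
  moreover have "hom_relboundary (q+1) X S T \<one>\<^bsub>relative_homology_group (q+1) X S\<^esub> = \<one>\<^bsub>relative_homology_group q (subtopology X S) T\<^esub>"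
    using hom_one[OF group_homomorphism_hom_relboundary[of "q+1" X S T]] by simp
  ultimately show ?thesis using assms(2) by (auto simp: trivial_group_def)
qed

lemma triple_trivial:
  assumes "T \<subseteq> S" "trivial_group (relative_homology_group q (subtopology X S) T)"
    "trivial_group (relative_homology_group q X S)"
  shows "trivial_group (relative_homology_group q X T)"
proof -
  have "z = \<one>\<^bsub>relative_homology_group q X T\<^esub>" if "z \<in> carrier (relative_homology_group q X T)" for z
    using triple_inj[OF assms(1,2) that] assms(3) hom_induced_carrier[of q X T X S id z]
    by (auto simp: trivial_group_def)
  then show ?thesis by (intro trivial_groupI) auto
qed

text \<open>The relevant part of the relative Mayer--Vietoris sequence: a class relative to \<open>A \<inter> B\<close> that dies
  relative to \<open>A\<close> comes from the pair \<open>(A, A \<inter> B)\<close>, which excision identifies with \<open>(A \<union> B, B)\<close>, where it dies because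
  it dies relative to \<open>B\<close>.\<close>

lemma mayer_vietoris_detect:
  assumes "openin X A" "openin X B"
    and triv: "trivial_group (relative_homology_group (q + 1) X (A \<union> B))"
    and z: "z \<in> carrier (relative_homology_group q X (A \<inter> B))"
    and zA: "hom_induced q X (A \<inter> B) X A id z = \<one>\<^bsub>relative_homology_group q X A\<^esub>"
    and zB: "hom_induced q X (A \<inter> B) X B id z = \<one>\<^bsub>relative_homology_group q X B\<^esub>"
  shows "z = \<one>\<^bsub>relative_homology_group q X (A \<inter> B)\<^esub>"
proof -
  have sub: "A \<subseteq> topspace X" "B \<subseteq> topspace X" using assms openin_subset by blast+
  obtain w where w: "w \<in> carrier (relative_homology_group q (subtopology X A) (A \<inter> B))"
    "hom_induced q (subtopology X A) (A \<inter> B) X (A \<inter> B) id w = z"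
    using triple_kernel_lift[OF _ z zA] by blast
  have e: "hom_induced q (subtopology X A) (A \<inter> B) (subtopology X (A \<union> B)) B id \<in>
    iso (relative_homology_group q (subtopology X A) (A \<inter> B)) (relative_homology_group q (subtopology X (A \<union> B)) B)"
    by (rule excision_Un[OF assms(1,2)])
  let ?e = "hom_induced q (subtopology X A) (A \<inter> B) (subtopology X (A \<union> B)) B id"
  have "hom_induced q (subtopology X (A \<union> B)) B X B id (?e w) = hom_induced q (subtopology X A) (A \<inter> B) X B id w"
    by (rule hom_induced_incl_sub) auto
  also have "\<dots> = hom_induced q X (A \<inter> B) X B id z"
    unfolding w(2)[symmetric] by (rule hom_induced_incl_abs(2)[symmetric]) auto
  finally have "hom_induced q (subtopology X (A \<union> B)) B X B id (?e w) = \<one>\<^bsub>relative_homology_group q X B\<^esub>"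
    using zB by simp
  then have "?e w = \<one>\<^bsub>relative_homology_group q (subtopology X (A \<union> B)) B\<^esub>"
    using triv by (intro triple_inj2[of B "A \<union> B"] hom_induced_carrier) auto
  then have "?e w = ?e \<one>\<^bsub>relative_homology_group q (subtopology X A) (A \<inter> B)\<^esub>" by (simp add: hom_induced_one)
  then have "w = \<one>\<^bsub>relative_homology_group q (subtopology X A) (A \<inter> B)\<^esub>"
    using e w(1) by (auto simp: iso_def bij_betw_def inj_on_def group.is_monoid monoid.one_closed)
  then show ?thesis using w(2) by (simp add: hom_induced_one)
qed

section \<open>Relative homology of the plane\<close>

text \<open>Radial projection onto the unit circle around \<open>p\<close>, with the sphere in its coordinate form.\<close>

lemma homotopy_equivalent_punctured_plane:
  "subtopology euclidean (- {p::complex}) homotopy_equivalent_space nsphere 1"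
  unfolding homotopy_equivalent_space_def
proof (intro exI conjI)
  define g where "g = (\<lambda>z i. if i = 0 then Re ((z - p) / of_real (cmod (z - p))) else if i = Suc 0 then Im ((z - p) / of_real (cmod (z - p))) else (0::real))"
  define f where "f = (\<lambda>x::nat\<Rightarrow>real. p + Complex (x 0) (x 1))"
  have g_cont: "continuous_on (- {p}) (\<lambda>z. g z i)" for i
    unfolding g_def by (cases "i = 0"; cases "i = Suc 0") (auto intro!: continuous_intros)
  have gsum: "(\<Sum>i\<le>1. (g z i)\<^sup>2) = 1" if "z \<noteq> p" for z
  proof -
    have "(\<Sum>i\<le>1. (g z i)\<^sup>2) = (cmod ((z - p) / of_real (cmod (z - p))))\<^sup>2"
      by (simp add: g_def cmod_power2)
    also have "\<dots> = 1" using that by (simp add: norm_divide)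
    finally show ?thesis .
  qed
  show cg: "continuous_map (subtopology euclidean (- {p})) (nsphere 1) g"
  proof -
    have "g z i = 0" if "i > 1" for z i using that by (simp add: g_def)
    moreover have "continuous_map (subtopology euclidean (- {p})) euclideanreal (\<lambda>z. g z k)" for k
      using g_cont by simp
    ultimately show ?thesis
      unfolding nsphere continuous_map_in_subtopology continuous_map_componentwise_UNIV
      using gsum by (auto simp del: sum.atMost_Suc One_nat_def)
  qed
  have fcont: "continuous_map (nsphere 1) euclidean f"
  proof -
    have "f = (\<lambda>x. p + (of_real (x 0) + \<i> * of_real (x 1)))" by (auto simp: f_def complex_eq_iff)
    moreover have "continuous_map (nsphere 1) euclidean (\<lambda>x. of_real (x k) :: complex)"
      "continuous_map (nsphere 1) euclidean (\<lambda>x. \<i> * of_real (x k) :: complex)" for k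
    proof -
      have "continuous_map euclideanreal euclidean (\<lambda>x. \<i> * of_real x :: complex)"
        "continuous_map euclideanreal euclidean (of_real :: real \<Rightarrow> complex)"
        by (auto intro!: continuous_intros)
      then show "continuous_map (nsphere 1) euclidean (\<lambda>x. of_real (x k) :: complex)"
          "continuous_map (nsphere 1) euclidean (\<lambda>x. \<i> * of_real (x k) :: complex)"
        using continuous_map_compose[OF continuous_map_nsphere_projection[of 1 k]]
        unfolding o_def by blast+
    qed
    ultimately show ?thesis by (auto intro!: continuous_map_add)
  qed
  have f_eq: "cmod (f x - p) = 1" if "x \<in> topspace (nsphere 1)" for x
    using that by (simp add: nsphere f_def cmod_def)
  then show cf: "continuous_map (nsphere 1) (subtopology euclidean (- {p})) f"
    using fcont by (force simp: continuous_map_in_subtopology)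
  have gf: "g (f x) = x" if "x \<in> topspace (nsphere 1)" for x
  proof
    fix i
    show "g (f x) i = x i"
      using f_eq[OF that] that by (auto simp: g_def f_def nsphere not_less_eq_eq intro!: Suc_lessI)
  qed
  then show "homotopic_with (\<lambda>x. True) (nsphere 1) (nsphere 1) (g \<circ> f) id"
    using cf cg by (intro homotopic_with_equal) (auto intro: continuous_map_compose)
  have fg: "f (g z) = p + (z - p) / of_real (cmod (z - p))" for z
    by (auto simp: f_def g_def complex_eq_iff)
  have "homotopic_with_canon (\<lambda>x. True) (- {p}) (- {p}) (f \<circ> g) id"
  proof (rule homotopic_with_linear)
    show "continuous_on (- {p}) (f \<circ> g)" unfolding o_def fg by (auto intro!: continuous_intros)
    fix z assume z: "z \<in> - {p}"
    show "closed_segment ((f \<circ> g) z) (id z) \<subseteq> - {p}"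
    proof
      fix y assume "y \<in> closed_segment ((f \<circ> g) z) (id z)"
      then obtain u where u: "0 \<le> u" "u \<le> 1" "y = (1 - u) *\<^sub>R (f (g z)) + u *\<^sub>R z" by (auto simp: in_segment)
      have "y - p = ((1 - u) / cmod (z - p) + u) *\<^sub>R (z - p)"
        unfolding u(3) fg by (simp add: scaleR_conv_of_real algebra_simps)
      moreover have "(1 - u) / cmod (z - p) + u > 0"
        using u z by (cases "u = 0") (auto intro: add_nonneg_pos)
      ultimately show "y \<in> - {p}" using z by auto
    qed
  qed auto
  then show "homotopic_with (\<lambda>x. True) (subtopology euclidean (- {p})) (subtopology euclidean (- {p})) (f \<circ> g) id" .
qed

lemma contractible_space_plane: "contractible_space (euclidean :: complex topology)"
  using contractible_space_top_of_set[of "UNIV :: complex set"] convex_imp_contractible[of "UNIV :: complex set"]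
  by simp

lemma relative_homology_punctured_plane:
  "relative_homology_group q euclidean (- {p::complex}) \<cong> reduced_homology_group (q - 1) (nsphere 1)"
proof -
  have "relative_homology_group q euclidean (- {p::complex}) \<cong> reduced_homology_group (q - 1) (subtopology euclidean (- {p}))"
  proof (intro isomorphic_group_relative_homology_of_contractible contractible_space_plane)
    have "p + 1 \<in> topspace euclidean \<inter> - {p}" by simp
    then show "topspace euclidean \<inter> - {p} \<noteq> {}" by blast
  qed
  then show ?thesis
    using homotopy_equivalent_space_imp_isomorphic_reduced_homology_groups[OF homotopy_equivalent_punctured_plane]
      iso_trans by blast
qed

text \<open>Pushing points radially away from \<open>p\<close> moves the punctured plane off \<open>C\<close>, and by convexity never
  moves a point of the complement of \<open>C\<close> into \<open>C\<close>.\<close>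

lemma trivial_relative_homology_convex:
  fixes C :: "complex set"
  assumes C: "compact C" "convex C" "p \<in> C"
  shows "trivial_group (relative_homology_group q (subtopology euclidean (- {p})) (- C))"
proof -
  obtain R where R: "R > 0" "C \<subseteq> ball p R"
    using bounded_subset_ballD[OF compact_imp_bounded[OF C(1)], of p] by auto
  define r where "r = (\<lambda>(t::real, x). p + (t + (1 - t) * max 1 (R / cmod (x - p))) *\<^sub>R (x - p))"
  have r_cont: "continuous_on ({0..1} \<times> (- {p})) r"
    unfolding r_def case_prod_beta by (intro continuous_intros) auto
  have r_out: "r (t, x) \<in> - C" if "x \<in> - C" "0 \<le> t" "t \<le> 1" for t x
  proof
    define s where "s = t + (1 - t) * max 1 (R / cmod (x - p))"
    have "(1 - t) * max 1 (R / cmod (x - p)) \<ge> (1 - t) * 1" using that by (intro mult_left_mono) auto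
    then have s: "s \<ge> 1" by (simp add: s_def)
    assume "r (t, x) \<in> C"
    then have "(1 - 1/s) *\<^sub>R p + (1/s) *\<^sub>R r (t, x) \<in> C"
      using C s by (intro convexD_alt) auto
    moreover have "(1 - 1/s) *\<^sub>R p + (1/s) *\<^sub>R r (t, x) = x"
      using s by (simp add: r_def s_def[symmetric] scaleR_add_right scaleR_diff_left scaleR_diff_right)
    ultimately show False using that by auto
  qed
  have r0: "r (0, x) \<in> - C" if "x \<noteq> p" for x
  proof
    assume "r (0, x) \<in> C"
    then have "cmod (r (0,x) - p) < R" using R by (auto simp: dist_norm norm_minus_commute)
    moreover have "cmod (r (0,x) - p) = max 1 (R / cmod (x - p)) * cmod (x - p)"
      by (simp add: r_def)
    moreover have "max 1 (R / cmod (x - p)) * cmod (x - p) \<ge> R / cmod (x - p) * cmod (x - p)"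
      by (intro mult_right_mono) auto
    ultimately show False using that by auto
  qed
  have rp: "r (t, x) \<noteq> p" if "x \<noteq> p" "0 \<le> t" "t \<le> 1" for t x
  proof -
    have "(1 - t) * max 1 (R / cmod (x - p)) \<ge> (1 - t) * 1" using that by (intro mult_left_mono) auto
    then have "t + (1 - t) * max 1 (R / cmod (x - p)) \<ge> 1" by simp
    then show ?thesis using that by (simp add: r_def)
  qed
  have sub: "subtopology (subtopology euclidean (- {p})) (- C) = subtopology euclidean (- C)"
    using C by (simp add: subtopology_subtopology) (metis Compl_anti_mono Int_absorb1 empty_subsetI insert_subset)
  have "continuous_on (- {p}) (\<lambda>x. r (0, x))"
    by (rule continuous_on_compose2[OF r_cont]) (auto intro!: continuous_intros)
  then have *: "continuous_map (subtopology euclidean (- {p})) (subtopology (subtopology euclidean (- {p})) (- C)) (\<lambda>x. r (0, x))"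
    unfolding sub using r0 by auto
  have "homotopic_with (\<lambda>k. k ` (- C) \<subseteq> - C) (subtopology euclidean (- {p})) (subtopology euclidean (- {p})) (\<lambda>x. r (0, x)) id"
    unfolding homotopic_with_def
  proof (intro exI[of _ r] conjI)
    have eq: "prod_topology (top_of_set {0..1::real}) (top_of_set (- {p})) = top_of_set ({0..1} \<times> (- {p}))"
      by (simp add: prod_topology_subtopology euclidean_product_topology subtopology_subtopology Times_Int_Times flip: subtopology_Times)
    show "continuous_map (prod_topology (top_of_set {0..1}) (top_of_set (- {p}))) (top_of_set (- {p})) r"
    proof -
      have "r y \<in> - {p}" if "y \<in> {0..1} \<times> - {p}" for y using that rp[of "snd y" "fst y"] by force
      then show ?thesis unfolding eq using r_cont by auto
    qed
  qed (use r_out in \<open>auto simp: r_def\<close>)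
  with * show ?thesis by (rule trivial_relative_homology_group_alt)
qed

text \<open>The plane is contractible, so the group is the reduced zeroth homology of the complement, which is
  trivial for a path connected space.\<close>

lemma trivial_homology_arc_complement:
  assumes "path_connected (- (K::complex set))" "K \<noteq> UNIV"
  shows "trivial_group (relative_homology_group 1 euclidean (- K))"
proof -
  let ?Y = "subtopology euclidean (- K)"
  have iso: "relative_homology_group 1 euclidean (- K) \<cong> reduced_homology_group 0 ?Y"
    using isomorphic_group_relative_homology_of_contractible[OF contractible_space_plane, of "- K" 1] assms by auto
  obtain a where a: "a \<in> - K" using assms by auto
  have pc: "path_connected_space ?Y" using assms by (simp add: path_connectedin_def[symmetric] flip: path_connectedin_iff_path_connected_real)
  have "\<exists>f. singular_simplex 0 ?Y f" using a
    by (intro exI[of _ "restrict (\<lambda>x. a) (standard_simplex 0)"]) (auto simp: singular_simplex_def)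
  then obtain f where f: "singular_simplex 0 ?Y f" ..
  let ?Z = "discrete_topology {()}"
  let ?c = "\<lambda>x::complex. ()"
  have cm: "continuous_map ?Y ?Z ?c" by simp
  have f': "singular_simplex 0 ?Z (restrict (?c \<circ> f) (standard_simplex 0))"
    by (simp add: singular_simplex_def)
  define G where "G = homology_group 0 ?Y"
  define H where "H = homology_group 0 ?Z"
  define g where "g = homologous_rel_set 0 ?Y {} (frag_of f)"
  define g' where "g' = homologous_rel_set 0 ?Z {} (frag_of (restrict (?c \<circ> f) (standard_simplex 0)))"
  have ig: "pow G g \<in> iso integer_group G" unfolding G_def g_def
    by (rule iso_integer_zeroth_homology_group[OF pc f])
  have ig': "pow H g' \<in> iso integer_group H" unfolding H_def g'_def
    by (rule iso_integer_zeroth_homology_group[OF _ f']) (auto simp: path_connected_space_discrete_topology)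
  have gG: "g \<in> carrier G" unfolding G_def g_def using f
    unfolding carrier_relative_homology_group_0
    by (intro imageI) (simp add: singular_cycle singular_chain_of chain_boundary_def)
  let ?h = "hom_induced 0 ?Y {} ?Z {} ?c"
  have hg: "?h g = g'"
    unfolding g_def g'_def using hom_induced_chain_map[OF cm, of "{}" "{}" 0 "frag_of f"] f
    by (simp add: singular_cycle singular_chain_of simplex_map_def chain_map_of chain_boundary_def)
  interpret h: group_hom G H ?h
    by (simp add: G_def H_def group_hom_def group_hom_axioms_def hom_induced_hom)
  have "x = \<one>\<^bsub>G\<^esub>" if x: "x \<in> carrier (reduced_homology_group 0 ?Y)" for x
  proof -
    have xG: "x \<in> carrier G" "?h x = \<one>\<^bsub>H\<^esub>" using x
      by (auto simp: carrier_reduced_homology_group kernel_def G_def H_def)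
    moreover have "range (pow G g :: int \<Rightarrow> _) = carrier G" using ig by (auto simp: iso_def bij_betw_def)
    ultimately obtain n :: int where n: "x = g [^]\<^bsub>G\<^esub> n" by (metis rangeE)
    then have "g' [^]\<^bsub>H\<^esub> n = \<one>\<^bsub>H\<^esub>" using xG hg gG by (simp add: h.hom_int_pow)
    then have "pow H g' n = pow H g' (0::int)" by simp
    then have "n = 0" using ig' by (auto simp: iso_def bij_betw_def inj_on_def)
    then show ?thesis using n by simp
  qed
  then have "trivial_group (reduced_homology_group 0 ?Y)"
    by (intro trivial_groupI) (auto simp: G_def one_reduced_homology_group)
  then show ?thesis
    using isomorphic_group_triviality[OF iso] by simp
qed

section \<open>Charts and local homology\<close>

(* connected is the topological notion from here on *)
hide_const (open) Digraph_Component.connected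

text \<open>A chart covers the whole plane, so that discs, complements and excision are available in it without
  restriction to a coordinate range.\<close>

definition chart :: "'s topology \<Rightarrow> 's set \<Rightarrow> ('s \<Rightarrow> complex) \<Rightarrow> bool" where
  "chart X U h \<longleftrightarrow> openin X U \<and> homeomorphic_map (subtopology X U) euclidean h"

lemma connectedin_one_part:
  assumes "connectedin X K" "openin X A" "openin X B" "K \<subseteq> A \<union> B" "A \<inter> B \<inter> K = {}" "A \<inter> K \<noteq> {}"
  shows "B \<inter> K = {}"
  using assms unfolding connectedin by metis

lemma connectedin_locally_constant:
  assumes K: "connectedin X K" "p \<in> K" "P p" "k \<in> K"
    and loc: "\<And>k. k \<in> K \<Longrightarrow> \<exists>W. openin X W \<and> k \<in> W \<and> (\<forall>k'\<in>W \<inter> K. P k' \<longleftrightarrow> P k)"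
  shows "P k"
proof (rule ccontr)
  assume "\<not> P k"
  obtain W where W: "\<And>k. k \<in> K \<Longrightarrow> openin X (W k)" "\<And>k. k \<in> K \<Longrightarrow> k \<in> W k"
    "\<And>k k'. k \<in> K \<Longrightarrow> k' \<in> W k \<inter> K \<Longrightarrow> P k' \<longleftrightarrow> P k" using loc by metis
  let ?A = "\<Union>(W ` {k \<in> K. P k})" and ?B = "\<Union>(W ` {k \<in> K. \<not> P k})"
  have "?B \<inter> K = {}"
  proof (rule connectedin_one_part[OF K(1)])
    show "openin X ?A" "openin X ?B" using W(1) by (auto intro!: openin_Union)
    show "K \<subseteq> ?A \<union> ?B" using W(2) by auto
    show "?A \<inter> ?B \<inter> K = {}" using W(3) by blast
    show "?A \<inter> K \<noteq> {}" using W(2)[OF K(2)] K by blast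
  qed
  then show False using W(2)[OF K(4)] K(4) \<open>\<not> P k\<close> by blast
qed

lemma chart_bij:
  assumes "chart X U h"
  shows "U \<subseteq> topspace X" "h ` U = UNIV" "inj_on h U" "openin X U"
proof -
  show o: "openin X U" using assms by (simp add: chart_def)
  show U: "U \<subseteq> topspace X" using openin_subset[OF o] .
  have "topspace (subtopology X U) = U" using U by auto
  then show "h ` U = UNIV" "inj_on h U"
    using assms homeomorphic_imp_surjective_map homeomorphic_imp_injective_map unfolding chart_def by fastforce+
qed

lemma chart_continuous: "chart X U h \<Longrightarrow> continuous_map (subtopology X U) euclidean h"
  by (simp add: chart_def homeomorphic_imp_continuous_map)

lemma chart_image_Diff:
  assumes "chart X U h" "A \<subseteq> U"
  shows "h ` (U - A) = - (h ` A)"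
  using chart_bij[OF assms(1)] inj_on_image_set_diff[of h U U A] assms(2) by (simp add: Compl_eq_Diff_UNIV)

lemma chart_image_vimage:
  assumes "chart X U h"
  shows "h ` {x \<in> U. h x \<in> S} = S"
  using chart_bij(2)[OF assms] by (auto simp: image_iff)

lemma chart_open_iff:
  assumes "chart X U h" "A \<subseteq> U"
  shows "openin X A \<longleftrightarrow> open (h ` A)"
proof -
  have "open (h ` A) \<longleftrightarrow> openin (subtopology X U) A"
    using homeomorphic_map_openness[of "subtopology X U" euclidean h A] assms chart_bij(1)[OF assms(1)]
    by (auto simp: chart_def)
  then show ?thesis using assms chart_bij(4)[OF assms(1)] by (simp add: openin_open_subtopology)
qed

lemma chart_compact_iff:
  assumes "chart X U h" "A \<subseteq> U"
  shows "compactin X A \<longleftrightarrow> compact (h ` A)"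
proof -
  have "compact (h ` A) \<longleftrightarrow> compactin (subtopology X U) A"
    using homeomorphic_map_compactness_eq[of "subtopology X U" euclidean h A] assms chart_bij(1)[OF assms(1)]
    by (auto simp: chart_def)
  then show ?thesis using assms by (simp add: compactin_subtopology)
qed

lemma chart_connected_iff:
  assumes "chart X U h" "A \<subseteq> U"
  shows "connectedin X A \<longleftrightarrow> connected (h ` A)"
proof -
  have "connected (h ` A) \<longleftrightarrow> connectedin (subtopology X U) A"
    using homeomorphic_map_connectedness_eq[of "subtopology X U" euclidean h A] assms chart_bij(1)[OF assms(1)]
    by (auto simp: chart_def)
  then show ?thesis using assms by (simp add: connectedin_subtopology)
qed

lemma chart_homeomorphic_sub:
  assumes "chart X U h" "A \<subseteq> U"
  shows "homeomorphic_map (subtopology X A) (subtopology euclidean (h ` A)) h"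
proof -
  have "homeomorphic_map (subtopology (subtopology X U) A) (subtopology euclidean (h ` A)) h"
    using assms chart_bij[OF assms(1)]
    by (intro homeomorphic_map_subtopologies) (auto simp: chart_def inf.absorb2)
  then show ?thesis using assms by (simp add: subtopology_subtopology inf.absorb2)
qed

lemma chart_preimage:
  assumes "chart X U h"
  shows "open S \<Longrightarrow> openin X {x \<in> U. h x \<in> S}" "compact S \<Longrightarrow> compactin X {x \<in> U. h x \<in> S}"
    "connected S \<Longrightarrow> connectedin X {x \<in> U. h x \<in> S}"
  using chart_open_iff[OF assms, of "{x \<in> U. h x \<in> S}"] chart_compact_iff[OF assms, of "{x \<in> U. h x \<in> S}"]
    chart_connected_iff[OF assms, of "{x \<in> U. h x \<in> S}"]
  by (auto simp: chart_image_vimage[OF assms])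

text \<open>Every disc is homeomorphic to the plane, so charts can be made arbitrarily small.\<close>

lemma chart_shrink:
  assumes "chart X U h" "x \<in> U" "openin X W" "x \<in> W"
  obtains U' h' where "chart X U' h'" "x \<in> U'" "U' \<subseteq> U \<inter> W"
proof -
  have "open (h ` (U \<inter> W))"
    using assms chart_bij(4)[OF assms(1)] by (subst chart_open_iff[OF assms(1), symmetric]) auto
  then obtain r where r: "r > 0" "ball (h x) r \<subseteq> h ` (U \<inter> W)" using assms open_contains_ball by blast
  obtain f g where fg: "homeomorphism (ball (h x) r) (UNIV :: complex set) f g"
    using homeomorphic_ball_UNIV[OF r(1), of "h x"] by (auto simp: homeomorphic_def)
  define U' where "U' = {y \<in> U. h y \<in> ball (h x) r}"
  have op: "openin X U'" unfolding U'_def by (rule chart_preimage[OF assms(1)]) auto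
  have sub: "U' \<subseteq> U \<inter> W"
    using r chart_bij(3)[OF assms(1)] unfolding U'_def by (auto simp: inj_on_def subset_iff image_iff)
  have hU': "h ` U' = ball (h x) r" unfolding U'_def by (rule chart_image_vimage[OF assms(1)])
  have "homeomorphic_map (subtopology X U') (subtopology euclidean (ball (h x) r)) h"
    using chart_homeomorphic_sub[OF assms(1), of U'] sub hU' by auto
  moreover have "homeomorphic_map (subtopology euclidean (ball (h x) r)) euclidean f"
    using fg homeomorphic_maps_iff_homeomorphism[of "ball (h x) r" UNIV f g] homeomorphic_maps_map by auto
  ultimately have "homeomorphic_map (subtopology X U') euclidean (f \<circ> h)" by (rule homeomorphic_map_compose)
  then have "chart X U' (f \<circ> h)" using op by (simp add: chart_def)
  then show ?thesis using that[of U' "f \<circ> h"] sub assms r by (auto simp: U'_def)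
qed

locale charted =
  fixes X :: "'s topology"
  assumes Hausdorff: "Hausdorff_space X"
    and charts: "\<And>x. x \<in> topspace X \<Longrightarrow> \<exists>U h. chart X U h \<and> x \<in> U"
begin

abbreviation H :: "int \<Rightarrow> 's set \<Rightarrow> 's chain set monoid" where
  "H q K \<equiv> relative_homology_group q X (topspace X - K)"

abbreviation res :: "int \<Rightarrow> 's set \<Rightarrow> 's set \<Rightarrow> 's chain set \<Rightarrow> 's chain set" where
  "res q K K' \<equiv> hom_induced q X (topspace X - K) X (topspace X - K') id"

lemma res_res: "K' \<subseteq> K \<Longrightarrow> K'' \<subseteq> K' \<Longrightarrow> res q K' K'' (res q K K' z) = res q K K'' z"
  by (rule hom_induced_incl_abs) auto

lemma chart_at:
  assumes "openin X W" "x \<in> W"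
  obtains U h where "chart X U h" "x \<in> U" "U \<subseteq> W"
proof -
  have "x \<in> topspace X" using assms openin_subset by blast
  then obtain U h where U: "chart X U h" "x \<in> U" using charts by blast
  show ?thesis
  proof (rule chart_shrink[OF U assms])
    fix U' h' assume "chart X U' h'" "x \<in> U'" "U' \<subseteq> U \<inter> W"
    then show thesis by (intro that[of U' h']) auto
  qed
qed

text \<open>The building blocks of compact sets: the homology relative to the complement of a cell is that of any of
  its points, and cells in one chart are closed under intersection.\<close>

definition cell :: "'s set \<Rightarrow> bool" where
  "cell B \<longleftrightarrow> (\<exists>U h. chart X U h \<and> B \<subseteq> U \<and> compact (h ` B) \<and> convex (h ` B))"

lemma cell_compact: "cell B \<Longrightarrow> compactin X B"
  unfolding cell_def using chart_compact_iff by blast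

lemma compact_closed: "compactin X B \<Longrightarrow> closedin X B"
  by (rule compactin_imp_closedin[OF Hausdorff])

lemma cell_at:
  assumes "openin X W" "x \<in> W"
  obtains B N where "cell B" "openin X N" "x \<in> N" "N \<subseteq> B" "B \<subseteq> W"
proof -
  obtain U h where U: "chart X U h" "x \<in> U" "U \<subseteq> W" using chart_at[OF assms] .
  let ?B = "{y \<in> U. h y \<in> cball (h x) 1}" and ?N = "{y \<in> U. h y \<in> ball (h x) 1}"
  have "cell ?B"
    unfolding cell_def using U chart_image_vimage[OF U(1), of "cball (h x) 1"]
    by (intro exI[of _ U] exI[of _ h]) auto
  moreover have "openin X ?N" by (rule chart_preimage[OF U(1)]) auto
  ultimately show ?thesis by (rule that) (use U in auto)
qed

lemma closed_Diff_open: "closedin X K \<Longrightarrow> openin X (topspace X - K)"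
  by blast

lemma closed_point: "p \<in> topspace X \<Longrightarrow> closedin X {p}"
  using Hausdorff_imp_t1_space[OF Hausdorff] by (simp add: t1_space_closedin_singleton)

text \<open>Excision to the chart reduces this to the plane, where a convex set and a point in it have the same
  relative homology.\<close>

lemma cell_trivial:
  assumes "cell B" "p \<in> B"
  shows "trivial_group (relative_homology_group q (subtopology X (topspace X - {p})) (topspace X - B))"
proof -
  obtain U h where U: "chart X U h" "B \<subseteq> U" "compact (h ` B)" "convex (h ` B)"
    using assms unfolding cell_def by blast
  note bij = chart_bij[OF U(1)]
  have pX: "p \<in> topspace X" using assms U bij by auto
  have clB: "closedin X B" using compact_closed cell_compact assms by blast
  have opA: "openin X (topspace X - {p})" using closed_point[OF pX] by blast
  let ?A = "topspace X - {p}"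
  have "hom_induced q (subtopology X (U - {p})) ((U - {p}) - (B - {p})) (subtopology X ?A) (?A - (B - {p})) id \<in>
    iso (relative_homology_group q (subtopology X (U - {p})) ((U - {p}) - (B - {p}))) (relative_homology_group q (subtopology X ?A) (?A - (B - {p})))"
  proof (rule excision_open)
    show "openin (subtopology X ?A) (U - {p})"
    proof -
      have "U - {p} = U \<inter> ?A" using bij(1) by auto
      then show ?thesis using opA openin_Int[OF bij(4) opA] by (simp add: openin_open_subtopology)
    qed
    show "closedin (subtopology X ?A) (B - {p})"
      unfolding closedin_subtopology using clB closedin_subset[OF clB] by (intro exI[of _ B]) auto
  qed (use U in auto)
  moreover have "(U - {p}) - (B - {p}) = U - B" "?A - (B - {p}) = topspace X - B"
    using assms pX by auto
  ultimately have iso1: "relative_homology_group q (subtopology X (U - {p})) (U - B) \<cong> relative_homology_group q (subtopology X ?A) (topspace X - B)"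
    by (auto intro: is_isoI)
  have hU: "h ` (U - {p}) = - {h p}" "h ` (U - B) = - (h ` B)"
    using chart_image_Diff[OF U(1), of "{p}"] chart_image_Diff[OF U(1), of B] U assms by auto
  have "homeomorphic_map (subtopology X (U - {p})) (subtopology euclidean (- {h p})) h"
    using chart_homeomorphic_sub[OF U(1), of "U - {p}"] hU by simp
  from homeomorphic_map_relative_homology_iso[OF this, of "U - B" "- (h ` B)" q]
  have iso2: "relative_homology_group q (subtopology X (U - {p})) (U - B) \<cong> relative_homology_group q (subtopology euclidean (- {h p})) (- (h ` B))"
    using hU bij assms(2) by (intro is_isoI) auto
  have "trivial_group (relative_homology_group q (subtopology euclidean (- {h p})) (- (h ` B)))"
    using U assms by (intro trivial_relative_homology_convex) auto
  then show ?thesis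
    using isomorphic_group_triviality[OF iso1] isomorphic_group_triviality[OF iso2] by simp
qed

lemma chart_excision:
  assumes "chart X U h" "K \<subseteq> U" "closedin X K"
  shows "H q K \<cong> relative_homology_group q euclidean (- (h ` K))"
proof -
  note bij = chart_bij[OF assms(1)]
  have "hom_induced q (subtopology X U) (U - K) (subtopology X (topspace X)) (topspace X - K) id \<in>
    iso (relative_homology_group q (subtopology X U) (U - K)) (relative_homology_group q (subtopology X (topspace X)) (topspace X - K))"
    by (rule excision_open) (use assms bij in auto)
  then have "relative_homology_group q (subtopology X U) (U - K) \<cong> H q K"
    by (auto intro: is_isoI)
  then have iso1: "H q K \<cong> relative_homology_group q (subtopology X U) (U - K)"
    by (rule group.iso_sym[rotated]) simp
  have hU: "h ` (U - K) = - (h ` K)"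
    by (rule chart_image_Diff[OF assms(1,2)])
  have "homeomorphic_map (subtopology X U) euclidean h" using assms by (simp add: chart_def)
  from homeomorphic_map_relative_homology_iso[OF this, of "U - K" "- (h ` K)" q]
  have iso2: "relative_homology_group q (subtopology X U) (U - K) \<cong> relative_homology_group q euclidean (- (h ` K))"
    using hU bij assms by (auto intro: is_isoI)
  show ?thesis using iso1 iso2 iso_trans by blast
qed

lemma local_homology:
  assumes "p \<in> topspace X"
  shows "H q {p} \<cong> reduced_homology_group (q - 1) (nsphere 1)"
proof -
  obtain U h where U: "chart X U h" "p \<in> U" using charts assms by blast
  have "H q {p} \<cong> relative_homology_group q euclidean (- (h ` {p}))"
    using U closed_point assms by (intro chart_excision) auto
  then show ?thesis using relative_homology_punctured_plane[of q "h p"] iso_trans by fastforce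
qed

lemma local_homology_trivial:
  assumes "p \<in> topspace X" "q \<noteq> 2"
  shows "trivial_group (H q {p})"
  using isomorphic_group_triviality[OF local_homology[OF assms(1), of q]] assms(2)
    reduced_homology_group_nsphere(2)[of "q - 1" 1] by auto

lemma local_homology_rank:
  assumes "p \<in> topspace X"
  shows "erank (H 2 {p}) (carrier (H 2 {p})) = 1"
proof -
  have "H 2 {p} \<cong> integer_group"
    using local_homology[OF assms, of 2] reduced_homology_group_nsphere(1)[of 1] iso_trans by fastforce
  then show ?thesis
    using erank_iso[of "H 2 {p}" integer_group] erank_integer_group abelian_integer_group by simp
qed

text \<open>For such \<open>K\<close>, classes of degree two relative to the complement of \<open>K\<close> are sections of the local homology over
  \<open>K\<close>. This is established for cells, for unions of cells in one chart, for compact sets in one chart, and finally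
  for all compact sets, each step by Mayer--Vietoris or by compact support. Taking \<open>K\<close> to be the whole surface bounds
  its homology in degrees at least two.\<close>

definition detects :: "'s set \<Rightarrow> bool" where
  "detects K \<longleftrightarrow> (\<forall>q\<ge>3. trivial_group (H q K)) \<and>
     (\<forall>z \<in> carrier (H 2 K). (\<forall>p\<in>K. res 2 K {p} z = \<one>\<^bsub>H 2 {p}\<^esub>) \<longrightarrow> z = \<one>\<^bsub>H 2 K\<^esub>)"

lemma detects_empty: "detects {}"
  using trivial_relative_homology_group_topspace[of _ X] by (auto simp: detects_def trivial_group_def)

lemma detects_Un:
  assumes cl: "closedin X K" "closedin X L" and d: "detects K" "detects L" "detects (K \<inter> L)"
  shows "detects (K \<union> L)"
proof -
  let ?A = "topspace X - K" and ?B = "topspace X - L"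
  have op: "openin X ?A" "openin X ?B" using cl by blast+
  have eq: "?A \<inter> ?B = topspace X - (K \<union> L)" "?A \<union> ?B = topspace X - (K \<inter> L)" by auto
  have det: "z = \<one>\<^bsub>H q (K \<union> L)\<^esub>" if "q \<ge> 2" "z \<in> carrier (H q (K \<union> L))"
     "res q (K \<union> L) K z = \<one>\<^bsub>H q K\<^esub>" "res q (K \<union> L) L z = \<one>\<^bsub>H q L\<^esub>" for q z
    using mayer_vietoris_detect[OF op, of q z] that d(3) unfolding eq by (simp add: detects_def)
  show ?thesis unfolding detects_def
  proof (intro conjI allI impI ballI)
    fix q :: int assume q: "q \<ge> 3"
    show "trivial_group (H q (K \<union> L))"
    proof (rule trivial_groupI)
      fix z assume z: "z \<in> carrier (H q (K \<union> L))"
      have "trivial_group (H q K)" "trivial_group (H q L)" using d q by (auto simp: detects_def)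
      then show "z = \<one>\<^bsub>H q (K \<union> L)\<^esub>"
        using hom_induced_carrier[of q X "topspace X - (K \<union> L)" X "topspace X - K" id z]
          hom_induced_carrier[of q X "topspace X - (K \<union> L)" X "topspace X - L" id z] q z
        by (intro det) (simp_all add: trivial_group_def)
    qed simp
  next
    fix z assume z: "z \<in> carrier (H 2 (K \<union> L))" and *: "\<forall>p\<in>K \<union> L. res 2 (K \<union> L) {p} z = \<one>\<^bsub>H 2 {p}\<^esub>"
    have "res 2 (K \<union> L) K z = \<one>\<^bsub>H 2 K\<^esub>"
      using d(1) * res_res[of K "K \<union> L" _ 2 z] unfolding detects_def by (simp add: hom_induced_carrier)
    moreover have "res 2 (K \<union> L) L z = \<one>\<^bsub>H 2 L\<^esub>"
      using d(2) * res_res[of L "K \<union> L" _ 2 z] unfolding detects_def by (simp add: hom_induced_carrier)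
    ultimately show "z = \<one>\<^bsub>H 2 (K \<union> L)\<^esub>" using z by (intro det) auto
  qed
qed

lemma res_cell_inj:
  assumes "cell B" "p \<in> B" "z \<in> carrier (H q B)" "res q B {p} z = \<one>\<^bsub>H q {p}\<^esub>"
  shows "z = \<one>\<^bsub>H q B\<^esub>"
  using assms by (intro triple_inj[OF _ cell_trivial[OF assms(1,2)]]) auto

lemma detects_cell:
  assumes "cell B"
  shows "detects B"
proof (cases "B = {}")
  case False
  then obtain p where p: "p \<in> B" by auto
  then have pX: "p \<in> topspace X" using cell_compact[OF assms] compactin_subset_topspace by blast
  show ?thesis unfolding detects_def
  proof (intro conjI allI impI ballI)
    fix q :: int assume q: "q \<ge> 3"
    show "trivial_group (H q B)"
      using p q local_homology_trivial[OF pX, of q] by (intro triple_trivial[OF _ cell_trivial[OF assms p]]) auto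
  qed (use res_cell_inj[OF assms p] p in auto)
qed (simp add: detects_empty)

text \<open>Induction on the number of cells with Mayer--Vietoris. The union of all but one meets the last cell in
  fewer cells, since intersections of convex sets are convex.\<close>

lemma detects_cells_in_chart:
  assumes "chart X U h" "finite \<F>" "\<And>B. B \<in> \<F> \<Longrightarrow> B \<subseteq> U \<and> compact (h ` B) \<and> convex (h ` B)"
  shows "detects (\<Union>\<F>)"
  using assms(2,3)
proof (induction "card \<F>" arbitrary: \<F> rule: less_induct)
  case less
  show ?case
  proof (cases "\<F> = {}")
    case False
    then obtain B where B: "B \<in> \<F>" by auto
    let ?G = "\<F> - {B}"
    have smaller: "card ?G < card \<F>" using B less.prems by (meson card_Diff1_less)
    have cl: "closedin X C" if "C \<in> \<F>" for C
      using chart_compact_iff[OF assms(1), of C] less.prems(2)[OF that] compact_closed by auto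
    have 1: "detects (\<Union>?G)" using less smaller by auto
    have 2: "detects B" using less.prems(2)[OF B] assms(1) by (intro detects_cell) (auto simp: cell_def)
    let ?I = "(\<lambda>C. C \<inter> B) ` ?G"
    have c1: "card ?I < card \<F>" using smaller less.prems card_image_le[of ?G "\<lambda>C. C \<inter> B"] by auto
    have c2: "D \<subseteq> U \<and> compact (h ` D) \<and> convex (h ` D)" if "D \<in> ?I" for D
    proof -
      obtain C where C: "C \<in> \<F>" "D = C \<inter> B" using \<open>D \<in> ?I\<close> by blast
      have "h ` D = h ` C \<inter> h ` B"
        unfolding C(2) using less.prems(2)[OF C(1)] less.prems(2)[OF B] chart_bij(3)[OF assms(1)]
        by (intro inj_on_image_Int) auto
      then show ?thesis
        using less.prems(2)[OF C(1)] less.prems(2)[OF B] C by (auto intro: compact_Int convex_Int)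
    qed
    have "detects (\<Union>?I)" using less.prems(1) by (intro less.hyps[OF c1 _ c2]) auto
    moreover have "\<Union>?I = \<Union>?G \<inter> B" by auto
    moreover have "\<Union>\<F> = \<Union>?G \<union> B" using B by auto
    moreover have "closedin X (\<Union>?G)" using cl less.prems by (intro closedin_Union) auto
    ultimately show ?thesis using 1 2 cl[OF B] detects_Un by metis
  qed (simp add: detects_empty)
qed

text \<open>The boundary of a relative cycle has compact support off \<open>K\<close>, so the class also exists relative to the
  complement of any larger set that avoids this support.\<close>

lemma compact_support:
  assumes "z \<in> carrier (H (int q) K)"
  obtains T where "compactin X T" "T \<inter> K = {}"
    "\<forall>K'. K \<subseteq> K' \<longrightarrow> K' \<inter> T = {} \<longrightarrow> (\<exists>z' \<in> carrier (H (int q) K'). res (int q) K' K z' = z)"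
proof -
  obtain c where c: "singular_relcycle q X (topspace X - K) c" "z = homologous_rel_set q X (topspace X - K) c"
    using assms by (auto simp: carrier_relative_homology_group)
  define T where "T = (\<Union>f\<in>Poly_Mapping.keys (chain_boundary q c). f ` standard_simplex (q - 1))"
  have bd: "singular_chain (q - 1) X (chain_boundary q c)"
    "\<forall>f\<in>Poly_Mapping.keys (chain_boundary q c). f ` standard_simplex (q - 1) \<subseteq> topspace X - K"
    using c(1) by (auto simp: singular_relcycle singular_chain_subtopology)
  have comp: "compactin X (f ` standard_simplex (q - 1))" if "f \<in> Poly_Mapping.keys (chain_boundary q c)" for f
  proof -
    have "continuous_map (subtopology (powertop_real UNIV) (standard_simplex (q - 1))) X f"
      using bd(1) that by (auto simp: singular_chain_def singular_simplex_def)
    then show ?thesis using compactin_standard_simplex[of "q - 1"]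
      by (intro image_compactin) (simp_all add: compactin_subtopology)
  qed
  show ?thesis
  proof
    show "compactin X T" unfolding T_def using comp by (intro compactin_Union) auto
    show "T \<inter> K = {}" using bd(2) by (auto simp: T_def)
    show "\<forall>K'. K \<subseteq> K' \<longrightarrow> K' \<inter> T = {} \<longrightarrow> (\<exists>z' \<in> carrier (H (int q) K'). res (int q) K' K z' = z)"
    proof (intro allI impI)
    fix K' assume K': "K \<subseteq> K'" "K' \<inter> T = {}"
    have "singular_relcycle q X (topspace X - K') c"
      using c(1) bd K' by (auto simp: singular_relcycle singular_chain_subtopology T_def) blast
    moreover from this have "res (int q) K' K (homologous_rel_set q X (topspace X - K') c) = z"
      using K' c by (subst hom_induced_chain_map) (auto simp: singular_relcycle chain_map_ident[of q X])
    ultimately show "\<exists>z' \<in> carrier (H (int q) K'). res (int q) K' K z' = z"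
      by (auto simp: carrier_relative_homology_group)
    qed
  qed
qed

text \<open>A class that vanishes at the points of \<open>K\<close> lives on a slightly larger finite union of discs centred in
  \<open>K\<close>. It vanishes at the centres, hence on each disc, hence at all points of the union, and there the previous lemma
  applies.\<close>

lemma detects_compact_in_chart:
  assumes U: "chart X U h" "K \<subseteq> U" "compactin X K"
  shows "detects K"
proof -
  note bij = chart_bij[OF U(1)]
  have KX: "K \<subseteq> topspace X" using U bij by auto
  have key: "z = \<one>\<^bsub>H (int q) K\<^esub>" if z: "z \<in> carrier (H (int q) K)"
    and pts: "\<And>p. p \<in> K \<Longrightarrow> res (int q) K {p} z = \<one>\<^bsub>H (int q) {p}\<^esub>" and q: "q \<ge> 2" for q z
  proof -
    from compact_support[OF z] obtain T where T: "compactin X T" "T \<inter> K = {}"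
      "\<forall>K'. K \<subseteq> K' \<longrightarrow> K' \<inter> T = {} \<longrightarrow> (\<exists>z' \<in> carrier (H (int q) K'). res (int q) K' K z' = z)" .
    have "openin X (U - T)" using bij(4) compact_closed[OF T(1)] by blast
    then have "open (h ` (U - T))" using chart_open_iff[OF U(1), of "U - T"] by auto
    then have "\<exists>r>0. cball (h k) r \<subseteq> h ` (U - T)" if "k \<in> K" for k
      using that U T(2) open_contains_cball by (metis Diff_iff disjoint_iff image_eqI subsetD)
    then obtain r where r: "\<And>k. k \<in> K \<Longrightarrow> r k > 0 \<and> cball (h k) (r k) \<subseteq> h ` (U - T)" by metis
    define B where "B k = {y \<in> U. h y \<in> cball (h k) (r k)}" for k
    have "compact (h ` K)" using U chart_compact_iff[OF U(1,2)] by auto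
    moreover have "h ` K \<subseteq> (\<Union>k\<in>K. ball (h k) (r k))" using r by auto
    ultimately obtain K0 where K0: "K0 \<subseteq> K" "finite K0" "h ` K \<subseteq> (\<Union>k\<in>K0. ball (h k) (r k))"
      using compactE_image[of "h ` K" K "\<lambda>k. ball (h k) (r k)"] by (metis open_ball)
    define P where "P = \<Union>(B ` K0)"
    have hB: "h ` B k = cball (h k) (r k)" for k unfolding B_def by (rule chart_image_vimage[OF U(1)])
    have cellB: "cell (B k)" for k
      unfolding cell_def using U hB[of k] by (intro exI[of _ U] exI[of _ h]) (auto simp: B_def)
    have "detects P"
      unfolding P_def using K0(2) hB by (intro detects_cells_in_chart[OF U(1)]) (auto simp: B_def)
    have KP: "K \<subseteq> P"
    proof
      fix k assume "k \<in> K"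
      then obtain k0 where "k0 \<in> K0" "h k \<in> ball (h k0) (r k0)" using K0(3) by auto
      then show "k \<in> P" using U \<open>k \<in> K\<close> by (auto simp: P_def B_def intro!: bexI[of _ k0])
    qed
    have "B k \<inter> T = {}" if "k \<in> K" for k
    proof -
      have "h ` B k \<subseteq> h ` (U - T)" using r[OF that] hB by auto
      then have "B k \<subseteq> U - T"
        using bij(3) by (subst (asm) inj_on_image_subset_iff[of h U]) (auto simp: B_def)
      then show ?thesis by auto
    qed
    then have "P \<inter> T = {}" using K0(1) by (auto simp: P_def)
    then obtain z' where z': "z' \<in> carrier (H (int q) P)" "res (int q) P K z' = z" using T(3) KP by blast
    have pt: "res (int q) P {p} z' = \<one>\<^bsub>H (int q) {p}\<^esub>" if p: "p \<in> P" for p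
    proof -
      obtain k where k: "k \<in> K0" "p \<in> B k" using p by (auto simp: P_def)
      have kK: "k \<in> K" "k \<in> B k" "B k \<subseteq> P" using k K0(1) U r[of k] by (auto simp: B_def P_def less_imp_le subset_iff)
      have "res (int q) (B k) {k} (res (int q) P (B k) z') = res (int q) P {k} z'"
        using kK by (intro res_res) auto
      also have "\<dots> = res (int q) K {k} (res (int q) P K z')"
        using kK KP by (intro res_res[symmetric]) auto
      also have "\<dots> = \<one>\<^bsub>H (int q) {k}\<^esub>" using z'(2) pts[OF kK(1)] by simp
      finally have "res (int q) P (B k) z' = \<one>\<^bsub>H (int q) (B k)\<^esub>"
        by (intro res_cell_inj[OF cellB kK(2)] hom_induced_carrier)
      then have "res (int q) (B k) {p} (res (int q) P (B k) z') = \<one>\<^bsub>H (int q) {p}\<^esub>"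
        using hom_induced_one by metis
      then show ?thesis using res_res[of "B k" P "{p}" "int q" z'] k kK by simp
    qed
    have "z' = \<one>\<^bsub>H (int q) P\<^esub>"
    proof (cases "q = 2")
      case True
      then show ?thesis using \<open>detects P\<close> z'(1) pt by (auto simp: detects_def)
    next
      case False
      then have "int q \<ge> 3" using q by simp
      then have "trivial_group (H (int q) P)" using \<open>detects P\<close> by (auto simp: detects_def)
      then show ?thesis using z'(1) by (simp add: trivial_group_def)
    qed
    then show ?thesis using z'(2) by (metis hom_induced_one)
  qed
  show ?thesis unfolding detects_def
  proof (intro conjI allI impI ballI)
    fix q :: int assume q: "q \<ge> 3"
    define n where "n = nat q"
    have n: "q = int n" "n \<ge> 2" using q by (auto simp: n_def)
    show "trivial_group (H q K)"
    proof (rule trivial_groupI)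
      fix z assume z: "z \<in> carrier (H q K)"
      have "res q K {p} z = \<one>\<^bsub>H q {p}\<^esub>" if "p \<in> K" for p
        using local_homology_trivial[of p q] that KX q hom_induced_carrier[of q X "topspace X - K" X "topspace X - {p}" id z]
        by (auto simp: trivial_group_def)
      then show "z = \<one>\<^bsub>H q K\<^esub>" using key[of z n] z n by simp
    qed simp
  next
    fix z assume "z \<in> carrier (H 2 K)" "\<forall>p\<in>K. res 2 K {p} z = \<one>\<^bsub>H 2 {p}\<^esub>"
    then show "z = \<one>\<^bsub>H 2 K\<^esub>" using key[of z 2] by simp
  qed
qed

lemma compact_cover_cells:
  assumes "compactin X K"
  obtains \<B> where "finite \<B>" "\<And>B. B \<in> \<B> \<Longrightarrow> cell B" "K \<subseteq> \<Union>\<B>"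
proof -
  have "\<exists>B N. cell B \<and> openin X N \<and> x \<in> N \<and> N \<subseteq> B" if "x \<in> K" for x
    using cell_at[of "topspace X" x] that compactin_subset_topspace[OF assms] by (metis openin_topspace subsetD)
  then obtain B N where BN: "\<And>x. x \<in> K \<Longrightarrow> cell (B x) \<and> openin X (N x) \<and> x \<in> N x \<and> N x \<subseteq> B x" by metis
  have "\<exists>\<F>. finite \<F> \<and> \<F> \<subseteq> N ` K \<and> K \<subseteq> \<Union>\<F>"
    using BN by (intro compactinD[OF assms]) auto
  then obtain \<F> where F: "finite \<F>" "\<F> \<subseteq> N ` K" "K \<subseteq> \<Union>\<F>" by blast
  then obtain K0 where K0: "K0 \<subseteq> K" "finite K0" "\<F> = N ` K0" using finite_subset_image by metis
  show ?thesis
  proof (rule that[of "B ` K0"])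
    show "K \<subseteq> \<Union>(B ` K0)"
    proof
      fix x assume "x \<in> K"
      then obtain y where "y \<in> K0" "x \<in> N y" using F(3) K0(3) by auto
      then show "x \<in> \<Union>(B ` K0)" using BN[of y] K0(1) by auto
    qed
  qed (use K0 BN in auto)
qed

text \<open>Induction over a finite cover by cells: the part of \<open>K\<close> in the next cell, and its intersection with the
  part treated so far, lie in a chart.\<close>

lemma detects_compact:
  assumes "compactin X K"
  shows "detects K"
proof -
  obtain \<B> where "finite \<B>" "\<And>B. B \<in> \<B> \<Longrightarrow> cell B" "K \<subseteq> \<Union>\<B>" using compact_cover_cells[OF assms] by blast
  then show ?thesis using assms
  proof (induction \<B> arbitrary: K rule: finite_induct)
    case empty
    then show ?case using detects_empty by auto
  next
    case (insert B \<B>)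
    let ?K1 = "K \<inter> \<Union>\<B>" and ?K2 = "K \<inter> B"
    have cB: "compactin X B" "compactin X (\<Union>\<B>)"
      using insert cell_compact by (auto intro!: compactin_Union)
    have c: "compactin X ?K1" "compactin X ?K2" "compactin X (?K1 \<inter> ?K2)"
      using insert.prems cB compact_closed by (auto intro!: compact_Int_closedin closed_Int_compactin closedin_Int)
    obtain U h where U: "chart X U h" "B \<subseteq> U" using insert.prems unfolding cell_def by blast
    have "detects ?K1" using insert c by auto
    moreover have "detects ?K2" "detects (?K1 \<inter> ?K2)" using U c by (auto intro!: detects_compact_in_chart[OF U(1)])
    ultimately have "detects (?K1 \<union> ?K2)" using c compact_closed by (intro detects_Un) auto
    moreover have "?K1 \<union> ?K2 = K" using insert.prems by auto
    ultimately show ?case by simp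
  qed
qed

lemma res_point_locally_constant:
  assumes z: "z \<in> carrier (H 2 K)" and p: "p \<in> K" "K \<subseteq> topspace X"
  obtains W where "openin X W" "p \<in> W"
    "\<forall>k\<in>W \<inter> K. res 2 K {k} z = \<one>\<^bsub>H 2 {k}\<^esub> \<longleftrightarrow> res 2 K {p} z = \<one>\<^bsub>H 2 {p}\<^esub>"
proof -
  have z2: "z \<in> carrier (H (int 2) K)" using z by simp
  from compact_support[OF z2] obtain T where T: "compactin X T" "T \<inter> K = {}"
    "\<forall>K'. K \<subseteq> K' \<longrightarrow> K' \<inter> T = {} \<longrightarrow> (\<exists>z' \<in> carrier (H (int 2) K'). res (int 2) K' K z' = z)" .
  have "openin X (topspace X - T)" "p \<in> topspace X - T" using T(1,2) p compact_closed[of T] by blast+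
  then obtain B N where B: "cell B" "openin X N" "p \<in> N" "N \<subseteq> B" "B \<subseteq> topspace X - T" using cell_at by blast
  obtain z' where z': "z' \<in> carrier (H 2 (K \<union> B))" "res 2 (K \<union> B) K z' = z"
  proof -
    have "\<exists>z'\<in>carrier (H (int 2) (K \<union> B)). res (int 2) (K \<union> B) K z' = z"
      by (rule T(3)[rule_format]) (use T(2) B in auto)
    then show thesis using that unfolding of_nat_numeral by (elim bexE)
  qed
  have "res 2 K {k} z = \<one>\<^bsub>H 2 {k}\<^esub> \<longleftrightarrow> res 2 (K \<union> B) B z' = \<one>\<^bsub>H 2 B\<^esub>" if k: "k \<in> B \<inter> K" for k
  proof -
    have "res 2 K {k} z = res 2 (K \<union> B) {k} z'" using res_res[of K "K \<union> B" "{k}" 2 z'] k z' by auto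
    also have "\<dots> = res 2 B {k} (res 2 (K \<union> B) B z')" using res_res[of B "K \<union> B" "{k}" 2 z'] k by auto
    finally have "res 2 K {k} z = res 2 B {k} (res 2 (K \<union> B) B z')" .
    then show ?thesis using res_cell_inj[OF B(1), of k "res 2 (K \<union> B) B z'" 2] k hom_induced_carrier hom_induced_one by (metis IntD1)
  qed
  note eq = this
  show ?thesis
  proof (rule that[OF B(2,3)], intro ballI)
    fix k assume k: "k \<in> N \<inter> K"
    show "res 2 K {k} z = \<one>\<^bsub>H 2 {k}\<^esub> \<longleftrightarrow> res 2 K {p} z = \<one>\<^bsub>H 2 {p}\<^esub>"
      using eq[of k] eq[of p] k p(1) B(3,4) by (simp add: subset_iff)
  qed
qed

text \<open>Vanishing at a point is locally constant along \<open>K\<close>, so on a connected \<open>K\<close> one point decides.\<close>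

lemma detect_at_one_point:
  assumes d: "detects K" and K: "connectedin X K" "p \<in> K" and z: "z \<in> carrier (H 2 K)"
    and zp: "res 2 K {p} z = \<one>\<^bsub>H 2 {p}\<^esub>"
  shows "z = \<one>\<^bsub>H 2 K\<^esub>"
proof -
  have KX: "K \<subseteq> topspace X" using K connectedin_subset_topspace by blast
  let ?Z = "\<lambda>k. res 2 K {k} z = \<one>\<^bsub>H 2 {k}\<^esub>"
  have "\<forall>k\<in>K. ?Z k"
  proof
    fix k assume "k \<in> K"
    show "?Z k"
    proof (rule connectedin_locally_constant[OF K _ \<open>k \<in> K\<close>, of ?Z, OF zp])
      fix l assume "l \<in> K"
      show "\<exists>W. openin X W \<and> l \<in> W \<and> (\<forall>k'\<in>W \<inter> K. ?Z k' \<longleftrightarrow> ?Z l)"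
        by (rule res_point_locally_constant[OF z \<open>l \<in> K\<close> KX]) (intro exI conjI, assumption+)
    qed
  qed
  then show ?thesis using d z by (auto simp: detects_def)
qed

end

section \<open>Arcs and the homology of complements\<close>

lemma insert_Int_two:
  assumes "c \<notin> A" "D \<inter> A \<subseteq> {a, c}" "a \<in> D" "a \<in> A" "b \<in> A"
  shows "insert b D \<inter> A = {a, b}"
  using assms by auto

lemma Un_Int_two: "D \<inter> B = {b, a} \<Longrightarrow> A \<inter> B \<subseteq> {a} \<Longrightarrow> (D \<union> A) \<inter> B = {a, b}"
  by auto

context charted
begin

text \<open>Arcs in a chart have these three properties, and removing a set with these properties has the same effect
  on homology as removing a point of it.\<close>

definition short_arc :: "'s set \<Rightarrow> bool" where
  "short_arc \<alpha> \<longleftrightarrow> (\<exists>U h. chart X U h \<and> \<alpha> \<subseteq> U \<and> compact (h ` \<alpha>) \<and> connected (h ` \<alpha>) \<and> path_connected (- (h ` \<alpha>)))"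

lemma short_arc_compact: "short_arc \<alpha> \<Longrightarrow> compactin X \<alpha>"
  unfolding short_arc_def using chart_compact_iff by blast

lemma short_arc_connected: "short_arc \<alpha> \<Longrightarrow> connectedin X \<alpha>"
  unfolding short_arc_def using chart_connected_iff by blast

lemma bounded_in_cell:
  assumes "chart X U h" "\<alpha> \<subseteq> U" "compact (h ` \<alpha>)"
  obtains B where "cell B" "\<alpha> \<subseteq> B"
proof -
  obtain R where R: "h ` \<alpha> \<subseteq> cball 0 R" using bounded_subset_ballD[OF compact_imp_bounded[OF assms(3)], of 0] ball_subset_cball by blast
  let ?B = "{y \<in> U. h y \<in> cball 0 R}"
  have "cell ?B"
    unfolding cell_def using chart_image_vimage[OF assms(1), of "cball 0 R"] assms(1)
    by (intro exI[of _ U] exI[of _ h]) auto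
  then show ?thesis by (rule that) (use assms R in auto)
qed

lemma res_cell_surj:
  assumes "cell B" "p \<in> B" "y \<in> carrier (H q {p})"
  obtains z where "z \<in> carrier (H q B)" "res q B {p} z = y"
proof -
  have *: "exact_seq ([relative_homology_group (q-1) (subtopology X (topspace X - {p})) (topspace X - B), H q {p}, H q B],
     [hom_relboundary q X (topspace X - {p}) (topspace X - B), res q B {p}])"
    using assms by (intro homology_exactness_triple_1) auto
  have "y \<in> kernel (H q {p}) (relative_homology_group (q-1) (subtopology X (topspace X - {p})) (topspace X - B)) (hom_relboundary q X (topspace X - {p}) (topspace X - B))"
    using cell_trivial[OF assms(1,2), of "q-1"] hom_relboundary[of q X "topspace X - {p}" "topspace X - B" y] assms(3)
    by (auto simp: kernel_def trivial_group_def)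
  then have "y \<in> res q B {p} ` carrier (H q B)" using * by auto
  then show ?thesis using that by blast
qed

text \<open>In degree two this is detection at one point, in higher degrees the groups vanish, in degree one the
  group vanishes because the complement of the arc in the chart is path connected, and below that because reduced
  homology starts in degree zero.\<close>

lemma short_arc_res_inj:
  assumes arc: "short_arc \<alpha>" "a \<in> \<alpha>" and z: "z \<in> carrier (H q \<alpha>)" "res q \<alpha> {a} z = \<one>\<^bsub>H q {a}\<^esub>"
  shows "z = \<one>\<^bsub>H q \<alpha>\<^esub>"
proof -
  obtain U h where U: "chart X U h" "\<alpha> \<subseteq> U" "compact (h ` \<alpha>)" "connected (h ` \<alpha>)" "path_connected (- (h ` \<alpha>))"
    using arc unfolding short_arc_def by blast
  have cl: "closedin X \<alpha>" using short_arc_compact[OF arc(1)] compact_closed by blast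
  have d: "detects \<alpha>" using detects_compact short_arc_compact arc by blast
  have ne: "h ` \<alpha> \<noteq> UNIV" using U(3) not_compact_UNIV by metis
  consider "q \<ge> 3" | "q = 2" | "q = 1" | "q \<le> 0" by linarith
  then show ?thesis
  proof cases
    case 1
    then show ?thesis using d z by (auto simp: detects_def trivial_group_def)
  next
    case 2
    then show ?thesis using detect_at_one_point[OF d short_arc_connected[OF arc(1)] arc(2)] z by simp
  next
    case 3
    have "trivial_group (H 1 \<alpha>)"
      using isomorphic_group_triviality[OF chart_excision[OF U(1,2) cl, of 1]] trivial_homology_arc_complement[OF U(5) ne] by simp
    then show ?thesis using z 3 by (simp add: trivial_group_def)
  next
    case 4
    have "relative_homology_group q euclidean (- (h ` \<alpha>)) \<cong> reduced_homology_group (q - 1) (subtopology euclidean (- (h ` \<alpha>)))"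
      using ne by (intro isomorphic_group_relative_homology_of_contractible contractible_space_plane) auto
    then have "trivial_group (relative_homology_group q euclidean (- (h ` \<alpha>)))"
      using isomorphic_group_triviality trivial_reduced_homology_group[of "q - 1"] 4
      by (metis diff_less_eq group_reduced_homology_group group_relative_homology_group le_imp_less_Suc less_add_one order_le_less_trans zless_add1_eq)
    then have "trivial_group (H q \<alpha>)"
      using isomorphic_group_triviality[OF chart_excision[OF U(1,2) cl, of q]] by simp
    then show ?thesis using z by (simp add: trivial_group_def)
  qed
qed

text \<open>Restriction from the arc to the point \<open>a\<close> is injective by the previous lemma, and surjective because
  a class at \<open>a\<close> extends to a cell around the whole arc. So the third group of the triple vanishes.\<close>

lemma short_arc_trivial:
  assumes arc: "short_arc \<alpha>" "a \<in> \<alpha>"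
  shows "trivial_group (relative_homology_group q (subtopology X (topspace X - {a})) (topspace X - \<alpha>))"
proof (rule trivial_groupI)
  let ?Y = "subtopology X (topspace X - {a})" and ?T = "topspace X - \<alpha>" and ?S = "topspace X - {a}"
  have TS: "?T \<subseteq> ?S" using arc by auto
  obtain U h where U: "chart X U h" "\<alpha> \<subseteq> U" "compact (h ` \<alpha>)" using arc unfolding short_arc_def by blast
  obtain B where B: "cell B" "\<alpha> \<subseteq> B" using bounded_in_cell[OF U] .
  fix w assume w: "w \<in> carrier (relative_homology_group q ?Y ?T)"
  let ?i = "hom_induced q ?Y ?T X ?T id"
  have ex3: "exact_seq ([H q {a}, H q \<alpha>, relative_homology_group q ?Y ?T], [res q \<alpha> {a}, ?i])"
    by (rule homology_exactness_triple_3[OF TS])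
  have "?i w \<in> kernel (H q \<alpha>) (H q {a}) (res q \<alpha> {a})" using ex3 w by auto
  then have "?i w = \<one>\<^bsub>H q \<alpha>\<^esub>" using short_arc_res_inj[OF arc, of "?i w" q] by (auto simp: kernel_def)
  then have ker: "w \<in> kernel (relative_homology_group q ?Y ?T) (H q \<alpha>) ?i" using w by (simp add: kernel_def)
  let ?d = "hom_relboundary (q + 1) X ?S ?T"
  have ex2: "exact_seq ([H q \<alpha>, relative_homology_group q ?Y ?T, H (q + 1) {a}], [?i, ?d])"
    using homology_exactness_triple_2[OF TS, of "q + 1" X] by simp
  have ex1: "exact_seq ([relative_homology_group q ?Y ?T, H (q + 1) {a}, H (q + 1) \<alpha>], [?d, res (q + 1) \<alpha> {a}])"
    using homology_exactness_triple_1[OF TS, of "q + 1" X] by simp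
  obtain u where u: "u \<in> carrier (H (q + 1) {a})" "w = ?d u" using ex2 ker by auto
  obtain v where v: "v \<in> carrier (H (q + 1) B)" "res (q + 1) B {a} v = u"
    using res_cell_surj[OF B(1) _ u(1)] arc(2) B(2) by blast
  have "u = res (q + 1) \<alpha> {a} (res (q + 1) B \<alpha> v)" using v res_res[of \<alpha> B "{a}" "q+1" v] B(2) arc(2) by simp
  then have "u \<in> res (q + 1) \<alpha> {a} ` carrier (H (q + 1) \<alpha>)" using hom_induced_carrier by blast
  then have "u \<in> kernel (H (q + 1) {a}) (relative_homology_group q ?Y ?T) ?d" using ex1 by auto
  then show "w = \<one>\<^bsub>relative_homology_group q ?Y ?T\<^esub>" using u(2) by (simp add: kernel_def)
qed simp

lemma remove_point_iso:
  assumes D: "closedin X D" and p: "p \<in> topspace X" "p \<notin> D"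
  shows "relative_homology_group q (subtopology X (topspace X - D)) (topspace X - insert p D) \<cong> H q {p}"
proof -
  have "hom_induced q (subtopology X (topspace X - D)) ((topspace X - D) - {p}) (subtopology X (topspace X)) (topspace X - {p}) id \<in>
    iso (relative_homology_group q (subtopology X (topspace X - D)) ((topspace X - D) - {p})) (relative_homology_group q (subtopology X (topspace X)) (topspace X - {p}))"
    by (rule excision_open) (use D p closed_point closed_Diff_open in auto)
  moreover have "(topspace X - D) - {p} = topspace X - insert p D" by auto
  ultimately show ?thesis by (auto intro: is_isoI)
qed

text \<open>By excision the closed set \<open>D\<close> may be shrunk to the two end points. Filling in \<open>b\<close> makes the arc trivial
  by \<open>short_arc_trivial\<close>, so the boundary map of the triple identifies the group with the local homology at \<open>b\<close>, in one degree
  higher.\<close>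

lemma remove_open_arc_iso:
  assumes D: "closedin X D" and arc: "short_arc \<alpha>" and ab: "a \<noteq> b" "D \<inter> \<alpha> = {a, b}"
  shows "relative_homology_group q (subtopology X (topspace X - D)) (topspace X - (D \<union> \<alpha>)) \<cong> H (q + 1) {b}"
proof -
  have cl: "closedin X \<alpha>" using short_arc_compact[OF arc] compact_closed by blast
  have abX: "a \<in> topspace X" "b \<in> topspace X" "a \<in> \<alpha>" "b \<in> \<alpha>" "a \<in> D" "b \<in> D" using ab closedin_subset[OF cl] by auto
  have clab: "closedin X {a, b}" using closed_point[OF abX(1)] closed_point[OF abX(2)] closedin_Un by force
  let ?A = "topspace X - {a, b}" and ?O = "topspace X - D" and ?C = "\<alpha> - {a, b}"
  have "hom_induced q (subtopology X ?O) (?O - ?C) (subtopology X ?A) (?A - ?C) id \<in>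
    iso (relative_homology_group q (subtopology X ?O) (?O - ?C)) (relative_homology_group q (subtopology X ?A) (?A - ?C))"
  proof (rule excision_open)
    show "openin (subtopology X ?A) ?O"
      using closed_Diff_open[OF D] closed_Diff_open[OF clab] abX by (subst openin_open_subtopology) auto
    show "closedin (subtopology X ?A) ?C"
      unfolding closedin_subtopology using cl closedin_subset[OF cl] by (intro exI[of _ \<alpha>]) auto
  qed (use ab closedin_subset[OF cl] in auto)
  moreover have "?O - ?C = topspace X - (D \<union> \<alpha>)" "?A - ?C = topspace X - \<alpha>" using ab by auto
  ultimately have iso1: "relative_homology_group q (subtopology X ?O) (topspace X - (D \<union> \<alpha>)) \<cong>
     relative_homology_group q (subtopology X ?A) (topspace X - \<alpha>)"
    by (auto intro: is_isoI)
  let ?Y = "subtopology X (topspace X - {a})" and ?T = "topspace X - \<alpha>"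
  have TA: "?T \<subseteq> ?A" using abX by auto
  have YA: "subtopology ?Y ?A = subtopology X ?A"
  proof -
    have "(topspace X - {a}) \<inter> ?A = ?A" by auto
    then show ?thesis by (simp add: subtopology_subtopology)
  qed
  have "hom_relboundary (q + 1) ?Y ?A ?T \<in> iso (relative_homology_group (q + 1) ?Y ?A) (relative_homology_group q (subtopology ?Y ?A) ?T)"
  proof -
    have ex2: "exact_seq ([relative_homology_group q ?Y ?T, relative_homology_group q (subtopology ?Y ?A) ?T, relative_homology_group (q + 1) ?Y ?A],
        [hom_induced q (subtopology ?Y ?A) ?T ?Y ?T id, hom_relboundary (q + 1) ?Y ?A ?T])"
      using homology_exactness_triple_2[OF TA, of "q + 1" ?Y] by simp
    have ex1: "exact_seq ([relative_homology_group q (subtopology ?Y ?A) ?T, relative_homology_group (q + 1) ?Y ?A, relative_homology_group (q + 1) ?Y ?T],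
        [hom_relboundary (q + 1) ?Y ?A ?T, hom_induced (q + 1) ?Y ?T ?Y ?A id])"
      using homology_exactness_triple_1[OF TA, of "q + 1" ?Y] by simp
    have "exact_seq ([relative_homology_group q ?Y ?T, relative_homology_group q (subtopology ?Y ?A) ?T, relative_homology_group (q + 1) ?Y ?A, relative_homology_group (q + 1) ?Y ?T],
        [hom_induced q (subtopology ?Y ?A) ?T ?Y ?T id, hom_relboundary (q + 1) ?Y ?A ?T, hom_induced (q + 1) ?Y ?T ?Y ?A id])"
      using ex1 ex2 by auto
    then show ?thesis
      by (rule very_short_exact_sequence) (use short_arc_trivial[OF arc abX(3)] in auto)
  qed
  then have "relative_homology_group (q + 1) ?Y ?A \<cong> relative_homology_group q (subtopology X ?A) ?T"
    unfolding YA by (rule is_isoI)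
  then have iso2: "relative_homology_group q (subtopology X ?A) ?T \<cong> relative_homology_group (q + 1) ?Y ?A"
    by (rule group.iso_sym[rotated]) simp
  have "topspace X - insert b {a} = ?A" by auto
  then have iso3: "relative_homology_group (q + 1) ?Y ?A \<cong> H (q + 1) {b}"
    using remove_point_iso[OF closed_point[OF abX(1)] abX(2), of "q + 1"] ab(1) by auto
  show ?thesis using iso_trans[OF iso1 iso_trans[OF iso2 iso3]] .
qed

abbreviation r :: "int \<Rightarrow> 's set \<Rightarrow> enat" where
  "r q D \<equiv> erank (H q D) (carrier (H q D))"

text \<open>The rank of \<open>H_1(X, X - D)\<close> exceeds that of \<open>H_2(X, X - D)\<close> by at least \<open>k\<close>. By duality the difference is minus the
  Euler characteristic of \<open>D\<close>; for a drawing it is the number of edges minus the number of vertices, and the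
  inequality is the direction that the count of faces needs.\<close>

definition excess :: "'s set \<Rightarrow> int \<Rightarrow> bool" where
  "excess D k \<longleftrightarrow> closedin X D \<and> r 1 D \<noteq> \<infinity> \<and> r 2 D \<noteq> \<infinity> \<and> int (the_enat (r 2 D)) + k \<le> int (the_enat (r 1 D))"

lemma excess_empty: "excess {} 0"
proof -
  have "r q {} = 0" for q
    using trivial_relative_homology_group_topspace[of q X] by (intro erank_trivial_group) auto
  then show ?thesis by (simp add: excess_def)
qed

text \<open>Ranks along the exact sequence of a triple from degree two down to degree one; \<open>b\<close> and \<open>c\<close> are the ranks of
  the image and of the boundary map out of degree two.\<close>

lemma triple_ranks:
  assumes "T \<subseteq> S" "S \<subseteq> topspace X"
  defines "M \<equiv> subtopology X S"
  assumes triv: "trivial_group (relative_homology_group 0 M T)"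
  obtains a b c where "erank (relative_homology_group 2 X T) (carrier (relative_homology_group 2 X T)) = a + b"
    "a \<le> erank (relative_homology_group 2 M T) (carrier (relative_homology_group 2 M T))"
    "b \<le> erank (relative_homology_group 2 X S) (carrier (relative_homology_group 2 X S))"
    "erank (relative_homology_group 2 X S) (carrier (relative_homology_group 2 X S)) = b + c"
    "erank (relative_homology_group 1 X T) (carrier (relative_homology_group 1 X T)) + c =
     erank (relative_homology_group 1 M T) (carrier (relative_homology_group 1 M T)) +
     erank (relative_homology_group 1 X S) (carrier (relative_homology_group 1 X S))"
proof -
  let ?i = "\<lambda>q. hom_induced q M T X T id" and ?j = "\<lambda>q. hom_induced q X T X S id" and ?d = "\<lambda>q. hom_relboundary q X S T"
  let ?A = "\<lambda>q. relative_homology_group q M T" and ?B = "\<lambda>q. relative_homology_group q X T" and ?C = "\<lambda>q. relative_homology_group q X S"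
  have e3: "erank (?B q) (carrier (?B q)) = erank (?B q) (?i q ` carrier (?A q)) + erank (?C q) (?j q ` carrier (?B q))" for q
    using homology_exactness_triple_3[OF assms(1), of q X] unfolding M_def by (intro erank_exact) auto
  have e1: "erank (?C q) (carrier (?C q)) = erank (?C q) (?j q ` carrier (?B q)) + erank (?A (q - 1)) (?d q ` carrier (?C q))" for q
    using homology_exactness_triple_1[OF assms(1), of q X] unfolding M_def by (intro erank_exact) auto
  have e2: "erank (?A 1) (carrier (?A 1)) = erank (?A 1) (?d 2 ` carrier (?C 2)) + erank (?B 1) (?i 1 ` carrier (?A 1))"
    using homology_exactness_triple_2[OF assms(1), of 2 X] unfolding M_def by (intro erank_exact) auto
  have e10: "erank (?A 0) (?d 1 ` carrier (?C 1)) = 0"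
    using erank_trivial_group[OF _ triv] erank_mono[of "?d 1 ` carrier (?C 1)" "carrier (?A 0)" "?A 0"]
      hom_relboundary[of 1 X S T] by (auto simp: M_def)
  let ?a = "erank (?B 2) (?i 2 ` carrier (?A 2))" and ?b = "erank (?C 2) (?j 2 ` carrier (?B 2))" and ?c = "erank (?A 1) (?d 2 ` carrier (?C 2))"
  have c1: "erank (?C 1) (carrier (?C 1)) = erank (?C 1) (?j 1 ` carrier (?B 1))"
    using e1[of 1] e10 by simp
  show ?thesis
  proof (rule that[of ?a ?b ?c])
    show "?a \<le> erank (?A 2) (carrier (?A 2))"
      by (intro erank_image_le) (auto simp: hom_induced_hom group.subgroup_self)
    show "?b \<le> erank (?C 2) (carrier (?C 2))"
      by (intro erank_mono) (auto simp: hom_induced_carrier)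
    show "erank (?B 1) (carrier (?B 1)) + ?c = erank (?A 1) (carrier (?A 1)) + erank (?C 1) (carrier (?C 1))"
      unfolding e3[of 1] e2 c1 by (simp add: ac_simps)
  qed (use e3[of 2] e1[of 2] in auto)
qed

text \<open>The point contributes one class in degree two and nothing in degree one.\<close>

lemma excess_insert_point:
  assumes "excess D k" "p \<in> topspace X" "p \<notin> D"
  shows "excess (insert p D) (k - 1)"
proof -
  have D: "closedin X D" "r 1 D \<noteq> \<infinity>" "r 2 D \<noteq> \<infinity>" "int (the_enat (r 2 D)) + k \<le> int (the_enat (r 1 D))"
    using assms by (auto simp: excess_def)
  have cl: "closedin X (insert p D)" using closedin_Un[OF closed_point[OF assms(2)] D(1)] by simp
  let ?S = "topspace X - D" and ?T = "topspace X - insert p D"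
  let ?A = "\<lambda>q. relative_homology_group q (subtopology X ?S) ?T"
  note iso = remove_point_iso[OF D(1) assms(2,3)]
  have triv: "trivial_group (?A q)" if "q \<noteq> 2" for q
    using isomorphic_group_triviality[OF iso[of q]] local_homology_trivial[OF assms(2) that] by simp
  have rk2: "erank (?A 2) (carrier (?A 2)) = 1"
    using erank_iso[OF _ _ iso[of 2]] local_homology_rank[OF assms(2)] by simp
  have rk1: "erank (?A 1) (carrier (?A 1)) = 0"
    using triv[of 1] by (intro erank_trivial_group) auto
  obtain a b c where abc: "r 2 (insert p D) = a + b" "a \<le> erank (?A 2) (carrier (?A 2))"
     "b \<le> r 2 D" "r 2 D = b + c" "r 1 (insert p D) + c = erank (?A 1) (carrier (?A 1)) + r 1 D"
    using triple_ranks[of ?T ?S] triv[of 0] by auto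
  obtain n1 n2 where n: "r 1 D = enat n1" "r 2 D = enat n2" using D by auto
  have "a \<le> 1" using abc(2) rk2 by simp
  then obtain a' b' c' where n': "a = enat a'" "b = enat b'" "c = enat c'"
    using abc(4) n by (cases a; cases b; cases c) (auto simp: one_enat_def)
  obtain m1 where m1: "r 1 (insert p D) = enat m1" using abc(5) rk1 n by (cases "r 1 (insert p D)") auto
  have "a' \<le> 1" "n2 = b' + c'" "m1 + c' = n1" using \<open>a \<le> 1\<close> abc n n' m1 rk1 by (auto simp: one_enat_def)
  then show ?thesis
    unfolding excess_def using cl abc(1) n n' m1 D(4) by simp
qed

text \<open>The open arc contributes a class of degree one, unless this class is the boundary of a class of degree
  two, which is then lost; in both cases the difference grows by one.\<close>

lemma excess_Un_short_arc:
  assumes "excess D k" "short_arc \<alpha>" "a \<noteq> b" "D \<inter> \<alpha> = {a, b}"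
  shows "excess (D \<union> \<alpha>) (k + 1)"
proof -
  have D: "closedin X D" "r 1 D \<noteq> \<infinity>" "r 2 D \<noteq> \<infinity>" "int (the_enat (r 2 D)) + k \<le> int (the_enat (r 1 D))"
    using assms by (auto simp: excess_def)
  have cl: "closedin X (D \<union> \<alpha>)" using closedin_Un D(1) compact_closed short_arc_compact assms by blast
  have bX: "b \<in> topspace X" using assms(4) closedin_subset[OF D(1)] by auto
  let ?S = "topspace X - D" and ?T = "topspace X - (D \<union> \<alpha>)"
  let ?A = "\<lambda>q. relative_homology_group q (subtopology X ?S) ?T"
  note iso = remove_open_arc_iso[OF D(1) assms(2-4)]
  have triv: "trivial_group (?A q)" if "q \<noteq> 1" for q
    using isomorphic_group_triviality[OF iso[of q]] local_homology_trivial[OF bX, of "q + 1"] that by simp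
  have rk1: "erank (?A 1) (carrier (?A 1)) = 1"
    using erank_iso[OF _ _ iso[of 1]] local_homology_rank[OF bX] by simp
  have rk2: "erank (?A 2) (carrier (?A 2)) = 0"
    using triv[of 2] by (intro erank_trivial_group) auto
  obtain a b c where abc: "r 2 (D \<union> \<alpha>) = a + b" "a \<le> erank (?A 2) (carrier (?A 2))"
     "b \<le> r 2 D" "r 2 D = b + c" "r 1 (D \<union> \<alpha>) + c = erank (?A 1) (carrier (?A 1)) + r 1 D"
    using triple_ranks[of ?T ?S] triv[of 0] by auto
  obtain n1 n2 where n: "r 1 D = enat n1" "r 2 D = enat n2" using D by auto
  have a0: "a = 0" using abc(2) rk2 by simp
  then obtain b' c' where n': "b = enat b'" "c = enat c'"
    using abc(4) n by (cases b; cases c) auto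
  obtain m1 where m1: "r 1 (D \<union> \<alpha>) = enat m1" using abc(5) rk1 n by (cases "r 1 (D \<union> \<alpha>)") (auto simp: one_enat_def)
  have "n2 = b' + c'" "m1 + c' = 1 + n1" using abc n n' m1 rk1 by (auto simp: one_enat_def)
  then show ?thesis
    unfolding excess_def using cl abc(1) a0 n n' m1 D(4) by simp
qed

lemma short_arc_subpath:
  assumes g: "pathin X g" "inj_on g {0..1}" and st: "0 \<le> s" "s \<le> t" "t \<le> 1" and U: "chart X U h" "g ` {s..t} \<subseteq> U"
  shows "short_arc (g ` {s..t})"
proof -
  have "continuous_map (subtopology euclideanreal {s..t}) (subtopology X U) g"
  proof -
    have "continuous_map (subtopology euclideanreal {s..t}) X g"
      using g(1) st unfolding pathin_def by (rule_tac continuous_map_from_subtopology_mono) auto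
    then show ?thesis using U(2) by (simp add: continuous_map_in_subtopology image_subset_iff)
  qed
  then have "continuous_map (subtopology euclideanreal {s..t}) euclidean (h \<circ> g)"
    using chart_continuous[OF U(1)] by (rule continuous_map_compose)
  then have c: "continuous_on {s..t} (h \<circ> g)" by simp
  have inj: "inj_on (h \<circ> g) {s..t}"
    using g(2) chart_bij(3)[OF U(1)] U(2) st by (intro comp_inj_on) (auto intro: inj_on_subset)
  have "{s..t} homeomorphic (h \<circ> g) ` {s..t}"
    using c inj by (intro homeomorphic_compact) auto
  then have hom: "h ` g ` {s..t} homeomorphic {s..t}" unfolding image_comp by (rule homeomorphic_sym[THEN iffD1])
  have "path_connected (- (h ` g ` {s..t}))"
    using hom by (rule path_connected_complement_homeomorphic_convex_compact) auto
  moreover have "compact (h ` g ` {s..t})" "connected (h ` g ` {s..t})"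
    using compact_continuous_image[OF c] connected_continuous_image[OF c] by (auto simp: image_comp)
  ultimately show ?thesis unfolding short_arc_def using U by blast
qed

lemma pathin_chart_delta:
  assumes g: "pathin X g" and x: "x \<in> {0..1}" and W: "openin X W" "g x \<in> W"
  obtains d where "d > 0" "\<And>y. y \<in> {0..1} \<Longrightarrow> \<bar>y - x\<bar> < d \<Longrightarrow> g y \<in> W"
proof -
  have "openin (subtopology euclideanreal {0..1}) {y \<in> {0..1}. g y \<in> W}"
    using openin_continuous_map_preimage[OF g[unfolded pathin_def] W(1)] by simp
  then obtain S where S: "open S" "{y \<in> {0..1}. g y \<in> W} = S \<inter> {0..1}" by (auto simp: openin_subtopology)
  then obtain d where d: "d > 0" "ball x d \<subseteq> S" using x W(2) open_contains_ball by blast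
  show ?thesis
    by (rule that[OF d(1)]) (use d S in \<open>auto simp: dist_real_def subset_iff\<close>)
qed

text \<open>Cut the arc into short arcs: adding a point in the middle costs one, adding the two halves gains two. The
  subdivision is hidden in Bolzano's principle, applied to the statement for all subintervals.\<close>

lemma excess_Un_path:
  assumes ex: "excess D k" and g: "pathin X g" "inj_on g {0..1}" and D: "D \<inter> g ` {0..1} = {g 0, g 1}"
  shows "excess (D \<union> g ` {0..1}) (k + 1)"
proof -
  define P where "P s t \<longleftrightarrow> (0 \<le> s \<and> s < t \<and> t \<le> 1 \<longrightarrow>
    (\<forall>D k. excess D k \<longrightarrow> D \<inter> g ` {s..t} = {g s, g t} \<longrightarrow> excess (D \<union> g ` {s..t}) (k + 1)))" for s t :: real
  have gX: "g y \<in> topspace X" if "y \<in> {0..1}" for y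
    using g(1) that unfolding pathin_def continuous_map_def by auto
  have inj: "g y = g z \<longleftrightarrow> y = z" if "y \<in> {0..1}" "z \<in> {0..1}" for y z
    using g(2) that by (auto simp: inj_on_def)
  have PD: "excess (D \<union> g ` {s..t}) (k + 1)"
    if "P s t" "0 \<le> s" "s < t" "t \<le> 1" "excess D k" "D \<inter> g ` {s..t} = {g s, g t}" for s t D k
    using that unfolding P_def by blast
  have "(0::real) \<le> 1" by simp
  then have "P 0 1"
  proof (induction rule: Bolzano)
    case (trans s u t)
    show ?case unfolding P_def
    proof (intro impI allI)
      fix D k assume st: "0 \<le> s \<and> s < t \<and> t \<le> 1" and ex: "excess D k" and D: "D \<inter> g ` {s..t} = {g s, g t}"
      show "excess (D \<union> g ` {s..t}) (k + 1)"
      proof (cases "s = u \<or> u = t")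
        case True
        then show ?thesis using trans st ex D by (auto simp: P_def)
      next
        case False
        then have sut: "s < u" "u < t" using trans by auto
        have split: "{s..t} = {s..u} \<union> {u..t}" using sut by auto
        have uD: "g u \<notin> D"
        proof
          assume "g u \<in> D"
          then have "g u \<in> {g s, g t}" using D sut by auto
          then show False using inj[of u s] inj[of u t] sut st by auto
        qed
        let ?D1 = "insert (g u) D"
        have "excess ?D1 (k - 1)" using ex uD sut st by (intro excess_insert_point gX) auto
        moreover have "?D1 \<inter> g ` {s..u} = {g s, g u}"
        proof -
          have "g t \<notin> g ` {s..u}"
          proof
            assume "g t \<in> g ` {s..u}"
            then obtain y where "y \<in> {s..u}" "g t = g y" by blast
            then show False using inj[of t y] sut st by auto
          qed
          moreover have "D \<inter> g ` {s..u} \<subseteq> {g s, g t}" "g s \<in> D" using D split sut by blast+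
          ultimately show ?thesis using sut by (intro insert_Int_two[where c = "g t"]) auto
        qed
        ultimately have "excess (?D1 \<union> g ` {s..u}) (k - 1 + 1)" using sut st by (intro PD[OF trans(1)]) auto
        then have "excess (?D1 \<union> g ` {s..u}) k" by simp
        moreover have "(?D1 \<union> g ` {s..u}) \<inter> g ` {u..t} = {g u, g t}"
        proof -
          have gs: "g s \<notin> g ` {u..t}"
          proof
            assume "g s \<in> g ` {u..t}"
            then obtain y where "y \<in> {u..t}" "g s = g y" by blast
            then show False using inj[of s y] sut st by auto
          qed
          have Dt: "D \<inter> g ` {u..t} \<subseteq> {g t, g s}" "g t \<in> D" using D split sut by blast+
          have "insert (g u) D \<inter> g ` {u..t} = {g t, g u}"
            using gs Dt sut by (intro insert_Int_two[where c = "g s"]) auto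
          moreover have "g ` {s..u} \<inter> g ` {u..t} \<subseteq> {g u}"
          proof
            fix x assume "x \<in> g ` {s..u} \<inter> g ` {u..t}"
            then obtain y z where "y \<in> {s..u}" "z \<in> {u..t}" "x = g y" "x = g z" by blast
            moreover from this have "y = z" using inj[of y z] sut st by auto
            ultimately show "x \<in> {g u}" by auto
          qed
          ultimately show ?thesis by (rule Un_Int_two)
        qed
        ultimately have "excess ((?D1 \<union> g ` {s..u}) \<union> g ` {u..t}) (k + 1)" using sut st by (intro PD[OF trans(2)]) auto
        moreover have "(?D1 \<union> g ` {s..u}) \<union> g ` {u..t} = D \<union> g ` {s..t}" using split sut by auto
        ultimately show ?thesis by simp
      qed
    qed
  next
    case (local x)
    then have x: "x \<in> {0..1}" by auto
    obtain U h where U: "chart X U h" "g x \<in> U" using charts[OF gX[OF x]] by blast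
    obtain d where d: "d > 0" "\<And>y. y \<in> {0..1} \<Longrightarrow> \<bar>y - x\<bar> < d \<Longrightarrow> g y \<in> U"
      using pathin_chart_delta[OF g(1) x chart_bij(4)[OF U(1)] U(2)] by blast
    have "P s t" if st: "s \<le> x" "x \<le> t" "t - s < d" for s t
      unfolding P_def
    proof (intro impI allI)
      fix D k assume st': "0 \<le> s \<and> s < t \<and> t \<le> 1" and ex: "excess D k" and D: "D \<inter> g ` {s..t} = {g s, g t}"
      have "g ` {s..t} \<subseteq> U" using d(2) st st' by auto
      then have "short_arc (g ` {s..t})" using short_arc_subpath[OF g _ _ _ U(1)] st' by auto
      then show "excess (D \<union> g ` {s..t}) (k + 1)"
        using inj[of s t] st' by (intro excess_Un_short_arc[OF ex _ _ D]) auto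
    qed
    then show ?case using d(1) by blast
  qed
  then show ?thesis using ex D by (auto simp: P_def)
qed

end

section \<open>Finite rank of the first homology group\<close>

lemma enat_le_add_finite: "x \<le> y + z \<Longrightarrow> y \<noteq> \<infinity> \<Longrightarrow> z \<noteq> \<infinity> \<Longrightarrow> x \<noteq> (\<infinity> :: enat)"
  by (cases x; cases y; cases z) auto

context charted
begin

abbreviation inc :: "int \<Rightarrow> 's set \<Rightarrow> 's set \<Rightarrow> 's chain set \<Rightarrow> 's chain set" where
  "inc q A B \<equiv> hom_induced q (subtopology X A) {} (subtopology X B) {} id"

text \<open>For open sets only the images in slightly larger sets can be shown to have finite rank by induction over
  a cover.\<close>

abbreviation img :: "int \<Rightarrow> 's set \<Rightarrow> 's set \<Rightarrow> 's chain set set" where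
  "img q A B \<equiv> inc q A B ` carrier (homology_group q (subtopology X A))"

lemma finite_rank_path_components:
  assumes "finite \<F>" "\<And>S. S \<in> \<F> \<Longrightarrow> path_connectedin X S"
  defines "Y \<equiv> subtopology X (\<Union>\<F>)"
  shows "erank (homology_group 0 Y) (carrier (homology_group 0 Y)) \<noteq> \<infinity>"
proof -
  define x where "x S = (SOME y. y \<in> S)" for S :: "'s set"
  have "path_components_of Y \<subseteq> (\<lambda>S. path_component_of_set Y (x S)) ` \<F>"
  proof
    fix C assume "C \<in> path_components_of Y"
    then obtain y where y: "y \<in> topspace Y" "C = path_component_of_set Y y" by (auto simp: path_components_of_def)
    then obtain S where S: "S \<in> \<F>" "y \<in> S" by (auto simp: Y_def)
    then have "x S \<in> S" unfolding x_def by (metis someI)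
    moreover have "path_connectedin Y S" using S assms(2) by (auto simp: Y_def path_connectedin_subtopology)
    ultimately have "path_component_of Y y (x S)" using S unfolding path_component_of by blast
    then have "C = path_component_of_set Y (x S)" using y by (metis path_component_of_equiv)
    then show "C \<in> (\<lambda>S. path_component_of_set Y (x S)) ` \<F>" using S by blast
  qed
  then have fin: "finite (path_components_of Y)" using assms(1) finite_surj by blast
  have "erank (homology_group 0 Y) (carrier (homology_group 0 Y)) =
      erank (free_Abelian_group (path_components_of Y)) (carrier (free_Abelian_group (path_components_of Y)))"
    by (intro erank_iso zeroth_homology_group abelian_free_Abelian_group) simp
  then show ?thesis using erank_free_Abelian_group[OF fin] by simp
qed

lemma chart_path_connected:
  assumes "chart X U h"
  shows "path_connectedin X U"
proof -
  have "subtopology X U homeomorphic_space (euclidean :: complex topology)"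
    using assms homeomorphic_map_imp_homeomorphic_space unfolding chart_def by blast
  then have "path_connected_space (subtopology X U)"
  proof -
    have "path_connected_space (euclidean :: complex topology)"
      using path_connected_UNIV[where ?'a = complex] path_connectedin_topspace[of "euclidean :: complex topology"] by simp
    then show ?thesis using homeomorphic_path_connected_space_imp homeomorphic_space_sym
      \<open>subtopology X U homeomorphic_space (euclidean :: complex topology)\<close> by blast
  qed
  then show ?thesis using chart_bij(1)[OF assms] by (simp add: path_connectedin_def)
qed

lemma img_inc:
  assumes "A \<subseteq> B" "B \<subseteq> C"
  shows "img q A C = inc q B C ` img q A B"
proof -
  have "inc q B C (inc q A B z) = inc q A C z" for z
    by (rule hom_induced_incl_incl) (use assms in auto)
  then show ?thesis by (auto simp: image_image)
qed

lemma subgroup_img: "subgroup (img q A B) (homology_group q (subtopology X B))"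
  by (intro group_hom.img_is_subgroup) (simp add: group_hom_def group_hom_axioms_def hom_induced_hom)

lemma img_subset: "img q A B \<subseteq> carrier (homology_group q (subtopology X B))"
  by (auto simp: hom_induced_carrier)

text \<open>The compact set in between meets only finitely many path connected charts.\<close>

lemma finite_rank_H0_between:
  assumes "compactin X K" "openin X C" "A \<subseteq> K" "K \<subseteq> C"
  shows "erank (homology_group 0 (subtopology X C)) (img 0 A C) \<noteq> \<infinity>"
proof -
  have "\<exists>U h. chart X U h \<and> x \<in> U \<and> U \<subseteq> C" if "x \<in> K" for x
    using chart_at[OF assms(2), of x] that assms(4) by (metis subsetD)
  then obtain U where U: "\<And>x. x \<in> K \<Longrightarrow> (\<exists>h. chart X (U x) h) \<and> x \<in> U x \<and> U x \<subseteq> C" by metis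
  have op: "openin X (U x)" "path_connectedin X (U x)" if "x \<in> K" for x
    using U[OF that] chart_bij(4) chart_path_connected by blast+
  have "\<exists>\<F>. finite \<F> \<and> \<F> \<subseteq> U ` K \<and> K \<subseteq> \<Union>\<F>"
    using U op by (intro compactinD[OF assms(1)]) auto
  then obtain \<F> where F: "finite \<F>" "\<F> \<subseteq> U ` K" "K \<subseteq> \<Union>\<F>" by blast
  define P where "P = \<Union>\<F>"
  have "S \<subseteq> C" if "S \<in> \<F>" for S using subsetD[OF F(2) that] U by auto
  then have PC: "A \<subseteq> P" "P \<subseteq> C" using F(3) assms(3) by (auto simp: P_def)
  have "erank (homology_group 0 (subtopology X C)) (img 0 A C) \<le> erank (homology_group 0 (subtopology X P)) (img 0 A P)"
    unfolding img_inc[OF PC] by (intro erank_image_le subgroup_img) (auto simp: hom_induced_hom)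
  also have "\<dots> \<le> erank (homology_group 0 (subtopology X P)) (carrier (homology_group 0 (subtopology X P)))"
    by (intro erank_mono img_subset)
  also have "\<dots> < \<infinity>"
    using finite_rank_path_components[OF F(1)] F(2) op unfolding P_def by (auto simp: less_top[symmetric] top_enat_def)
  finally show ?thesis by simp
qed

text \<open>Adding one chart disc \<open>B\<close> to an open set \<open>V\<close>: modulo the image of \<open>V\<close>, the first homology of the union
  embeds in the zeroth homology of \<open>B \<inter> V\<close>, so passing to slightly larger sets leaves finite rank. There are
  three nested sizes because each of the two estimates passes to a larger set.\<close>

lemma finite_rank_H1_step:
  assumes op: "openin X B1" "openin X V1" "openin X B2" "openin X V2" "openin X V3" "openin X B3"
    and sub: "B1 \<subseteq> B2" "V1 \<subseteq> V2" "V2 \<subseteq> V3" "B2 \<subseteq> B3"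
    and triv: "trivial_group (homology_group 1 (subtopology X B2))"
    and fin0: "erank (homology_group 0 (subtopology X (B2 \<inter> V2))) (img 0 (B1 \<inter> V1) (B2 \<inter> V2)) \<noteq> \<infinity>"
    and fin1: "erank (homology_group 1 (subtopology X V3)) (img 1 V2 V3) \<noteq> \<infinity>"
  shows "erank (homology_group 1 (subtopology X (B3 \<union> V3))) (img 1 (B1 \<union> V1) (B3 \<union> V3)) \<noteq> \<infinity>"
proof -
  let ?W1 = "B1 \<union> V1" and ?W2 = "B2 \<union> V2" and ?W3 = "B3 \<union> V3"
  let ?R = "\<lambda>W V. relative_homology_group 1 (subtopology X W) V"
  let ?j = "hom_induced 1 (subtopology X ?W2) {} (subtopology X ?W2) V2 id"
  let ?S = "img 1 ?W1 ?W2"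
  have "erank (homology_group 1 (subtopology X ?W3)) (inc 1 ?W2 ?W3 ` ?S) \<le>
     erank (homology_group 1 (subtopology X ?W3)) (inc 1 ?W2 ?W3 ` (?S \<inter> kernel (homology_group 1 (subtopology X ?W2)) (?R ?W2 V2) ?j)) +
     erank (?R ?W2 V2) (?j ` ?S)"
    by (intro erank_image_two_homs subgroup_img) (auto simp: hom_induced_hom)
  moreover have "img 1 ?W1 ?W3 = inc 1 ?W2 ?W3 ` ?S" using sub by (intro img_inc) auto
  moreover have "erank (homology_group 1 (subtopology X ?W3)) (inc 1 ?W2 ?W3 ` (?S \<inter> kernel (homology_group 1 (subtopology X ?W2)) (?R ?W2 V2) ?j)) \<noteq> \<infinity>"
  proof -
    have "subtopology (subtopology X ?W2) V2 = subtopology X V2" by (simp add: subtopology_subtopology inf.absorb2)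
    then have "kernel (homology_group 1 (subtopology X ?W2)) (?R ?W2 V2) ?j = img 1 V2 ?W2"
      using homology_exactness_axiom_3[of 1 "subtopology X ?W2" V2] by auto
    then have "inc 1 ?W2 ?W3 ` (?S \<inter> kernel (homology_group 1 (subtopology X ?W2)) (?R ?W2 V2) ?j) \<subseteq> inc 1 ?W2 ?W3 ` img 1 V2 ?W2"
      by blast
    also have "\<dots> = img 1 V2 ?W3" using sub by (intro img_inc[symmetric]) auto
    also have "\<dots> = inc 1 V3 ?W3 ` img 1 V2 V3" using sub by (intro img_inc) auto
    finally have "erank (homology_group 1 (subtopology X ?W3)) (inc 1 ?W2 ?W3 ` (?S \<inter> kernel (homology_group 1 (subtopology X ?W2)) (?R ?W2 V2) ?j))
       \<le> erank (homology_group 1 (subtopology X ?W3)) (inc 1 V3 ?W3 ` img 1 V2 V3)" by (rule erank_mono)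
    also have "\<dots> \<le> erank (homology_group 1 (subtopology X V3)) (img 1 V2 V3)"
      by (intro erank_image_le subgroup_img) (auto simp: hom_induced_hom)
    finally show ?thesis using fin1 by (auto simp: top_enat_def[symmetric] top_unique)
  qed
  moreover have "erank (?R ?W2 V2) (?j ` ?S) \<noteq> \<infinity>"
  proof -
    let ?k1 = "hom_induced 1 (subtopology X ?W1) {} (subtopology X ?W1) V1 id"
    let ?r12 = "hom_induced 1 (subtopology X ?W1) V1 (subtopology X ?W2) V2 id"
    let ?e1 = "hom_induced 1 (subtopology X B1) (B1 \<inter> V1) (subtopology X ?W1) V1 id"
    let ?e2 = "hom_induced 1 (subtopology X B2) (B2 \<inter> V2) (subtopology X ?W2) V2 id"
    let ?b12 = "hom_induced 1 (subtopology X B1) (B1 \<inter> V1) (subtopology X B2) (B2 \<inter> V2) id"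
    let ?P1 = "?R B1 (B1 \<inter> V1)" and ?P2 = "?R B2 (B2 \<inter> V2)"
    let ?d1 = "hom_boundary 1 (subtopology X B1) (B1 \<inter> V1)" and ?d2 = "hom_boundary 1 (subtopology X B2) (B2 \<inter> V2)"
    have "?j ` ?S \<subseteq> ?r12 ` carrier (?R ?W1 V1)"
    proof -
      have "?j (inc 1 ?W1 ?W2 z) = ?r12 (?k1 z)" for z
        using sub by (subst (1 2) hom_induced_incl_incl) auto
      then show ?thesis using hom_induced_carrier by blast
    qed
    also have "carrier (?R ?W1 V1) = ?e1 ` carrier ?P1"
      using excision_Un[OF op(1,2), of 1] by (auto simp: iso_def bij_betw_def)
    also have "?r12 ` ?e1 ` carrier ?P1 = ?e2 ` ?b12 ` carrier ?P1"
    proof -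
      have "?r12 (?e1 z) = ?e2 (?b12 z)" for z
        using sub by (subst (1 2) hom_induced_incl_incl) auto
      then show ?thesis by (simp add: image_image)
    qed
    finally have "erank (?R ?W2 V2) (?j ` ?S) \<le> erank (?R ?W2 V2) (?e2 ` ?b12 ` carrier ?P1)" by (rule erank_mono)
    also have "\<dots> \<le> erank ?P2 (?b12 ` carrier ?P1)"
      by (intro erank_image_le group_hom.img_is_subgroup) (auto simp: hom_induced_hom group_hom_def group_hom_axioms_def)
    also have "\<dots> = erank (homology_group 0 (subtopology X (B2 \<inter> V2))) (?d2 ` ?b12 ` carrier ?P1)"
    proof (rule erank_image_inj[symmetric])
      have sub2: "subtopology (subtopology X B2) (B2 \<inter> V2) = subtopology X (B2 \<inter> V2)" by (simp add: subtopology_subtopology)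
      show "?d2 \<in> hom ?P2 (homology_group 0 (subtopology X (B2 \<inter> V2)))"
        using hom_boundary_hom[of 1 "subtopology X B2" "B2 \<inter> V2"] sub2 by simp
      show "subgroup (?b12 ` carrier ?P1) ?P2"
        by (intro group_hom.img_is_subgroup) (auto simp: hom_induced_hom group_hom_def group_hom_axioms_def)
      fix x assume "x \<in> ?b12 ` carrier ?P1" and dx: "?d2 x = \<one>\<^bsub>homology_group 0 (subtopology X (B2 \<inter> V2))\<^esub>"
      then have x: "x \<in> carrier ?P2" by (auto simp: hom_induced_carrier)
      have ex: "exact_seq ([homology_group 0 (subtopology X (B2 \<inter> V2)), ?P2, homology_group 1 (subtopology X B2)],
         [?d2, hom_induced 1 (subtopology X B2) {} (subtopology X B2) (B2 \<inter> V2) id])"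
        using homology_exactness_axiom_1[of 1 "subtopology X B2" "B2 \<inter> V2"] sub2 by simp
      have "x \<in> kernel ?P2 (homology_group 0 (subtopology X (B2 \<inter> V2))) ?d2" using x dx by (simp add: kernel_def)
      then have "x \<in> hom_induced 1 (subtopology X B2) {} (subtopology X B2) (B2 \<inter> V2) id ` carrier (homology_group 1 (subtopology X B2))"
        using ex by auto
      then show "x = \<one>\<^bsub>?P2\<^esub>" using triv hom_induced_one by (metis imageE singletonD trivial_group_def)
    qed auto
    also have "\<dots> \<le> erank (homology_group 0 (subtopology X (B2 \<inter> V2))) (img 0 (B1 \<inter> V1) (B2 \<inter> V2))"
    proof (rule erank_mono)
      have sub12: "subtopology (subtopology X B1) (B1 \<inter> V1) = subtopology X (B1 \<inter> V1)"
         "subtopology (subtopology X B2) (B2 \<inter> V2) = subtopology X (B2 \<inter> V2)" by (simp_all add: subtopology_subtopology)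
      have cm: "continuous_map (subtopology X B1) (subtopology X B2) id"
        using sub by (auto simp: continuous_map_in_subtopology continuous_map_from_subtopology)
      have "id \<in> B1 \<inter> V1 \<rightarrow> B2 \<inter> V2" using sub by auto
      from naturality_hom_induced[OF cm this, of 1]
      have nat: "?d2 (?b12 z) = inc 0 (B1 \<inter> V1) (B2 \<inter> V2) (?d1 z)" for z
        using sub12 by (simp add: fun_eq_iff)
      have "?d1 z \<in> carrier (homology_group 0 (subtopology X (B1 \<inter> V1)))" for z
        using hom_boundary_carrier[of 1 "subtopology X B1" "B1 \<inter> V1" z] sub12 by simp
      then show "?d2 ` ?b12 ` carrier ?P1 \<subseteq> img 0 (B1 \<inter> V1) (B2 \<inter> V2)"
        unfolding image_image nat by blast
    qed
    finally show ?thesis using fin0 by (auto simp: top_enat_def[symmetric] top_unique)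
  qed
  ultimately show ?thesis using enat_le_add_finite by metis
qed

text \<open>Induction on the number of discs, with an intermediate radius \<open>\<tau>\<close> for the middle size of the step.\<close>

lemma finite_rank_H1_discs:
  assumes "finite J" "\<And>U h c. (U, h, c) \<in> J \<Longrightarrow> chart X U h"
  defines "V \<equiv> \<lambda>J \<rho>. \<Union>(U, h, c)\<in>J. {y \<in> U. h y \<in> ball (c::complex) \<rho>}"
  shows "0 < \<rho> \<Longrightarrow> \<rho> < \<sigma> \<Longrightarrow> erank (homology_group 1 (subtopology X (V J \<sigma>))) (img 1 (V J \<rho>) (V J \<sigma>)) \<noteq> \<infinity>"
  using assms(1,2)
proof (induction J arbitrary: \<rho> \<sigma> rule: finite_induct)
  case empty
  have "V {} \<rho> = {}" "V {} \<sigma> = {}" by (auto simp: V_def)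
  moreover have "erank (homology_group 1 (subtopology X {})) (img 1 {} {}) \<le> erank (homology_group 1 (subtopology X {})) (carrier (homology_group 1 (subtopology X {})))"
    by (intro erank_mono img_subset)
  moreover have "erank (homology_group 1 (subtopology X {})) (carrier (homology_group 1 (subtopology X {}))) = 0"
    by (intro erank_trivial_group trivial_homology_group_empty) auto
  ultimately show ?case by (metis enat_0 infinity_ne_i0 le_zero_eq)
next
  case (insert x J)
  obtain U h c where x: "x = (U, h, c)" by (cases x)
  have U: "chart X U h" using insert.prems x by auto
  define B where "B \<rho> = {y \<in> U. h y \<in> ball c \<rho>}" for \<rho>
  have VB: "V (insert x J) \<rho> = B \<rho> \<union> V J \<rho>" for \<rho> by (auto simp: V_def B_def x)
  define \<tau> where "\<tau> = (\<rho> + \<sigma>) / 2"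
  have \<tau>: "\<rho> < \<tau>" "\<tau> < \<sigma>" using insert.prems by (auto simp: \<tau>_def)
  have opB: "openin X (B \<rho>)" for \<rho> unfolding B_def by (rule chart_preimage[OF U]) auto
  have opV: "openin X (V J \<rho>)" for \<rho>
  proof -
    have "openin X {y \<in> U'. h' y \<in> ball c' \<rho>}" if "(U', h', c') \<in> J" for U' h' c'
      using insert.prems(3) that chart_preimage(1)[of X U' h' "ball c' \<rho>"] by auto
    then show ?thesis unfolding V_def by (intro openin_Union) auto
  qed
  have Bmono: "B a \<subseteq> B b" "V J a \<subseteq> V J b" if "a \<le> b" for a b
  proof -
    show "B a \<subseteq> B b" using that by (auto simp: B_def)
    show "V J a \<subseteq> V J b"
    proof
      fix y assume "y \<in> V J a"
      then obtain U' h' c' where "(U', h', c') \<in> J" "y \<in> U'" "h' y \<in> ball c' a" by (auto simp: V_def)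
      then show "y \<in> V J b" unfolding V_def using that by (intro UN_I[of "(U', h', c')"]) auto
    qed
  qed
  show ?case unfolding VB
  proof (rule finite_rank_H1_step[where ?B2.0 = "B \<tau>" and ?V2.0 = "V J \<tau>"])
    have "subtopology X (B \<tau>) homeomorphic_space subtopology euclidean (ball c \<tau>)"
      using chart_homeomorphic_sub[OF U, of "B \<tau>"] chart_image_vimage[OF U, of "ball c \<tau>"]
      unfolding B_def by (auto intro: homeomorphic_map_imp_homeomorphic_space)
    then have "contractible_space (subtopology X (B \<tau>))"
      by (rule homeomorphic_space_contractibility[THEN iffD2]) (auto intro: convex_imp_contractible)
    then show "trivial_group (homology_group 1 (subtopology X (B \<tau>)))"
      using trivial_reduced_homology_group_contractible_space[of "subtopology X (B \<tau>)" 1] by (simp add: un_reduced_homology_group)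
    define K where "K = {y \<in> U. h y \<in> cball c \<rho>} \<inter> (\<Union>(U, h, c)\<in>J. {y \<in> U. h y \<in> cball c \<rho>})"
    have "compactin X {y \<in> U'. h' y \<in> cball c' \<rho>}" if "(U', h', c') \<in> insert x J" for U' h' c'
      using insert.prems(3) that chart_preimage(2)[of X U' h' "cball c' \<rho>"] by auto
    then have "compactin X K"
      unfolding K_def using x insert.hyps
      by (intro closed_Int_compactin compact_closed compactin_Union) auto
    then show "erank (homology_group 0 (subtopology X (B \<tau> \<inter> V J \<tau>))) (img 0 (B \<rho> \<inter> V J \<rho>) (B \<tau> \<inter> V J \<tau>)) \<noteq> \<infinity>"
    proof (rule finite_rank_H0_between)
      show "openin X (B \<tau> \<inter> V J \<tau>)" using opB opV by blast
      show "B \<rho> \<inter> V J \<rho> \<subseteq> K" "K \<subseteq> B \<tau> \<inter> V J \<tau>"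
      proof -
        show "B \<rho> \<inter> V J \<rho> \<subseteq> K"
        proof
          fix y assume "y \<in> B \<rho> \<inter> V J \<rho>"
          then obtain U' h' c' where y: "(U', h', c') \<in> J" "y \<in> U'" "h' y \<in> ball c' \<rho>" "y \<in> U" "h y \<in> ball c \<rho>"
            by (auto simp: V_def B_def)
          then have "y \<in> (\<Union>(U, h, c)\<in>J. {y \<in> U. h y \<in> cball c \<rho>})" by (intro UN_I[of "(U', h', c')"]) auto
          then show "y \<in> K" using y by (auto simp: K_def)
        qed
        show "K \<subseteq> B \<tau> \<inter> V J \<tau>"
        proof
          fix y assume "y \<in> K"
          then obtain U' h' c' where y: "(U', h', c') \<in> J" "y \<in> U'" "h' y \<in> cball c' \<rho>" "y \<in> U" "h y \<in> cball c \<rho>"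
            by (auto simp: K_def)
          then have "y \<in> V J \<tau>" unfolding V_def using \<tau> by (intro UN_I[of "(U', h', c')"]) auto
          then show "y \<in> B \<tau> \<inter> V J \<tau>" using y \<tau> by (auto simp: B_def)
        qed
      qed
    qed
    show "erank (homology_group 1 (subtopology X (V J \<sigma>))) (img 1 (V J \<tau>) (V J \<sigma>)) \<noteq> \<infinity>"
      using insert.prems \<tau> by (intro insert.IH) auto
  qed (use opB opV Bmono \<tau> in auto)
qed

text \<open>On a compact space the discs of radius one and those of radius two both cover everything, so the image
  whose rank is finite is the whole group.\<close>

lemma finite_rank_H1:
  assumes "compact_space X"
  shows "erank (homology_group 1 X) (carrier (homology_group 1 X)) \<noteq> \<infinity>"
proof -
  obtain U h where U: "\<And>x. x \<in> topspace X \<Longrightarrow> chart X (U x) (h x) \<and> x \<in> U x" using charts by metis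
  define B where "B x \<rho> = {y \<in> U x. h x y \<in> ball (h x x) \<rho>}" for x \<rho>
  have "\<exists>\<F>. finite \<F> \<and> \<F> \<subseteq> (\<lambda>x. B x 1) ` topspace X \<and> topspace X \<subseteq> \<Union>\<F>"
  proof (rule compactinD)
    show "compactin X (topspace X)" using assms by (simp add: compact_space_def)
    show "openin X S" if "S \<in> (\<lambda>x. B x 1) ` topspace X" for S
    proof -
      obtain x where "x \<in> topspace X" "S = B x 1" using \<open>S \<in> _\<close> by blast
      then show ?thesis using chart_preimage(1)[of X "U x" "h x" "ball (h x x) 1"] U by (auto simp: B_def)
    qed
    show "topspace X \<subseteq> \<Union>((\<lambda>x. B x 1) ` topspace X)" using U by (auto simp: B_def)
  qed
  then obtain T where T: "finite T" "T \<subseteq> topspace X" "topspace X \<subseteq> (\<Union>x\<in>T. B x 1)"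
    by (metis (no_types, lifting) finite_subset_image)
  define J where "J = (\<lambda>x. (U x, h x, h x x)) ` T"
  have V: "(\<Union>(U, h, c)\<in>J. {y \<in> U. h y \<in> ball c \<rho>}) = topspace X" if "\<rho> \<ge> 1" for \<rho>
  proof -
    have "(\<Union>(U, h, c)\<in>J. {y \<in> U. h y \<in> ball c \<rho>}) = (\<Union>x\<in>T. B x \<rho>)" by (auto simp: J_def B_def)
    moreover have "(\<Union>x\<in>T. B x \<rho>) = topspace X"
    proof
      have "B x \<rho> \<subseteq> topspace X" if "x \<in> T" for x
        using that T(2) U[of x] chart_bij(1)[of X "U x" "h x"] by (auto simp: B_def)
      then show "(\<Union>x\<in>T. B x \<rho>) \<subseteq> topspace X" by auto
      have "B x 1 \<subseteq> B x \<rho>" for x using that by (auto simp: B_def)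
      then show "topspace X \<subseteq> (\<Union>x\<in>T. B x \<rho>)" using T(3) by (meson UN_mono order_refl subset_trans)
    qed
    ultimately show ?thesis by simp
  qed
  have "erank (homology_group 1 (subtopology X (topspace X))) (img 1 (topspace X) (topspace X)) \<noteq> \<infinity>"
  proof -
    have fin: "finite J" using T by (simp add: J_def)
    have ch: "chart X U' h'" if "(U', h', c') \<in> J" for U' h' c' using that T(2) U by (auto simp: J_def)
    have 1: "(\<Union>(U, h, c)\<in>J. {y \<in> U. h y \<in> ball c 1}) = topspace X" by (rule V) simp
    have 2: "(\<Union>(U, h, c)\<in>J. {y \<in> U. h y \<in> ball c 2}) = topspace X" by (rule V) simp
    show ?thesis using finite_rank_H1_discs[OF fin ch, where \<rho> = 1 and \<sigma> = 2] unfolding 1 2 by simp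
  qed
  moreover have "img 1 (topspace X) (topspace X) = carrier (homology_group 1 X)"
    by (simp add: hom_induced_id image_def)
  ultimately show ?thesis by simp
qed

end

section \<open>Complementary components and the inequality of Euler\<close>

context charted
begin

definition comps :: "'s set \<Rightarrow> 's set set" where
  "comps D = connected_components_of (subtopology X (topspace X - D))"

lemma locally_path_connected: "locally_path_connected_space X"
  unfolding locally_path_connected_space
proof (intro allI impI)
  fix W x assume "openin X W \<and> x \<in> W"
  then obtain U h where "chart X U h" "x \<in> U" "U \<subseteq> W" using chart_at[of W x] by metis
  then show "\<exists>U. openin X U \<and> path_connectedin X U \<and> x \<in> U \<and> U \<subseteq> W"
    using chart_bij(4)[of X U h] chart_path_connected[of U h] by (intro exI[of _ U]) simp
qed

lemma locally_path_connected_minus: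
  "closedin X D \<Longrightarrow> locally_path_connected_space (subtopology X (topspace X - D))"
  by (intro locally_path_connected_space_open_subset locally_path_connected closed_Diff_open)

lemma comps_connected:
  assumes "\<phi> \<in> comps D"
  shows "connectedin X \<phi>" "\<phi> \<subseteq> topspace X - D" "\<phi> \<noteq> {}"
  using assms connectedin_connected_components_of[of \<phi> "subtopology X (topspace X - D)"]
    nonempty_connected_components_of[of \<phi> "subtopology X (topspace X - D)"]
  by (auto simp: comps_def connectedin_subtopology)

lemma comps_open: "closedin X D \<Longrightarrow> \<phi> \<in> comps D \<Longrightarrow> openin X \<phi>"
  using locally_path_connected_minus[of D] closed_Diff_open[of D]
  by (metis comps_def openin_path_components_of_locally_path_connected_space openin_trans_full
      path_components_eq_connected_components_of)

lemma comps_Union: "\<Union>(comps D) = topspace X - D"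
  unfolding comps_def Union_connected_components_of by auto

lemma comps_disjoint: "\<phi> \<in> comps D \<Longrightarrow> \<psi> \<in> comps D \<Longrightarrow> \<phi> \<noteq> \<psi> \<Longrightarrow> \<phi> \<inter> \<psi> = {}"
  using pairwise_disjoint_connected_components_of[of "subtopology X (topspace X - D)"]
  by (auto simp: comps_def pairwise_def disjnt_def)

lemma comps_maximal:
  assumes "\<phi> \<in> comps D" "connectedin X T" "T \<subseteq> topspace X - D" "T \<inter> \<phi> \<noteq> {}"
  shows "T \<subseteq> \<phi>"
  using assms unfolding comps_def
  by (intro connected_components_of_maximal[of \<phi> "subtopology X (topspace X - D)"])
    (auto simp: connectedin_subtopology disjnt_def)

lemma comps_extend:
  assumes "connectedin X T" "T \<subseteq> topspace X - D" "T \<noteq> {}"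
  obtains \<phi> where "\<phi> \<in> comps D" "T \<subseteq> \<phi>"
proof -
  obtain x where "x \<in> T" using assms by auto
  then obtain \<phi> where "\<phi> \<in> comps D" "x \<in> \<phi>" using comps_Union[of D] assms by blast
  then show ?thesis using that comps_maximal[OF _ assms(1,2)] \<open>x \<in> T\<close> by blast
qed

text \<open>Components are path components because the space is locally a plane, and these freely generate the zeroth
  homology group.\<close>

lemma comps_rank:
  assumes "closedin X D"
  defines "Y \<equiv> subtopology X (topspace X - D)"
  shows "finite (comps D) \<Longrightarrow> erank (homology_group 0 Y) (carrier (homology_group 0 Y)) = enat (card (comps D))"
    "erank (homology_group 0 Y) (carrier (homology_group 0 Y)) \<noteq> \<infinity> \<Longrightarrow> finite (comps D)"
proof -
  have "path_components_of Y = comps D"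
    using locally_path_connected_minus[OF assms(1)] by (simp add: Y_def comps_def path_components_eq_connected_components_of)
  then have eq: "erank (homology_group 0 Y) (carrier (homology_group 0 Y)) =
      erank (free_Abelian_group (comps D)) (carrier (free_Abelian_group (comps D)))"
    using zeroth_homology_group[of Y] by (intro erank_iso abelian_free_Abelian_group) auto
  show "erank (homology_group 0 Y) (carrier (homology_group 0 Y)) = enat (card (comps D))" if "finite (comps D)"
    unfolding eq by (rule erank_free_Abelian_group[OF that])
  show "finite (comps D)" if "erank (homology_group 0 Y) (carrier (homology_group 0 Y)) \<noteq> \<infinity>"
  proof (rule ccontr)
    assume inf: "infinite (comps D)"
    obtain n where n: "erank (homology_group 0 Y) (carrier (homology_group 0 Y)) = enat n" using \<open>_ \<noteq> \<infinity>\<close> by auto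
    obtain T where "finite T" "T \<subseteq> comps D" "card T = Suc n" using infinite_arbitrarily_large[OF inf] by blast
    then show False using erank_free_Abelian_group_ge[of T "comps D"] n eq by simp
  qed
qed

text \<open>The relative group that compares the two complements has rank one in degree one and vanishes in degree zero, so
  the number of components grows by at most one.\<close>

lemma comps_add_short_arc:
  assumes D: "closedin X D" and arc: "short_arc \<alpha>" and ab: "a \<noteq> b" "D \<inter> \<alpha> = {a, b}"
    and fin: "finite (comps (D \<union> \<alpha>))"
  shows "finite (comps D)" "card (comps (D \<union> \<alpha>)) \<le> card (comps D) + 1"
proof -
  let ?S = "topspace X - D" and ?T = "topspace X - (D \<union> \<alpha>)"
  let ?M = "subtopology X ?S"
  have bX: "b \<in> topspace X" using ab closedin_subset[OF D] by auto
  have cl: "closedin X (D \<union> \<alpha>)" using closedin_Un D(1) compact_closed short_arc_compact assms by blast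
  have sub: "subtopology ?M ?T = subtopology X ?T"
    by (simp add: subtopology_subtopology inf.absorb2 Diff_mono)
  note iso = remove_open_arc_iso[OF D arc ab]
  have triv0: "trivial_group (relative_homology_group 0 ?M ?T)"
    using isomorphic_group_triviality[OF iso[of 0]] local_homology_trivial[OF bX, of 1] by simp
  have rk1: "erank (relative_homology_group 1 ?M ?T) (carrier (relative_homology_group 1 ?M ?T)) = 1"
    using erank_iso[OF _ _ iso[of 1]] local_homology_rank[OF bX] by simp
  let ?h0 = "\<lambda>S. homology_group 0 (subtopology X S)"
  let ?i = "hom_induced 0 (subtopology X ?T) {} ?M {} id"
  have e2: "erank (?h0 ?T) (carrier (?h0 ?T)) = erank (?h0 ?T) (hom_boundary 1 ?M ?T ` carrier (relative_homology_group 1 ?M ?T)) + erank (?h0 ?S) (?i ` carrier (?h0 ?T))"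
    using homology_exactness_axiom_2[of 1 ?M ?T] unfolding sub by (intro erank_exact) auto
  have e3: "erank (?h0 ?S) (carrier (?h0 ?S)) = erank (?h0 ?S) (?i ` carrier (?h0 ?T)) +
     erank (relative_homology_group 0 ?M ?T) (hom_induced 0 ?M {} ?M ?T id ` carrier (?h0 ?S))"
    using homology_exactness_axiom_3[of 0 ?M ?T] unfolding sub by (intro erank_exact) auto
  have "erank (relative_homology_group 0 ?M ?T) (hom_induced 0 ?M {} ?M ?T id ` carrier (?h0 ?S)) \<le>
      erank (relative_homology_group 0 ?M ?T) (carrier (relative_homology_group 0 ?M ?T))"
    by (intro erank_mono) (auto simp: hom_induced_carrier)
  then have z: "erank (relative_homology_group 0 ?M ?T) (hom_induced 0 ?M {} ?M ?T id ` carrier (?h0 ?S)) = 0"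
    using erank_trivial_group[OF _ triv0] by simp
  have "erank (?h0 ?T) (hom_boundary 1 ?M ?T ` carrier (relative_homology_group 1 ?M ?T)) \<le> 1"
    unfolding rk1[symmetric] using hom_boundary_hom[of 1 ?M ?T] unfolding sub
    by (intro erank_image_le) (auto simp: group.subgroup_self)
  then have le: "erank (?h0 ?T) (carrier (?h0 ?T)) \<le> 1 + erank (?h0 ?S) (carrier (?h0 ?S))"
    unfolding e2 e3 z by (simp add: add_mono)
  have "erank (?h0 ?S) (carrier (?h0 ?S)) \<le> erank (?h0 ?T) (carrier (?h0 ?T))" unfolding e2 e3 z by simp
  then have "erank (?h0 ?S) (carrier (?h0 ?S)) \<noteq> \<infinity>" using comps_rank(1)[OF cl fin] by (metis enat_ord_simps(5) infinity_ileE)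
  then show finD: "finite (comps D)" by (rule comps_rank(2)[OF D])
  show "card (comps (D \<union> \<alpha>)) \<le> card (comps D) + 1"
    using le unfolding comps_rank(1)[OF cl fin] comps_rank(1)[OF D finD] by (simp add: one_enat_def)
qed

text \<open>Only the component that contains the open arc can be split by it, and the number of components grows by at
  most one, so at most two components are found along the arc.\<close>

lemma short_arc_two_sides:
  assumes D: "closedin X D" and arc: "short_arc \<alpha>" and ab: "a \<noteq> b" "D \<inter> \<alpha> = {a, b}"
    and conn: "connectedin X (\<alpha> - {a, b})" and fin: "finite (comps (D \<union> \<alpha>))"
    and \<Phi>: "\<Phi> \<subseteq> comps (D \<union> \<alpha>)" "\<And>\<phi>. \<phi> \<in> \<Phi> \<Longrightarrow> X closure_of \<phi> \<inter> (\<alpha> - {a, b}) \<noteq> {}"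
  shows "card \<Phi> \<le> 2"
proof (cases "\<alpha> - {a, b} = {}")
  case True
  then have "\<Phi> = {}" using \<Phi> by blast
  then show ?thesis by simp
next
  case False
  have "\<alpha> \<subseteq> topspace X" using short_arc_compact[OF arc] compactin_subset_topspace by blast
  then have "\<alpha> - {a, b} \<subseteq> topspace X - D" using ab by auto
  then obtain C where C: "C \<in> comps D" "\<alpha> - {a, b} \<subseteq> C" using comps_extend[OF conn _ False] by blast
  note finD = comps_add_short_arc[OF D arc ab fin]
  have opC: "openin X C" by (rule comps_open[OF D C(1)])
  have inC: "\<phi> \<subseteq> C" if in\<Phi>: "\<phi> \<in> \<Phi>" for \<phi>
  proof -
    have \<phi>: "\<phi> \<in> comps (D \<union> \<alpha>)" using in\<Phi> \<Phi> by auto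
    obtain p where p: "p \<in> X closure_of \<phi>" "p \<in> \<alpha> - {a, b}" using \<Phi>(2)[OF in\<Phi>] by blast
    then have "C \<inter> \<phi> \<noteq> {}" using C(2) opC by (auto simp: in_closure_of)
    then show ?thesis using comps_connected[OF \<phi>] by (intro comps_maximal[OF C(1)]) auto
  qed
  have others: "comps D - {C} \<subseteq> comps (D \<union> \<alpha>)"
  proof
    fix \<psi> assume \<psi>: "\<psi> \<in> comps D - {C}"
    then have "\<psi> \<inter> C = {}" using comps_disjoint[of \<psi> D C] C by auto
    then have "\<psi> \<subseteq> topspace X - (D \<union> \<alpha>)" using comps_connected[of \<psi> D] \<psi> C(2) ab by blast
    then obtain \<omega> where \<omega>: "\<omega> \<in> comps (D \<union> \<alpha>)" "\<psi> \<subseteq> \<omega>"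
      using comps_extend[of \<psi> "D \<union> \<alpha>"] comps_connected[of \<psi> D] \<psi> by (metis DiffD1)
    have "\<omega> \<subseteq> \<psi>"
    proof (rule comps_maximal)
      show "\<psi> \<in> comps D" using \<psi> by simp
      show "connectedin X \<omega>" "\<omega> \<subseteq> topspace X - D" using comps_connected[OF \<omega>(1)] by auto
      show "\<omega> \<inter> \<psi> \<noteq> {}" using \<omega>(2) comps_connected(3)[of \<psi> D] \<psi> by auto
    qed
    then show "\<psi> \<in> comps (D \<union> \<alpha>)" using \<omega> by auto
  qed
  have "\<phi> \<notin> comps D - {C}" if "\<phi> \<in> \<Phi>" for \<phi>
    using inC[OF that] comps_disjoint[of \<phi> D C] C(1) comps_connected(3)[of \<phi> D] by blast
  then have disj: "(comps D - {C}) \<inter> \<Phi> = {}" by auto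
  have "card (comps D - {C}) + card \<Phi> = card ((comps D - {C}) \<union> \<Phi>)"
    using finD(1) fin \<Phi>(1) disj by (intro card_Un_disjoint[symmetric]) (auto intro: finite_subset)
  also have "\<dots> \<le> card (comps (D \<union> \<alpha>))" using others \<Phi>(1) fin by (intro card_mono) auto
  also have "\<dots> \<le> card (comps D) + 1" by (rule finD(2))
  finally have "card (comps D - {C}) + card \<Phi> \<le> card (comps D) + 1" .
  moreover have "card (comps D) = Suc (card (comps D - {C}))" using C(1) finD(1) by (rule card.remove[rotated])
  ultimately show ?thesis by simp
qed

end

locale closed_surface = charted +
  assumes compact: "compact_space X" and connected: "connected_space X" and nonempty: "topspace X \<noteq> {}"
begin

lemma detects_topspace: "detects (topspace X)"
  using detects_compact compact by (simp add: compact_space_def)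

text \<open>A class of degree two that vanishes relative to \<open>X - D\<close> vanishes at a point, hence everywhere because the surface
  is connected.\<close>

lemma H2_injective:
  assumes "p \<in> topspace X" "p \<in> D" "D \<subseteq> topspace X"
  shows "erank (homology_group 2 X) (carrier (homology_group 2 X)) \<le> r 2 D"
proof -
  let ?j = "hom_induced 2 X {} X (topspace X - D) id"
  have "erank (H 2 D) (?j ` carrier (homology_group 2 X)) = erank (homology_group 2 X) (carrier (homology_group 2 X))"
  proof (rule erank_image_inj)
    show "?j \<in> hom (homology_group 2 X) (H 2 D)" by (rule hom_induced_hom)
    show "subgroup (carrier (homology_group 2 X)) (homology_group 2 X)" by (simp add: group.subgroup_self)
    fix z assume z: "z \<in> carrier (homology_group 2 X)" and jz: "?j z = \<one>\<^bsub>H 2 D\<^esub>"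
    have "hom_induced 2 X {} X (topspace X - {p}) id z = hom_induced 2 X (topspace X - D) X (topspace X - {p}) id (?j z)"
      using assms by (intro hom_induced_incl_abs(3)[symmetric]) auto
    also have "\<dots> = \<one>\<^bsub>H 2 {p}\<^esub>" unfolding jz by (rule hom_induced_one)
    finally have "res 2 (topspace X) {p} z = \<one>\<^bsub>H 2 {p}\<^esub>" by simp
    then have "z = \<one>\<^bsub>H 2 (topspace X)\<^esub>"
      using z connected assms(1) by (intro detect_at_one_point[OF detects_topspace]) (auto simp: connectedin_topspace)
    then show "z = \<one>\<^bsub>homology_group 2 X\<^esub>" by simp
  qed simp_all
  then show ?thesis using erank_mono[of "?j ` carrier (homology_group 2 X)" "carrier (H 2 D)" "H 2 D"]
    by (metis hom_induced_carrier image_subsetI)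
qed

lemma path_connected: "path_connected_space X"
  using connected locally_path_connected path_connected_eq_connected_space by blast

lemma rank_H0: "erank (homology_group 0 X) (carrier (homology_group 0 X)) = 1"
  using erank_iso[OF _ _ isomorphic_integer_zeroth_homology_group[OF path_connected nonempty]]
    erank_integer_group abelian_integer_group by simp

text \<open>Detection at points, applied to the whole surface, bounds the second Betti number by the local homology and makes
  the higher ones vanish; \<open>finite_rank_H1\<close> takes care of the first.\<close>

lemma euler_genus_betti:
  "euler_genus X = 1 + int (betti_number 1 X) - int (betti_number 2 X)"
    and rank_H1: "erank (homology_group 1 X) (carrier (homology_group 1 X)) = enat (betti_number 1 X)"
    and rank_H2: "erank (homology_group 2 X) (carrier (homology_group 2 X)) = enat (betti_number 2 X)"
proof -
  show b1: "erank (homology_group 1 X) (carrier (homology_group 1 X)) = enat (betti_number 1 X)"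
  proof -
    obtain n where "erank (homology_group 1 X) (carrier (homology_group 1 X)) = enat n" using finite_rank_H1[OF compact] by auto
    then show ?thesis using group_rank_eq_erank by (fastforce simp: betti_number_def)
  qed
  obtain p where p: "p \<in> topspace X" using nonempty by blast
  have "erank (homology_group 2 X) (carrier (homology_group 2 X)) \<le> 1"
    using H2_injective[OF p, of "{p}"] local_homology_rank[OF p] p by simp
  then obtain n where n: "erank (homology_group 2 X) (carrier (homology_group 2 X)) = enat n"
    by (cases "erank (homology_group 2 X) (carrier (homology_group 2 X))") (auto simp: one_enat_def)
  then show "erank (homology_group 2 X) (carrier (homology_group 2 X)) = enat (betti_number 2 X)"
    using group_rank_eq_erank by (fastforce simp: betti_number_def)
  have b0: "betti_number 0 X = 1"
    using group_rank_eq_erank[of "homology_group 0 X" 1] rank_H0 by (simp add: betti_number_def one_enat_def)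
  have bq: "betti_number q X = 0" if "q \<ge> 3" for q
  proof -
    have "trivial_group (H (int q) (topspace X))" using detects_topspace that by (auto simp: detects_def)
    then have "erank (homology_group (int q) X) (carrier (homology_group (int q) X)) = enat 0"
      by (simp add: erank_trivial_group zero_enat_def)
    then show ?thesis using group_rank_eq_erank by (fastforce simp: betti_number_def)
  qed
  have "euler_characteristic X = (\<Sum>p\<in>{0,1,2}. (- 1) ^ p * int (betti_number p X))"
    unfolding euler_characteristic_def
  proof (rule sum.mono_neutral_left)
    show "{p. betti_number p X \<noteq> 0} \<subseteq> {0, 1, 2}"
    proof
      fix q assume "q \<in> {p. betti_number p X \<noteq> 0}"
      then have "\<not> q \<ge> 3" using bq by auto
      then show "q \<in> {0, 1, 2}" by auto
    qed
  qed auto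
  then show "euler_genus X = 1 + int (betti_number 1 X) - int (betti_number 2 X)"
    using b0 by (simp add: euler_genus_def)
qed

text \<open>Euler's inequality, from the exact sequence of the pair. The number of components is one more than the
  rank of the boundary map from \<open>H_1(X, X - D)\<close>, whose kernel has at most the rank of \<open>H_1(X)\<close>; and \<open>H_1(X, X - D)\<close> has
  rank at least \<open>k\<close> plus that of \<open>H_2(X, X - D)\<close>, which is at least the second Betti number. Equality may fail
  because the components need not be discs.\<close>

lemma comps_card_ge:
  assumes ex: "excess D k" and ne: "D \<noteq> {}" "topspace X - D \<noteq> {}"
  shows "finite (comps D)" "int (card (comps D)) \<ge> 2 + k - euler_genus X"
proof -
  have D: "closedin X D" "r 1 D \<noteq> \<infinity>" "r 2 D \<noteq> \<infinity>" "int (the_enat (r 2 D)) + k \<le> int (the_enat (r 1 D))"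
    using ex by (auto simp: excess_def)
  obtain n1 n2 where n: "r 1 D = enat n1" "r 2 D = enat n2" using D by auto
  let ?T = "topspace X - D"
  let ?Y = "subtopology X ?T"
  have e1: "r 1 D = erank (H 1 D) (hom_induced 1 X {} X ?T id ` carrier (homology_group 1 X)) + erank (homology_group 0 ?Y) (hom_boundary 1 X ?T ` carrier (H 1 D))"
    using homology_exactness_axiom_1[of 1 X ?T] by (intro erank_exact) auto
  have e2: "erank (homology_group 0 ?Y) (carrier (homology_group 0 ?Y)) =
     erank (homology_group 0 ?Y) (hom_boundary 1 X ?T ` carrier (H 1 D)) + erank (homology_group 0 X) (hom_induced 0 ?Y {} X {} id ` carrier (homology_group 0 ?Y))"
    using homology_exactness_axiom_2[of 1 X ?T] by (intro erank_exact) auto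
  have le1: "erank (H 1 D) (hom_induced 1 X {} X ?T id ` carrier (homology_group 1 X)) \<le> enat (betti_number 1 X)"
    unfolding rank_H1[symmetric] by (intro erank_image_le) (auto simp: hom_induced_hom group.subgroup_self)
  have ge1: "erank (homology_group 0 X) (hom_induced 0 ?Y {} X {} id ` carrier (homology_group 0 ?Y)) \<ge> 1"
  proof -
    obtain y where y: "y \<in> ?T" using ne by auto
    let ?P = "subtopology X {y}"
    have "{y} retract_of_space X"
      using y by (auto simp: retract_of_space_def intro!: exI[of _ "\<lambda>x. y"])
    then have inj: "inj_on (hom_induced 0 ?P {} X {} id) (carrier (homology_group 0 ?P))"
      by (intro inj_on_hom_induced_inclusion) auto
    have "erank (homology_group 0 X) (hom_induced 0 ?P {} X {} id ` carrier (homology_group 0 ?P)) = erank (homology_group 0 ?P) (carrier (homology_group 0 ?P))"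
    proof (rule erank_image_inj)
      fix z assume z: "z \<in> carrier (homology_group 0 ?P)" "hom_induced 0 ?P {} X {} id z = \<one>\<^bsub>homology_group 0 X\<^esub>"
      moreover have "hom_induced 0 ?P {} X {} id \<one>\<^bsub>homology_group 0 ?P\<^esub> = \<one>\<^bsub>homology_group 0 X\<^esub>" by (rule hom_induced_one)
      moreover have "\<one>\<^bsub>homology_group 0 ?P\<^esub> \<in> carrier (homology_group 0 ?P)" by (simp add: group.is_monoid monoid.one_closed)
      ultimately show "z = \<one>\<^bsub>homology_group 0 ?P\<^esub>" using inj_onD[OF inj] by metis
    qed (auto simp: hom_induced_hom group.subgroup_self)
    also have "\<dots> = 1"
      using erank_iso[OF _ _ homology_coefficients[of ?P y]] y erank_integer_group abelian_integer_group by simp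
    finally have eq: "erank (homology_group 0 X) (hom_induced 0 ?P {} X {} id ` carrier (homology_group 0 ?P)) = 1" .
    have "hom_induced 0 ?P {} X {} id z = hom_induced 0 ?Y {} X {} id (hom_induced 0 ?P {} ?Y {} id z)" for z
      using y by (intro hom_induced_incl_sub[symmetric]) auto
    then have "hom_induced 0 ?P {} X {} id ` carrier (homology_group 0 ?P) \<subseteq> hom_induced 0 ?Y {} X {} id ` carrier (homology_group 0 ?Y)"
      using hom_induced_carrier by (auto intro!: imageI)
    then show ?thesis unfolding eq[symmetric] by (rule erank_mono)
  qed
  have le0: "erank (homology_group 0 X) (hom_induced 0 ?Y {} X {} id ` carrier (homology_group 0 ?Y)) \<le> 1"
    unfolding rank_H0[symmetric] by (intro erank_mono) (auto simp: hom_induced_carrier)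
  obtain i x where ix: "erank (H 1 D) (hom_induced 1 X {} X ?T id ` carrier (homology_group 1 X)) = enat i"
     "erank (homology_group 0 ?Y) (hom_boundary 1 X ?T ` carrier (H 1 D)) = enat x" "n1 = i + x"
    using e1 n(1) by (cases "erank (H 1 D) (hom_induced 1 X {} X ?T id ` carrier (homology_group 1 X))";
       cases "erank (homology_group 0 ?Y) (hom_boundary 1 X ?T ` carrier (H 1 D))") auto
  have im: "erank (homology_group 0 X) (hom_induced 0 ?Y {} X {} id ` carrier (homology_group 0 ?Y)) = enat 1"
    using ge1 le0 by (simp add: one_enat_def)
  have N: "erank (homology_group 0 ?Y) (carrier (homology_group 0 ?Y)) = enat (x + 1)"
    using e2 ix(2) im by simp
  then show fin: "finite (comps D)" by (intro comps_rank(2)[OF D(1)]) simp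
  have card: "card (comps D) = x + 1" using comps_rank(1)[OF D(1) fin] N by simp
  obtain p where p: "p \<in> D" "p \<in> topspace X" using ne closedin_subset[OF D(1)] by auto
  have "betti_number 2 X \<le> n2"
    using H2_injective[OF p(2,1) closedin_subset[OF D(1)]] n rank_H2 by simp
  moreover have "i \<le> betti_number 1 X" using le1 ix by simp
  ultimately show "int (card (comps D)) \<ge> 2 + k - euler_genus X"
    unfolding euler_genus_betti card using ix(3) D(4) n by simp
qed

end

section \<open>Faces and edges of a drawing\<close>

lemma chart_punctured_connected:
  assumes "chart X U h" "p \<in> U"
  shows "connectedin X (U - {p})"
proof -
  have "h ` (U - {p}) = - {h p}" using chart_image_Diff[OF assms(1), of "{p}"] assms(2) by auto
  moreover have "connected (- {h p})" by (simp add: connected_punctured_universe)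
  ultimately show ?thesis using chart_connected_iff[OF assms(1), of "U - {p}"] by auto
qed

lemma pathin_reverse_segment:
  assumes "pathin X g" "0 < t" "t \<le> 1"
  shows "pathin X (\<lambda>s. g (t * (1 - s)))" "(\<lambda>s. g (t * (1 - s))) ` {0..1} = g ` {0..t}"
proof -
  have im: "(\<lambda>s. t * (1 - s)) ` {0..1} = {0..t}"
  proof
    show "{0..t} \<subseteq> (\<lambda>s. t * (1 - s)) ` {0..1}"
    proof
      fix x assume "x \<in> {0..t}"
      then show "x \<in> (\<lambda>s. t * (1 - s)) ` {0..1}"
        using assms(2) by (intro image_eqI[of _ _ "1 - x / t"]) (auto simp: field_simps)
    qed
    show "(\<lambda>s. t * (1 - s)) ` {0..1} \<subseteq> {0..t}" using assms(2) by (auto simp: mult_le_cancel_left1)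
  qed
  then show "(\<lambda>s. g (t * (1 - s))) ` {0..1} = g ` {0..t}" by (metis (no_types, lifting) image_image image_cong)
  have "continuous_map (subtopology euclideanreal {0..1}) (subtopology euclideanreal {0..1}) (\<lambda>s. t * (1 - s))"
    using assms(2,3) by (auto intro!: continuous_intros mult_le_one)
  then have "continuous_map (subtopology euclideanreal {0..1}) X (g \<circ> (\<lambda>s. t * (1 - s)))"
    using assms(1) unfolding pathin_def by (rule continuous_map_compose)
  then show "pathin X (\<lambda>s. g (t * (1 - s)))" by (simp add: pathin_def o_def)
qed

lemma pathin_compact_image:
  assumes "pathin X g" "0 \<le> s" "t \<le> 1"
  shows "compactin X (g ` {s..t})"
proof -
  have "compactin (subtopology euclideanreal {0..1}) {s..t}" using assms by (simp add: compactin_subtopology)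
  then show ?thesis using assms(1) unfolding pathin_def by (rule image_compactin)
qed

lemma pathin_connected_image:
  assumes "pathin X g" "C \<subseteq> {0..1}" "connected C"
  shows "connectedin X (g ` C)"
proof -
  have "connectedin (subtopology euclideanreal {0..1}) C" using assms by (simp add: connectedin_subtopology)
  then show ?thesis using assms(1) unfolding pathin_def by (rule connectedin_continuous_map_image[rotated])
qed

context charted
begin

text \<open>An arc does not separate the space locally at its end point, even though it may return close to
  that end point infinitely often: this is Janiszewski's theorem applied to a short initial piece of the arc
  and to the rest of the arc together with the outside of a chart.\<close>

lemma arc_end_nonseparating:
  assumes g: "pathin X g" "inj_on g {0..1}" and W: "openin X W" "g 0 \<in> W"
  obtains B where "openin X B" "g 0 \<in> B" "B \<subseteq> W"
    "\<And>x y. x \<in> B - g ` {0..1} \<Longrightarrow> y \<in> B - g ` {0..1} \<Longrightarrow> \<exists>T. connectedin X T \<and> T \<subseteq> W - g ` {0..1} \<and> x \<in> T \<and> y \<in> T"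
proof -
  obtain U h where U: "chart X U h" "g 0 \<in> U" "U \<subseteq> W" using chart_at[OF W] .
  obtain d where d: "d > 0" "\<And>y. y \<in> {0..1} \<Longrightarrow> \<bar>y - 0\<bar> < d \<Longrightarrow> g y \<in> U"
    using pathin_chart_delta[OF g(1) _ chart_bij(4)[OF U(1)] U(2)] by (metis atLeastAtMost_iff order_refl zero_le_one)
  define s where "s = min (1/2) (d/2)"
  have s: "0 < s" "s < 1" "s < d" using d by (auto simp: s_def)
  have gU: "g ` {0..s} \<subseteq> U" using d(2) s by auto
  define \<beta> where "\<beta> = g ` {s..1}"
  have cl\<beta>: "closedin X \<beta>" unfolding \<beta>_def using pathin_compact_image[OF g(1)] s compact_closed by auto
  have inj: "g y = g z \<longleftrightarrow> y = z" if "y \<in> {0..1}" "z \<in> {0..1}" for y z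
    using g(2) that by (auto simp: inj_on_def)
  have g0: "g 0 \<notin> \<beta>"
  proof
    assume "g 0 \<in> \<beta>"
    then obtain z where "z \<in> {s..1}" "g 0 = g z" by (auto simp: \<beta>_def)
    then show False using inj[of 0 z] s by auto
  qed
  have split: "g ` {0..1} = g ` {0..s} \<union> \<beta>" unfolding \<beta>_def using s by (simp add: image_Un[symmetric] ivl_disj_un_two_touch(4))
  have meet: "g ` {0..s} \<inter> \<beta> = {g s}"
  proof
    show "g ` {0..s} \<inter> \<beta> \<subseteq> {g s}"
    proof
      fix x assume "x \<in> g ` {0..s} \<inter> \<beta>"
      then obtain y z where "y \<in> {0..s}" "z \<in> {s..1}" "x = g y" "x = g z" unfolding \<beta>_def by blast
      moreover from this have "y = z" using inj[of y z] s by auto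
      ultimately show "x \<in> {g s}" by auto
    qed
  qed (use s in \<open>auto simp: \<beta>_def\<close>)
  define S where "S = h ` g ` {0..s}"
  define T where "T = - (h ` (U - \<beta>))"
  have opU: "openin X (U - \<beta>)" using cl\<beta> chart_bij(4)[OF U(1)] by blast
  then have opT: "open (h ` (U - \<beta>))" using chart_open_iff[OF U(1), of "U - \<beta>"] by auto
  obtain e where e: "e > 0" "ball (h (g 0)) e \<subseteq> h ` (U - \<beta>)"
    using opT g0 U(2) open_contains_ball by blast
  define B where "B = {y \<in> U. h y \<in> ball (h (g 0)) e}"
  have "short_arc (g ` {0..s})" using short_arc_subpath[OF g _ _ _ U(1) gU] s by auto
  have arcS: "compact S" "connected (- S)"
  proof -
    show "compact S" unfolding S_def using chart_compact_iff[OF U(1) gU] pathin_compact_image[OF g(1), of 0 s] s by auto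
    have "S homeomorphic {0..s}"
    proof -
      have "continuous_map (subtopology euclideanreal {0..s}) X g"
        using g(1) s unfolding pathin_def by (rule_tac continuous_map_from_subtopology_mono) auto
      then have "continuous_map (subtopology euclideanreal {0..s}) (subtopology X U) g"
        using gU by (simp add: continuous_map_in_subtopology image_subset_iff)
      then have "continuous_map (subtopology euclideanreal {0..s}) euclidean (h \<circ> g)"
        using chart_continuous[OF U(1)] by (rule continuous_map_compose)
      moreover have "inj_on (h \<circ> g) {0..s}"
        using g(2) chart_bij(3)[OF U(1)] gU s by (intro comp_inj_on) (auto intro: inj_on_subset)
      ultimately have "{0..s} homeomorphic (h \<circ> g) ` {0..s}" by (intro homeomorphic_compact) auto
      then show ?thesis unfolding S_def image_comp by (rule homeomorphic_sym[THEN iffD1])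
    qed
    then show "connected (- S)" by (rule connected_complement_homeomorphic_convex_compact) auto
  qed
  have "S \<inter> T = {h (g s)}"
  proof -
    have "h ` (U - \<beta>) = UNIV - h ` (U \<inter> \<beta>)"
      using chart_image_Diff[OF U(1), of "U \<inter> \<beta>"] by (auto simp: Diff_Int)
    then have T: "T = h ` (U \<inter> \<beta>)" by (auto simp: T_def)
    have "S \<inter> T = h ` (g ` {0..s} \<inter> (U \<inter> \<beta>))"
      unfolding S_def T using chart_bij(3)[OF U(1)] gU by (intro inj_on_image_Int[symmetric]) auto
    also have "g ` {0..s} \<inter> (U \<inter> \<beta>) = {g s}" using meet gU by blast
    finally show ?thesis by simp
  qed
  then have conST: "connected (S \<inter> T)" by simp
  have key: "\<exists>C. connectedin X C \<and> C \<subseteq> W - g ` {0..1} \<and> x \<in> C \<and> y \<in> C"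
    if xy: "x \<in> B - g ` {0..1}" "y \<in> B - g ` {0..1}" for x y
  proof -
    have xyU: "x \<in> U" "y \<in> U" "h x \<in> ball (h (g 0)) e" "h y \<in> ball (h (g 0)) e" using xy by (auto simp: B_def)
    have "h x \<notin> S" "h y \<notin> S"
      unfolding S_def using xy split inj_on_image_mem_iff[OF chart_bij(3)[OF U(1)] xyU(1) gU]
        inj_on_image_mem_iff[OF chart_bij(3)[OF U(1)] xyU(2) gU] by auto
    then have ccS: "connected_component (- S) (h x) (h y)"
      using arcS(2) unfolding connected_component_def by blast
    have "connected (ball (h (g 0)) e)" by simp
    then have ccT: "connected_component (- T) (h x) (h y)"
      unfolding connected_component_def T_def using xyU e(2) by (intro exI[of _ "ball (h (g 0)) e"]) auto
    have "closed T" unfolding T_def using opT by auto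
    from Janiszewski[OF arcS(1) this conST ccS ccT]
    obtain C where C: "connected C" "C \<subseteq> - (S \<union> T)" "h x \<in> C" "h y \<in> C" unfolding connected_component_def by blast
    define C' where "C' = {z \<in> U. h z \<in> C}"
    have "connectedin X C'" unfolding C'_def by (rule chart_preimage(3)[OF U(1) C(1)])
    moreover have "C' \<subseteq> W - g ` {0..1}"
    proof
      fix z assume z: "z \<in> C'"
      then have zU: "z \<in> U" "h z \<notin> S" "h z \<notin> T" using C by (auto simp: C'_def)
      then obtain z' where "z' \<in> U - \<beta>" "h z = h z'" by (auto simp: T_def)
      then have "z \<notin> \<beta>" using zU chart_bij(3)[OF U(1)] by (auto simp: inj_on_def)
      moreover have "z \<notin> g ` {0..s}" using zU(2) by (auto simp: S_def)
      ultimately show "z \<in> W - g ` {0..1}" using split zU U(3) by auto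
    qed
    ultimately show ?thesis using xyU C by (intro exI[of _ C']) (auto simp: C'_def)
  qed
  show ?thesis
  proof (rule that[OF _ _ _ key])
    show "openin X B" unfolding B_def by (rule chart_preimage[OF U(1)]) auto
  qed (use U e in \<open>auto simp: B_def\<close>)
qed

end

locale drawn_graph = closed_surface X for X :: "'s topology" +
  fixes V :: "'v set" and A :: "('v \<times> 'v) set" and pos :: "'v \<Rightarrow> 's" and crv :: "'v \<times> 'v \<Rightarrow> real \<Rightarrow> 's"
  assumes finV: "finite V" and AV: "A \<subseteq> V \<times> V"
    and symA: "(u, v) \<in> A \<Longrightarrow> (v, u) \<in> A" and irrefl: "(u, u) \<notin> A"
    and posX: "pos ` V \<subseteq> topspace X" and inj_pos: "inj_on pos V"
    and path: "a \<in> A \<Longrightarrow> pathin X (crv a)" and inj_crv: "a \<in> A \<Longrightarrow> inj_on (crv a) {0..1}"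
    and crv0: "(u, v) \<in> A \<Longrightarrow> crv (u, v) 0 = pos u" and crv1: "(u, v) \<in> A \<Longrightarrow> crv (u, v) 1 = pos v"
    and crv_rev: "(u, v) \<in> A \<Longrightarrow> t \<in> {0..1} \<Longrightarrow> crv (v, u) t = crv (u, v) (1 - t)"
    and crv_pos: "a \<in> A \<Longrightarrow> crv a ` {0<..<1} \<inter> pos ` V = {}"
    and crv_disj: "(u, v) \<in> A \<Longrightarrow> (x, y) \<in> A \<Longrightarrow> {u, v} \<noteq> {x, y} \<Longrightarrow> crv (u, v) ` {0<..<1} \<inter> crv (x, y) ` {0<..<1} = {}"
begin

definition carc :: "'v \<times> 'v \<Rightarrow> 's set" where "carc a = crv a ` {0..1}"
definition oarc :: "'v \<times> 'v \<Rightarrow> 's set" where "oarc a = crv a ` {0<..<1}"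
definition D :: "'s set" where "D = pos ` V \<union> (\<Union>a\<in>A. carc a)"

lemma finA: "finite A"
  using finV AV finite_subset by blast

lemma AD: "(u, v) \<in> A \<Longrightarrow> u \<in> V" "(u, v) \<in> A \<Longrightarrow> v \<in> V"
  using AV by auto

lemma carc_eq:
  assumes "(u, v) \<in> A"
  shows "carc (u, v) = insert (pos u) (insert (pos v) (oarc (u, v)))"
proof -
  have "{0..1::real} = insert 0 (insert 1 {0<..<1})" by auto
  then show ?thesis using crv0[OF assms] crv1[OF assms] by (simp add: carc_def oarc_def)
qed

lemma oarc_sym:
  assumes "(u, v) \<in> A"
  shows "oarc (v, u) = oarc (u, v)"
proof -
  have sub: "oarc (y, x) \<subseteq> oarc (x, y)" if xy: "(x, y) \<in> A" for x y
  proof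
    fix p assume "p \<in> oarc (y, x)"
    then obtain t where t: "0 < t" "t < 1" "p = crv (y, x) t" by (auto simp: oarc_def)
    then have "p = crv (x, y) (1 - t)" using crv_rev[OF xy, of t] by simp
    then show "p \<in> oarc (x, y)" using t by (auto simp: oarc_def)
  qed
  show ?thesis using sub[OF assms] sub[OF symA[OF assms]] by auto
qed

lemma carc_sym: "(u, v) \<in> A \<Longrightarrow> carc (v, u) = carc (u, v)"
  using carc_eq oarc_sym symA by (simp add: insert_commute)

lemma D_eq: "D = pos ` V \<union> (\<Union>a\<in>A. oarc a)"
proof
  show "D \<subseteq> pos ` V \<union> (\<Union>a\<in>A. oarc a)"
    unfolding D_def using carc_eq AD by fastforce
  have "oarc a \<subseteq> carc a" for a by (auto simp: oarc_def carc_def)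
  then show "pos ` V \<union> (\<Union>a\<in>A. oarc a) \<subseteq> D" unfolding D_def by blast
qed

lemma oarc_D: "a \<in> A \<Longrightarrow> oarc a \<subseteq> D"
  unfolding D_eq by auto

lemma pos_D: "v \<in> V \<Longrightarrow> pos v \<in> D"
  unfolding D_eq by auto

lemma oarc_pos: "a \<in> A \<Longrightarrow> v \<in> V \<Longrightarrow> pos v \<notin> oarc a"
  using crv_pos unfolding oarc_def by blast

lemma oarc_disj: "(u, v) \<in> A \<Longrightarrow> (x, y) \<in> A \<Longrightarrow> {u, v} \<noteq> {x, y} \<Longrightarrow> oarc (u, v) \<inter> oarc (x, y) = {}"
  unfolding oarc_def by (rule crv_disj)

lemma carc_closed: "a \<in> A \<Longrightarrow> closedin X (carc a)"
  unfolding carc_def using path pathin_compact_image[of X "crv a" 0 1] compact_closed by auto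

lemma pos_closed: "S \<subseteq> V \<Longrightarrow> closedin X (pos ` S)"
proof -
  assume S: "S \<subseteq> V"
  have "closedin X (\<Union>v\<in>S. {pos v})"
    using S posX finite_subset[OF S finV] by (intro closedin_Union) (auto intro: closed_point)
  moreover have "(\<Union>v\<in>S. {pos v}) = pos ` S" by auto
  ultimately show ?thesis by simp
qed

lemma D_closed: "closedin X D"
  unfolding D_def using finA pos_closed[of V] carc_closed by (intro closedin_Un closedin_Union) auto

text \<open>What is removed is a finite union of closed sets, so this is an open set in which only the given edge is
  visible.\<close>

definition edge_nbhd :: "'v \<times> 'v \<Rightarrow> 's set" where
  "edge_nbhd a = topspace X - (pos ` V \<union> (\<Union>b\<in>A - {a, prod.swap a}. carc b))"

lemma edge_nbhd:
  assumes "(u, v) \<in> A"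
  shows "openin X (edge_nbhd (u, v))" "oarc (u, v) \<subseteq> edge_nbhd (u, v)" "edge_nbhd (u, v) \<inter> D \<subseteq> oarc (u, v)"
proof -
  show "openin X (edge_nbhd (u, v))"
    unfolding edge_nbhd_def using finA pos_closed[of V] carc_closed
    by (intro closed_Diff_open closedin_Un closedin_Union) auto
  show "oarc (u, v) \<subseteq> edge_nbhd (u, v)"
  proof
    fix p assume p: "p \<in> oarc (u, v)"
    have "p \<notin> pos ` V" using p oarc_pos[OF assms] by auto
    moreover have "p \<notin> carc (x, y)" if xy: "(x, y) \<in> A - {(u, v), prod.swap (u, v)}" for x y
    proof -
      have "{u, v} \<noteq> {x, y}" using xy by (auto simp: doubleton_eq_iff)
      then have "p \<notin> oarc (x, y)" using oarc_disj[OF assms, of x y] xy p by blast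
      then show ?thesis using carc_eq[of x y] xy AD[of x y] \<open>p \<notin> pos ` V\<close> by auto
    qed
    moreover have "p \<in> topspace X" using oarc_D[OF assms] p closedin_subset[OF D_closed] by auto
    ultimately show "p \<in> edge_nbhd (u, v)" by (auto simp: edge_nbhd_def)
  qed
  show "edge_nbhd (u, v) \<inter> D \<subseteq> oarc (u, v)"
    unfolding edge_nbhd_def D_def using carc_eq[OF assms] carc_sym[OF assms] AD[OF assms] by auto
qed

definition vertex_nbhd :: "'v \<Rightarrow> 's set" where
  "vertex_nbhd v = topspace X - (pos ` (V - {v}) \<union> (\<Union>b\<in>{b\<in>A. fst b \<noteq> v \<and> snd b \<noteq> v}. carc b))"

lemma vertex_nbhd:
  assumes "v \<in> V"
  shows "openin X (vertex_nbhd v)" "pos v \<in> vertex_nbhd v"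
    "vertex_nbhd v \<inter> D \<subseteq> insert (pos v) (\<Union>u\<in>{u. (v, u) \<in> A}. oarc (v, u))"
proof -
  show "openin X (vertex_nbhd v)"
    unfolding vertex_nbhd_def using finA pos_closed[of "V - {v}"] carc_closed
    by (intro closed_Diff_open closedin_Un closedin_Union) auto
  show "pos v \<in> vertex_nbhd v"
  proof -
    have "pos v \<notin> carc b" if "b \<in> A" "fst b \<noteq> v" "snd b \<noteq> v" for b
      using that carc_eq[of "fst b" "snd b"] oarc_pos[of b v] assms AD[of "fst b" "snd b"] inj_pos
      by (auto simp: inj_on_def)
    moreover have "pos v \<notin> pos ` (V - {v})" using inj_pos assms by (auto simp: inj_on_def)
    ultimately show ?thesis using posX assms by (auto simp: vertex_nbhd_def)
  qed
  show "vertex_nbhd v \<inter> D \<subseteq> insert (pos v) (\<Union>u\<in>{u. (v, u) \<in> A}. oarc (v, u))"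
  proof
    fix p assume p: "p \<in> vertex_nbhd v \<inter> D"
    show "p \<in> insert (pos v) (\<Union>u\<in>{u. (v, u) \<in> A}. oarc (v, u))"
    proof (cases "p \<in> pos ` V")
      case True
      then show ?thesis using p by (auto simp: vertex_nbhd_def)
    next
      case False
      then obtain x y where xy: "(x, y) \<in> A" "p \<in> oarc (x, y)" using p unfolding D_eq by auto
      have "p \<in> carc (x, y)" using carc_eq[OF xy(1)] xy(2) by auto
      then have "x = v \<or> y = v" using p xy(1) by (auto simp: vertex_nbhd_def)
      then show ?thesis using xy oarc_sym[OF xy(1)] symA[OF xy(1)] by auto
    qed
  qed
qed

lemma oarc_near_end:
  assumes "(u, v) \<in> A" "openin X N" "pos u \<in> N"
  shows "N \<inter> oarc (u, v) \<noteq> {}"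
proof -
  obtain d where d: "d > 0" "\<And>y. y \<in> {0..1} \<Longrightarrow> \<bar>y - 0\<bar> < d \<Longrightarrow> crv (u, v) y \<in> N"
    using pathin_chart_delta[OF path[OF assms(1)] _ assms(2), of 0] assms crv0[OF assms(1)] by auto
  define t where "t = min (1/2) (d/2)"
  have t: "0 < t" "t < 1" "t < d" using d by (auto simp: t_def)
  have "crv (u, v) t \<in> N" using d(2)[of t] t by auto
  moreover have "crv (u, v) t \<in> oarc (u, v)" using t by (auto simp: oarc_def)
  ultimately show ?thesis by blast
qed

abbreviation bd :: "'s set \<Rightarrow> 's set" where "bd \<phi> \<equiv> X frontier_of \<phi>"

definition borders :: "'s set \<Rightarrow> 'v \<times> 'v \<Rightarrow> bool" where
  "borders \<phi> a \<longleftrightarrow> bd \<phi> \<inter> oarc a \<noteq> {}"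

lemma face_frontier:
  assumes "\<phi> \<in> comps D"
  shows "bd \<phi> = X closure_of \<phi> - \<phi>" "bd \<phi> \<subseteq> D"
proof -
  have op: "openin X \<phi>" using comps_open[OF D_closed assms] .
  then show eq: "bd \<phi> = X closure_of \<phi> - \<phi>" by (rule frontier_of_openin)
  show "bd \<phi> \<subseteq> D"
  proof
    fix x assume x: "x \<in> bd \<phi>"
    show "x \<in> D"
    proof (rule ccontr)
      assume "x \<notin> D"
      then have "x \<in> topspace X - D" using x frontier_of_subset_topspace[of X \<phi>] by blast
      then obtain \<psi> where \<psi>: "\<psi> \<in> comps D" "x \<in> \<psi>" using comps_Union[of D] by blast
      then have "\<psi> \<inter> \<phi> \<noteq> {}" using comps_open[OF D_closed \<psi>(1)] x eq by (auto simp: in_closure_of)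
      then have "\<psi> = \<phi>" using comps_disjoint[OF \<psi>(1) assms] by blast
      then show False using \<psi>(2) x eq by auto
    qed
  qed
qed

lemma face_trap:
  assumes "connectedin X T" "T \<inter> \<phi> \<noteq> {}" "T \<inter> bd \<phi> = {}"
  shows "T \<subseteq> \<phi>"
  using connectedin_Int_frontier_of[OF assms(1,2)] assms(3) by blast

lemma borders_sym: "(u, v) \<in> A \<Longrightarrow> borders \<phi> (v, u) = borders \<phi> (u, v)"
  by (simp add: borders_def oarc_sym)

lemma borders_closure:
  assumes "\<phi> \<in> comps D" "a \<in> A"
  shows "borders \<phi> a \<longleftrightarrow> X closure_of \<phi> \<inter> oarc a \<noteq> {}"
  unfolding borders_def face_frontier(1)[OF assms(1)]
  using comps_connected(2)[OF assms(1)] oarc_D[OF assms(2)] by blast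

text \<open>At the last parameter \<open>t0\<close> up to which the face follows the edge, the part of the edge already followed is an arc
  that ends there and has only one side. So points of the face near its end can be joined, off this arc, to
  points of the edge just beyond, without meeting the frontier of the face; these would lie in the face.\<close>

lemma borders_forward:
  assumes \<phi>: "\<phi> \<in> comps D" and uv: "(u, v) \<in> A"
    and t: "0 < t2" "t2 \<le> t1" "t1 < 1" "crv (u, v) t2 \<in> bd \<phi>"
  shows "crv (u, v) t1 \<in> bd \<phi>"
proof (rule ccontr)
  assume no: "crv (u, v) t1 \<notin> bd \<phi>"
  let ?g = "crv (u, v)"
  note g = path[OF uv] inj_crv[OF uv]
  have inj: "?g y = ?g z \<longleftrightarrow> y = z" if "y \<in> {0..1}" "z \<in> {0..1}" for y z
    using g(2) that by (auto simp: inj_on_def)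
  have "closedin (subtopology euclideanreal {0..1}) {y \<in> {0..1}. ?g y \<in> bd \<phi>}"
    using closedin_continuous_map_preimage[OF g(1)[unfolded pathin_def] closedin_frontier_of[of X \<phi>]] by simp
  then have cl: "closed {y \<in> {0..1}. ?g y \<in> bd \<phi>}" by (simp add: closedin_closed_trans)
  have "{y \<in> {0..1}. ?g y \<in> bd \<phi>} \<inter> {t2..t1} = {y \<in> {t2..t1}. ?g y \<in> bd \<phi>}" using t by auto
  then have "compact {y \<in> {t2..t1}. ?g y \<in> bd \<phi>}" using closed_Int_compact[OF cl, of "{t2..t1}"] by simp
  moreover have "t2 \<in> {y \<in> {t2..t1}. ?g y \<in> bd \<phi>}" using t by auto
  ultimately obtain t0 where t0: "t0 \<in> {t2..t1}" "?g t0 \<in> bd \<phi>"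
    and max: "\<And>y. y \<in> {t2..t1} \<Longrightarrow> ?g y \<in> bd \<phi> \<Longrightarrow> y \<le> t0"
    using compact_attains_sup[of "{y \<in> {t2..t1}. ?g y \<in> bd \<phi>}"] by blast
  have t0': "0 < t0" "t0 < t1" using t t0 no by (auto simp: order.order_iff_strict)
  let ?r = "\<lambda>s. ?g (t0 * (1 - s))"
  have r: "pathin X ?r" "?r ` {0..1} = ?g ` {0..t0}"
    using pathin_reverse_segment[OF g(1), of t0] t0' t by auto
  have injr: "inj_on ?r {0..1}"
  proof (rule inj_onI)
    fix y z assume yz: "y \<in> {0..1::real}" "z \<in> {0..1::real}" "?r y = ?r z"
    have "t0 * (1 - y) \<in> {0..1}" "t0 * (1 - z) \<in> {0..1}"
      using yz t0' t by (auto intro!: mult_le_one mult_nonneg_nonneg)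
    then have "t0 * (1 - y) = t0 * (1 - z)" using inj yz(3) by blast
    then show "y = z" using t0' by simp
  qed
  \<comment> \<open>Removing the rest of the edge confines the frontier of the face to the parameters between \<open>t0\<close> and \<open>t1\<close>,
    where by maximality of \<open>t0\<close> there is none.\<close>
  define W where "W = edge_nbhd (u, v) - ?g ` {t1..1}"
  have opW: "openin X W"
    unfolding W_def using edge_nbhd(1)[OF uv] pathin_compact_image[OF g(1), of t1 1] t compact_closed by auto
  have g0W: "?r 0 \<in> W"
  proof -
    have "?g t0 \<in> oarc (u, v)" using t0' t by (auto simp: oarc_def)
    moreover have "?g t0 \<notin> ?g ` {t1..1}"
    proof
      assume "?g t0 \<in> ?g ` {t1..1}"
      then obtain y where "y \<in> {t1..1}" "?g t0 = ?g y" by blast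
      then show False using inj[of t0 y] t0' t by auto
    qed
    ultimately show ?thesis using edge_nbhd(2)[OF uv] by (auto simp: W_def)
  qed
  obtain B where B: "openin X B" "?r 0 \<in> B" "B \<subseteq> W"
    "\<And>x y. x \<in> B - ?r ` {0..1} \<Longrightarrow> y \<in> B - ?r ` {0..1} \<Longrightarrow> \<exists>T. connectedin X T \<and> T \<subseteq> W - ?r ` {0..1} \<and> x \<in> T \<and> y \<in> T"
    by (rule arc_end_nonseparating[OF r(1) injr opW g0W]) blast
  have "?r 0 \<in> X closure_of \<phi>" using t0(2) face_frontier(1)[OF \<phi>] by auto
  then obtain x where x: "x \<in> \<phi>" "x \<in> B" using B(1,2) unfolding in_closure_of by blast
  have t0B: "?g t0 \<in> B" using B(2) by simp
  obtain d where d: "d > 0" "\<And>y. y \<in> {0..1} \<Longrightarrow> \<bar>y - t0\<bar> < d \<Longrightarrow> ?g y \<in> B"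
    using pathin_chart_delta[OF g(1) _ B(1) t0B] t0' t by auto
  define y where "y = t0 + min (d/2) ((t1 - t0)/2)"
  have y: "t0 < y" "y < t1" "\<bar>y - t0\<bar> < d" using d(1) t0' by (auto simp: y_def min_def field_simps)
  have yB: "?g y \<in> B" using d(2)[of y] y t0' t by auto
  have ynot: "?g y \<notin> ?g ` {0..t0}"
  proof
    assume "?g y \<in> ?g ` {0..t0}"
    then obtain z where "z \<in> {0..t0}" "?g y = ?g z" by blast
    then show False using inj[of y z] y t0' t by auto
  qed
  have seg: "?g ` {0..t0} \<subseteq> D" using t0' t uv unfolding D_def carc_def by fastforce
  have xnot: "x \<notin> ?g ` {0..t0}" using seg x(1) comps_connected(2)[OF \<phi>] by blast
  obtain T where T: "connectedin X T" "T \<subseteq> W - ?g ` {0..t0}" "x \<in> T" "?g y \<in> T"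
    using B(4)[of x "?g y"] x(2) xnot yB ynot unfolding r(2) by blast
  have "T \<inter> bd \<phi> = {}"
  proof (rule ccontr)
    assume "T \<inter> bd \<phi> \<noteq> {}"
    then obtain p where p: "p \<in> T" "p \<in> bd \<phi>" by blast
    then have "p \<in> edge_nbhd (u, v) \<inter> D" using T(2) face_frontier(2)[OF \<phi>] by (auto simp: W_def)
    then have "p \<in> oarc (u, v)" using edge_nbhd(3)[OF uv] by blast
    then obtain z where z: "0 < z" "z < 1" "p = ?g z" by (auto simp: oarc_def)
    have "p \<notin> ?g ` {t1..1}" "p \<notin> ?g ` {0..t0}" using T(2) p(1) by (auto simp: W_def)
    then have "z < t1" "t0 < z" using z by (force simp: not_less)+
    then show False using max[of z] p(2) z t0 by auto
  qed
  then have "T \<subseteq> \<phi>" using face_trap[OF T(1), of \<phi>] T(3) x(1) by blast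
  then have "?g y \<in> \<phi>" using T(4) by blast
  moreover have "?g y \<in> D" using oarc_D[OF uv] y t0' t by (auto simp: oarc_def)
  ultimately show False using comps_connected(2)[OF \<phi>] by blast
qed

text \<open>Following the edge in both directions, and closing up at the ends.\<close>

lemma borders_all:
  assumes \<phi>: "\<phi> \<in> comps D" and uv: "(u, v) \<in> A" and b: "borders \<phi> (u, v)"
  shows "oarc (u, v) \<subseteq> bd \<phi>" "pos u \<in> bd \<phi>" "pos v \<in> bd \<phi>"
proof -
  obtain t where t: "0 < t" "t < 1" "crv (u, v) t \<in> bd \<phi>" using b by (auto simp: borders_def oarc_def)
  show *: "oarc (u, v) \<subseteq> bd \<phi>"
  proof
    fix p assume "p \<in> oarc (u, v)"
    then obtain s where s: "0 < s" "s < 1" "p = crv (u, v) s" by (auto simp: oarc_def)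
    show "p \<in> bd \<phi>"
    proof (cases "t \<le> s")
      case True
      then show ?thesis using borders_forward[OF \<phi> uv, of t s] t s by auto
    next
      case False
      have "crv (v, u) (1 - t) \<in> bd \<phi>" using crv_rev[OF uv, of "1 - t"] t by simp
      then have "crv (v, u) (1 - s) \<in> bd \<phi>" using borders_forward[OF \<phi> symA[OF uv], of "1 - t" "1 - s"] t s False by auto
      then show ?thesis using crv_rev[OF uv, of "1 - s"] s by simp
    qed
  qed
  have "pos x \<in> bd \<phi>" if xy: "(x, y) \<in> A" "oarc (x, y) \<subseteq> bd \<phi>" for x y
  proof -
    have "pos x \<in> X closure_of (bd \<phi>)"
      unfolding in_closure_of using oarc_near_end[OF xy(1)] xy(2) posX AD[OF xy(1)] by blast
    then show ?thesis using closedin_frontier_of[of X \<phi>] by (simp add: closure_of_closedin)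
  qed
  then show "pos u \<in> bd \<phi>" "pos v \<in> bd \<phi>"
    using * uv symA[OF uv] oarc_sym[OF uv] by auto
qed

end

section \<open>Faces along an edge and around a vertex\<close>

context drawn_graph
begin

lemma excess_points: "S \<subseteq> V \<Longrightarrow> excess (pos ` S) (- int (card S))"
proof -
  assume S: "S \<subseteq> V"
  then have "finite S" using finV finite_subset by blast
  then show ?thesis using S
  proof (induction S rule: finite_induct)
    case (insert x S)
    have "pos x \<notin> pos ` S" using insert inj_pos by (auto simp: inj_on_def)
    then have "excess (insert (pos x) (pos ` S)) (- int (card S) - 1)"
      using insert posX by (intro excess_insert_point) auto
    moreover have "- int (card (insert x S)) = - int (card S) - 1" using insert.hyps by simp
    ultimately show ?case by simp
  qed (simp add: excess_empty)
qed

text \<open>Each edge is attached to the vertices and the earlier edges exactly at its two ends.\<close>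

lemma excess_edges:
  assumes "finite B" "B \<subseteq> A" "\<And>u v. (u, v) \<in> B \<Longrightarrow> (v, u) \<notin> B"
  shows "excess (pos ` V \<union> (\<Union>a\<in>B. carc a)) (int (card B) - int (card V))"
  using assms
proof (induction B rule: finite_induct)
  case empty
  then show ?case using excess_points[of V] by simp
next
  case (insert a B)
  obtain u v where a: "a = (u, v)" by (cases a)
  have uv: "(u, v) \<in> A" using insert.prems(1) a by auto
  let ?D = "pos ` V \<union> (\<Union>a\<in>B. carc a)"
  have "?D \<inter> carc (u, v) = {pos u, pos v}"
  proof
    have "carc (x, y) \<inter> carc (u, v) \<subseteq> {pos u, pos v}" if xy: "(x, y) \<in> B" for x y
    proof -
      have "(v, u) \<notin> insert a B" by (rule insert.prems(2)) (simp add: a)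
      then have "(x, y) \<noteq> (u, v)" "(x, y) \<noteq> (v, u)" using xy insert.hyps(2) a by auto
      then have "{u, v} \<noteq> {x, y}" by (auto simp: doubleton_eq_iff)
      moreover have xyA: "(x, y) \<in> A" using xy insert.prems(1) by auto
      ultimately have "oarc (u, v) \<inter> oarc (x, y) = {}" using oarc_disj[OF uv] by blast
      then show ?thesis
        unfolding carc_eq[OF uv] carc_eq[OF xyA] using oarc_pos[OF uv] oarc_pos[OF xyA] AD[OF uv] AD[OF xyA] by blast
    qed
    moreover have "pos ` V \<inter> carc (u, v) \<subseteq> {pos u, pos v}"
      unfolding carc_eq[OF uv] using oarc_pos[OF uv] by auto
    ultimately show "?D \<inter> carc (u, v) \<subseteq> {pos u, pos v}" by fastforce
    show "{pos u, pos v} \<subseteq> ?D \<inter> carc (u, v)" using AD[OF uv] carc_eq[OF uv] by auto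
  qed
  then have "?D \<inter> crv (u, v) ` {0..1} = {crv (u, v) 0, crv (u, v) 1}"
    using crv0[OF uv] crv1[OF uv] by (simp add: carc_def)
  moreover have "excess ?D (int (card B) - int (card V))"
    by (rule insert.IH) (use insert.prems in blast)+
  ultimately have "excess (?D \<union> crv (u, v) ` {0..1}) (int (card B) - int (card V) + 1)"
    using path[OF uv] inj_crv[OF uv] by (intro excess_Un_path)
  moreover have "?D \<union> crv (u, v) ` {0..1} = pos ` V \<union> (\<Union>a\<in>insert a B. carc a)" by (auto simp: a carc_def)
  ultimately show ?case using insert.hyps by (simp add: algebra_simps)
qed

text \<open>Orienting every edge selects one of its two arcs, so that each curve is added once.\<close>

lemma excess_drawing: "\<exists>k. excess D k \<and> 2 * k = int (card A) - 2 * int (card V)"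
proof -
  obtain f :: "'v \<Rightarrow> nat" where f: "inj_on f V" using finite_imp_inj_to_nat_seg[OF finV] by blast
  define B where "B = {a \<in> A. f (fst a) < f (snd a)}"
  have AB: "A = B \<union> prod.swap ` B"
  proof
    show "A \<subseteq> B \<union> prod.swap ` B"
    proof
      fix a assume a: "a \<in> A"
      obtain u v where uv: "a = (u, v)" by (cases a)
      have "f u \<noteq> f v" using f a uv AD[of u v] irrefl[of u] by (auto simp: inj_on_def)
      then consider "f u < f v" | "f v < f u" by linarith
      then show "a \<in> B \<union> prod.swap ` B"
      proof cases
        case 2
        then have "(v, u) \<in> B" using symA a uv by (auto simp: B_def)
        then show ?thesis using uv by (auto intro!: image_eqI[of _ _ "(v, u)"])
      qed (use a uv in \<open>auto simp: B_def\<close>)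
    qed
    show "B \<union> prod.swap ` B \<subseteq> A" using symA by (auto simp: B_def)
  qed
  have finB: "finite B" using finA by (auto simp: B_def)
  have "B \<inter> prod.swap ` B = {}" by (auto simp: B_def)
  then have "card A = card B + card (prod.swap ` B)" using finB card_Un_disjoint[of B "prod.swap ` B"] AB by auto
  also have "card (prod.swap ` B) = card B" by (intro card_image) (auto simp: inj_on_def)
  finally have cardA: "card A = 2 * card B" by simp
  have ex: "excess (pos ` V \<union> (\<Union>a\<in>B. carc a)) (int (card B) - int (card V))"
    using finB by (intro excess_edges) (auto simp: B_def)
  have "carc (prod.swap a) = carc a" if "a \<in> B" for a
  proof -
    have "(fst a, snd a) \<in> A" using that by (simp add: B_def)
    from carc_sym[OF this] show ?thesis by (simp only: prod.swap_def prod.collapse)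
  qed
  then have "(\<Union>a\<in>A. carc a) = (\<Union>a\<in>B. carc a)" by (subst AB) auto
  then have "pos ` V \<union> (\<Union>a\<in>B. carc a) = D" unfolding D_def by simp
  then show ?thesis using ex cardA by (intro exI[of _ "int (card B) - int (card V)"]) simp
qed

text \<open>Finitely many faces stay away from the point.\<close>

lemma edge_local:
  assumes fin: "finite (comps D)" and uv: "(u, v) \<in> A" and x: "x \<in> oarc (u, v)"
  obtains N where "openin X N" "x \<in> N" "N \<subseteq> oarc (u, v) \<union> \<Union>{\<phi> \<in> comps D. borders \<phi> (u, v)}"
proof
  let ?N = "edge_nbhd (u, v) - \<Union>((\<lambda>\<phi>. X closure_of \<phi>) ` {\<phi> \<in> comps D. \<not> borders \<phi> (u, v)})"
  have "closedin X (\<Union>((\<lambda>\<phi>. X closure_of \<phi>) ` {\<phi> \<in> comps D. \<not> borders \<phi> (u, v)}))"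
    using fin by (intro closedin_Union) auto
  then show "openin X ?N" using edge_nbhd(1)[OF uv] by blast
  have "x \<notin> X closure_of \<phi>" if "\<phi> \<in> comps D" "\<not> borders \<phi> (u, v)" for \<phi>
    using that x borders_closure[OF that(1) uv] by blast
  then show "x \<in> ?N" using x edge_nbhd(2)[OF uv] by auto
  show "?N \<subseteq> oarc (u, v) \<union> \<Union>{\<phi> \<in> comps D. borders \<phi> (u, v)}"
  proof
    fix y assume y: "y \<in> ?N"
    show "y \<in> oarc (u, v) \<union> \<Union>{\<phi> \<in> comps D. borders \<phi> (u, v)}"
    proof (cases "y \<in> D")
      case True
      then show ?thesis using y edge_nbhd(3)[OF uv] by auto
    next
      case False
      then have "y \<in> topspace X - D" using y openin_subset[OF edge_nbhd(1)[OF uv]] by auto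
      then obtain \<phi> where \<phi>: "\<phi> \<in> comps D" "y \<in> \<phi>" using comps_Union[of D] by blast
      then have "y \<in> X closure_of \<phi>" using closure_of_subset[of \<phi> X] comps_connected(2)[OF \<phi>(1)] by blast
      then have "borders \<phi> (u, v)" using y \<phi>(1) by auto
      then show ?thesis using \<phi> by auto
    qed
  qed
qed

text \<open>Around a vertex: a set of faces and of edges that is closed under incidence there fills a whole
  punctured neighbourhood, because a punctured disc is connected.\<close>

lemma star_connected:
  assumes fin: "finite (comps D)" and c: "c \<in> V" and N1: "N1 \<subseteq> {a. (c, a) \<in> A}" and \<Phi>1: "\<Phi>1 \<subseteq> comps D"
    and consist: "\<And>a \<phi>. (c, a) \<in> A \<Longrightarrow> \<phi> \<in> comps D \<Longrightarrow> borders \<phi> (c, a) \<Longrightarrow> \<phi> \<in> \<Phi>1 \<longleftrightarrow> a \<in> N1"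
  defines "O1 \<equiv> \<Union>\<Phi>1 \<union> (\<Union>a\<in>N1. oarc (c, a))"
  assumes near: "\<And>N. openin X N \<Longrightarrow> pos c \<in> N \<Longrightarrow> N \<inter> O1 \<noteq> {}"
  obtains U where "openin X U" "pos c \<in> U" "U - {pos c} \<subseteq> O1"
proof -
  obtain U h where U: "chart X U h" "pos c \<in> U" "U \<subseteq> vertex_nbhd c"
    by (rule chart_at[OF vertex_nbhd(1,2)[OF c]])
  have memf: "x \<in> O1 \<longleftrightarrow> \<phi> \<in> \<Phi>1" if "\<phi> \<in> comps D" "x \<in> \<phi>" for x \<phi>
  proof -
    have "x \<notin> D" using that comps_connected(2) by blast
    then have "x \<notin> oarc (c, a)" if "a \<in> N1" for a using oarc_D N1 that by blast
    moreover have "x \<in> \<Union>\<Phi>1 \<longleftrightarrow> \<phi> \<in> \<Phi>1" using that comps_disjoint[of \<phi> D] \<Phi>1 by blast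
    ultimately show ?thesis by (auto simp: O1_def)
  qed
  have mema: "x \<in> O1 \<longleftrightarrow> a \<in> N1" if "(c, a) \<in> A" "x \<in> oarc (c, a)" for x a
  proof -
    have "x \<in> D" using that oarc_D by blast
    then have "x \<notin> \<Union>\<Phi>1" using \<Phi>1 comps_connected(2) by blast
    moreover have "a' = a" if "a' \<in> N1" "x \<in> oarc (c, a')" for a'
      using oarc_disj[of c a c a'] that \<open>(c, a) \<in> A\<close> \<open>x \<in> oarc (c, a)\<close> N1 by (auto simp: doubleton_eq_iff)
    ultimately show ?thesis using that by (auto simp: O1_def)
  qed
  have pc: "pos c \<notin> O1"
  proof -
    have "pos c \<in> D" using pos_D[OF c] .
    then have "pos c \<notin> \<Union>\<Phi>1" using \<Phi>1 comps_connected(2) by blast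
    then show ?thesis using oarc_pos[OF _ c] N1 by (auto simp: O1_def)
  qed
  obtain p where p: "p \<in> U - {pos c}" "p \<in> O1" using near[OF chart_bij(4)[OF U(1)] U(2)] pc by blast
  have "k \<in> O1" if k: "k \<in> U - {pos c}" for k
  proof (rule connectedin_locally_constant[where P = "\<lambda>x. x \<in> O1", OF chart_punctured_connected[OF U(1,2)] p k])
    fix k assume k: "k \<in> U - {pos c}"
    show "\<exists>W. openin X W \<and> k \<in> W \<and> (\<forall>k'\<in>W \<inter> (U - {pos c}). k' \<in> O1 \<longleftrightarrow> k \<in> O1)"
    proof (cases "k \<in> D")
      case False
      then have "k \<in> topspace X - D" using k chart_bij(1)[OF U(1)] by auto
      then obtain \<phi> where \<phi>: "\<phi> \<in> comps D" "k \<in> \<phi>" using comps_Union[of D] by blast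
      then show ?thesis using comps_open[OF D_closed \<phi>(1)] memf[OF \<phi>(1)] by blast
    next
      case True
      then obtain a where a: "(c, a) \<in> A" "k \<in> oarc (c, a)" using vertex_nbhd(3)[OF c] k U(3) by blast
      obtain N where N: "openin X N" "k \<in> N" "N \<subseteq> oarc (c, a) \<union> \<Union>{\<phi> \<in> comps D. borders \<phi> (c, a)}"
        by (rule edge_local[OF fin a])
      have "k' \<in> O1 \<longleftrightarrow> a \<in> N1" if "k' \<in> N" for k'
      proof (cases "k' \<in> oarc (c, a)")
        case True
        then show ?thesis using mema a by blast
      next
        case False
        then obtain \<phi> where "\<phi> \<in> comps D" "borders \<phi> (c, a)" "k' \<in> \<phi>" using N(3) \<open>k' \<in> N\<close> by auto
        then show ?thesis using memf consist[OF a(1)] by blast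
      qed
      then show ?thesis using N(1,2) by blast
    qed
  qed
  then show ?thesis using that[OF chart_bij(4)[OF U(1)] U(2)] by blast
qed

text \<open>Otherwise the face alone would fill a punctured neighbourhood of the vertex, and leave no room for the
  edge.\<close>

lemma vertex_borders_edge:
  assumes fin: "finite (comps D)" and \<phi>: "\<phi> \<in> comps D" and c: "c \<in> V" "pos c \<in> bd \<phi>" and a: "(c, a) \<in> A"
  obtains b where "(c, b) \<in> A" "borders \<phi> (c, b)"
proof (rule ccontr)
  assume *: "\<not> thesis"
  have no: "\<not> borders \<phi> (c, b)" if "(c, b) \<in> A" for b using * that \<open>\<And>b. \<lbrakk>(c, b) \<in> A; borders \<phi> (c, b)\<rbrakk> \<Longrightarrow> thesis\<close> by blast
  obtain U where U: "openin X U" "pos c \<in> U" "U - {pos c} \<subseteq> \<Union>{\<phi>} \<union> (\<Union>a\<in>{}. oarc (c, a))"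
  proof (rule star_connected[OF fin c(1), of "{}" "{\<phi>}"])
    fix N assume "openin X N" "pos c \<in> N"
    moreover have "pos c \<in> X closure_of \<phi>" using c(2) face_frontier(1)[OF \<phi>] by auto
    ultimately show "N \<inter> (\<Union>{\<phi>} \<union> (\<Union>a\<in>{}. oarc (c, a))) \<noteq> {}" unfolding in_closure_of by blast
  qed (use \<phi> no in auto)
  obtain p where p: "p \<in> U" "p \<in> oarc (c, a)" using oarc_near_end[OF a U(1,2)] by blast
  then have "p \<noteq> pos c" using oarc_pos[OF a c(1)] by auto
  then have "p \<in> \<phi>" using p U(3) by auto
  then show False using p(2) oarc_D[OF a] comps_connected(2)[OF \<phi>] by blast
qed

text \<open>If \<open>a\<close> is the only edge at \<open>c\<close> along which the face is found, points of the face near \<open>c\<close> can be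
  joined to points of the other face around the end of this edge, because an arc has only one side at its end point.\<close>

lemma unique_border_edge_two_sided:
  assumes \<phi>: "\<phi> \<in> comps D" and a: "(c, a) \<in> A" "borders \<phi> (c, a)"
    and uniq: "\<And>b. (c, b) \<in> A \<Longrightarrow> borders \<phi> (c, b) \<Longrightarrow> b = a"
    and \<psi>: "\<psi> \<in> comps D" "borders \<psi> (c, a)"
  shows "\<psi> = \<phi>"
proof (rule ccontr)
  assume neq: "\<psi> \<noteq> \<phi>"
  have c: "c \<in> V" using AD[OF a(1)] by simp
  define W where "W = vertex_nbhd c"
  note g = path[OF a(1)] inj_crv[OF a(1)]
  have W: "openin X W" "crv (c, a) 0 \<in> W" using vertex_nbhd(1,2)[OF c] crv0[OF a(1)] by (auto simp: W_def)
  obtain B where B: "openin X B" "crv (c, a) 0 \<in> B" "B \<subseteq> W"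
    "\<And>x y. x \<in> B - crv (c, a) ` {0..1} \<Longrightarrow> y \<in> B - crv (c, a) ` {0..1} \<Longrightarrow>
       \<exists>T. connectedin X T \<and> T \<subseteq> W - crv (c, a) ` {0..1} \<and> x \<in> T \<and> y \<in> T"
    by (rule arc_end_nonseparating[OF g W]) blast
  have cB: "pos c \<in> B" using B(2) crv0[OF a(1)] by simp
  have "pos c \<in> X closure_of \<phi>" "pos c \<in> X closure_of \<psi>"
    using borders_all(2)[OF \<phi> a] borders_all(2)[OF \<psi>(1) a(1) \<psi>(2)] face_frontier(1)[OF \<phi>] face_frontier(1)[OF \<psi>(1)] by auto
  then obtain x y where xy: "x \<in> \<phi>" "x \<in> B" "y \<in> \<psi>" "y \<in> B" using B(1) cB unfolding in_closure_of by metis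
  have carcD: "crv (c, a) ` {0..1} \<subseteq> D" using a(1) unfolding D_def carc_def by blast
  then have "x \<notin> crv (c, a) ` {0..1}" "y \<notin> crv (c, a) ` {0..1}"
    using xy comps_connected(2)[OF \<phi>] comps_connected(2)[OF \<psi>(1)] by blast+
  then obtain T where T: "connectedin X T" "T \<subseteq> W - crv (c, a) ` {0..1}" "x \<in> T" "y \<in> T"
    using B(4)[of x y] xy by blast
  have "T \<inter> bd \<phi> = {}"
  proof (rule ccontr)
    assume "T \<inter> bd \<phi> \<noteq> {}"
    then obtain p where p: "p \<in> T" "p \<in> bd \<phi>" by blast
    then have "p \<in> vertex_nbhd c \<inter> D" using T(2) face_frontier(2)[OF \<phi>] by (auto simp: W_def)
    then have "p = pos c \<or> (\<exists>b. (c, b) \<in> A \<and> p \<in> oarc (c, b))" using vertex_nbhd(3)[OF c] by blast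
    moreover have "p \<notin> carc (c, a)" using T(2) p(1) by (auto simp: carc_def)
    ultimately obtain b where b: "(c, b) \<in> A" "p \<in> oarc (c, b)" "b \<noteq> a" using carc_eq[OF a(1)] by auto
    then have "borders \<phi> (c, b)" using p(2) by (auto simp: borders_def)
    then show False using uniq b by blast
  qed
  then have "T \<subseteq> \<phi>" using face_trap[OF T(1), of \<phi>] T(3) xy(1) by blast
  then have "y \<in> \<phi> \<inter> \<psi>" using T(4) xy by blast
  then show False using comps_disjoint[OF \<phi> \<psi>(1)] neq by blast
qed

lemma middle_piece:
  assumes uv: "(u, v) \<in> A"
  obtains s t where "0 < s" "s < 1/2" "1/2 < t" "t < 1" "short_arc (crv (u, v) ` {s..t})"
proof -
  note g = path[OF uv] inj_crv[OF uv]
  have gX: "crv (u, v) (1/2) \<in> topspace X" using g(1) unfolding pathin_def continuous_map_def by auto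
  obtain U h where U: "chart X U h" "crv (u, v) (1/2) \<in> U" using charts[OF gX] by blast
  obtain d where d: "d > 0" "\<And>y. y \<in> {0..1} \<Longrightarrow> \<bar>y - 1/2\<bar> < d \<Longrightarrow> crv (u, v) y \<in> U"
    using pathin_chart_delta[OF g(1) _ chart_bij(4)[OF U(1)] U(2)] by auto
  define e where "e = min (1/4) (d/2)"
  have e: "0 < e" "e < 1/2" "e < d" using d by (auto simp: e_def)
  have "crv (u, v) ` {1/2 - e..1/2 + e} \<subseteq> U" using d(2) e by (auto simp: abs_if)
  then have "short_arc (crv (u, v) ` {1/2 - e..1/2 + e})" using short_arc_subpath[OF g _ _ _ U(1)] e by auto
  then show ?thesis by (rule that[rotated -1]) (use e in auto)
qed

text \<open>A short middle piece of the edge is the last arc that is drawn; all faces along the edge are found along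
  this piece.\<close>

lemma edge_at_most_two_faces:
  assumes fin: "finite (comps D)" and uv: "(u, v) \<in> A"
  shows "card {\<phi> \<in> comps D. borders \<phi> (u, v)} \<le> 2"
proof -
  obtain s t where st: "0 < s" "s < 1/2" "1/2 < t" "t < 1" and arc: "short_arc (crv (u, v) ` {s..t})" using middle_piece[OF uv] .
  let ?g = "crv (u, v)"
  note g = path[OF uv] inj_crv[OF uv]
  have inj: "?g y = ?g z \<longleftrightarrow> y = z" if "y \<in> {0..1}" "z \<in> {0..1}" for y z
    using g(2) that by (auto simp: inj_on_def)
  \<comment> \<open>the drawing without the open middle piece of the edge\<close>
  define D0 where "D0 = (topspace X - edge_nbhd (u, v)) \<union> ?g ` {0..s} \<union> ?g ` {t..1}"
  have "closedin X (topspace X - edge_nbhd (u, v))" using edge_nbhd(1)[OF uv] by blast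
  then have cl: "closedin X D0" unfolding D0_def
    using pathin_compact_image[OF g(1)] compact_closed st by (intro closedin_Un) auto
  have Dsub: "topspace X - edge_nbhd (u, v) \<subseteq> D" unfolding edge_nbhd_def D_def by auto
  have seg: "?g ` {s..t} \<subseteq> oarc (u, v)" using st by (auto simp: oarc_def)
  have split: "oarc (u, v) \<subseteq> ?g ` {0..s} \<union> ?g ` {s..t} \<union> ?g ` {t..1}"
  proof -
    have "{0<..<1} \<subseteq> {0..s} \<union> {s..t} \<union> {t..1}" by auto
    then show ?thesis unfolding oarc_def image_Un[symmetric] by (rule image_mono)
  qed
  have DD: "D0 \<union> ?g ` {s..t} = D"
  proof
    have "?g ` {0..s} \<subseteq> D" "?g ` {t..1} \<subseteq> D" "?g ` {s..t} \<subseteq> D" using st uv unfolding D_def carc_def by fastforce+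
    then show "D0 \<union> ?g ` {s..t} \<subseteq> D" using Dsub by (auto simp: D0_def)
    show "D \<subseteq> D0 \<union> ?g ` {s..t}"
      using edge_nbhd(3)[OF uv] split closedin_subset[OF D_closed] by (auto simp: D0_def)
  qed
  have meet: "D0 \<inter> ?g ` {s..t} = {?g s, ?g t}"
  proof
    show "{?g s, ?g t} \<subseteq> D0 \<inter> ?g ` {s..t}" using st by (auto simp: D0_def)
    show "D0 \<inter> ?g ` {s..t} \<subseteq> {?g s, ?g t}"
    proof
      fix p assume p: "p \<in> D0 \<inter> ?g ` {s..t}"
      then obtain y where y: "y \<in> {s..t}" "p = ?g y" by auto
      have "p \<in> edge_nbhd (u, v)" using p seg edge_nbhd(2)[OF uv] by auto
      then have "p \<in> ?g ` {0..s} \<union> ?g ` {t..1}" using p by (auto simp: D0_def)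
      then have "p \<in> ?g ` ({0..s} \<union> {t..1})" by (simp only: image_Un)
      then obtain z where z: "z \<in> {0..s} \<union> {t..1}" "p = ?g z" by (rule imageE)
      then have "y = z" using inj[of y z] y st by auto
      then have "y = s \<or> y = t" using y z by auto
      then show "p \<in> {?g s, ?g t}" using y by auto
    qed
  qed
  have ends: "?g ` {s..t} - {?g s, ?g t} = ?g ` {s<..<t}"
  proof -
    have "?g ` {s..t} - ?g ` {s, t} = ?g ` ({s..t} - {s, t})"
      using st by (intro inj_on_image_set_diff[symmetric, OF g(2)]) auto
    moreover have "{s..t} - {s, t} = {s<..<t}" by auto
    ultimately show ?thesis by simp
  qed
  show ?thesis
  proof (rule short_arc_two_sides[OF cl arc _ meet])
    show "?g s \<noteq> ?g t" using inj[of s t] st by auto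
    show "connectedin X (?g ` {s..t} - {?g s, ?g t})" unfolding ends using st by (intro pathin_connected_image g) auto
    show "finite (comps (D0 \<union> ?g ` {s..t}))" "{\<phi> \<in> comps D. borders \<phi> (u, v)} \<subseteq> comps (D0 \<union> ?g ` {s..t})"
      unfolding DD using fin by auto
    fix \<phi> assume \<phi>: "\<phi> \<in> {\<phi> \<in> comps D. borders \<phi> (u, v)}"
    have "?g (1/2) \<in> oarc (u, v)" by (auto simp: oarc_def)
    then have "?g (1/2) \<in> X closure_of \<phi>" using borders_all(1)[OF _ uv] \<phi> face_frontier(1) by blast
    then show "X closure_of \<phi> \<inter> (?g ` {s..t} - {?g s, ?g t}) \<noteq> {}" unfolding ends using st by auto
  qed
qed

text \<open>Otherwise a neighbourhood of an interior point would consist of the edge alone, but removing the point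
  disconnects the edge and not the disc.\<close>

lemma edge_at_least_one_face:
  assumes fin: "finite (comps D)" and uv: "(u, v) \<in> A"
  obtains \<phi> where "\<phi> \<in> comps D" "borders \<phi> (u, v)"
proof (rule ccontr)
  assume "\<not> thesis"
  then have none: "{\<phi> \<in> comps D. borders \<phi> (u, v)} = {}" using that by blast
  let ?g = "crv (u, v)" and ?p = "crv (u, v) (1/2)"
  note g = path[OF uv] inj_crv[OF uv]
  have inj: "?g y = ?g z \<longleftrightarrow> y = z" if "y \<in> {0..1}" "z \<in> {0..1}" for y z
    using g(2) that by (auto simp: inj_on_def)
  have "?p \<in> oarc (u, v)" by (auto simp: oarc_def)
  then obtain N where N0: "openin X N" "?p \<in> N" "N \<subseteq> oarc (u, v) \<union> \<Union>{\<phi> \<in> comps D. borders \<phi> (u, v)}"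
    by (rule edge_local[OF fin uv])
  then have N: "openin X N" "?p \<in> N" "N \<subseteq> oarc (u, v)" unfolding none by auto
  obtain U h where U: "chart X U h" "?p \<in> U" "U \<subseteq> N" using chart_at[OF N(1,2)] .
  obtain d where d: "d > 0" "\<And>y. y \<in> {0..1} \<Longrightarrow> \<bar>y - 1/2\<bar> < d \<Longrightarrow> ?g y \<in> U"
    using pathin_chart_delta[OF g(1) _ chart_bij(4)[OF U(1)] U(2)] by auto
  define e where "e = min (1/4) (d/2)"
  have e: "0 < e" "e < 1/2" "e < d" using d by (auto simp: e_def)
  have con: "connectedin X (U - {?p})" by (rule chart_punctured_connected[OF U(1,2)])
  let ?E1 = "?g ` {0..1/2}" and ?E2 = "?g ` {1/2..1}"
  have "closedin X ?E1" "closedin X ?E2" using pathin_compact_image[OF g(1)] compact_closed by auto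
  moreover have "U - {?p} \<subseteq> ?E1 \<union> ?E2"
  proof
    fix x assume "x \<in> U - {?p}"
    then have "x \<in> ?g ` {0<..<1}" using U(3) N(3) by (auto simp: oarc_def)
    then obtain y where "0 < y" "y < 1" "x = ?g y" by auto
    then show "x \<in> ?E1 \<union> ?E2" by (cases "y \<le> 1/2") auto
  qed
  moreover have "?E1 \<inter> ?E2 \<inter> (U - {?p}) = {}"
  proof (rule ccontr)
    assume "?E1 \<inter> ?E2 \<inter> (U - {?p}) \<noteq> {}"
    then obtain y z where yz: "y \<in> {0..1/2}" "z \<in> {1/2..1}" "?g y = ?g z" "?g y \<noteq> ?p" by force
    then have "y = z" using inj[of y z] by auto
    then have "y = 1/2" using yz(1,2) by auto
    then show False using yz(4) by metis
  qed
  moreover have "?g (1/2 - e) \<in> ?E1 \<inter> (U - {?p})" "?g (1/2 + e) \<in> ?E2 \<inter> (U - {?p})"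
    using d(2)[of "1/2 - e"] d(2)[of "1/2 + e"] e inj[of "1/2 - e" "1/2"] inj[of "1/2 + e" "1/2"] by auto
  ultimately show False using con unfolding connectedin_closedin by blast
qed

end

section \<open>Counting edge sides\<close>

context drawn_graph
begin

text \<open>An edge has two sides, and both belong to the same face if no other face is found along it, as for a
  bridge.\<close>

definition sides :: "'s set \<Rightarrow> 'v \<times> 'v \<Rightarrow> nat" where
  "sides \<phi> a = (if borders \<phi> a then if \<exists>\<psi>\<in>comps D. \<psi> \<noteq> \<phi> \<and> borders \<psi> a then 1 else 2 else 0)"

definition face_vertices :: "'s set \<Rightarrow> 'v set" where
  "face_vertices \<phi> = {v \<in> V. pos v \<in> bd \<phi>}"

definition nbrs :: "'v \<Rightarrow> 'v set" where
  "nbrs v = {u. (v, u) \<in> A}"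

lemma nbrs_finite: "finite (nbrs v)"
  using finV AD finite_subset[of "nbrs v" V] by (auto simp: nbrs_def)

lemma sum_sides_faces:
  assumes fin: "finite (comps D)" and a: "a \<in> A"
  shows "(\<Sum>\<phi>\<in>comps D. sides \<phi> a) = 2"
proof -
  obtain u v where uv: "a = (u, v)" by (cases a)
  define S where "S = {\<phi> \<in> comps D. borders \<phi> a}"
  have finS: "finite S" using fin by (simp add: S_def)
  have "card S \<le> 2" using edge_at_most_two_faces[OF fin, of u v] a uv by (simp add: S_def)
  moreover obtain \<phi> where \<phi>: "\<phi> \<in> S" using edge_at_least_one_face[OF fin, of u v] a uv by (auto simp: S_def)
  then have "card S \<noteq> 0" using finS by auto
  ultimately have "card S = 1 \<or> card S = 2" by linarith
  moreover have "(\<Sum>\<phi>\<in>comps D. sides \<phi> a) = (\<Sum>\<phi>\<in>S. sides \<phi> a)"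
    using fin by (intro sum.mono_neutral_right) (auto simp: S_def sides_def)
  moreover have "(\<Sum>\<phi>\<in>S. sides \<phi> a) = 2" if "card S = 1"
  proof -
    obtain \<phi> where S: "S = {\<phi>}" using \<open>card S = 1\<close> by (auto simp: card_1_singleton_iff)
    then have "borders \<phi> a" "\<not> (\<exists>\<psi>\<in>comps D. \<psi> \<noteq> \<phi> \<and> borders \<psi> a)" unfolding S_def by blast+
    then show ?thesis by (simp add: S sides_def)
  qed
  moreover have "(\<Sum>\<phi>\<in>S. sides \<phi> a) = 2" if "card S = 2"
  proof -
    obtain \<phi> \<psi> where S: "S = {\<phi>, \<psi>}" "\<phi> \<noteq> \<psi>" using \<open>card S = 2\<close> by (auto simp: card_2_iff)
    then have b: "borders \<phi> a" "borders \<psi> a" "\<phi> \<in> comps D" "\<psi> \<in> comps D" unfolding S_def by blast+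
    then have "sides \<phi> a = 1" "sides \<psi> a = 1" using S(2) unfolding sides_def by auto
    then show ?thesis using S by simp
  qed
  ultimately show ?thesis by auto
qed

lemma sides_sym: "(u, v) \<in> A \<Longrightarrow> sides \<phi> (v, u) = sides \<phi> (u, v)"
  by (simp add: sides_def borders_sym)

text \<open>Going around the vertex, the face is entered and left: either along two edges, or along the same edge, whose
  two sides then both belong to the face.\<close>

lemma sum_sides_vertex:
  assumes fin: "finite (comps D)" and \<phi>: "\<phi> \<in> comps D" and v: "v \<in> face_vertices \<phi>" and deg: "nbrs v \<noteq> {}"
  shows "(\<Sum>u\<in>nbrs v. sides \<phi> (v, u)) \<ge> 2"
proof -
  obtain a where "(v, a) \<in> A" using deg by (auto simp: nbrs_def)
  then obtain b where b: "(v, b) \<in> A" "borders \<phi> (v, b)"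
    using vertex_borders_edge[OF fin \<phi>] v by (auto simp: face_vertices_def)
  show ?thesis
  proof (cases "\<exists>b'. (v, b') \<in> A \<and> borders \<phi> (v, b') \<and> b' \<noteq> b")
    case True
    then obtain b' where b': "(v, b') \<in> A" "borders \<phi> (v, b')" "b' \<noteq> b" by blast
    have "2 \<le> (\<Sum>u\<in>{b, b'}. sides \<phi> (v, u))" using b b' by (auto simp: sides_def)
    also have "\<dots> \<le> (\<Sum>u\<in>nbrs v. sides \<phi> (v, u))"
      using b b' nbrs_finite by (intro sum_mono2) (auto simp: nbrs_def)
    finally show ?thesis .
  next
    case False
    then have "\<psi> = \<phi>" if "\<psi> \<in> comps D" "borders \<psi> (v, b)" for \<psi>
      using unique_border_edge_two_sided[OF \<phi> b _ that] by blast
    then have "sides \<phi> (v, b) = 2" using b(2) by (auto simp: sides_def)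
    moreover have "sides \<phi> (v, b) \<le> (\<Sum>u\<in>nbrs v. sides \<phi> (v, u))"
      using b(1) nbrs_finite by (intro member_le_sum) (auto simp: nbrs_def)
    ultimately show ?thesis by simp
  qed
qed

lemma sides_zero:
  assumes "\<phi> \<in> comps D" "(v, u) \<in> A" "v \<notin> face_vertices \<phi> \<or> u \<notin> face_vertices \<phi>"
  shows "sides \<phi> (v, u) = 0"
  using assms borders_all(2,3)[of \<phi> v u] AD[of v u] by (auto simp: face_vertices_def sides_def)

lemma sum_sides_arcs: "(\<Sum>a\<in>A. sides \<phi> a) = (\<Sum>v\<in>V. \<Sum>u\<in>nbrs v. sides \<phi> (v, u))"
proof -
  have "A = Sigma V nbrs" using AV by (auto simp: nbrs_def)
  then show ?thesis using finV nbrs_finite by (simp add: sum.Sigma)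
qed

text \<open>The arcs are grouped by their tails, and at each vertex on the face at least two edge sides belong to it.\<close>

lemma sum_sides_ge:
  assumes fin: "finite (comps D)" and \<phi>: "\<phi> \<in> comps D" and deg: "\<And>v. v \<in> V \<Longrightarrow> nbrs v \<noteq> {}"
  shows "2 * card (face_vertices \<phi>) \<le> (\<Sum>a\<in>A. sides \<phi> a)"
proof -
  have sub: "face_vertices \<phi> \<subseteq> V" by (auto simp: face_vertices_def)
  have "2 * card (face_vertices \<phi>) = (\<Sum>v\<in>face_vertices \<phi>. 2)" by simp
  also have "\<dots> \<le> (\<Sum>v\<in>face_vertices \<phi>. \<Sum>u\<in>nbrs v. sides \<phi> (v, u))"
    using sum_sides_vertex[OF fin \<phi>] deg sub by (intro sum_mono) auto
  also have "\<dots> \<le> (\<Sum>v\<in>V. \<Sum>u\<in>nbrs v. sides \<phi> (v, u))"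
    using finV sub by (intro sum_mono2) auto
  finally show ?thesis by (simp add: sum_sides_arcs)
qed

text \<open>A face without vertices on its frontier has no frontier, and would be the whole surface.\<close>

lemma face_has_vertex:
  assumes "\<phi> \<in> comps D" "V \<noteq> {}"
  shows "face_vertices \<phi> \<noteq> {}"
proof
  assume no: "face_vertices \<phi> = {}"
  have "bd \<phi> = {}"
  proof (rule ccontr)
    assume "bd \<phi> \<noteq> {}"
    then obtain p where p: "p \<in> bd \<phi>" by blast
    then have "p \<in> D" using face_frontier(2)[OF assms(1)] by blast
    then consider v where "v \<in> V" "p = pos v" | u v where "(u, v) \<in> A" "p \<in> oarc (u, v)" unfolding D_eq by auto
    then show False
    proof cases
      case (1 v)
      then show ?thesis using no p by (auto simp: face_vertices_def)
    next
      case (2 u v)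
      then have "borders \<phi> (u, v)" using p by (auto simp: borders_def)
      then show ?thesis using borders_all(2)[OF assms(1) 2(1)] AD[OF 2(1)] no by (auto simp: face_vertices_def)
    qed
  qed
  then have "topspace X \<subseteq> \<phi>"
    using connected comps_connected[OF assms(1)] by (intro face_trap) (auto simp: connectedin_topspace)
  then show False using comps_connected(2)[OF assms(1)] assms(2) pos_D posX by blast
qed

text \<open>A face with at most two vertices is bounded by a single edge, seen from both sides; together with
  that edge it is open and closed, so there is no third vertex.\<close>

lemma face_three_vertices:
  assumes fin: "finite (comps D)" and \<phi>: "\<phi> \<in> comps D" and deg: "\<And>v. v \<in> V \<Longrightarrow> nbrs v \<noteq> {}" and V3: "card V \<ge> 3"
  shows "card (face_vertices \<phi>) \<ge> 3"
proof (rule ccontr)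
  assume "\<not> card (face_vertices \<phi>) \<ge> 3"
  then have le: "card (face_vertices \<phi>) \<le> 2" by simp
  have finfv: "finite (face_vertices \<phi>)" using finV by (simp add: face_vertices_def)
  have bordE: "x \<in> face_vertices \<phi>" "y \<in> face_vertices \<phi>" if "(x, y) \<in> A" "borders \<phi> (x, y)" for x y
    using borders_all(2,3)[OF \<phi> that] AD[OF that(1)] by (auto simp: face_vertices_def)
  have "V \<noteq> {}" using V3 by auto
  then obtain u where u: "u \<in> face_vertices \<phi>" using face_has_vertex[OF \<phi>] by blast
  then have uV: "u \<in> V" "pos u \<in> bd \<phi>" by (auto simp: face_vertices_def)
  obtain v where v: "(u, v) \<in> A" "borders \<phi> (u, v)"
    using vertex_borders_edge[OF fin \<phi> uV] deg[OF uV(1)] by (auto simp: nbrs_def)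
  have uv: "u \<noteq> v" using v irrefl by blast
  have "{u, v} \<subseteq> face_vertices \<phi>" using bordE[OF v] by auto
  then have fv: "face_vertices \<phi> = {u, v}" using card_seteq[OF finfv, of "{u, v}"] le uv by simp
  have only: "{x, y} = {u, v}" if "(x, y) \<in> A" "borders \<phi> (x, y)" for x y
    using bordE[OF that] fv that(1) irrefl by auto
  have one: "\<psi> = \<phi>" if "\<psi> \<in> comps D" "borders \<psi> (u, v)" for \<psi>
  proof (rule unique_border_edge_two_sided[OF \<phi> v _ that])
    fix b assume "(u, b) \<in> A" "borders \<phi> (u, b)"
    then show "b = v" using only[of u b] by (auto simp: doubleton_eq_iff)
  qed
  define O1 where "O1 = \<phi> \<union> carc (u, v)"
  have star: "\<exists>U. openin X U \<and> pos x \<in> U \<and> U \<subseteq> O1" if xy: "(x, y) \<in> A" "{x, y} = {u, v}" for x y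
  proof -
    have bxy: "borders \<phi> (x, y)" "oarc (x, y) = oarc (u, v)" "pos x \<in> carc (u, v)"
      using xy v(2) borders_sym[OF v(1)] oarc_sym[OF v(1)] carc_eq[OF v(1)] by (auto simp: doubleton_eq_iff)
    obtain U where U: "openin X U" "pos x \<in> U" "U - {pos x} \<subseteq> \<Union>{\<phi>} \<union> (\<Union>a\<in>{y}. oarc (x, a))"
    proof (rule star_connected[OF fin, of x "{y}" "{\<phi>}"])
      fix a \<psi> assume a: "(x, a) \<in> A" "\<psi> \<in> comps D" "borders \<psi> (x, a)"
      have "\<psi> = \<phi>" if "a = y"
        using one a(2,3) bxy(2) \<open>a = y\<close> by (simp add: borders_def)
      moreover have "a = y" if "\<psi> = \<phi>"
        using only[of x a] a(1,3) \<open>\<psi> = \<phi>\<close> xy by (auto simp: doubleton_eq_iff)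
      ultimately show "\<psi> \<in> {\<phi>} \<longleftrightarrow> a \<in> {y}" by auto
    next
      fix N assume N: "openin X N" "pos x \<in> N"
      show "N \<inter> (\<Union>{\<phi>} \<union> (\<Union>a\<in>{y}. oarc (x, a))) \<noteq> {}" using oarc_near_end[OF xy(1) N] by auto
    next
      show "x \<in> V" using AD[OF xy(1)] by simp
      show "{y} \<subseteq> {a. (x, a) \<in> A}" using xy(1) by simp
      show "{\<phi>} \<subseteq> comps D" using \<phi> by simp
    qed
    have "oarc (u, v) \<subseteq> carc (u, v)" using carc_eq[OF v(1)] by auto
    then have "U \<subseteq> O1" using U(3) bxy(2,3) by (auto simp: O1_def)
    then show ?thesis using U by blast
  qed
  have "x \<in> O1" if x: "x \<in> topspace X" for x
  proof (rule connectedin_locally_constant[where P = "\<lambda>x. x \<in> O1" and p = "pos u"])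
    show "connectedin X (topspace X)" using connected by (simp add: connectedin_topspace)
    show "pos u \<in> topspace X" using posX uV by auto
    show "pos u \<in> O1" using carc_eq[OF v(1)] by (auto simp: O1_def)
    fix k assume k: "k \<in> topspace X"
    show "\<exists>W. openin X W \<and> k \<in> W \<and> (\<forall>k'\<in>W \<inter> topspace X. k' \<in> O1 \<longleftrightarrow> k \<in> O1)"
    proof (cases "k \<in> O1")
      case True
      then consider "k \<in> \<phi>" | "k \<in> oarc (u, v)" | "k = pos u" | "k = pos v" using carc_eq[OF v(1)] by (auto simp: O1_def)
      then have "\<exists>W. openin X W \<and> k \<in> W \<and> W \<subseteq> O1"
      proof cases
        case 1
        then show ?thesis using comps_open[OF D_closed \<phi>] by (auto simp: O1_def)
      next
        case 2
        then obtain N where N: "openin X N" "k \<in> N" "N \<subseteq> oarc (u, v) \<union> \<Union>{\<phi> \<in> comps D. borders \<phi> (u, v)}"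
          using edge_local[OF fin v(1)] by metis
        have "N \<subseteq> oarc (u, v) \<union> \<phi>" using N(3) one by blast
        then have "N \<subseteq> O1" using carc_eq[OF v(1)] by (auto simp: O1_def)
        then show ?thesis using N by blast
      next
        case 3
        then show ?thesis using star[OF v(1)] by auto
      next
        case 4
        then show ?thesis using star[OF symA[OF v(1)]] by auto
      qed
      then show ?thesis using True by blast
    next
      case False
      have "closedin X (X closure_of \<phi> \<union> carc (u, v))" using carc_closed[OF v(1)] by (intro closedin_Un) auto
      moreover have "X closure_of \<phi> \<union> carc (u, v) = O1"
      proof -
        have "bd \<phi> \<subseteq> carc (u, v)"
        proof
          fix p assume p: "p \<in> bd \<phi>"
          then have "p \<in> D" using face_frontier(2)[OF \<phi>] by blast
          then consider w where "w \<in> V" "p = pos w" | x y where "(x, y) \<in> A" "p \<in> oarc (x, y)" unfolding D_eq by auto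
          then show "p \<in> carc (u, v)"
          proof cases
            case (1 w)
            then have "w \<in> {u, v}" using p fv by (auto simp: face_vertices_def)
            then show ?thesis using 1 carc_eq[OF v(1)] by auto
          next
            case (2 x y)
            then have "{x, y} = {u, v}" using only[OF 2(1)] p by (auto simp: borders_def)
            then show ?thesis using 2(2) carc_eq[OF v(1)] oarc_sym[OF v(1)] by (auto simp: doubleton_eq_iff)
          qed
        qed
        moreover have "\<phi> \<subseteq> X closure_of \<phi>" using comps_connected(2)[OF \<phi>] by (intro closure_of_subset) auto
        ultimately show ?thesis using face_frontier(1)[OF \<phi>] by (auto simp: O1_def)
      qed
      ultimately have "openin X (topspace X - O1)" by (metis closed_Diff_open)
      then show ?thesis using False k by (intro exI[of _ "topspace X - O1"]) auto
    qed
  qed (use x in auto)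
  then have all: "topspace X \<subseteq> O1" by blast
  have "V \<subseteq> {u, v}"
  proof
    fix w assume w: "w \<in> V"
    then have "pos w \<in> O1" using all posX by auto
    moreover have "pos w \<notin> \<phi>" using pos_D[OF w] comps_connected(2)[OF \<phi>] by blast
    ultimately have "pos w = pos u \<or> pos w = pos v" using carc_eq[OF v(1)] oarc_pos[OF v(1) w] by (auto simp: O1_def)
    then show "w \<in> {u, v}" using inj_pos w AD[OF v(1)] by (auto simp: inj_on_def)
  qed
  then have "card V \<le> 2" using card_mono[of "{u, v}" V] uv by simp
  then show False using V3 by simp
qed

lemma euler_inequality:
  assumes F: "F \<in> comps D" and V: "V \<noteq> {}"
  shows "finite (comps D)" "2 * int (card (comps D)) \<ge> 4 + int (card A) - 2 * int (card V) - 2 * euler_genus X"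
proof -
  obtain k where k: "excess D k" "2 * k = int (card A) - 2 * int (card V)" using excess_drawing by blast
  have ne: "D \<noteq> {}" "topspace X - D \<noteq> {}" using pos_D V comps_connected[OF F] by blast+
  show "finite (comps D)" using comps_card_ge(1)[OF k(1) ne] .
  show "2 * int (card (comps D)) \<ge> 4 + int (card A) - 2 * int (card V) - 2 * euler_genus X"
    using comps_card_ge(2)[OF k(1) ne] k(2) by linarith
qed

text \<open>Counting sides of edges face by face: all faces have at least three, and the face \<open>F\<close> has at least as many as
  vertices. Each edge is represented by two arcs, so the sums over the arcs count every edge side
  twice.\<close>

theorem face_count:
  assumes F: "F \<in> comps D" and V3: "card V \<ge> 3" and deg: "\<And>v. v \<in> V \<Longrightarrow> nbrs v \<noteq> {}"
  shows "int (card A) + 2 * int (max 3 (card (face_vertices F))) \<le> 6 * int (card V) + 6 * euler_genus X - 6"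
    and "int (card A) + 2 * int (card (face_vertices F)) = 6 * int (card V) + 6 * euler_genus X - 6 \<Longrightarrow>
      \<phi> \<in> comps D \<Longrightarrow> \<phi> \<noteq> F \<Longrightarrow> (\<Sum>a\<in>A. sides \<phi> a) = 6"
proof -
  have V0: "V \<noteq> {}" using V3 by auto
  note eul = euler_inequality[OF F V0]
  note fin = eul(1)
  let ?s = "\<lambda>\<phi>. \<Sum>a\<in>A. sides \<phi> a"
  have s6: "?s \<phi> \<ge> 6" if "\<phi> \<in> comps D" for \<phi>
    using sum_sides_ge[OF fin that deg] face_three_vertices[OF fin that deg V3] by simp
  have sF: "?s F \<ge> 2 * max 3 (card (face_vertices F))"
    using sum_sides_ge[OF fin F deg] s6[OF F] by simp
  have tot: "(\<Sum>\<phi>\<in>comps D. ?s \<phi>) = 2 * card A"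
  proof -
    have "(\<Sum>\<phi>\<in>comps D. ?s \<phi>) = (\<Sum>a\<in>A. \<Sum>\<phi>\<in>comps D. sides \<phi> a)" by (rule sum.swap)
    also have "\<dots> = (\<Sum>a\<in>A. 2)" using sum_sides_faces[OF fin] by (intro sum.cong) auto
    finally show ?thesis by simp
  qed
  have split: "(\<Sum>\<phi>\<in>comps D. ?s \<phi>) = ?s F + (\<Sum>\<phi>\<in>comps D - {F}. ?s \<phi>)" using fin F by (rule sum.remove)
  have cardF: "card (comps D) = Suc (card (comps D - {F}))" using fin F by (rule card.remove)
  have rest: "(\<Sum>\<phi>\<in>comps D - {F}. ?s \<phi>) \<ge> 6 * card (comps D - {F})"
    using sum_mono[of "comps D - {F}" "\<lambda>_. 6" ?s] s6 by simp
  show "int (card A) + 2 * int (max 3 (card (face_vertices F))) \<le> 6 * int (card V) + 6 * euler_genus X - 6"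
    using eul(2) tot split rest sF cardF by linarith
  assume eq: "int (card A) + 2 * int (card (face_vertices F)) = 6 * int (card V) + 6 * euler_genus X - 6"
    and \<phi>: "\<phi> \<in> comps D" "\<phi> \<noteq> F"
  have split2: "(\<Sum>\<phi>\<in>comps D - {F}. ?s \<phi>) = ?s \<phi> + (\<Sum>\<phi>\<in>comps D - {F} - {\<phi>}. ?s \<phi>)"
    using fin \<phi> by (intro sum.remove) auto
  have card2: "card (comps D - {F}) = Suc (card (comps D - {F} - {\<phi>}))" using fin \<phi> by (intro card.remove) auto
  have rest2: "(\<Sum>\<phi>\<in>comps D - {F} - {\<phi>}. ?s \<phi>) \<ge> 6 * card (comps D - {F} - {\<phi>})"
    using sum_mono[of "comps D - {F} - {\<phi>}" "\<lambda>_. 6" ?s] s6 by simp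
  show "?s \<phi> = 6"
    using eul(2) tot split sF cardF split2 card2 rest2 s6[OF \<phi>(1)] eq by linarith
qed

text \<open>With three vertices and three edge sides, two at each vertex, the sides must form a triangle: each pair of
  vertices accounts for one of them.\<close>

lemma triangular_face:
  assumes fin: "finite (comps D)" and \<phi>: "\<phi> \<in> comps D" and deg: "\<And>v. v \<in> V \<Longrightarrow> nbrs v \<noteq> {}" and V3: "card V \<ge> 3"
    and six: "(\<Sum>a\<in>A. sides \<phi> a) = 6" and ca: "(c, a) \<in> A" "borders \<phi> (c, a)"
  obtains b where "b \<noteq> a" "(c, b) \<in> A" "borders \<phi> (c, b)" "(a, b) \<in> A"
    "\<forall>d. (c, d) \<in> A \<longrightarrow> borders \<phi> (c, d) \<longrightarrow> d = a \<or> d = b"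
proof -
  let ?S = "\<lambda>v. \<Sum>u\<in>nbrs v. sides \<phi> (v, u)"
  have finfv: "finite (face_vertices \<phi>)" using finV by (simp add: face_vertices_def)
  have fvV: "face_vertices \<phi> \<subseteq> V" by (auto simp: face_vertices_def)
  have c3: "card (face_vertices \<phi>) = 3"
    using sum_sides_ge[OF fin \<phi> deg] face_three_vertices[OF fin \<phi> deg V3] six by simp
  have ge2: "?S v \<ge> 2" if "v \<in> face_vertices \<phi>" for v using sum_sides_vertex[OF fin \<phi> that] deg that fvV by blast
  have tot: "(\<Sum>v\<in>face_vertices \<phi>. ?S v) \<le> 6"
    unfolding six[symmetric] sum_sides_arcs using finV fvV by (intro sum_mono2) auto
  have S2: "?S v = 2" if v: "v \<in> face_vertices \<phi>" for v
  proof -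
    have "(\<Sum>v\<in>face_vertices \<phi>. ?S v) = ?S v + (\<Sum>v\<in>face_vertices \<phi> - {v}. ?S v)" using finfv v by (rule sum.remove)
    moreover have "(\<Sum>v\<in>face_vertices \<phi> - {v}. ?S v) \<ge> 2 * card (face_vertices \<phi> - {v})"
      using sum_mono[of "face_vertices \<phi> - {v}" "\<lambda>_. 2" ?S] ge2 by simp
    moreover have "card (face_vertices \<phi> - {v}) = 2" using c3 v finfv by simp
    ultimately show ?thesis using tot ge2[OF v] by linarith
  qed
  have mem: "c \<in> face_vertices \<phi>" "a \<in> face_vertices \<phi>" "c \<noteq> a"
    using borders_all(2,3)[OF \<phi> ca] AD[OF ca(1)] ca(1) irrefl by (auto simp: face_vertices_def)
  obtain b where b: "face_vertices \<phi> = {c, a, b}" "b \<noteq> c" "b \<noteq> a"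
  proof -
    have "card (face_vertices \<phi> - {c, a}) = 1" using c3 mem finfv by (simp add: card_Diff_subset)
    then obtain b where "face_vertices \<phi> - {c, a} = {b}" by (auto simp: card_1_singleton_iff)
    then show ?thesis using that[of b] mem by blast
  qed
  define w where "w x y = (if (x, y) \<in> A then sides \<phi> (x, y) else 0)" for x y
  have wsym: "w x y = w y x" for x y unfolding w_def using symA sides_sym by metis
  have Sw: "?S x = w x y + w x z" if "face_vertices \<phi> = {x, y, z}" "x \<noteq> y" "x \<noteq> z" "y \<noteq> z" for x y z
  proof -
    have "?S x = (\<Sum>u\<in>nbrs x \<inter> {y, z}. sides \<phi> (x, u))"
    proof (rule sum.mono_neutral_right)
      show "\<forall>i\<in>nbrs x - nbrs x \<inter> {y, z}. sides \<phi> (x, i) = 0"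
      proof
        fix i assume i: "i \<in> nbrs x - nbrs x \<inter> {y, z}"
        then have "i \<noteq> x" using irrefl by (auto simp: nbrs_def)
        then show "sides \<phi> (x, i) = 0" using i that(1) by (intro sides_zero[OF \<phi>]) (auto simp: nbrs_def)
      qed
    qed (use nbrs_finite in auto)
    also have "\<dots> = (\<Sum>u\<in>{y, z}. w x u)"
      by (intro sum.mono_neutral_cong_left) (auto simp: w_def nbrs_def)
    also have "\<dots> = w x y + w x z" using that by simp
    finally show ?thesis .
  qed
  have e1: "w c a + w c b = 2" using Sw[of c a b] S2[OF mem(1)] b mem(3) by auto
  have e2: "w a c + w a b = 2" using Sw[of a c b] S2[OF mem(2)] b mem(3) by (auto simp: insert_commute)
  have "b \<in> face_vertices \<phi>" using b by auto
  then have e3: "w b c + w b a = 2" using Sw[of b c a] S2[of b] b mem(3) by (auto simp: insert_commute)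
  have "w c b = 1" "w a b = 1" using e1 e2 e3 wsym[of a c] wsym[of b c] wsym[of b a] by linarith+
  then have cb: "(c, b) \<in> A" "borders \<phi> (c, b)" "(a, b) \<in> A" by (auto simp: w_def sides_def split: if_splits)
  show ?thesis
  proof (rule that[OF b(3) cb], intro allI impI)
    fix d assume "(c, d) \<in> A" "borders \<phi> (c, d)"
    then have "d \<in> face_vertices \<phi>" "d \<noteq> c" using borders_all(3)[OF \<phi>, of c d] AD[of c d] irrefl by (auto simp: face_vertices_def)
    then show "d = a \<or> d = b" using b by auto
  qed
qed

text \<open>If the count is tight, all faces but \<open>F\<close> are triangles. Around a vertex off \<open>F\<close>, the edges to \<open>N1\<close> and
  the triangles along them would be closed under incidence if no edge left \<open>N1\<close>, and would fill a punctured
  neighbourhood without the other edges.\<close>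

theorem tight_link_connected:
  assumes F: "F \<in> comps D" and V3: "card V \<ge> 3" and deg: "\<And>v. v \<in> V \<Longrightarrow> nbrs v \<noteq> {}"
    and tight: "int (card A) + 2 * int (card (face_vertices F)) = 6 * int (card V) + 6 * euler_genus X - 6"
    and c: "c \<in> V" "c \<notin> face_vertices F" and N: "N1 \<subseteq> nbrs c" "N1 \<noteq> {}" "N1 \<noteq> nbrs c"
  obtains a b where "a \<in> N1" "b \<in> nbrs c - N1" "(a, b) \<in> A"
proof (rule ccontr)
  assume "\<not> thesis"
  then have no: "(a, b) \<notin> A" if "a \<in> N1" "b \<in> nbrs c - N1" for a b using that \<open>\<And>a b. \<lbrakk>a \<in> N1; b \<in> nbrs c - N1; (a, b) \<in> A\<rbrakk> \<Longrightarrow> thesis\<close> by blast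
  have V0: "V \<noteq> {}" using V3 by auto
  note fin = euler_inequality(1)[OF F V0]
  have notF: "\<phi> \<noteq> F" if "\<phi> \<in> comps D" "(c, a) \<in> A" "borders \<phi> (c, a)" for \<phi> a
    using borders_all(2)[OF that] c by (auto simp: face_vertices_def)
  define \<Phi>1 where "\<Phi>1 = {\<phi> \<in> comps D. \<exists>a\<in>N1. borders \<phi> (c, a)}"
  obtain a0 where a0: "a0 \<in> N1" using N by auto
  obtain U where U: "openin X U" "pos c \<in> U" "U - {pos c} \<subseteq> \<Union>\<Phi>1 \<union> (\<Union>a\<in>N1. oarc (c, a))"
  proof (rule star_connected[OF fin c(1), of N1 \<Phi>1])
    show "N1 \<subseteq> {a. (c, a) \<in> A}" using N by (auto simp: nbrs_def)
    show "\<Phi>1 \<subseteq> comps D" by (auto simp: \<Phi>1_def)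
    fix a \<phi> assume a: "(c, a) \<in> A" and \<phi>: "\<phi> \<in> comps D" "borders \<phi> (c, a)"
    have "a \<in> N1" if "\<phi> \<in> \<Phi>1"
    proof -
      obtain a' where a': "a' \<in> N1" "borders \<phi> (c, a')" using \<open>\<phi> \<in> \<Phi>1\<close> by (auto simp: \<Phi>1_def)
      have ca': "(c, a') \<in> A" using a' N by (auto simp: nbrs_def)
      have six: "(\<Sum>a\<in>A. sides \<phi> a) = 6" using face_count(2)[OF F V3 deg tight \<phi>(1) notF[OF \<phi>(1) a \<phi>(2)]] by blast
      obtain b where b: "b \<noteq> a'" "(c, b) \<in> A" "borders \<phi> (c, b)" "(a', b) \<in> A"
          "\<forall>d. (c, d) \<in> A \<longrightarrow> borders \<phi> (c, d) \<longrightarrow> d = a' \<or> d = b"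
        by (rule triangular_face[OF fin \<phi>(1) deg V3 six ca' a'(2)])
      have "b \<in> N1" using no[OF a'(1), of b] b by (auto simp: nbrs_def)
      then show ?thesis using b(5) a \<phi>(2) a'(1) by blast
    qed
    moreover have "\<phi> \<in> \<Phi>1" if "a \<in> N1" using that \<phi> by (auto simp: \<Phi>1_def)
    ultimately show "\<phi> \<in> \<Phi>1 \<longleftrightarrow> a \<in> N1" by blast
  next
    fix M assume M: "openin X M" "pos c \<in> M"
    have "(c, a0) \<in> A" using a0 N by (auto simp: nbrs_def)
    then show "M \<inter> (\<Union>\<Phi>1 \<union> (\<Union>a\<in>N1. oarc (c, a))) \<noteq> {}" using oarc_near_end[OF _ M, of a0] a0 by blast
  qed
  obtain b where b: "b \<in> nbrs c" "b \<notin> N1" using N by blast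
  then have cb: "(c, b) \<in> A" by (simp add: nbrs_def)
  obtain p where p: "p \<in> U" "p \<in> oarc (c, b)" using oarc_near_end[OF cb U(1,2)] by blast
  have "p \<noteq> pos c" using oarc_pos[OF cb c(1)] p by auto
  then have "p \<in> \<Union>\<Phi>1 \<union> (\<Union>a\<in>N1. oarc (c, a))" using p U(3) by blast
  moreover have "p \<notin> \<Union>\<Phi>1" using oarc_D[OF cb] p(2) comps_connected(2) by (fastforce simp: \<Phi>1_def)
  moreover have "p \<notin> oarc (c, a)" if "a \<in> N1" for a
    using oarc_disj[OF cb, of c a] that b N p(2) by (auto simp: nbrs_def doubleton_eq_iff)
  ultimately show False by blast
qed

end

section \<open>List colouring\<close>

locale simple_graph =
  fixes A :: "('v \<times> 'v) set"
  assumes adj_sym: "(u, v) \<in> A \<Longrightarrow> (v, u) \<in> A"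
    and adj_irrefl: "(v, v) \<notin> A"
begin

definition nbs :: "'v set \<Rightarrow> 'v \<Rightarrow> 'v set" where
  "nbs S v = {u \<in> S. (v, u) \<in> A}"

definition coloring :: "'v set \<Rightarrow> ('v \<Rightarrow> 'c set) \<Rightarrow> ('v \<Rightarrow> 'c) \<Rightarrow> bool" where
  "coloring S L c \<longleftrightarrow> (\<forall>v\<in>S. c v \<in> L v) \<and> (\<forall>u\<in>S. \<forall>v\<in>S. (u, v) \<in> A \<longrightarrow> c u \<noteq> c v)"

definition colorable :: "'v set \<Rightarrow> ('v \<Rightarrow> 'c set) \<Rightarrow> bool" where
  "colorable S L \<longleftrightarrow> (\<exists>c. coloring S L c)"

text \<open>Connectedness of the induced subgraph, in terms of cuts.\<close>

definition linked :: "'v set \<Rightarrow> bool" where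
  "linked S \<longleftrightarrow> (\<forall>T. T \<subseteq> S \<longrightarrow> T \<noteq> {} \<longrightarrow> T \<noteq> S \<longrightarrow> (\<exists>a\<in>T. \<exists>b\<in>S - T. (a, b) \<in> A))"

lemma nbs_finite: "finite S \<Longrightarrow> finite (nbs S v)"
  by (simp add: nbs_def)

lemma nbs_mono: "S \<subseteq> T \<Longrightarrow> nbs S v \<subseteq> nbs T v"
  by (auto simp: nbs_def)

lemma nbs_subset: "nbs S v \<subseteq> S - {v}"
  using adj_irrefl by (auto simp: nbs_def)

lemma linked_step:
  assumes "linked S" "T \<subseteq> S" "T \<noteq> {}" "T \<noteq> S"
  obtains a b where "a \<in> T" "b \<in> S - T" "(a, b) \<in> A"
  using assms unfolding linked_def by meson

text \<open>After the vertices in \<open>P\<close> have been coloured, the others lose the colours of their neighbours in \<open>P\<close>.\<close>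

lemma coloring_extend:
  assumes c: "coloring P L c" and d: "coloring R (\<lambda>v. L v - c ` nbs P v) d" and disj: "P \<inter> R = {}"
  shows "coloring (P \<union> R) L (\<lambda>v. if v \<in> R then d v else c v)"
proof -
  have x: "d v \<noteq> c u" if "v \<in> R" "u \<in> P" "(v, u) \<in> A" for u v
    using d that by (auto simp: coloring_def nbs_def)
  show ?thesis
    unfolding coloring_def
  proof (intro conjI ballI impI)
    fix v assume "v \<in> P \<union> R"
    then show "(if v \<in> R then d v else c v) \<in> L v" using c d by (auto simp: coloring_def)
  next
    fix u v assume uv: "u \<in> P \<union> R" "v \<in> P \<union> R" "(u, v) \<in> A"
    then show "(if u \<in> R then d u else c u) \<noteq> (if v \<in> R then d v else c v)"
      using c d x[of u v] x[of v u] adj_sym[OF uv(3)] by (auto simp: coloring_def)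
  qed
qed

text \<open>Greedy colouring: a vertex with more colours than neighbours may wait until the end.\<close>

lemma degenerate_colorable:
  assumes "finite S" and "\<And>T. T \<subseteq> S \<Longrightarrow> T \<noteq> {} \<Longrightarrow> \<exists>w\<in>T. card (nbs T w) < card (L w)"
  shows "colorable S L"
  using assms
proof (induction S rule: finite_psubset_induct)
  case (psubset S)
  show ?case
  proof (cases "S = {}")
    case True
    then show ?thesis by (auto simp: colorable_def coloring_def)
  next
    case False
    then obtain w where w: "w \<in> S" "card (nbs S w) < card (L w)" using psubset.prems[of S] by auto
    have "colorable (S - {w}) L"
    proof (rule psubset.IH)
      fix T assume "T \<subseteq> S - {w}" "T \<noteq> {}"
      then show "\<exists>w\<in>T. card (nbs T w) < card (L w)" using psubset.prems[of T] by blast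
    qed (use w in auto)
    then obtain c where c: "coloring (S - {w}) L c" by (auto simp: colorable_def)
    have "card (c ` nbs (S - {w}) w) \<le> card (nbs S w)"
      using card_image_le[of "nbs (S - {w}) w" c] card_mono[OF nbs_finite[OF psubset.hyps(1)] nbs_mono[of "S - {w}" S w]]
        nbs_finite[of "S - {w}" w] psubset.hyps by auto
    then have "\<not> L w \<subseteq> c ` nbs (S - {w}) w"
      using w(2) card_mono[of "c ` nbs (S - {w}) w" "L w"] nbs_finite[of "S - {w}" w] psubset.hyps by auto
    then obtain x where "x \<in> L w" "x \<notin> c ` nbs (S - {w}) w" by blast
    then have "coloring {w} (\<lambda>v. L v - c ` nbs (S - {w}) v) (\<lambda>_. x)"
      using adj_irrefl by (auto simp: coloring_def)
    then have "coloring (S - {w} \<union> {w}) L (\<lambda>v. if v \<in> {w} then x else c v)" by (intro coloring_extend[OF c]) auto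
    then show ?thesis using w by (auto simp: colorable_def insert_absorb)
  qed
qed

text \<open>Colour the vertices in order of decreasing distance to \<open>r\<close>: each one still has an uncoloured neighbour when it
  is its turn, and \<open>r\<close> has a spare colour.\<close>

lemma linked_slack_colorable:
  assumes "finite S" "linked S" "\<And>v. v \<in> S \<Longrightarrow> card (nbs S v) \<le> card (L v)" "r \<in> S" "card (nbs S r) < card (L r)"
  shows "colorable S L"
proof (rule degenerate_colorable[OF assms(1)])
  fix T assume T: "T \<subseteq> S" "T \<noteq> {}"
  show "\<exists>w\<in>T. card (nbs T w) < card (L w)"
  proof (cases "T = S")
    case True
    then show ?thesis using assms by auto
  next
    case False
    obtain a b where ab: "a \<in> T" "b \<in> S - T" "(a, b) \<in> A" using linked_step[OF assms(2) T False] by blast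
    have "nbs T a \<subset> nbs S a" using ab T by (auto simp: nbs_def)
    then have "card (nbs T a) < card (nbs S a)" using nbs_finite[OF assms(1)] by (intro psubset_card_mono)
    then show ?thesis using assms(3)[of a] ab T by (intro bexI[of _ a]) auto
  qed
qed

lemma degree_sum:
  assumes "finite S" shows "card (A \<inter> S \<times> S) = (\<Sum>v\<in>S. card (nbs S v))"
proof -
  have "A \<inter> S \<times> S = Sigma S (nbs S)" by (auto simp: nbs_def)
  then show ?thesis using card_SigmaI[OF assms, of "nbs S"] nbs_finite[OF assms] by simp
qed

end

section \<open>Systems of distinct representatives\<close>

text \<open>Hall's theorem. If some proper subset has just as many colours as elements, it is treated first, and the rest keeps
  Hall's condition without its colours; otherwise there is room to spare and any colour may be given to any
  element.\<close>

theorem hall: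
  fixes L :: "'v \<Rightarrow> 'c set"
  assumes "finite S" "\<And>v. v \<in> S \<Longrightarrow> finite (L v)" "\<And>T. T \<subseteq> S \<Longrightarrow> card T \<le> card (\<Union> (L ` T))"
  shows "\<exists>c. inj_on c S \<and> (\<forall>v\<in>S. c v \<in> L v)"
  using assms
proof (induction S arbitrary: L rule: finite_psubset_induct)
  case (psubset S)
  have finU: "finite (\<Union> (L ` T))" if "T \<subseteq> S" for T using psubset.prems(1) psubset.hyps that by (auto intro: finite_subset)
  show ?case
  proof (cases "\<exists>T. T \<subset> S \<and> T \<noteq> {} \<and> card (\<Union> (L ` T)) = card T")
    case True
    then obtain T where T: "T \<subset> S" "T \<noteq> {}" "card (\<Union> (L ` T)) = card T" by blast
    have finT: "finite T" using T psubset.hyps by (auto intro: finite_subset)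
    obtain c where c: "inj_on c T" "\<forall>v\<in>T. c v \<in> L v"
      using psubset.IH[OF T(1), of L] psubset.prems T(1) by blast
    define L' where "L' v = L v - \<Union> (L ` T)" for v
    have "\<exists>d. inj_on d (S - T) \<and> (\<forall>v\<in>S - T. d v \<in> L' v)"
    proof (rule psubset.IH)
      show "S - T \<subset> S" using T by auto
      fix R assume R: "R \<subseteq> S - T"
      have finR: "finite R" using R psubset.hyps by (auto intro: finite_subset)
      have "card T + card R = card (T \<union> R)" using R finR finT by (subst card_Un_disjoint) auto
      also have "\<dots> \<le> card (\<Union> (L ` (T \<union> R)))" using psubset.prems(2)[of "T \<union> R"] R T by auto
      also have "\<Union> (L ` (T \<union> R)) = \<Union> (L ` T) \<union> \<Union> (L' ` R)" by (auto simp: L'_def)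
      also have "card \<dots> \<le> card (\<Union> (L ` T)) + card (\<Union> (L' ` R))" by (rule card_Un_le)
      finally show "card R \<le> card (\<Union> (L' ` R))" using T(3) by simp
    qed (use psubset.prems(1) in \<open>auto simp: L'_def\<close>)
    then obtain d where d: "inj_on d (S - T)" "\<forall>v\<in>S - T. d v \<in> L' v" by blast
    let ?c = "\<lambda>v. if v \<in> T then c v else d v"
    have "inj_on ?c S"
    proof (rule inj_onI)
      fix u v assume uv: "u \<in> S" "v \<in> S" "?c u = ?c v"
      have cross: "c x \<noteq> d y" if "x \<in> T" "y \<in> S - T" for x y
        using c(2) d(2) that by (auto simp: L'_def)
      show "u = v"
        using uv c(1) d(1) cross[of u v] cross[of v u] by (auto simp: inj_on_def split: if_splits)
    qed
    moreover have "\<forall>v\<in>S. ?c v \<in> L v" using c d by (auto simp: L'_def)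
    ultimately show ?thesis by blast
  next
    case False
    have strict: "card T < card (\<Union> (L ` T))" if "T \<subset> S" "T \<noteq> {}" for T
      using False psubset.prems(2)[of T] that by (metis le_neq_implies_less psubset_imp_subset)
    show ?thesis
    proof (cases "S = {}")
      case False
      then obtain w where w: "w \<in> S" by blast
      have "card {w} \<le> card (\<Union> (L ` {w}))" using w by (intro psubset.prems) auto
      then have "L w \<noteq> {}" by (auto simp: card_gt_0_iff Suc_le_eq)
      then obtain x where x: "x \<in> L w" by blast
      have "\<exists>d. inj_on d (S - {w}) \<and> (\<forall>v\<in>S - {w}. d v \<in> L v - {x})"
      proof (rule psubset.IH)
        fix R assume R: "R \<subseteq> S - {w}"
        show "card R \<le> card (\<Union>v\<in>R. L v - {x})"
        proof (cases "R = {}")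
          case False
          have eq: "(\<Union>v\<in>R. L v - {x}) = \<Union> (L ` R) - {x}" by auto
          have "card (\<Union> (L ` R) - {x}) \<ge> card (\<Union> (L ` R)) - 1"
            using finU[of R] R by (simp add: card_Diff_singleton_if)
          moreover have "card R < card (\<Union> (L ` R))" using R w False by (intro strict) auto
          ultimately show ?thesis unfolding eq by linarith
        qed simp
      qed (use w psubset.prems(1) in auto)
      then obtain d where d: "inj_on d (S - {w})" "\<forall>v\<in>S - {w}. d v \<in> L v - {x}" by blast
      have "inj_on (d(w := x)) S"
        using d w by (auto simp: inj_on_def)
      moreover have "\<forall>v\<in>S. (d(w := x)) v \<in> L v" using d x by auto
      ultimately show ?thesis by blast
    qed auto
  qed
qed

section \<open>Disjoint pairs of nonadjacent vertices\<close>

context simple_graph begin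

text \<open>A matching in the complement graph, with an arbitrary orientation of its edges.\<close>

definition antimatching :: "'v set \<Rightarrow> ('v \<times> 'v) set \<Rightarrow> bool" where
  "antimatching S M \<longleftrightarrow> M \<subseteq> S \<times> S \<and> (\<forall>(x, y)\<in>M. x \<noteq> y \<and> (x, y) \<notin> A) \<and>
     (\<forall>p\<in>M. \<forall>q\<in>M. p \<noteq> q \<longrightarrow> {fst p, snd p} \<inter> {fst q, snd q} = {})"

lemma antimatching_transversal:
  assumes "antimatching S M" "finite S" "T \<subseteq> S" "\<And>x y. (x, y) \<in> M \<Longrightarrow> x \<notin> T \<or> y \<notin> T"
  shows "card T + card M \<le> card S"
proof -
  define f where "f p = (if fst p \<in> T then snd p else fst p)" for p :: "'v \<times> 'v"
  have "f p \<in> S - T" if "p \<in> M" for p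
    using that assms(1) assms(4)[of "fst p" "snd p"] by (auto simp: f_def antimatching_def)
  moreover have "inj_on f M"
  proof (rule inj_onI, rule ccontr)
    fix p q assume pq: "p \<in> M" "q \<in> M" "f p = f q" "p \<noteq> q"
    then have "{fst p, snd p} \<inter> {fst q, snd q} = {}" using assms(1) by (auto simp: antimatching_def)
    moreover have "f p \<in> {fst p, snd p}" "f q \<in> {fst q, snd q}" by (auto simp: f_def)
    ultimately show False using pq(3) by auto
  qed
  ultimately have "card M \<le> card (S - T)" using assms(2) by (intro card_inj_on_le[of f]) auto
  then show ?thesis using assms(2,3) card_mono[of S T] by (simp add: card_Diff_subset finite_subset)
qed

text \<open>A pair whose lists share a colour receives this colour twice; after removing the pair and the
  colour, all hypotheses are preserved. If no pair shares a colour, the two lists of a pair together have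
  at least \<open>2 s\<close> colours, no fewer than there are vertices, so Hall's condition can only fail for sets that contain no pair,
  and these are small.\<close>

theorem antimatching_colorable:
  assumes "finite P" "finite Q" "P \<inter> Q = {}" "antimatching P M"
    and "\<And>v. v \<in> P \<union> Q \<Longrightarrow> finite (L v)"
    and "\<And>v. v \<in> P \<Longrightarrow> s \<le> card (L v)" "card P \<le> s + card M" "card (P \<union> Q) \<le> 2 * s"
    and "\<And>v. v \<in> Q \<Longrightarrow> card (P \<union> Q) \<le> card (L v) + card M"
  shows "colorable (P \<union> Q) L"
  using assms
proof (induction "card M" arbitrary: M P L s rule: less_induct)
  case less
  note A = less.prems
  show ?case
  proof (cases "\<exists>x y. (x, y) \<in> M \<and> L x \<inter> L y \<noteq> {}")
    case True
    then obtain x y \<alpha> where xy: "(x, y) \<in> M" "\<alpha> \<in> L x" "\<alpha> \<in> L y" by blast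
    have xyP: "x \<in> P" "y \<in> P" "x \<noteq> y" "(x, y) \<notin> A" using A(4) xy(1) by (auto simp: antimatching_def)
    have finM: "finite M" using A(1,4) by (auto simp: antimatching_def intro: finite_subset)
    define P' where "P' = P - {x, y}"
    have PQ: "P \<union> Q - {x, y} = P' \<union> Q" using A(3) xyP by (auto simp: P'_def)
    have cM: "card M = Suc (card (M - {(x, y)}))" using finM xy(1) by (rule card.remove)
    have cP: "card P = card P' + 2"
    proof -
      have "card (P - {x}) = Suc (card (P - {x} - {y}))" using A(1) xyP by (intro card.remove) auto
      moreover have "card P = Suc (card (P - {x}))" using A(1) xyP(1) by (rule card.remove)
      moreover have "P - {x} - {y} = P'" by (auto simp: P'_def)
      ultimately show ?thesis by simp
    qed
    have cS: "card (P \<union> Q) = card (P' \<union> Q) + 2"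
    proof -
      have "card (P \<union> Q) = card P + card Q" "card (P' \<union> Q) = card P' + card Q"
        using A(1-3) by (auto simp: P'_def intro!: card_Un_disjoint)
      then show ?thesis using cP by simp
    qed
    have drop: "card (L v) \<le> card (L v - {\<alpha>}) + 1" for v
      by (auto simp: card_Diff_singleton_if)
    have "colorable (P' \<union> Q) (\<lambda>v. L v - {\<alpha>})"
    proof (rule less.hyps[of "M - {(x, y)}" P' "\<lambda>v. L v - {\<alpha>}" "s - 1"])
      show "card (M - {(x, y)}) < card M" using cM by simp
      show "antimatching P' (M - {(x, y)})"
      proof -
        have "p \<in> P' \<times> P'" if p: "p \<in> M - {(x, y)}" for p
        proof -
          have "{fst (x, y), snd (x, y)} \<inter> {fst p, snd p} = {}" "p \<in> P \<times> P"
            using A(4) xy(1) p unfolding antimatching_def by blast+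
          then show ?thesis by (cases p) (auto simp: P'_def)
        qed
        then show ?thesis using A(4) unfolding antimatching_def by blast
      qed
      show "card P' \<le> s - 1 + card (M - {(x, y)})" using A(7) cM cP by linarith
      show "card (P' \<union> Q) \<le> 2 * (s - 1)" using A(8) cS by linarith
      show "s - 1 \<le> card (L v - {\<alpha>})" if "v \<in> P'" for v
        using A(6)[of v] drop[of v] that by (auto simp: P'_def)
      show "card (P' \<union> Q) \<le> card (L v - {\<alpha>}) + card (M - {(x, y)})" if "v \<in> Q" for v
        using A(9)[of v] drop[of v] that cM cS by simp
    qed (use A in \<open>auto simp: P'_def\<close>)
    then obtain d where d: "coloring (P' \<union> Q) (\<lambda>v. L v - {\<alpha>}) d" by (auto simp: colorable_def)
    have c: "coloring {x, y} L (\<lambda>_. \<alpha>)"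
      using xy xyP(4) adj_sym[of y x] adj_irrefl by (auto simp: coloring_def)
    have "coloring (P' \<union> Q) (\<lambda>v. L v - (\<lambda>_. \<alpha>) ` nbs {x, y} v) d"
      using d unfolding coloring_def by blast
    then have "coloring ({x, y} \<union> (P' \<union> Q)) L (\<lambda>v. if v \<in> P' \<union> Q then d v else \<alpha>)"
      using A(3) xyP by (intro coloring_extend[OF c]) (auto simp: P'_def)
    moreover have "{x, y} \<union> (P' \<union> Q) = P \<union> Q" using PQ xyP by auto
    ultimately show ?thesis by (auto simp: colorable_def)
  next
    case False
    have "\<exists>c. inj_on c (P \<union> Q) \<and> (\<forall>v\<in>P \<union> Q. c v \<in> L v)"
    proof (rule hall)
      fix T assume T: "T \<subseteq> P \<union> Q"
      have finT: "finite T" using T A(1,2) by (auto intro: finite_subset)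
      have fU: "finite (\<Union> (L ` T))" using A(5) T finT by auto
      have Lle: "card (L v) \<le> card (\<Union> (L ` T))" if "v \<in> T" for v using fU that by (intro card_mono) auto
      show "card T \<le> card (\<Union> (L ` T))"
      proof (cases "\<exists>x y. (x, y) \<in> M \<and> x \<in> T \<and> y \<in> T")
        case True
        then obtain x y where xy: "(x, y) \<in> M" "x \<in> T" "y \<in> T" by blast
        have "x \<in> P" "y \<in> P" using A(4) xy(1) by (auto simp: antimatching_def)
        then have "2 * s \<le> card (L x) + card (L y)" using A(6)[of x] A(6)[of y] by simp
        also have "\<dots> = card (L x \<union> L y)" using False xy(1) A(5) T xy by (subst card_Un_disjoint) auto
        also have "\<dots> \<le> card (\<Union> (L ` T))" using fU xy by (intro card_mono) auto
        finally have "2 * s \<le> card (\<Union> (L ` T))" .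
        moreover have "card T \<le> card (P \<union> Q)" using T A(1,2) by (intro card_mono) auto
        ultimately show ?thesis using A(8) by linarith
      next
        case noP: False
        \<comment> \<open>A set without a pair misses an element of each pair.\<close>
        show ?thesis
        proof (cases "T \<subseteq> P")
          case True
          have "card T + card M \<le> card P" using noP by (intro antimatching_transversal[OF A(4,1) True]) auto
          then have "card T \<le> s" using A(7) by linarith
          then show ?thesis using A(6) Lle True by (cases "T = {}") fastforce+
        next
          case False
          then obtain v where v: "v \<in> T" "v \<in> Q" using T by auto
          have "antimatching (P \<union> Q) M" using A(4) unfolding antimatching_def by blast
          then have "card T + card M \<le> card (P \<union> Q)" using noP T A(1,2) by (intro antimatching_transversal) auto
          then show ?thesis using A(9)[OF v(2)] Lle[OF v(1)] by linarith
        qed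
      qed
    qed (use A in auto)
    then obtain c where c: "inj_on c (P \<union> Q)" "\<forall>v\<in>P \<union> Q. c v \<in> L v" by blast
    have "coloring (P \<union> Q) L c"
      unfolding coloring_def
    proof (intro conjI ballI impI)
      fix u v assume uv: "u \<in> P \<union> Q" "v \<in> P \<union> Q" "(u, v) \<in> A"
      then have "u \<noteq> v" using adj_irrefl by auto
      then show "c u \<noteq> c v" using c(1) uv by (auto dest: inj_onD)
    qed (use c in auto)
    then show ?thesis by (auto simp: colorable_def)
  qed
qed

text \<open>Every missing edge meets the \<open>2 |M|\<close> vertices of a maximal antimatching \<open>M\<close>, and the edges in \<open>M\<close> meet them
  twice. Missing edges are counted as ordered pairs.\<close>

lemma maximal_antimatching:
  assumes finS: "finite S" and d: "\<And>v. v \<in> S \<Longrightarrow> card (S - {v} - nbs S v) \<le> d"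
  obtains M where "antimatching S M" "card {(x, y) \<in> S \<times> S. x \<noteq> y \<and> (x, y) \<notin> A} + 2 * card M \<le> 4 * d * card M"
proof -
  let ?E = "{(x, y) \<in> S \<times> S. x \<noteq> y \<and> (x, y) \<notin> A}"
  have bnd: "card M \<le> card (S \<times> S)" if "antimatching S M" for M
    using that finS by (intro card_mono) (auto simp: antimatching_def)
  have "\<exists>M. antimatching S M \<and> (\<forall>M'. antimatching S M' \<longrightarrow> card M' \<le> card M)"
    by (rule ex_has_greatest_nat[of "antimatching S" "{}" card "Suc (card (S \<times> S))"])
      (use bnd in \<open>auto simp: antimatching_def le_imp_less_Suc simp del: card_cartesian_product\<close>)
  then obtain M where M: "antimatching S M" "\<And>M'. antimatching S M' \<Longrightarrow> card M' \<le> card M" by metis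
  have finM: "finite M" using M(1) finS by (auto simp: antimatching_def intro: finite_subset)
  define W where "W = fst ` M \<union> snd ` M"
  have WS: "W \<subseteq> S" using M(1) by (auto simp: W_def antimatching_def)
  have cW: "card W \<le> 2 * card M"
    using card_Un_le[of "fst ` M" "snd ` M"] card_image_le[OF finM, of fst] card_image_le[OF finM, of snd] by (simp add: W_def)
  let ?X = "Sigma W (\<lambda>v. S - {v} - nbs S v)"
  have finX: "finite ?X" using finS WS by (auto intro: finite_subset)
  have cX: "card ?X \<le> 2 * card M * d"
  proof -
    have "card ?X = (\<Sum>v\<in>W. card (S - {v} - nbs S v))" using WS finS by (intro card_SigmaI) (auto intro: finite_subset)
    also have "\<dots> \<le> (\<Sum>v\<in>W. d)" using d WS by (intro sum_mono) auto
    also have "\<dots> \<le> 2 * card M * d" using cW by simp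
    finally show ?thesis .
  qed
  have meet: "?E \<subseteq> ?X \<union> prod.swap ` ?X"
  proof
    fix p assume "p \<in> ?E"
    then obtain x y where xy: "p = (x, y)" "x \<in> S" "y \<in> S" "x \<noteq> y" "(x, y) \<notin> A" by auto
    have "x \<in> W \<or> y \<in> W"
    proof (rule ccontr)
      assume no: "\<not> (x \<in> W \<or> y \<in> W)"
      have out: "x \<notin> {fst p, snd p} \<and> y \<notin> {fst p, snd p}" if "p \<in> M" for p using no that by (auto simp: W_def)
      have "antimatching S (insert (x, y) M)"
        unfolding antimatching_def
      proof (intro conjI ballI impI)
        show "insert (x, y) M \<subseteq> S \<times> S" using M(1) xy by (auto simp: antimatching_def)
      next
        fix p assume "p \<in> insert (x, y) M"
        then show "case p of (x, y) \<Rightarrow> x \<noteq> y \<and> (x, y) \<notin> A" using M(1) xy by (auto simp: antimatching_def)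
      next
        fix p q assume pq: "p \<in> insert (x, y) M" "q \<in> insert (x, y) M" "p \<noteq> q"
        show "{fst p, snd p} \<inter> {fst q, snd q} = {}"
        proof (cases "p \<in> M \<and> q \<in> M")
          case True
          then show ?thesis using M(1) pq(3) by (simp add: antimatching_def)
        next
          case False
          then consider "p = (x, y)" "q \<in> M" | "q = (x, y)" "p \<in> M" using pq by blast
          then show ?thesis using out[of p] out[of q] by cases simp_all
        qed
      qed
      moreover have "(x, y) \<notin> M" using no by (force simp: W_def)
      ultimately show False using M(2)[of "insert (x, y) M"] finM by simp
    qed
    then show "p \<in> ?X \<union> prod.swap ` ?X"
      using xy adj_sym by (force simp: nbs_def image_iff)
  qed
  have "M \<union> prod.swap ` M \<subseteq> ?X \<inter> prod.swap ` ?X"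
  proof -
    have "p \<in> ?X \<and> prod.swap p \<in> ?X" if "p \<in> M" for p
    proof -
      have "fst p \<in> S" "snd p \<in> S" "fst p \<noteq> snd p" "(fst p, snd p) \<notin> A" using M(1) that by (auto simp: antimatching_def)
      then show ?thesis using that adj_sym by (cases p) (force simp: W_def nbs_def)
    qed
    then show ?thesis by (force simp: image_iff)
  qed
  moreover have "card (M \<union> prod.swap ` M) = 2 * card M"
  proof -
    have "M \<inter> prod.swap ` M = {}"
    proof (rule ccontr)
      assume "M \<inter> prod.swap ` M \<noteq> {}"
      then obtain x y where xy: "(x, y) \<in> M" "(y, x) \<in> M" by auto
      then have "x \<noteq> y" using M(1) by (auto simp: antimatching_def)
      then have "(x, y) \<noteq> (y, x)" by simp
      then have "{fst (x, y), snd (x, y)} \<inter> {fst (y, x), snd (y, x)} = {}"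
        using M(1) xy unfolding antimatching_def by blast
      then show False by simp
    qed
    moreover have "card (prod.swap ` M) = card M" by (rule card_image) (auto simp: inj_on_def)
    ultimately show ?thesis using finM by (subst card_Un_disjoint) auto
  qed
  ultimately have "2 * card M \<le> card (?X \<inter> prod.swap ` ?X)"
    using card_mono[of "?X \<inter> prod.swap ` ?X" "M \<union> prod.swap ` M"] finX by simp
  moreover have "card (prod.swap ` ?X) = card ?X" by (rule card_image) (auto simp: inj_on_def)
  moreover have "card (?X \<union> prod.swap ` ?X) + card (?X \<inter> prod.swap ` ?X) = card ?X + card (prod.swap ` ?X)"
    using finX by (intro card_Un_Int[symmetric]) auto
  moreover have "card ?E \<le> card (?X \<union> prod.swap ` ?X)" using meet finX by (intro card_mono) auto
  ultimately have "card ?E + 2 * card M \<le> 4 * d * card M" using cX by (simp add: algebra_simps)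
  then show ?thesis using M(1) that by blast
qed

end

section \<open>Critical list assignments\<close>

lemma transpose_mem: "a \<in> B \<Longrightarrow> b \<in> B \<Longrightarrow> x \<in> B \<Longrightarrow> Transposition.transpose a b x \<in> B"
  by (simp add: Transposition.transpose_def)

text \<open>Lists of equal colours are used up to renaming: two colours can be moved to two prescribed colours
  inside \<open>B\<close>, provided that coincidences match.\<close>

lemma recolor:
  assumes "a \<in> B" "b \<in> B" "a' \<in> B" "b' \<in> B" "a = b \<longleftrightarrow> a' = b'"
  obtains \<pi> where "inj \<pi>" "\<And>x. x \<in> B \<Longrightarrow> \<pi> x \<in> B" "\<pi> a = a'" "\<pi> b = b'"
proof -
  let ?f = "Transposition.transpose a a'"
  let ?g = "Transposition.transpose (?f b) b'"
  have "inj (?g \<circ> ?f)" by (intro inj_compose) (auto intro: bij_is_inj)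
  moreover have "(?g \<circ> ?f) x \<in> B" if "x \<in> B" for x
    using that assms by (auto intro!: transpose_mem)
  moreover have "(?g \<circ> ?f) b = b'" by simp
  moreover have "(?g \<circ> ?f) a = a'"
    using assms(5) by (cases "a = b") (auto simp: Transposition.transpose_def)
  ultimately show ?thesis using that by blast
qed

context simple_graph begin

definition critical :: "'v set \<Rightarrow> ('v \<Rightarrow> 'c set) \<Rightarrow> bool" where
  "critical S L \<longleftrightarrow> finite S \<and> \<not> colorable S L \<and> (\<forall>T. T \<subset> S \<longrightarrow> colorable T L)"

lemma critical_exists:
  assumes "finite V" "\<not> colorable V L"
  obtains S where "S \<subseteq> V" "critical S L"
proof -
  have "\<exists>S. S \<subseteq> V \<and> critical S L"
    using assms
  proof (induction V rule: finite_psubset_induct)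
    case (psubset V)
    show ?case
    proof (cases "critical V L")
      case False
      then obtain T where T: "T \<subset> V" "\<not> colorable T L" using psubset by (auto simp: critical_def)
      then show ?thesis using psubset.IH[of T] by blast
    qed auto
  qed
  then show ?thesis using that by blast
qed

lemma critical_nonempty: "critical S L \<Longrightarrow> S \<noteq> {}"
  by (auto simp: critical_def colorable_def coloring_def)

text \<open>Otherwise the vertex could be coloured last.\<close>

lemma critical_degree:
  assumes S: "critical S L" and v: "v \<in> S"
  shows "card (L v) \<le> card (nbs S v)"
proof (rule ccontr)
  assume less: "\<not> card (L v) \<le> card (nbs S v)"
  have finS: "finite S" using S by (simp add: critical_def)
  obtain c where c: "coloring (S - {v}) L c" using S v by (auto simp: critical_def colorable_def)
  have "colorable {v} (\<lambda>u. L u - c ` nbs (S - {v}) u)"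
  proof (rule degenerate_colorable)
    fix T assume T: "T \<subseteq> {v}" "T \<noteq> {}"
    have "nbs T v = {}" using nbs_subset[of T v] T by auto
    moreover have "card (c ` nbs (S - {v}) v) \<le> card (nbs S v)"
      using card_image_le[OF nbs_finite[OF finite_Diff[OF finS]], of c "{v}" v]
        card_mono[OF nbs_finite[OF finS] nbs_mono[of "S - {v}" S v]] by auto
    then have "card (L v - c ` nbs (S - {v}) v) > 0"
      using less diff_card_le_card_Diff[of "c ` nbs (S - {v}) v" "L v"] nbs_finite[OF finite_Diff[OF finS]] by simp
    ultimately show "\<exists>w\<in>T. card (nbs T w) < card (L w - c ` nbs (S - {v}) w)"
      using T by (intro bexI[of _ v]) auto
  qed simp
  then obtain d where "coloring {v} (\<lambda>u. L u - c ` nbs (S - {v}) u) d" by (auto simp: colorable_def)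
  from coloring_extend[OF c this] have "colorable (S - {v} \<union> {v}) L" by (auto simp: colorable_def)
  then show False using S v by (simp add: critical_def insert_absorb)
qed

lemma coloring_union_separated:
  assumes "coloring P L c" "coloring R L d" "\<And>a b. a \<in> P - R \<Longrightarrow> b \<in> R - P \<Longrightarrow> (a, b) \<notin> A"
    and "\<And>x. x \<in> P \<inter> R \<Longrightarrow> c x = d x"
  shows "colorable (P \<union> R) L"
proof -
  have no: "(b, a) \<notin> A" if "a \<in> P - R" "b \<in> R - P" for a b using assms(3)[OF that] adj_sym by blast
  have "coloring (P \<union> R) L (\<lambda>v. if v \<in> P then c v else d v)"
    unfolding coloring_def
  proof (intro conjI ballI impI)
    fix u v assume uv: "u \<in> P \<union> R" "v \<in> P \<union> R" "(u, v) \<in> A"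
    have "v \<in> R" if "u \<notin> P" using assms(3) no uv that by blast
    moreover have "u \<in> R" if "v \<notin> P" using assms(3) no uv that by blast
    ultimately show "(if u \<in> P then c u else d u) \<noteq> (if v \<in> P then c v else d v)"
      using assms(1,2) assms(4)[of u] assms(4)[of v] uv by (auto simp: coloring_def)
  qed (use assms in \<open>auto simp: coloring_def\<close>)
  then show ?thesis by (auto simp: colorable_def)
qed

lemma critical_linked:
  assumes S: "critical S L" shows "linked S"
  unfolding linked_def
proof (intro allI impI)
  fix T assume T: "T \<subseteq> S" "T \<noteq> {}" "T \<noteq> S"
  show "\<exists>a\<in>T. \<exists>b\<in>S - T. (a, b) \<in> A"
  proof (rule ccontr)
    assume no: "\<not> ?thesis"
    have "T \<subset> S" "S - T \<subset> S" using T by auto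
    then obtain c d where "coloring T L c" "coloring (S - T) L d" using S unfolding critical_def colorable_def by metis
    then have "colorable (T \<union> (S - T)) L" using no by (intro coloring_union_separated) auto
    moreover have "T \<union> (S - T) = S" using T by auto
    ultimately show False using S by (simp add: critical_def)
  qed
qed

text \<open>Give \<open>u\<close> a colour that \<open>v\<close> does not have. A neighbour of \<open>u\<close> loses a neighbour and at most one colour, \<open>v\<close>
  loses only a neighbour, and the rest is connected, so it can be coloured greedily towards \<open>v\<close>.\<close>

lemma noncut_lists_subset:
  assumes S: "critical S L" and tight: "\<And>v. v \<in> S \<Longrightarrow> card (L v) = card (nbs S v)"
    and u: "u \<in> S" "linked (S - {u})" and v: "v \<in> S" "(u, v) \<in> A"
  shows "L u \<subseteq> L v"
proof
  fix x assume x: "x \<in> L u"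
  show "x \<in> L v"
  proof (rule ccontr)
    assume xv: "x \<notin> L v"
    have finS: "finite S" using S by (simp add: critical_def)
    have c: "coloring {u} L (\<lambda>_. x)" using x adj_irrefl by (auto simp: coloring_def)
    have im: "(\<lambda>_. x) ` nbs {u} w = (if (w, u) \<in> A then {x} else {})" for w by (auto simp: nbs_def)
    have nb: "nbs S w = nbs (S - {u}) w \<union> (if (w, u) \<in> A then {u} else {})" for w
      using u(1) by (auto simp: nbs_def)
    have cnb: "card (nbs S w) = card (nbs (S - {u}) w) + (if (w, u) \<in> A then 1 else 0)" for w
      unfolding nb using finS by (subst card_Un_disjoint) (auto simp: nbs_def)
    have "colorable (S - {u}) (\<lambda>w. L w - (\<lambda>_. x) ` nbs {u} w)"
    proof (rule linked_slack_colorable[OF _ u(2)])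
      fix w assume w: "w \<in> S - {u}"
      show "card (nbs (S - {u}) w) \<le> card (L w - (\<lambda>_. x) ` nbs {u} w)"
        using cnb[of w] tight[of w] w unfolding im by (auto simp: card_Diff_singleton_if)
    next
      show v': "v \<in> S - {u}" using v u(1) adj_irrefl by auto
      have "(v, u) \<in> A" using v adj_sym by blast
      then show "card (nbs (S - {u}) v) < card (L v - (\<lambda>_. x) ` nbs {u} v)"
        using cnb[of v] tight[of v] v xv unfolding im by auto
    qed (use finS in auto)
    then obtain d where "coloring (S - {u}) (\<lambda>w. L w - (\<lambda>_. x) ` nbs {u} w) d" by (auto simp: colorable_def)
    from coloring_extend[OF c this] have "colorable ({u} \<union> (S - {u})) L" by (auto simp: colorable_def)
    then show False using S u(1) by (simp add: critical_def insert_absorb)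
  qed
qed

lemma linked_constant:
  assumes "linked S" "\<And>u v. u \<in> S \<Longrightarrow> v \<in> S \<Longrightarrow> (u, v) \<in> A \<Longrightarrow> f u = f v" "u \<in> S" "v \<in> S"
  shows "f u = f v"
proof (rule ccontr)
  assume ne: "f u \<noteq> f v"
  obtain a b where "a \<in> {w \<in> S. f w = f u}" "b \<in> S - {w \<in> S. f w = f u}" "(a, b) \<in> A"
  proof (rule linked_step[OF assms(1), of "{w \<in> S. f w = f u}"])
    show "{w \<in> S. f w = f u} \<noteq> S" using assms(4) ne by force
  qed (use assms(3) in auto)
  then show False using assms(2)[of a b] by auto
qed

lemma noncut_lists_equal:
  assumes S: "critical S L" and tight: "\<And>v. v \<in> S \<Longrightarrow> card (L v) = card (nbs S v)"
    and Q: "Q \<subseteq> S" "linked Q" "\<And>u. u \<in> Q \<Longrightarrow> linked (S - {u})" and uv: "u \<in> Q" "v \<in> Q"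
  shows "L u = L v"
proof (rule linked_constant[OF Q(2) _ uv])
  fix u v assume "u \<in> Q" "v \<in> Q" "(u, v) \<in> A"
  then show "L u = L v"
    using noncut_lists_subset[OF S tight, of u v] noncut_lists_subset[OF S tight, of v u] Q adj_sym by blast
qed

text \<open>Two overlapping pieces, one of which has all its lists equal, can be coloured separately and glued along at
  most two vertices after renaming colours.\<close>

lemma glue_coloring:
  assumes c: "coloring P L c" and d: "coloring R (\<lambda>_. B) d"
    and sep: "\<And>a b. a \<in> P - R \<Longrightarrow> b \<in> R - P \<Longrightarrow> (a, b) \<notin> A" and PR: "P \<inter> R = {x, y}"
    and B: "\<And>v. v \<in> R \<Longrightarrow> L v = B" and pat: "c x = c y \<longleftrightarrow> d x = d y"
  shows "colorable (P \<union> R) L"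
proof -
  have xy: "x \<in> P" "x \<in> R" "y \<in> P" "y \<in> R" using PR by auto
  obtain \<pi> where \<pi>: "inj \<pi>" "\<And>z. z \<in> B \<Longrightarrow> \<pi> z \<in> B" "\<pi> (d x) = c x" "\<pi> (d y) = c y"
    by (rule recolor[of "d x" B "d y" "c x" "c y"]) (use c d xy B[of x] B[of y] pat in \<open>auto simp: coloring_def\<close>)
  have "coloring R L (\<pi> \<circ> d)"
    using d \<pi>(1,2) B by (auto simp: coloring_def inj_eq)
  then show ?thesis using \<pi>(3,4) PR sep by (intro coloring_union_separated[OF c, of R "\<pi> \<circ> d"]) auto
qed

text \<open>Take a cut vertex \<open>c\<close> and a union \<open>Q\<close> of components behind it with \<open>Q\<close> as small as possible. A cut vertex
  inside \<open>Q\<close> would have a smaller piece behind it, on the side away from \<open>c\<close>.\<close>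

lemma end_component:
  assumes S: "linked S" "finite S" and c0: "c0 \<in> S" "\<not> linked (S - {c0})"
  obtains c Q where "c \<in> S" "Q \<subset> S - {c}" "Q \<noteq> {}" "\<forall>a\<in>Q. \<forall>b\<in>S - {c} - Q. (a, b) \<notin> A"
    "linked Q" "\<forall>q\<in>Q. linked (S - {q})"
proof -
  define good where "good c Q \<longleftrightarrow> c \<in> S \<and> Q \<subset> S - {c} \<and> Q \<noteq> {} \<and> (\<forall>a\<in>Q. \<forall>b\<in>S - {c} - Q. (a, b) \<notin> A)" for c Q
  have "\<exists>n c Q. good c Q \<and> card Q = n" using c0 unfolding good_def linked_def by blast
  then obtain n where n: "\<exists>c Q. good c Q \<and> card Q = n" "\<And>m. m < n \<Longrightarrow> \<not> (\<exists>c Q. good c Q \<and> card Q = m)"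
    using exists_least_iff[of "\<lambda>n. \<exists>c Q. good c Q \<and> card Q = n"] by auto
  obtain c Q where g: "good c Q" "card Q = n" using n(1) by blast
  have least: "\<not> good c' Q'" if "Q' \<subset> Q" for c' Q'
  proof -
    have "finite Q" using g(1) S(2) unfolding good_def by (meson finite_Diff finite_subset psubset_imp_subset)
    then have "card Q' < n" using that g(2) by (metis psubset_card_mono)
    then show ?thesis using n(2) by blast
  qed
  have linkQ: "linked Q"
    unfolding linked_def
  proof (intro allI impI, rule ccontr)
    fix T assume T: "T \<subseteq> Q" "T \<noteq> {}" "T \<noteq> Q" "\<not> (\<exists>a\<in>T. \<exists>b\<in>Q - T. (a, b) \<in> A)"
    have "good c T" using g(1) T unfolding good_def by blast
    then show False using least[of T c] T by blast
  qed
  have one_side: False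
    if q: "q \<in> Q" and T: "T \<subseteq> S - {q}" "T \<noteq> {}" "\<forall>a\<in>T. \<forall>b\<in>S - {q} - T. (a, b) \<notin> A" "c \<notin> T" for q T
  proof (cases "T \<inter> Q = {}")
    case True
    have "T \<noteq> S" using q T(1) g(1) by (auto simp: good_def)
    then obtain a b where ab: "a \<in> T" "b \<in> S - T" "(a, b) \<in> A" using linked_step[OF S(1), of T] T by blast
    then have "b = q" using T(3) by blast
    then have "(q, a) \<in> A" using ab adj_sym by blast
    moreover have "a \<in> S - {c} - Q" using ab(1) T True by blast
    ultimately show False using g(1) q unfolding good_def by blast
  next
    case False
    have "q \<notin> T" using T(1) by auto
    have "good q (T \<inter> Q)"
      unfolding good_def
    proof (intro conjI ballI)
      show "q \<in> S" using g(1) q unfolding good_def by blast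
      show "T \<inter> Q \<subset> S - {q}" using T g(1) q unfolding good_def by blast
      show "T \<inter> Q \<noteq> {}" by fact
      fix a b assume ab: "a \<in> T \<inter> Q" "b \<in> S - {q} - (T \<inter> Q)"
      show "(a, b) \<notin> A"
      proof
        assume e: "(a, b) \<in> A"
        then have "b \<in> T" using T(3) ab by blast
        then have "b \<in> S - {c} - Q" using ab T(4) by blast
        then show False using g(1) ab(1) e unfolding good_def by blast
      qed
    qed
    moreover have "T \<inter> Q \<subset> Q" using q \<open>q \<notin> T\<close> by auto
    ultimately show False using least by blast
  qed
  have "linked (S - {q})" if q: "q \<in> Q" for q
    unfolding linked_def
  proof (intro allI impI, rule ccontr)
    fix T assume T: "T \<subseteq> S - {q}" "T \<noteq> {}" "T \<noteq> S - {q}" "\<not> (\<exists>a\<in>T. \<exists>b\<in>S - {q} - T. (a, b) \<in> A)"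
    show False
    proof (cases "c \<in> T")
      case False
      then show False using one_side[OF q, of T] T by blast
    next
      case True
      have "\<forall>a\<in>S - {q} - T. \<forall>b\<in>S - {q} - (S - {q} - T). (a, b) \<notin> A"
        using T(1,4) adj_sym by blast
      then show False using one_side[OF q, of "S - {q} - T"] T True by blast
    qed
  qed
  then show ?thesis using that[of c Q] g(1) linkQ unfolding good_def by blast
qed

text \<open>Behind a cut vertex \<open>c\<close> lies a piece without cut vertices, where all lists are equal and contained in that
  of \<open>c\<close>; they are not smaller, hence equal to it. Then this piece with \<open>c\<close>, and the rest with \<open>c\<close>, are coloured
  separately and the colours are renamed to agree at \<open>c\<close>.\<close>

theorem critical_no_cutvertex:
  assumes S: "critical S L" and tight: "\<And>v. v \<in> S \<Longrightarrow> card (L v) = card (nbs S v)"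
    and cut: "\<And>u v. u \<in> S \<Longrightarrow> \<not> linked (S - {u}) \<Longrightarrow> v \<in> S \<Longrightarrow> card (L u) \<le> card (L v)"
    and L: "\<And>v. v \<in> S \<Longrightarrow> finite (L v)" and u: "u \<in> S"
  shows "linked (S - {u})"
proof (rule ccontr)
  assume "\<not> linked (S - {u})"
  note link = critical_linked[OF S]
  have finS: "finite S" using S by (simp add: critical_def)
  obtain c Q where c: "c \<in> S" and Q: "Q \<subset> S - {c}" "Q \<noteq> {}" "\<forall>a\<in>Q. \<forall>b\<in>S - {c} - Q. (a, b) \<notin> A"
    and nc: "linked Q" "\<forall>q\<in>Q. linked (S - {q})"
    by (rule end_component[OF link finS u \<open>\<not> linked (S - {u})\<close>])
  have QS: "Q \<subseteq> S" using Q by auto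
  have "\<not> linked (S - {c})"
  proof
    assume "linked (S - {c})"
    then obtain a b where "a \<in> Q" "b \<in> S - {c} - Q" "(a, b) \<in> A" using linked_step[of "S - {c}" Q] Q by blast
    then show False using Q(3) by blast
  qed
  note cle = cut[OF c this]
  obtain a b where ab: "a \<in> Q" "b \<in> S - Q" "(a, b) \<in> A"
    by (rule linked_step[OF link QS Q(2)]) (use Q in auto)
  then have "b = c" using Q(3) by blast
  have La: "L a = L c"
  proof (rule card_subset_eq)
    show "L a \<subseteq> L c" using noncut_lists_subset[OF S tight, of a c] ab nc QS \<open>b = c\<close> c by blast
    then show "card (L a) = card (L c)" using cle[of a] ab QS card_mono[OF L[OF c]] by (meson le_antisym subsetD)
  qed (use L c in auto)
  have LQ: "L v = L c" if "v \<in> insert c Q" for v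
    using noncut_lists_equal[OF S tight QS nc(1) _ _ ab(1), of v] nc(2) that La by auto
  have "S - Q \<subset> S" "insert c Q \<subset> S" using Q c by auto
  then obtain c1 c2 where c12: "coloring (S - Q) L c1" "coloring (insert c Q) L c2"
    using S unfolding critical_def colorable_def by metis
  have "colorable (S - Q \<union> insert c Q) L"
  proof (rule glue_coloring[OF c12(1), where x = c and y = c])
    show "coloring (insert c Q) (\<lambda>_. L c) c2" using c12(2) LQ unfolding coloring_def by blast
    show "(a, b) \<notin> A" if "a \<in> S - Q - insert c Q" "b \<in> insert c Q - (S - Q)" for a b
      using that Q(3) adj_sym c by blast
    show "(S - Q) \<inter> insert c Q = {c, c}" using Q c by auto
    show "L v = L c" if "v \<in> insert c Q" for v using LQ[OF that] .
  qed simp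
  moreover have "S - Q \<union> insert c Q = S" using Q c by auto
  ultimately show False using S by (simp add: critical_def)
qed

end

section \<open>The theorem of Brooks\<close>

context simple_graph begin

context
  fixes S :: "'v set" and B :: "'c set" and k :: nat
  assumes S: "critical S (\<lambda>_. B)" and B: "finite B" "card B = k" and k3: "k \<ge> 3"
    and reg: "\<And>v. v \<in> S \<Longrightarrow> card (nbs S v) = k"
begin

lemma finS: "finite S"
  using S by (simp add: critical_def)

lemma proper_colorable:
  assumes "T \<subset> S" obtains c where "coloring T (\<lambda>_. B) c"
  using S assms unfolding critical_def colorable_def by metis

lemma color_vertex:
  assumes c: "coloring P (\<lambda>_. B) c" and fin: "finite P" and v: "v \<notin> P" and Z: "finite Z" "card Z < k" "c ` nbs P v \<subseteq> Z"
  obtains d where "coloring (insert v P) (\<lambda>_. B) d" "d v \<notin> Z" "\<And>u. u \<in> P \<Longrightarrow> d u = c u"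
proof -
  have "\<not> B \<subseteq> Z" using Z B card_mono[of Z B] by auto
  then obtain z where z: "z \<in> B" "z \<notin> Z" by blast
  have "coloring {v} (\<lambda>u. B - c ` nbs P u) (\<lambda>_. z)"
    using z Z(3) adj_irrefl by (auto simp: coloring_def)
  from coloring_extend[OF c this] v have "coloring (insert v P) (\<lambda>_. B) (\<lambda>u. if u \<in> {v} then z else c u)" by simp
  then show ?thesis using z v by (intro that[of "\<lambda>u. if u \<in> {v} then z else c u"]) auto
qed

text \<open>Suppose that \<open>x\<close> and \<open>y\<close> separate \<open>T\<close> from \<open>U\<close>. Each of the two sides together with \<open>x\<close> and \<open>y\<close> has a
  colouring, and if both sides have one where \<open>x\<close> and \<open>y\<close> agree, or both have one where they differ, the
  two colourings can be glued. A vertex with at most \<open>k - 2\<close> neighbours on one side can be recoloured there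
  to differ from the other. If \<open>x\<close> and \<open>y\<close> both have at most one neighbour on a side, then on that side both kinds of
  colouring exist, because \<open>k \<ge> 3\<close>; otherwise one of them has at most \<open>k - 2\<close> neighbours on the other side. So either one
  side has both kinds, or both sides have a colouring where \<open>x\<close> and \<open>y\<close> differ.\<close>

lemma nonadjacent_pair_noncut:
  assumes x: "x \<in> S" and y: "y \<in> S" and xy: "x \<noteq> y" "(x, y) \<notin> A"
  shows "linked (S - {x, y})"
  unfolding linked_def
proof (intro allI impI, rule ccontr)
  fix T assume T: "T \<subseteq> S - {x, y}" "T \<noteq> {}" "T \<noteq> S - {x, y}" "\<not> (\<exists>a\<in>T. \<exists>b\<in>S - {x, y} - T. (a, b) \<in> A)"
  define U where "U = S - {x, y} - T"
  have yx: "(y, x) \<notin> A" using xy adj_sym by blast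
  have STU: "S = T \<union> U \<union> {x, y}" using T x y by (auto simp: U_def)
  have disj: "T \<inter> U = {}" "T \<inter> {x, y} = {}" "U \<inter> {x, y} = {}" using T by (auto simp: U_def)
  have ne: "T \<noteq> {}" "U \<noteq> {}" using T by (auto simp: U_def)
  have noTU: "(a, b) \<notin> A" "(b, a) \<notin> A" if "a \<in> T" "b \<in> U" for a b
    using that T(4) adj_sym unfolding U_def by blast+
  define same where "same W \<longleftrightarrow> (\<exists>c. coloring (W \<union> {x, y}) (\<lambda>_. B) c \<and> c x = c y)" for W
  define diff where "diff W \<longleftrightarrow> (\<exists>c. coloring (W \<union> {x, y}) (\<lambda>_. B) c \<and> c x \<noteq> c y)" for W
  have some: "same W \<or> diff W" if "W \<union> {x, y} \<subset> S" for W
    using proper_colorable[OF that] unfolding same_def diff_def by metis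
  have proper: "T \<union> {x, y} \<subset> S" "U \<union> {x, y} \<subset> S" using STU disj ne by blast+
  have deg: "card (nbs T w) + card (nbs U w) = k" if "w \<in> {x, y}" for w
  proof -
    have "nbs S w = nbs T w \<union> nbs U w" using that xy yx adj_irrefl unfolding STU by (auto simp: nbs_def)
    moreover have "nbs T w \<inter> nbs U w = {}" using disj by (auto simp: nbs_def)
    moreover have "finite T" "finite U" using finS STU by auto
    ultimately have "card (nbs S w) = card (nbs T w) + card (nbs U w)" using nbs_finite by (simp add: card_Un_disjoint)
    then show ?thesis using reg[of w] that x y by auto
  qed
  have diffI': "\<exists>c. coloring (W \<union> {v, w}) (\<lambda>_. B) c \<and> c v \<noteq> c w"
    if vw: "{v, w} = {x, y}" and W: "W \<union> {x, y} \<subset> S" "W \<inter> {x, y} = {}" "card (nbs W v) \<le> k - 2" for v w W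
  proof -
    have finW: "finite W" using W finS by (meson finite_Un finite_subset psubset_imp_subset)
    obtain c where c: "coloring (insert w W) (\<lambda>_. B) c" using proper_colorable[of "insert w W"] vw W x y by blast
    have v: "v \<notin> insert w W" "(v, w) \<notin> A" using vw W xy yx by (auto simp: doubleton_eq_iff)
    have nb: "nbs (insert w W) v = nbs W v" using v by (auto simp: nbs_def)
    have "card (insert (c w) (c ` nbs W v)) \<le> Suc (card (c ` nbs W v))" by (simp add: card_insert_if nbs_finite[OF finW])
    also have "\<dots> \<le> Suc (k - 2)" using W(3) card_image_le[OF nbs_finite[OF finW], of c v] by linarith
    also have "\<dots> < k" using k3 by simp
    finally have less: "card (insert (c w) (c ` nbs W v)) < k" .
    obtain d where d: "coloring (insert v (insert w W)) (\<lambda>_. B) d" "d v \<notin> insert (c w) (c ` nbs W v)" "\<And>u. u \<in> insert w W \<Longrightarrow> d u = c u"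
      using color_vertex[OF c _ v(1) _ less] nbs_finite[OF finW] finW nb by auto
    then have "d v \<noteq> d w" by auto
    moreover have "insert v (insert w W) = W \<union> {v, w}" by auto
    ultimately show ?thesis using d(1) by auto
  qed
  have diffI: "diff W" if W: "W \<union> {x, y} \<subset> S" "W \<inter> {x, y} = {}" "card (nbs W x) \<le> k - 2 \<or> card (nbs W y) \<le> k - 2" for W
    using diffI'[of x y W] diffI'[of y x W] W unfolding diff_def by (metis insert_commute)
  have sameI: "same W" if W: "W \<union> {x, y} \<subset> S" "W \<inter> {x, y} = {}" "card (nbs W x) \<le> 1" "card (nbs W y) \<le> 1" for W
  proof -
    have finW: "finite W" using W finS by (meson finite_Un finite_subset psubset_imp_subset)
    obtain c where c: "coloring W (\<lambda>_. B) c" using proper_colorable[of W] W by blast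
    let ?Z = "c ` (nbs W x \<union> nbs W y)"
    have "card ?Z \<le> card (nbs W x \<union> nbs W y)" using nbs_finite[OF finW] by (intro card_image_le) auto
    also have "\<dots> \<le> 2" using card_Un_le[of "nbs W x" "nbs W y"] W by linarith
    finally have "\<not> B \<subseteq> ?Z" using k3 B card_mono[of ?Z B] nbs_finite[OF finW] by auto
    then obtain z where z: "z \<in> B" "z \<notin> ?Z" by blast
    have "coloring {x, y} (\<lambda>u. B - c ` nbs W u) (\<lambda>_. z)"
      using z xy(2) yx adj_irrefl by (auto simp: coloring_def)
    from coloring_extend[OF c this] W(2) show ?thesis
      unfolding same_def by (intro exI[of _ "\<lambda>v. if v \<in> {x, y} then z else c v"]) auto
  qed
  have glue: False if cT: "coloring (T \<union> {x, y}) (\<lambda>_. B) c" and dU: "coloring (U \<union> {x, y}) (\<lambda>_. B) d"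
    and pat: "c x = c y \<longleftrightarrow> d x = d y" for c d
  proof -
    have "colorable ((T \<union> {x, y}) \<union> (U \<union> {x, y})) (\<lambda>_. B)"
    proof (rule glue_coloring[OF cT dU])
      show "(T \<union> {x, y}) \<inter> (U \<union> {x, y}) = {x, y}" using disj by auto
      show "(a, b) \<notin> A" if "a \<in> T \<union> {x, y} - (U \<union> {x, y})" "b \<in> U \<union> {x, y} - (T \<union> {x, y})" for a b
        using noTU(1)[of a b] that by auto
    qed (use pat in auto)
    moreover have "(T \<union> {x, y}) \<union> (U \<union> {x, y}) = S" using STU by auto
    ultimately show False using S by (simp add: critical_def)
  qed
  have no_same: "\<not> (same T \<and> same U)" using glue unfolding same_def by blast
  have no_diff: "\<not> (diff T \<and> diff U)" using glue unfolding diff_def by blast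
  have side: "(same W \<and> diff W) \<or> diff W'"
    if W: "W \<union> {x, y} \<subset> S" "W \<inter> {x, y} = {}" "W' \<union> {x, y} \<subset> S" "W' \<inter> {x, y} = {}"
      and d: "card (nbs W' x) + card (nbs W x) = k" "card (nbs W' y) + card (nbs W y) = k" for W W'
  proof (cases "card (nbs W x) \<le> 1 \<and> card (nbs W y) \<le> 1")
    case True
    then have "card (nbs W x) \<le> k - 2" using k3 by linarith
    then show ?thesis using sameI[OF W(1,2)] diffI[OF W(1,2)] True by blast
  next
    case False
    then have "card (nbs W' x) \<le> k - 2 \<or> card (nbs W' y) \<le> k - 2" using d by linarith
    then show ?thesis using diffI[OF W(3,4)] by blast
  qed
  have "(same T \<and> diff T) \<or> diff U"
    using side[OF proper(1) disj(2) proper(2) disj(3)] deg[of x] deg[of y] by simp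
  moreover have "(same U \<and> diff U) \<or> diff T"
    using side[OF proper(2) disj(3) proper(1) disj(2)] deg[of x] deg[of y] by simp
  ultimately show False using some[OF proper(1)] some[OF proper(2)] no_same no_diff by blast
qed

text \<open>Two nonadjacent neighbours of a vertex \<open>v\<close> receive the same colour; the rest is connected and can be coloured
  greedily towards \<open>v\<close>, which sees one colour twice.\<close>

theorem brooks:
  assumes uw: "u \<in> S" "w \<in> S" "u \<noteq> w" shows "(u, w) \<in> A"
proof (rule ccontr)
  assume nuw: "(u, w) \<notin> A"
  have "insert w (nbs S w) \<noteq> S" using uw nuw adj_sym by (auto simp: nbs_def)
  obtain v y where v: "v \<in> insert w (nbs S w)" and y: "y \<in> S - insert w (nbs S w)" and vy: "(v, y) \<in> A"
    by (rule linked_step[OF critical_linked[OF S], of "insert w (nbs S w)"]) (use uw \<open>insert w (nbs S w) \<noteq> S\<close> in \<open>auto simp: nbs_def\<close>)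
  have wy: "y \<in> S" "w \<noteq> y" "(w, y) \<notin> A" "(y, w) \<notin> A" using y adj_sym by (auto simp: nbs_def)
  have v': "v \<in> S" "(v, w) \<in> A" "v \<noteq> w" "v \<noteq> y"
    using v vy wy(3) adj_sym adj_irrefl by (auto simp: nbs_def)
  let ?R = "S - {w, y}"
  have link: "linked ?R" using wy uw by (intro nonadjacent_pair_noncut) auto
  obtain z where z: "z \<in> B" using B k3 by fastforce
  have c: "coloring {w, y} (\<lambda>_. B) (\<lambda>_. z)" using z wy adj_irrefl by (auto simp: coloring_def)
  have im: "(\<lambda>_. z) ` nbs {w, y} a = (if nbs {w, y} a = {} then {} else {z})" for a by auto
  have cnb: "card (nbs ?R a) + card (nbs {w, y} a) = k" if "a \<in> S" for a
  proof -
    have "nbs S a = nbs ?R a \<union> nbs {w, y} a" using uw wy by (auto simp: nbs_def)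
    moreover have "nbs ?R a \<inter> nbs {w, y} a = {}" by (auto simp: nbs_def)
    ultimately show ?thesis using reg[OF that] finS by (simp add: card_Un_disjoint nbs_finite)
  qed
  have cB: "card (B - (\<lambda>_. z) ` nbs {w, y} a) = (if nbs {w, y} a = {} then k else k - 1)" for a
    unfolding im using z B by simp
  have "colorable ?R (\<lambda>a. B - (\<lambda>_. z) ` nbs {w, y} a)"
  proof (rule linked_slack_colorable[OF _ link, where r = v])
    fix a assume a: "a \<in> ?R"
    have "card (nbs {w, y} a) \<ge> 1" if "nbs {w, y} a \<noteq> {}"
      using that nbs_finite[of "{w, y}" a] by (simp add: Suc_le_eq card_gt_0_iff)
    moreover have "card (nbs ?R a) + card (nbs {w, y} a) = k" using a by (intro cnb) auto
    ultimately have "card (nbs ?R a) \<le> k" "nbs {w, y} a \<noteq> {} \<Longrightarrow> card (nbs ?R a) \<le> k - 1" by linarith+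
    then show "card (nbs ?R a) \<le> card (B - (\<lambda>_. z) ` nbs {w, y} a)"
      unfolding cB by simp
  next
    have nv: "nbs {w, y} v = {w, y}" using v' vy by (auto simp: nbs_def)
    then have "card (nbs ?R v) + 2 = k" using cnb[OF v'(1)] wy(2) by simp
    then have "card (nbs ?R v) < k - 1" by linarith
    then show "card (nbs ?R v) < card (B - (\<lambda>_. z) ` nbs {w, y} v)"
      unfolding cB by (simp add: nv)
  qed (use finS v' in auto)
  then obtain d where "coloring ?R (\<lambda>a. B - (\<lambda>_. z) ` nbs {w, y} a) d" by (auto simp: colorable_def)
  from coloring_extend[OF c this] have "colorable ({w, y} \<union> ?R) (\<lambda>_. B)" by (auto simp: colorable_def)
  moreover have "{w, y} \<union> ?R = S" using uw wy by auto
  ultimately show False using S by (simp add: critical_def)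
qed

end

end

section \<open>Critical graphs within the Heawood bound\<close>

lemma heawood_bounds:
  assumes "\<epsilon> \<ge> 1"
  shows "heawood \<epsilon> \<ge> 6" "(int (heawood \<epsilon>) - 3) * (int (heawood \<epsilon>) - 4) \<le> 6 * \<epsilon>"
    "6 * \<epsilon> < (int (heawood \<epsilon>) - 2) * (int (heawood \<epsilon>) - 3)"
proof -
  define r where "r = sqrt (24 * real_of_int \<epsilon> + 1)"
  define h where "h = \<lfloor>(7 + r) / 2\<rfloor>"
  have r2: "r\<^sup>2 = 24 * real_of_int \<epsilon> + 1" using assms by (simp add: r_def)
  have "sqrt (5\<^sup>2) \<le> r" unfolding r_def using assms by (intro real_sqrt_le_mono) simp
  then have r5: "r \<ge> 5" by simp
  then have h6: "h \<ge> 6" by (simp add: h_def le_floor_iff)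
  have H: "int (heawood \<epsilon>) = h" using h6 by (simp add: heawood_def h_def r_def)
  have "real_of_int h \<le> (7 + r) / 2" "(7 + r) / 2 < real_of_int h + 1" unfolding h_def by linarith+
  then have b: "2 * real_of_int h - 7 \<le> r" "r < 2 * real_of_int h - 5" by auto
  have "(2 * real_of_int h - 7)\<^sup>2 \<le> r\<^sup>2" using b(1) h6 by (intro power_mono) auto
  then have "real_of_int ((2 * h - 7)\<^sup>2) \<le> real_of_int (24 * \<epsilon> + 1)" unfolding r2 by simp
  then have "(2 * h - 7)\<^sup>2 \<le> 24 * \<epsilon> + 1" by linarith
  then show "(int (heawood \<epsilon>) - 3) * (int (heawood \<epsilon>) - 4) \<le> 6 * \<epsilon>"
    unfolding H by (simp add: power2_eq_square algebra_simps)
  have "r\<^sup>2 < (2 * real_of_int h - 5)\<^sup>2" using b(2) r5 by (intro power_strict_mono) auto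
  then have "real_of_int (24 * \<epsilon> + 1) < real_of_int ((2 * h - 5)\<^sup>2)" unfolding r2 by simp
  then have "24 * \<epsilon> + 1 < (2 * h - 5)\<^sup>2" by linarith
  then show "6 * \<epsilon> < (int (heawood \<epsilon>) - 2) * (int (heawood \<epsilon>) - 3)"
    unfolding H by (simp add: power2_eq_square algebra_simps)
  show "heawood \<epsilon> \<ge> 6" using H h6 by linarith
qed

lemma (in simple_graph) colorable_cong:
  assumes "\<And>v. v \<in> S \<Longrightarrow> L v = L' v" shows "colorable S L \<longleftrightarrow> colorable S L'"
  using assms by (auto simp: colorable_def coloring_def)

locale critical_count = simple_graph A for A :: "('v \<times> 'v) set" +
  fixes S FV :: "'v set" and L :: "'v \<Rightarrow> 'c set" and \<epsilon> :: int and H :: nat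
  assumes crit: "critical S L" and \<epsilon>: "\<epsilon> \<ge> 1" "\<epsilon> \<noteq> 3"
    and H6: "H \<ge> 6" and H_le: "(int H - 3) * (int H - 4) \<le> 6 * \<epsilon>" and H_gt: "6 * \<epsilon> < (int H - 2) * (int H - 3)"
    and list_face: "v \<in> S \<Longrightarrow> v \<in> FV \<Longrightarrow> card (L v) = H - 2"
    and list_off: "v \<in> S \<Longrightarrow> v \<notin> FV \<Longrightarrow> card (L v) = H"
    and count: "int (card (A \<inter> S \<times> S)) + 2 * int (max 3 (card (S \<inter> FV))) \<le> 6 * int (card S) + 6 * \<epsilon> - 6"
    and link: "int (card (A \<inter> S \<times> S)) + 2 * int (card (S \<inter> FV)) = 6 * int (card S) + 6 * \<epsilon> - 6 \<Longrightarrow>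
      c \<in> S \<Longrightarrow> c \<notin> FV \<Longrightarrow> N \<subseteq> nbs S c \<Longrightarrow> N \<noteq> {} \<Longrightarrow> N \<noteq> nbs S c \<Longrightarrow> \<exists>a\<in>N. \<exists>b\<in>nbs S c - N. (a, b) \<in> A"
    and no_clique: "K \<subseteq> S \<Longrightarrow> K \<subseteq> FV \<Longrightarrow> card K = H - 1 \<Longrightarrow> \<exists>u\<in>K. \<exists>v\<in>K. u \<noteq> v \<and> (u, v) \<notin> A"
begin

lemma finS: "finite S"
  using crit by (simp add: critical_def)

lemma not_colorable: "\<not> colorable S L"
  using crit by (simp add: critical_def)

lemma list_finite: "v \<in> S \<Longrightarrow> finite (L v)"
  using list_face[of v] list_off[of v] H6 by (intro card_ge_0_finite) (cases "v \<in> FV"; simp)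

lemma degree_ge: "v \<in> S \<Longrightarrow> card (L v) \<le> card (nbs S v)"
  by (rule critical_degree[OF crit])

lemma degree_less: "v \<in> S \<Longrightarrow> card (nbs S v) < card S"
  using nbs_subset[of S v] finS by (intro psubset_card_mono) auto

lemma list_sum: "(\<Sum>v\<in>S. int (card (L v))) = int H * int (card S) - 2 * int (card (S \<inter> FV))"
proof -
  have "(\<Sum>v\<in>S. int (card (L v))) = (\<Sum>v\<in>S. int H - (if v \<in> FV then 2 else 0))"
    using list_face list_off H6 by (intro sum.cong) (auto simp: of_nat_diff)
  also have "\<dots> = int H * int (card S) - (\<Sum>v\<in>S. if v \<in> FV then 2 else 0)"
    by (simp add: sum_subtractf)
  also have "(\<Sum>v\<in>S. if v \<in> FV then 2 else 0) = 2 * int (card (S \<inter> FV))"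
    using finS by (simp add: sum.If_cases)
  finally show ?thesis .
qed

lemma arcs_sum: "int (card (A \<inter> S \<times> S)) = (\<Sum>v\<in>S. int (card (nbs S v)))"
  by (simp add: degree_sum[OF finS])

lemma arcs_ge: "int H * int (card S) - 2 * int (card (S \<inter> FV)) \<le> int (card (A \<inter> S \<times> S))"
  unfolding list_sum[symmetric] arcs_sum using degree_ge by (intro sum_mono) simp

text \<open>The two counts of edges: a vertex on the face has two colours fewer, which are paid for by its contribution to
  the sides of the face.\<close>

lemma size_bound: "(int H - 6) * int (card S) + 2 * (int (max 3 (card (S \<inter> FV))) - int (card (S \<inter> FV))) \<le> 6 * \<epsilon> - 6"
  using arcs_ge count by (simp add: algebra_simps)

text \<open>If the bound on the number of vertices is attained, all estimates that led to it are equalities.\<close>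

lemma tight_case:
  assumes eq: "(int H - 6) * int (card S) = 6 * \<epsilon> - 6"
  shows "card (S \<inter> FV) \<ge> 3"
    and "int (card (A \<inter> S \<times> S)) + 2 * int (card (S \<inter> FV)) = 6 * int (card S) + 6 * \<epsilon> - 6"
    and "\<And>v. v \<in> S \<Longrightarrow> card (L v) = card (nbs S v)"
proof -
  show f3: "card (S \<inter> FV) \<ge> 3" 
  proof (rule ccontr)
    assume "\<not> 3 \<le> card (S \<inter> FV)"
    then have "max 3 (card (S \<inter> FV)) = 3" "card (S \<inter> FV) < 3" by auto
    then show False using size_bound eq by simp
  qed
  have e: "int (card (A \<inter> S \<times> S)) = int H * int (card S) - 2 * int (card (S \<inter> FV))"
    using arcs_ge count eq f3 by (simp add: algebra_simps)
  then show "int (card (A \<inter> S \<times> S)) + 2 * int (card (S \<inter> FV)) = 6 * int (card S) + 6 * \<epsilon> - 6"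
    using eq by (simp add: algebra_simps)
  fix v assume v: "v \<in> S"
  have "(\<Sum>v\<in>S. int (card (nbs S v)) - int (card (L v))) = 0"
    using e unfolding arcs_sum list_sum[symmetric] by (simp add: sum_subtractf)
  then have "\<forall>v\<in>S. int (card (nbs S v)) - int (card (L v)) = 0"
    using degree_ge by (subst (asm) sum_nonneg_eq_0_iff[OF finS]) auto
  then show "card (L v) = card (nbs S v)" using v by simp
qed

definition nonarcs :: "('v \<times> 'v) set" where
  "nonarcs = {(x, y) \<in> S \<times> S. x \<noteq> y \<and> (x, y) \<notin> A}"

lemma finite_nonarcs: "finite nonarcs"
  unfolding nonarcs_def using finS by (auto intro: finite_subset[of _ "S \<times> S"])

lemma card_nonarcs: "int (card nonarcs) + int (card (A \<inter> S \<times> S)) = int (card S) * int (card S) - int (card S)"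
proof -
  have "S \<times> S = nonarcs \<union> (A \<inter> S \<times> S) \<union> (\<lambda>v. (v, v)) ` S" by (auto simp: nonarcs_def)
  then have "card S * card S = card (nonarcs \<union> (A \<inter> S \<times> S) \<union> (\<lambda>v. (v, v)) ` S)" by (metis card_cartesian_product)
  also have "\<dots> = card (nonarcs \<union> (A \<inter> S \<times> S)) + card ((\<lambda>v. (v, v)) ` S)"
    using finS finite_nonarcs adj_irrefl by (intro card_Un_disjoint) (auto simp: nonarcs_def)
  also have "card (nonarcs \<union> (A \<inter> S \<times> S)) = card nonarcs + card (A \<inter> S \<times> S)"
    using finS finite_nonarcs by (intro card_Un_disjoint) (auto simp: nonarcs_def)
  also have "card ((\<lambda>v. (v, v)) ` S) = card S" by (rule card_image) (simp add: inj_on_def)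
  finally show ?thesis by (simp flip: of_nat_mult add: of_nat_add)
qed

lemma codegree: "v \<in> S \<Longrightarrow> card (S - {v} - nbs S v) = card S - 1 - card (nbs S v)"
  using nbs_subset[of S v] finS nbs_finite[OF finS] by (simp add: card_Diff_subset)

lemma universal: "v \<in> S \<Longrightarrow> card (nbs S v) \<ge> card S - 1 \<Longrightarrow> u \<in> S \<Longrightarrow> u \<noteq> v \<Longrightarrow> (v, u) \<in> A"
  using codegree[of v] finS by (auto simp: nbs_def)

lemma not_complete: "card S \<noteq> H - 1"
proof
  assume n: "card S = H - 1"
  have face: "S \<subseteq> FV"
  proof
    fix v assume v: "v \<in> S"
    show "v \<in> FV"
    proof (rule ccontr)
      assume "v \<notin> FV"
      then show False using degree_ge[OF v] degree_less[OF v] list_off[OF v] n by linarith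
    qed
  qed
  then obtain u v where uv: "u \<in> S" "v \<in> S" "u \<noteq> v" "(u, v) \<notin> A" using no_clique[of S] n by blast
  have "card (nbs S u) \<ge> card S - 1" using degree_ge[OF uv(1)] list_face[OF uv(1)] face uv(1) n by auto
  then show False using universal[OF uv(1) _ uv(2)] uv by auto
qed

text \<open>All vertices lie on the face and the complement graph has maximal degree one. It has two edges, because with at most one
  a complete graph on \<open>H - 1\<close> vertices of the face would remain.\<close>

lemma not_one_more: "card S \<noteq> H"
proof
  assume n: "card S = H"
  have face: "S \<subseteq> FV"
  proof
    fix v assume v: "v \<in> S"
    show "v \<in> FV"
    proof (rule ccontr)
      assume "v \<notin> FV"
      then show False using degree_ge[OF v] degree_less[OF v] list_off[OF v] n by linarith
    qed
  qed
  have codeg: "card (S - {v} - nbs S v) \<le> 1" if "v \<in> S" for v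
    using codegree[OF that] degree_ge[OF that] list_face[OF that] face that n by auto
  obtain M where M: "antimatching S M" "card nonarcs + 2 * card M \<le> 4 * 1 * card M"
    unfolding nonarcs_def by (rule maximal_antimatching[OF finS codeg]) auto
  have nonadj: "\<exists>u v. (u, v) \<in> nonarcs \<and> u \<noteq> x \<and> v \<noteq> x" if "x \<in> S" for x
    using no_clique[of "S - {x}"] that finS n face by (fastforce simp: nonarcs_def)
  have "S \<noteq> {}" using n H6 by auto
  then obtain u v where uv: "(u, v) \<in> nonarcs" using nonadj by blast
  then have "u \<in> S" "u \<noteq> v" by (auto simp: nonarcs_def)
  then obtain a b where ab: "(a, b) \<in> nonarcs" "a \<noteq> u" "b \<noteq> u" using nonadj by blast
  have "{(u, v), (v, u), (a, b)} \<subseteq> nonarcs" using uv ab adj_sym by (auto simp: nonarcs_def)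
  then have "card {(u, v), (v, u), (a, b)} \<le> card nonarcs" by (rule card_mono[OF finite_nonarcs])
  moreover have "card {(u, v), (v, u), (a, b)} = 3" using \<open>u \<noteq> v\<close> ab by auto
  ultimately have m: "card M \<ge> 2" using M(2) by linarith
  have "colorable (S \<union> {}) L"
  proof (rule antimatching_colorable[OF finS _ _ M(1), where s = "H - 2"])
    show "H - 2 \<le> card (L v)" if "v \<in> S" for v using list_face[OF that] that face by auto
    show "card S \<le> H - 2 + card M" using n m by linarith
    show "card (S \<union> {}) \<le> 2 * (H - 2)" using n H6 by simp
  qed (use list_finite in auto)
  then show False using not_colorable by simp
qed

text \<open>Vertices off the face are adjacent to all others, and on the face the complement graph has maximal degree
  two. The count of edges forces at least \<open>f - 2\<close> missing edges and at least one, so a maximal antimatching has enough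
  pairs.\<close>

lemma not_two_more:
  assumes H8: "H \<ge> 8" shows "card S \<noteq> H + 1"
proof
  assume n: "card S = H + 1"
  let ?P = "S \<inter> FV" and ?Q = "S - FV"
  have "even ((int H - 2) * (int H - 3))" by auto
  then obtain q where "(int H - 2) * (int H - 3) = 2 * q" by (rule evenE)
  then have "6 * \<epsilon> \<le> (int H - 2) * (int H - 3) - 2" using H_gt by presburger
  then have b: "6 * \<epsilon> \<le> int H * int H - 5 * int H + 4" by (simp add: algebra_simps)
  have nonarcs: "nonarcs = {(x, y) \<in> ?P \<times> ?P. x \<noteq> y \<and> (x, y) \<notin> A}"
  proof -
    have "v \<in> FV" if "v \<in> S" "u \<in> S" "u \<noteq> v" "(v, u) \<notin> A" for u v
    proof (rule ccontr)
      assume "v \<notin> FV"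
      then have "card (nbs S v) \<ge> card S - 1" using degree_ge[OF that(1)] list_off[OF that(1)] n by simp
      then show False using universal[OF that(1) _ that(2,3)] that(4) by blast
    qed
    then show ?thesis using adj_sym unfolding nonarcs_def by blast
  qed
  have codeg: "card (?P - {v} - nbs ?P v) \<le> 2" if "v \<in> ?P" for v
  proof -
    have "card (?P - {v} - nbs ?P v) \<le> card (S - {v} - nbs S v)"
      using finS by (intro card_mono) (auto simp: nbs_def)
    also have "\<dots> \<le> 2" using codegree[of v] degree_ge[of v] list_face[of v] that n by auto
    finally show ?thesis .
  qed
  have finP: "finite ?P" using finS by simp
  obtain M where M: "antimatching ?P M" "card nonarcs + 2 * card M \<le> 4 * 2 * card M"
    unfolding nonarcs by (rule maximal_antimatching[OF finP codeg]) auto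
  have "int (card nonarcs) \<ge> 2 * int (max 3 (card ?P)) - 4"
    using card_nonarcs count b unfolding n by (simp add: algebra_simps)
  then have m: "6 * int (card M) \<ge> 2 * int (max 3 (card ?P)) - 4" using M(2) by linarith
  have fle: "card ?P \<le> H + 1" using card_mono[OF finS, of ?P] n by auto
  have m1: "card M \<ge> 1" using m by linarith
  have PQ: "?P \<union> ?Q = S" by auto
  have "colorable (?P \<union> ?Q) L"
  proof (rule antimatching_colorable[OF _ _ _ M(1), where s = "H - 2"])
    show "H - 2 \<le> card (L v)" if "v \<in> ?P" for v using list_face that by auto
    show "card ?P \<le> H - 2 + card M" using m fle H8 by linarith
    show "card (?P \<union> ?Q) \<le> 2 * (H - 2)" unfolding PQ using n H8 by simp
    show "card (?P \<union> ?Q) \<le> card (L v) + card M" if "v \<in> ?Q" for v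
      unfolding PQ using n m1 list_off[of v] that by simp
  qed (use finS list_finite in auto)
  then show False using not_colorable unfolding PQ by simp
qed

text \<open>Here the count is tight. If all vertices are on the face, the complement graph is cubic and has four disjoint edges.
  Otherwise the minimum degree \<open>8\<close> among \<open>12\<close> vertices rules out cut vertices, so all lists are equal, although they have
  different sizes on the face and off it.\<close>

lemma not_genus_nine: "\<not> (\<epsilon> = 9 \<and> H = 10 \<and> card S = 12)"
proof
  assume n: "\<epsilon> = 9 \<and> H = 10 \<and> card S = 12"
  then have eq: "(int H - 6) * int (card S) = 6 * \<epsilon> - 6" by simp
  note t = tight_case[OF eq]
  show False
  proof (cases "S \<subseteq> FV")
    case face: True
    then have deg: "card (nbs S v) = 8" if "v \<in> S" for v using t(3)[OF that] list_face[OF that] that n by auto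
    have codeg: "card (S - {v} - nbs S v) \<le> 3" if "v \<in> S" for v
      using codegree[OF that] deg[OF that] n by simp
    obtain M where M: "antimatching S M" "card nonarcs + 2 * card M \<le> 4 * 3 * card M"
      unfolding nonarcs_def by (rule maximal_antimatching[OF finS codeg]) auto
    have "card nonarcs = 36" using card_nonarcs deg n unfolding arcs_sum by simp
    then have m: "card M \<ge> 4" using M(2) by linarith
    have "colorable (S \<union> {}) L"
    proof (rule antimatching_colorable[OF finS _ _ M(1), where s = "H - 2"])
      show "H - 2 \<le> card (L v)" if "v \<in> S" for v using list_face[OF that] that face by auto
      show "card S \<le> H - 2 + card M" using n m by linarith
      show "card (S \<union> {}) \<le> 2 * (H - 2)" using n by simp
    qed (use list_finite in auto)
    then show False using not_colorable by simp
  next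
    case False
    then obtain p where p: "p \<in> S" "p \<notin> FV" by blast
    have "S \<inter> FV \<noteq> {}" using t(1) by auto
    then obtain q where q: "q \<in> S" "q \<in> FV" by blast
    have deg8: "card (nbs S v) \<ge> 8" if "v \<in> S" for v
      using degree_ge[OF that] list_face[OF that] list_off[OF that] n by (cases "v \<in> FV") auto
    have big: "card T \<ge> 8" if T: "T \<subseteq> S - {u}" "T \<noteq> {}" "\<forall>a\<in>T. \<forall>b\<in>S - {u} - T. (a, b) \<notin> A" for T u
    proof -
      obtain a where a: "a \<in> T" using T by blast
      have finT: "finite T" using T(1) finS by (auto intro: finite_subset)
      have "nbs S a \<subseteq> insert u (T - {a})" using T a adj_irrefl by (auto simp: nbs_def)
      then have "card (nbs S a) \<le> card (insert u (T - {a}))" using finT by (intro card_mono) auto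
      also have "\<dots> \<le> Suc (card (T - {a}))" using finT by (simp add: card_insert_if)
      also have "\<dots> = card T" using finT a by (metis card.remove)
      finally show ?thesis using deg8[of a] T(1) a by auto
    qed
    have noncut: "linked (S - {u})" if u: "u \<in> S" for u
      unfolding linked_def
    proof (intro allI impI, rule ccontr)
      fix T assume T: "T \<subseteq> S - {u}" "T \<noteq> {}" "T \<noteq> S - {u}" "\<not> (\<exists>a\<in>T. \<exists>b\<in>S - {u} - T. (a, b) \<in> A)"
      have "card T \<ge> 8" using T by (intro big[of T u]) auto
      moreover have "card (S - {u} - T) \<ge> 8" using T adj_sym by (intro big[of _ u]) blast+
      moreover have "card (S - {u} - T) = card S - 1 - card T"
        using T(1) u finS by (simp add: card_Diff_subset finite_subset)
      ultimately show False using n by linarith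
    qed
    have "L p = L q"
      by (rule noncut_lists_equal[OF crit t(3) _ critical_linked[OF crit] noncut p(1) q(1)]) auto
    then show False using list_off[OF p] list_face[OF q] n by simp
  qed
qed

text \<open>Here the count is tight. Vertices off the face are not cut vertices because of the triangles around them, and those
  on the face have the smallest lists. So all lists are equal, of size four since the face has a vertex, and the graph
  is complete on five vertices by the theorem of Brooks.\<close>

lemma not_genus_one: "\<not> (\<epsilon> = 1 \<and> H = 6)"
proof
  assume n: "\<epsilon> = 1 \<and> H = 6"
  then have eq: "(int H - 6) * int (card S) = 6 * \<epsilon> - 6" by simp
  note t = tight_case[OF eq]
  note lnk = critical_linked[OF crit]
  have off_noncut: "linked (S - {c})" if c: "c \<in> S" "c \<notin> FV" for c
    unfolding linked_def
  proof (intro allI impI, rule ccontr)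
    fix T assume T: "T \<subseteq> S - {c}" "T \<noteq> {}" "T \<noteq> S - {c}" "\<not> (\<exists>a\<in>T. \<exists>b\<in>S - {c} - T. (a, b) \<in> A)"
    let ?N = "nbs S c \<inter> T"
    have touch: "nbs S c \<inter> W \<noteq> {}" if W: "W \<subseteq> S - {c}" "W \<noteq> {}" "\<forall>a\<in>W. \<forall>b\<in>S - {c} - W. (a, b) \<notin> A" for W
    proof -
      have "W \<subseteq> S" "W \<noteq> S" using W(1) c(1) by auto
      then obtain a b where ab: "a \<in> W" "b \<in> S - W" "(a, b) \<in> A" using linked_step[OF lnk, of W] W(2) by blast
      then have "b = c" using W(3) by blast
      then show ?thesis using ab W(1) adj_sym by (auto simp: nbs_def)
    qed
    have "?N \<noteq> {}" using T by (intro touch) auto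
    moreover have "nbs S c \<inter> (S - {c} - T) \<noteq> {}" using T adj_sym by (intro touch) blast+
    ultimately obtain a b where "a \<in> ?N" "b \<in> nbs S c - ?N" "(a, b) \<in> A"
      using link[OF t(2) c, of ?N] by blast
    moreover have "nbs S c \<subseteq> S - {c}" by (rule nbs_subset)
    ultimately show False using T(4) by blast
  qed
  have noncut: "linked (S - {u})" if "u \<in> S" for u
  proof (rule critical_no_cutvertex[OF crit t(3) _ list_finite that])
    fix u v assume u: "u \<in> S" "\<not> linked (S - {u})" and v: "v \<in> S"
    have "u \<in> FV" using off_noncut u by blast
    then show "card (L u) \<le> card (L v)" using list_face[OF u(1)] list_face[OF v] list_off[OF v] by (cases "v \<in> FV") auto
  qed
  have same: "L u = L v" if "u \<in> S" "v \<in> S" for u v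
    by (rule noncut_lists_equal[OF crit t(3) _ lnk noncut that]) auto
  have "S \<inter> FV \<noteq> {}" using t(1) by auto
  then obtain q where q: "q \<in> S" "q \<in> FV" by blast
  have L4: "card (L v) = 4" if "v \<in> S" for v using list_face[OF q] same[OF that q(1)] n by simp
  have face: "S \<subseteq> FV"
  proof
    fix v assume v: "v \<in> S"
    show "v \<in> FV" using L4[OF v] list_off[OF v] n by (cases "v \<in> FV") auto
  qed
  have deg: "card (nbs S v) = 4" if "v \<in> S" for v using t(3)[OF that] L4[OF that] by simp
  have Lq: "L v = L q" if "v \<in> S" for v using same[OF that q(1)] .
  have critq: "critical S (\<lambda>_. L q)"
  proof -
    have "colorable T L \<longleftrightarrow> colorable T (\<lambda>_. L q)" if "T \<subseteq> S" for T
      using that Lq by (intro colorable_cong) blast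
    then show ?thesis using crit unfolding critical_def by blast
  qed
  have complete: "(u, v) \<in> A" if "u \<in> S" "v \<in> S" "u \<noteq> v" for u v
    by (rule brooks[OF critq list_finite[OF q(1)] L4[OF q(1)] _ deg that]) simp
  have "nbs S q = S - {q}" using complete[OF q(1)] adj_irrefl by (auto simp: nbs_def)
  then have "card S - 1 = 4" using deg[OF q(1)] finS q(1) by simp
  then have "card S = H - 1" using n by simp
  then show False using not_complete by blast
qed

theorem impossible: False
proof -
  let ?n = "int (card S)" and ?h = "int H"
  have nge: "card S \<ge> H - 1"
  proof -
    obtain v where v: "v \<in> S" using critical_nonempty[OF crit] by blast
    then show ?thesis using degree_less[OF v] degree_ge[OF v] list_face[OF v] list_off[OF v] by (cases "v \<in> FV") auto
  qed
  have sb: "(?h - 6) * ?n \<le> 6 * \<epsilon> - 6"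
  proof -
    have "(?h - 6) * ?n \<le> (?h - 6) * ?n + 2 * (int (max 3 (card (S \<inter> FV))) - int (card (S \<inter> FV)))" by simp
    also note size_bound
    finally show ?thesis .
  qed
  have q1: "?h * ?h - 7 * ?h + 12 \<le> 6 * \<epsilon>" and q2: "6 * \<epsilon> < ?h * ?h - 5 * ?h + 6"
    using H_le H_gt by (auto simp: algebra_simps)
  show False
  proof (cases "H \<le> 7")
    case True
    then have "H = 6 \<or> H = 7" using H6 by auto
    then consider "H = 6" "\<epsilon> = 1" | "H = 7" "\<epsilon> = 2" using q1 q2 \<epsilon> by fastforce
    then show False
    proof cases
      case 1
      then show False using not_genus_one by blast
    next
      case 2
      then show False using sb nge not_complete by auto
    qed
  next
    case False
    then have H8: "H \<ge> 8" by simp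
    \<comment> \<open>Since \<open>6 * \<epsilon> - 6\<close> exceeds \<open>(H - 6) * (H + 1)\<close> by at most a small constant, more vertices are possible
      only for \<open>H \<le> 11\<close>, which leaves few values of \<open>\<epsilon>\<close>.\<close>
    have "\<not> card S \<ge> H + 2"
    proof
      assume big: "card S \<ge> H + 2"
      have "(?h - 6) * (?h + 2) \<le> (?h - 6) * ?n" using big H8 by (intro mult_left_mono) auto
      then have "?h * ?h - 4 * ?h - 12 \<le> 6 * \<epsilon> - 6" using sb by (simp add: algebra_simps)
      then have "H \<le> 11" using q2 by linarith
      then have "H = 8 \<or> H = 9 \<or> H = 10 \<or> H = 11" using H8 by auto
      then show False
      proof (elim disjE)
        assume h: "H = 10"
        then have "\<epsilon> \<le> 9" "4 * ?n \<le> 6 * \<epsilon> - 6" using q2 sb by auto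
        then have "\<epsilon> = 9" "card S = 12" using big h by auto
        then show False using not_genus_nine h by blast
      qed (use q1 q2 sb big in auto)
    qed
    then have "card S = H - 1 \<or> card S = H \<or> card S = H + 1" using nge by linarith
    then show False using not_complete not_one_more not_two_more[OF H8] by blast
  qed
qed

end

section \<open>Colouring graphs drawn on a surface\<close>

lemma surface_closed_surface:
  assumes "surface X" shows "closed_surface X"
proof
  show "compact_space X" "connected_space X" "topspace X \<noteq> {}" "Hausdorff_space X"
    using assms by (auto simp: surface_def manifold_def)
  fix x assume "x \<in> topspace X"
  then obtain U where U: "openin X U" "x \<in> U" "subtopology X U homeomorphic_space Euclidean_space 2"
    using assms by (auto simp: surface_def manifold_def)
  have "(euclidean :: complex topology) homeomorphic_space Euclidean_space 2"
    using homeomorphic_subspace_Euclidean_space[of "UNIV :: complex set"] by (simp add: dim_UNIV)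
  then have "subtopology X U homeomorphic_space (euclidean :: complex topology)"
    using U(3) homeomorphic_space_sym homeomorphic_space_trans by blast
  then obtain h where "homeomorphic_map (subtopology X U) (euclidean :: complex topology) h"
    by (auto simp: homeomorphic_space)
  then show "\<exists>U h. chart X U h \<and> x \<in> U" using U by (auto simp: chart_def)
qed

context drawn_graph begin

lemma subdrawing:
  assumes "S \<subseteq> V" shows "drawn_graph X S (A \<inter> S \<times> S) pos crv"
proof
  show "finite S" using assms finV by (rule finite_subset)
  show "inj_on pos S" using inj_pos assms by (rule inj_on_subset)
  show "pos ` S \<subseteq> topspace X" using posX assms by blast
  show "crv a ` {0<..<1} \<inter> pos ` S = {}" if "a \<in> A \<inter> S \<times> S" for a using crv_pos[of a] that assms by blast
  show "crv (v, u) t = crv (u, v) (1 - t)" if "(u, v) \<in> A \<inter> S \<times> S" "t \<in> {0..1}" for u v t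
    using crv_rev[of u v t] that by blast
  show "crv (u, v) ` {0<..<1} \<inter> crv (x, y) ` {0<..<1} = {}" if "(u, v) \<in> A \<inter> S \<times> S" "(x, y) \<in> A \<inter> S \<times> S" "{u, v} \<noteq> {x, y}" for u v x y
    using crv_disj[of u v x y] that by blast
qed (use symA irrefl path inj_crv crv0 crv1 in auto)

sublocale simple_graph A
  by unfold_locales (use symA irrefl in auto)

text \<open>The count applies to the drawing of a subgraph with the face that contains \<open>F\<close>. Its frontier keeps all vertices
  of \<open>F\<close> that remain; if the count is tight with these, it has no others.\<close>

lemma subgraph_count:
  assumes F: "F \<in> comps D" and S: "S \<subseteq> V" "card S \<ge> 3" and deg: "\<And>v. v \<in> S \<Longrightarrow> nbs S v \<noteq> {}"
  shows "int (card (A \<inter> S \<times> S)) + 2 * int (max 3 (card (S \<inter> face_vertices F))) \<le> 6 * int (card S) + 6 * euler_genus X - 6" (is ?count)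
    and "int (card (A \<inter> S \<times> S)) + 2 * int (card (S \<inter> face_vertices F)) = 6 * int (card S) + 6 * euler_genus X - 6 \<Longrightarrow>
      c \<in> S \<Longrightarrow> c \<notin> face_vertices F \<Longrightarrow> N \<subseteq> nbs S c \<Longrightarrow> N \<noteq> {} \<Longrightarrow> N \<noteq> nbs S c \<Longrightarrow> \<exists>a\<in>N. \<exists>b\<in>nbs S c - N. (a, b) \<in> A"
proof -
  interpret sub: drawn_graph X S "A \<inter> S \<times> S" pos crv by (rule subdrawing[OF S(1)])
  have DD: "sub.D \<subseteq> D"
    using S(1) by (auto simp: D_def carc_def sub.D_def sub.carc_def)
  obtain F' where F': "F' \<in> comps sub.D" "F \<subseteq> F'"
    by (rule comps_extend[of F "sub.D"]) (use comps_connected[OF F] DD in blast)+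
  have fv: "S \<inter> face_vertices F \<subseteq> sub.face_vertices F'"
  proof
    fix v assume v: "v \<in> S \<inter> face_vertices F"
    then have "pos v \<in> X closure_of F" by (auto simp: face_vertices_def frontier_of_def)
    then have "pos v \<in> X closure_of F'" using closure_of_mono[OF F'(2)] by blast
    moreover have "pos v \<notin> F'" using comps_connected(2)[OF F'(1)] v by (auto simp: sub.D_def)
    then have "pos v \<notin> X interior_of F'" using interior_of_subset by fastforce
    ultimately show "v \<in> sub.face_vertices F'" using v by (auto simp: sub.face_vertices_def frontier_of_def)
  qed
  have finfv: "finite (sub.face_vertices F')" using sub.finV by (simp add: sub.face_vertices_def)
  have nb: "sub.nbrs v = nbs S v" if "v \<in> S" for v using that by (auto simp: sub.nbrs_def nbs_def)
  have deg': "sub.nbrs v \<noteq> {}" if "v \<in> S" for v using deg[OF that] nb[OF that] by simp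
  note cnt = sub.face_count(1)[OF F'(1) S(2) deg']
  have le: "card (S \<inter> face_vertices F) \<le> card (sub.face_vertices F')" by (rule card_mono[OF finfv fv])
  then show ?count using cnt by linarith
  assume tight: "int (card (A \<inter> S \<times> S)) + 2 * int (card (S \<inter> face_vertices F)) = 6 * int (card S) + 6 * euler_genus X - 6"
    and c: "c \<in> S" "c \<notin> face_vertices F" and N: "N \<subseteq> nbs S c" "N \<noteq> {}" "N \<noteq> nbs S c"
  have eq: "card (sub.face_vertices F') = card (S \<inter> face_vertices F)" using tight cnt le by linarith
  have fv_eq: "S \<inter> face_vertices F = sub.face_vertices F'" using eq by (intro card_subset_eq[OF finfv fv]) simp
  obtain a b where "a \<in> N" "b \<in> sub.nbrs c - N" "(a, b) \<in> A \<inter> S \<times> S"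
  proof (rule sub.tight_link_connected[OF F'(1) S(2) deg' _ c(1)])
    show "int (card (A \<inter> S \<times> S)) + 2 * int (card (sub.face_vertices F')) = 6 * int (card S) + 6 * euler_genus X - 6"
      using tight eq by simp
    show "c \<notin> sub.face_vertices F'" using c fv_eq by blast
    show "N \<subseteq> sub.nbrs c" "N \<noteq> {}" "N \<noteq> sub.nbrs c" using N nb[OF c(1)] by auto
  qed auto
  then show "\<exists>a\<in>N. \<exists>b\<in>nbs S c - N. (a, b) \<in> A" using nb[OF c(1)] by blast
qed

theorem colorable_drawn_graph:
  fixes L :: "'v \<Rightarrow> 'c set"
  assumes F: "F \<in> comps D" and \<epsilon>: "euler_genus X \<ge> 1" "euler_genus X \<noteq> 3"
    and face: "\<And>v. v \<in> V \<Longrightarrow> v \<in> face_vertices F \<Longrightarrow> card (L v) = heawood (euler_genus X) - 2"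
    and off: "\<And>v. v \<in> V \<Longrightarrow> v \<notin> face_vertices F \<Longrightarrow> card (L v) = heawood (euler_genus X)"
    and clique: "\<And>K. K \<subseteq> face_vertices F \<Longrightarrow> card K = heawood (euler_genus X) - 1 \<Longrightarrow> \<exists>u\<in>K. \<exists>v\<in>K. u \<noteq> v \<and> (u, v) \<notin> A"
  shows "colorable V L"
proof (rule ccontr)
  assume "\<not> colorable V L"
  then obtain S where S: "S \<subseteq> V" "critical S L" by (rule critical_exists[OF finV])
  let ?H = "heawood (euler_genus X)"
  note hb = heawood_bounds[OF \<epsilon>(1)]
  have finS: "finite S" using S finV by (auto intro: finite_subset)
  have deg4: "card (nbs S v) \<ge> 4" if v: "v \<in> S" for v
  proof -
    have "card (L v) = ?H - 2 \<or> card (L v) = ?H" using face[of v] off[of v] v S(1) by blast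
    then have "card (L v) \<ge> 4" using hb(1) by auto
    then show ?thesis using critical_degree[OF S(2) v] by linarith
  qed
  have S3: "card S \<ge> 3"
  proof -
    obtain v where v: "v \<in> S" using critical_nonempty[OF S(2)] by blast
    have "nbs S v \<subseteq> S" by (auto simp: nbs_def)
    then have "card (nbs S v) \<le> card S" by (rule card_mono[OF finS])
    then show ?thesis using deg4[OF v] by linarith
  qed
  have ne: "nbs S v \<noteq> {}" if "v \<in> S" for v using deg4[OF that] by auto
  note sc = subgraph_count[OF F S(1) S3 ne]
  interpret cc: critical_count A S "face_vertices F" L "euler_genus X" ?H
  proof
    show "critical S L" by (rule S(2))
    show "card (L v) = ?H - 2" if "v \<in> S" "v \<in> face_vertices F" for v using face that S(1) by blast
    show "card (L v) = ?H" if "v \<in> S" "v \<notin> face_vertices F" for v using off that S(1) by blast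
    show "\<exists>u\<in>K. \<exists>v\<in>K. u \<noteq> v \<and> (u, v) \<notin> A" if "K \<subseteq> S" "K \<subseteq> face_vertices F" "card K = ?H - 1" for K
      using clique[OF that(2,3)] .
    show "\<exists>a\<in>N. \<exists>b\<in>nbs S c - N. (a, b) \<in> A"
      if "int (card (A \<inter> S \<times> S)) + 2 * int (card (S \<inter> face_vertices F)) = 6 * int (card S) + 6 * euler_genus X - 6"
        "c \<in> S" "c \<notin> face_vertices F" "N \<subseteq> nbs S c" "N \<noteq> {}" "N \<noteq> nbs S c" for c N
      by (rule sc(2)[OF _ that])
    show "int (card (A \<inter> S \<times> S)) + 2 * int (max 3 (card (S \<inter> face_vertices F))) \<le> 6 * int (card S) + 6 * euler_genus X - 6"
      by (rule sc(1))
  qed (use \<epsilon> hb in auto)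
  show False by (rule cc.impossible)
qed

end

lemma embedding_drawn_graph:
  assumes "surface X" "pair_graph G" "embedding X G pos crv"
  shows "drawn_graph X (pverts G) (parcs G) pos crv"
proof -
  interpret closed_surface X using assms(1) by (rule surface_closed_surface)
  interpret G: pair_graph G by (rule assms(2))
  show ?thesis
  proof
    note E = assms(3)[unfolded embedding_def]
    have arc: "pathin X (crv (u, v)) \<and> inj_on (crv (u, v)) {0..1} \<and> crv (u, v) 0 = pos u \<and> crv (u, v) 1 = pos v \<and>
        (\<forall>t \<in> {0..1}. crv (v, u) t = crv (u, v) (1 - t)) \<and> crv (u, v) ` {0<..<1} \<inter> pos ` pverts G = {}"
      if "(u, v) \<in> parcs G" for u v
      using bspec[OF conjunct1[OF conjunct2[OF conjunct2[OF E]]] that] unfolding prod.case .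
    show "finite (pverts G)" by (rule G.pair_finite_verts)
    show "parcs G \<subseteq> pverts G \<times> pverts G" using G.arc_fst_in_verts G.arc_snd_in_verts by force
    show "(v, u) \<in> parcs G" if "(u, v) \<in> parcs G" for u v
      using G.pair_sym_arcs that by (auto simp: symmetric_def sym_def)
    show "(u, u) \<notin> parcs G" for u using G.pair_no_loops[of "(u, u)"] by auto
    show "pos ` pverts G \<subseteq> topspace X" by (rule conjunct1[OF E])
    show "inj_on pos (pverts G)" by (rule conjunct1[OF conjunct2[OF E]])
    show "pathin X (crv a)" "inj_on (crv a) {0..1}" "crv a ` {0<..<1} \<inter> pos ` pverts G = {}" if "a \<in> parcs G" for a
      using arc[of "fst a" "snd a"] that by simp_all
    show "crv (u, v) 0 = pos u" "crv (u, v) 1 = pos v" if "(u, v) \<in> parcs G" for u v using arc[OF that] by simp_all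
    show "crv (v, u) t = crv (u, v) (1 - t)" if "(u, v) \<in> parcs G" "t \<in> {0..1}" for u v t
      using arc[OF that(1)] that(2) by blast
    show "crv (u, v) ` {0<..<1} \<inter> crv (x, y) ` {0<..<1} = {}"
      if uv: "(u, v) \<in> parcs G" and xy: "(x, y) \<in> parcs G" and ne: "{u, v} \<noteq> {x, y}" for u v x y
    proof -
      have pair: "\<forall>(x, y) \<in> parcs G. {u, v} \<noteq> {x, y} \<longrightarrow> crv (u, v) ` {0<..<1} \<inter> crv (x, y) ` {0<..<1} = {}"
        using bspec[OF conjunct2[OF conjunct2[OF conjunct2[OF E]]] uv] unfolding prod.case .
      then show ?thesis using bspec[OF pair xy] ne unfolding prod.case by blast
    qed
  qed
qed

theorem theorem1p1:
  fixes \<epsilon> :: int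
    and X :: "'s topology"
    and G :: "'v pair_pre_digraph"
    and pos :: "'v \<Rightarrow> 's"
    and crv :: "'v \<times> 'v \<Rightarrow> real \<Rightarrow> 's"
    and F :: "'s set"
    and L :: "'v \<Rightarrow> 'c set"
  assumes "\<epsilon> \<ge> 1" and "\<epsilon> \<noteq> 3"
    and "surface X" and "euler_genus X = \<epsilon>"
    and "pair_graph G" and "embedding X G pos crv"
    and "F \<in> faces X G pos crv"
    and "\<And>v. v \<in> face_verts X G pos F \<Longrightarrow> card (L v) = heawood \<epsilon> - 2"
    and "\<And>v. v \<in> pverts G - face_verts X G pos F \<Longrightarrow> card (L v) = heawood \<epsilon>"
    and "\<not> (\<exists>K :: 'v pair_pre_digraph. subgraph (with_proj K) (with_proj G) \<and>
           complete_digraph (heawood \<epsilon> - 1) (with_proj K) \<and> pverts K \<subseteq> face_verts X G pos F)"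
  shows "list_colorable G L"
proof -
  interpret drawn_graph X "pverts G" "parcs G" pos crv
    using assms(3,5,6) by (rule embedding_drawn_graph)
  interpret G: pair_graph G by (rule assms(5))
  have fv: "face_vertices F = face_verts X G pos F" by (simp add: face_vertices_def face_verts_def)
  have "D = drawing G pos crv" by (simp add: D_def carc_def drawing_def)
  then have F: "F \<in> comps D" using assms(7) by (simp add: faces_def comps_def)
  have "colorable (pverts G) L"
  proof (rule colorable_drawn_graph[OF F])
    show "euler_genus X \<ge> 1" "euler_genus X \<noteq> 3" using assms(1,2,4) by auto
    show "card (L v) = heawood (euler_genus X) - 2" if "v \<in> face_vertices F" for v
      using assms(4) assms(8) that fv by simp
    show "card (L v) = heawood (euler_genus X)" if "v \<in> pverts G" "v \<notin> face_vertices F" for v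
      using assms(4) assms(9) that fv by simp
    fix K assume K: "K \<subseteq> face_vertices F" "card K = heawood (euler_genus X) - 1"
    show "\<exists>u\<in>K. \<exists>v\<in>K. u \<noteq> v \<and> (u, v) \<notin> parcs G"
    proof (rule ccontr)
      assume "\<not> ?thesis"
      then have all: "(u, v) \<in> parcs G" if "u \<in> K" "v \<in> K" "u \<noteq> v" for u v using that by blast
      define C where "C = \<lparr>pverts = K, parcs = {(u, v) \<in> K \<times> K. u \<noteq> v}\<rparr>"
      have KV: "K \<subseteq> pverts G" using K(1) by (auto simp: face_vertices_def)
      have finK: "finite K" using KV G.pair_finite_verts by (rule finite_subset)
      have "wf_digraph (with_proj C)" by unfold_locales (auto simp: C_def)
      then have "subgraph (with_proj C) (with_proj G)"
        unfolding subgraph_def compatible_def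
        using KV all G.wf_digraph_axioms by (auto simp: C_def)
      moreover have "complete_digraph (heawood \<epsilon> - 1) (with_proj C)"
        unfolding complete_digraph_pair_def using finK K(2) assms(4) by (auto simp: C_def)
      moreover have "pverts C \<subseteq> face_verts X G pos F" using K(1) fv by (simp add: C_def)
      ultimately show False using assms(10) by blast
    qed
  qed
  then obtain c where c: "coloring (pverts G) L c" by (auto simp: colorable_def)
  then have "\<forall>(u, v)\<in>parcs G. c u \<noteq> c v" using AV by (fastforce simp: coloring_def)
  then show ?thesis using c unfolding list_colorable_def coloring_def by blast
qed

end
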